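(* Let $\Omega\subset\mathbb R^3$ be a bounded domain with smooth boundary (zero Dirichlet boundary conditions), $u_0\in\mathbb V$, $\kappa>0$, and let $r=1$ or $2\le r\le5$. For $2<r\le5$ there is a constant $C_r>0$ depending only on $r$ such that the following holds (for $r=1$ and $r=2$ no such constant is needed). Let $\widetilde U\in\mathcal U_{ad}$ be any control which, with its adjoint state $\varphi_{\widetilde U}$, satisfies the variational inequality $$\int_{\Omega_T}(\varphi_{\widetilde U}+\lambda\widetilde U)\cdot(U-\widetilde U)\,dx\,dt\ge0\qquad\text{for all }U\in\mathcal U_{ad}.$$ In addition, assume $$\frac\kappa2\ \ge\ \begin{cases}\big(C+2\beta C_5C_r\,\widehat C_1^{\,r-2}\big)\|\varphi_{\widetilde U}\|_{L^\infty(0,T;\mathbb V)} & \text{if }2<r\le5,\\[1mm] C\big(\|\varphi_{\widetilde U}\|_{L^\infty(0,T;\mathbb V)}+4\beta\|\varphi_{\widetilde U}\|_{L^\infty(0,T;\mathbb H)}\big) & \text{if }r=2,\\[1mm] C\,\|\varphi_{\widetilde U}\|_{L^\infty(0,T;\mathbb V)} & \text{if }r=1.\end{cases}$$ Then $\widetilde U$ is a global optimal control, i.e. $\mathfrak J(\widetilde U)\le\mathfrak J(U)$ for all $U\in\mathcal U_{ad}$. Furthermore, if the strict inequality $$\frac\kappa2\ >\ \begin{cases}\big(C+2\beta C_5C_r\,\widehat C_1^{\,r-2}\big)\|\varphi_{\widetilde U}\|_{L^\infty(0,T;\mathbb V)} & \text{if }2<r\le5,\\[1mm] C\big(\|\varphi_{\widetilde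 U}\|_{L^\infty(0,T;\mathbb V)}+4\beta\|\varphi_{\widetilde U}\|_{L^\infty(0,T;\mathbb H)}\big) & \text{if }r=2,\\[1mm] C\,\|\varphi_{\widetilde U}\|_{L^\infty(0,T;\mathbb V)} & \text{if }r=1\end{cases}$$ holds, then the global optimal control $\widetilde U$ is unique.
   Context: Spaces (bounded domain $\Omega$ with outward unit normal $n$; $0<T<\infty$, $\Omega_T=\Omega\times(0,T]$): $\mathbb H=\{v\in L^2(\Omega)^3:\nabla\cdot v=0,\ v\cdot n=0\text{ on }\partial\Omega\}$ with the $L^2$ norm and inner product $(\cdot,\cdot)$; $\mathbb V=\{v\in H^1(\Omega)^3:\nabla\cdot v=0,\ v=0\text{ on }\partial\Omega\}$ with $\|v\|_{\mathbb V}=\|\nabla v\|_{L^2}$; $\mathbb L^p=\{v\in L^p(\Omega)^3:\nabla\cdot v=0,\ v\cdot n=0\text{ on }\partial\Omega\}$ with the $L^p$ norm. $\langle\cdot,\cdot\rangle$ denotes the duality pairing. $\mathrm b(u,v,w)=\int_\Omega(u\cdot\nabla)v\cdot w\,dx$. State system ($\mu,\nu,\alpha,\beta>0$): $u_t-\mu\Delta u_t-\nu\Delta u+(u\cdot\nabla)u+\nabla p+\alpha u+\beta|u|^{r-1}u=U$, $\nabla\cdot u=0$ in $\Omega_T$, $u=0$ on $\partial\Omega\times[0,T]$, $u(x,0)=u_0$. Weak solution: $u\in C([0,T];\mathbb V)$ with $u(0)=u_0$ and, for all $v\in\mathbb V$, a.e. $t$, $(u_t,v)+\mu(\nabla u_t,\nabla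 v)+\nu(\nabla u,\nabla v)+\mathrm b(u,u,v)+\alpha(u,v)+\beta\langle|u|^{r-1}u,v\rangle=(U,v)$; for $1\le r\le5$ it satisfies $u\in H^1(0,T;\mathbb V)$. Controls: $\mathcal U_{ad}=\{U\in L^2(0,T;\mathbb H):U_{\min}\le U\le U_{\max}\text{ a.e. in }\Omega_T\}$ (componentwise), where $U_{\min}\le U_{\max}$ are given in $L^\infty(\Omega_T)$; $\mathcal U$ is a non-empty open bounded subset of $L^2(0,T;\mathbb H)$ containing $\mathcal U_{ad}$. For $U\in\mathcal U$, $u_U$ is the unique weak solution with control $U$. With given $u_d\in L^2(0,T;\mathbb V)$ and $\lambda\ge0$, $$\mathfrak J(U)=\frac\kappa2\int_0^T\|\nabla(u_U-u_d)\|_{\mathbb H}^2dt+\frac\lambda2\int_0^T\|U\|_{\mathbb H}^2dt .$$ Derivative of $f(u)=|u|^{r-1}u$: $f'(z)w=(r-1)|z|^{r-3}(z\cdot w)z+|z|^{r-1}w$ for $r\ge3$, and for $1<r<3$, $z\ne0$; $f'(0)w=0$ for $1<r<3$; $f'(z)w=w$ for $r=1$. Adjoint state: for $U\in\mathcal U$, $\varphi_U\in H^1(0,T;\mathbb V)$ is the unique function such that for all $v\in\mathbb V$, a.e. $t$, $$-(\varphi_t,v)-\mu(\nabla\varphi_t,\nabla v)+\nu(\nabla\varphi,\nabla v)+\mathrm b(v,u_U,\varphi)-\mathrm b(u_U,\varphi,v)+\alpha(\varphi,v)+\beta\langle f'(u_U)\varphi,v\rangle=\kappa(\nabla(u_U-u_d),\nabla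 v)$$ and $(\varphi(T),v)+\mu(\nabla\varphi(T),\nabla v)=0$ for all $v\in\mathbb V$. Constants: $C>0$ is the constant with $\|v\|_{\mathbb L^4}\le\sqrt C\,\|v\|_{\mathbb V}$ for $v\in\mathbb V$ (so $|\mathrm b(u,v,w)|\le C\|u\|_{\mathbb V}\|v\|_{\mathbb V}\|w\|_{\mathbb V}$). $C_5=C_6C_7$, where $\|v\|_{\mathbb L^{12(r+1)/(17-r)}}\le\sqrt{C_6}\,\|v\|_{\mathbb V}$ and $\|v\|_{\mathbb L^6}\le C_7\|v\|_{\mathbb V}$ for $v\in\mathbb V$. $\widehat C_1=\big[\tfrac{\widetilde C_1(r+1)}{2\beta}\big]^{1/(r+1)}$, where $\widetilde C_1>0$ is the constant of the a priori estimate, valid for all $U\in\mathcal U$ and $u=u_U$, $$\sup_{t\in(0,T]}\Big[\alpha\|u(t)\|_{\mathbb H}^2+\nu\|u(t)\|_{\mathbb V}^2+\frac{2\beta}{r+1}\|u(t)\|_{\mathbb L^{r+1}}^{r+1}\Big]+\mu\int_0^T\|u_t(t)\|_{\mathbb V}^2dt\le\widetilde C_1 .$$ *)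

theory Defs
  imports "HOL-Analysis.Analysis" "HOL-Probability.Essential_Supremum"
begin

type_synonym R3 = "real^3"
type_synonym field = "R3 \<Rightarrow> R3"

(* Elements of a function space are represented by functions on the whole of R^3 (resp. R);
   only their values on Omega (resp. [0,T]) matter, up to null sets. *)


section \<open>Smooth functions and smooth bounded domains\<close>

primrec dir_derivs :: "'a list \<Rightarrow> ('a::real_normed_vector \<Rightarrow> real) \<Rightarrow> 'a \<Rightarrow> real" where
  "dir_derivs [] f = f"
| "dir_derivs (v # vs) f = (\<lambda>x. frechet_derivative (dir_derivs vs f) (at x) v)"

(* C^infinity on an open set S. *)
definition smooth_on :: "'a::real_normed_vector set \<Rightarrow> ('a \<Rightarrow> real) \<Rightarrow> bool" where
  "smooth_on S f \<longleftrightarrow> (\<forall>vs. \<forall>x\<in>S. dir_derivs vs f differentiable (at x))"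

(* C_c^infinity(S) *)
definition test_fun :: "'a::real_normed_vector set \<Rightarrow> ('a \<Rightarrow> real) \<Rightarrow> bool" where
  "test_fun S \<phi> \<longleftrightarrow> smooth_on UNIV \<phi> \<and> compact (closure {x. \<phi> x \<noteq> 0}) \<and> closure {x. \<phi> x \<noteq> 0} \<subseteq> S"

definition gradient :: "(R3 \<Rightarrow> real) \<Rightarrow> field" where
  "gradient f x = (\<chi> j. frechet_derivative f (at x) (axis j 1))"

(* Smoothness of the boundary: locally, Omega is a sublevel set of a smooth function
   with non-vanishing gradient. *)
definition smooth_bounded_domain :: "R3 set \<Rightarrow> bool" where
  "smooth_bounded_domain \<Omega> \<longleftrightarrow>
     open \<Omega> \<and> connected \<Omega> \<and> \<Omega> \<noteq> {} \<and> bounded \<Omega> \<and>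
     (\<forall>x\<in>frontier \<Omega>. \<exists>W g. open W \<and> x \<in> W \<and> smooth_on W g \<and>
        (\<forall>y\<in>W. gradient g y \<noteq> 0) \<and> \<Omega> \<inter> W = {y \<in> W. g y < 0})"


section \<open>Lebesgue and Sobolev spaces on the domain\<close>

definition Lp :: "real \<Rightarrow> R3 set \<Rightarrow> (R3 \<Rightarrow> 'b::euclidean_space) set" where
  "Lp p \<Omega> = {f \<in> borel_measurable (lebesgue_on \<Omega>). integrable (lebesgue_on \<Omega>) (\<lambda>x. norm (f x) powr p)}"

definition Lp_norm :: "real \<Rightarrow> R3 set \<Rightarrow> (R3 \<Rightarrow> 'b::euclidean_space) \<Rightarrow> real" where
  "Lp_norm p \<Omega> f = (LINT x|lebesgue_on \<Omega>. norm (f x) powr p) powr (1 / p)"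

definition L2_inner :: "R3 set \<Rightarrow> (R3 \<Rightarrow> 'b::euclidean_space) \<Rightarrow> (R3 \<Rightarrow> 'b) \<Rightarrow> real" where
  "L2_inner \<Omega> f g = (LINT x|lebesgue_on \<Omega>. f x \<bullet> g x)"

definition weak_gradient :: "R3 set \<Rightarrow> (R3 \<Rightarrow> real) \<Rightarrow> field \<Rightarrow> bool" where
  "weak_gradient \<Omega> f g \<longleftrightarrow>
     (\<forall>\<phi>. test_fun \<Omega> \<phi> \<longrightarrow> (\<forall>j. (LINT x|lebesgue_on \<Omega>. f x * gradient \<phi> x $ j)
                             = - (LINT x|lebesgue_on \<Omega>. g x $ j * \<phi> x)))"

definition H1 :: "R3 set \<Rightarrow> (R3 \<Rightarrow> real) set" where
  "H1 \<Omega> = {f \<in> Lp 2 \<Omega>. \<exists>g\<in>Lp 2 \<Omega>. weak_gradient \<Omega> f g}"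

definition wgrad :: "R3 set \<Rightarrow> (R3 \<Rightarrow> real) \<Rightarrow> field" where
  "wgrad \<Omega> f = (SOME g. g \<in> Lp 2 \<Omega> \<and> weak_gradient \<Omega> f g)"

(* Jacobian: row i is the weak gradient of the i-th component. The norm and the inner product
   of real^3^3 are the Frobenius ones. *)
definition vgrad :: "R3 set \<Rightarrow> field \<Rightarrow> R3 \<Rightarrow> real^3^3" where
  "vgrad \<Omega> v x = (\<chi> i. wgrad \<Omega> (\<lambda>y. v y $ i) x)"

definition H1_vec :: "R3 set \<Rightarrow> field set" where
  "H1_vec \<Omega> = {v. \<forall>i. (\<lambda>x. v x $ i) \<in> H1 \<Omega>}"

(* Vanishing trace, as usual: membership in the closure of C_c^infinity(Omega)^3 in H^1. *)
definition H10_vec :: "R3 set \<Rightarrow> field set" where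
  "H10_vec \<Omega> = {v \<in> H1_vec \<Omega>. \<exists>\<Phi> :: nat \<Rightarrow> field.
     (\<forall>n i. test_fun \<Omega> (\<lambda>x. \<Phi> n x $ i)) \<and>
     (\<lambda>n. Lp_norm 2 \<Omega> (v - \<Phi> n)) \<longlonglongrightarrow> 0 \<and>
     (\<lambda>n. Lp_norm 2 \<Omega> (vgrad \<Omega> v - vgrad \<Omega> (\<Phi> n))) \<longlonglongrightarrow> 0}"

(* div v = 0 in the sense of distributions *)
definition div_free :: "R3 set \<Rightarrow> field \<Rightarrow> bool" where
  "div_free \<Omega> v \<longleftrightarrow> (\<forall>\<phi>. test_fun \<Omega> \<phi> \<longrightarrow> (LINT x|lebesgue_on \<Omega>. v x \<bullet> gradient \<phi> x) = 0)"

(* The normal trace of v in L^2 with div v in L^2 is the functional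
   phi |-> (v, grad phi) + (div v, phi) on H^1; here it is needed for div v = 0 only. *)
definition normal_trace_zero :: "R3 set \<Rightarrow> field \<Rightarrow> bool" where
  "normal_trace_zero \<Omega> v \<longleftrightarrow> (\<forall>\<phi>\<in>H1 \<Omega>. L2_inner \<Omega> v (wgrad \<Omega> \<phi>) = 0)"

definition H_space :: "R3 set \<Rightarrow> field set" where
  "H_space \<Omega> = {v \<in> Lp 2 \<Omega>. div_free \<Omega> v \<and> normal_trace_zero \<Omega> v}"

abbreviation H_norm :: "R3 set \<Rightarrow> field \<Rightarrow> real" where
  "H_norm \<Omega> \<equiv> Lp_norm 2 \<Omega>"

definition V_space :: "R3 set \<Rightarrow> field set" where
  "V_space \<Omega> = {v \<in> H10_vec \<Omega>. div_free \<Omega> v}"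

definition V_inner :: "R3 set \<Rightarrow> field \<Rightarrow> field \<Rightarrow> real" where
  "V_inner \<Omega> v w = L2_inner \<Omega> (vgrad \<Omega> v) (vgrad \<Omega> w)"

definition V_norm :: "R3 set \<Rightarrow> field \<Rightarrow> real" where
  "V_norm \<Omega> v = Lp_norm 2 \<Omega> (vgrad \<Omega> v)"


section \<open>Spaces of vector-valued functions of time\<close>

(* A (semi)normed space of fields is given by its set of elements X and its norm N. *)

(* Bochner measurability: a.e. limit of simple functions *)
definition strongly_measurable :: "field set \<Rightarrow> (field \<Rightarrow> real) \<Rightarrow> real \<Rightarrow> (real \<Rightarrow> field) \<Rightarrow> bool" where
  "strongly_measurable X N T u \<longleftrightarrow> (\<exists>s :: nat \<Rightarrow> real \<Rightarrow> field.
     (\<forall>n. finite (range (s n)) \<and> range (s n) \<subseteq> X \<and>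
          (\<forall>w. {t \<in> {0..T}. s n t = w} \<in> sets lebesgue)) \<and>
     (AE t in lebesgue_on {0..T}. (\<lambda>n. N (u t - s n t)) \<longlonglongrightarrow> 0))"

definition L2_time :: "field set \<Rightarrow> (field \<Rightarrow> real) \<Rightarrow> real \<Rightarrow> (real \<Rightarrow> field) set" where
  "L2_time X N T = {u. (AE t in lebesgue_on {0..T}. u t \<in> X) \<and> strongly_measurable X N T u \<and>
     integrable (lebesgue_on {0..T}) (\<lambda>t. (N (u t))\<^sup>2)}"

definition L2_time_norm :: "(field \<Rightarrow> real) \<Rightarrow> real \<Rightarrow> (real \<Rightarrow> field) \<Rightarrow> real" where
  "L2_time_norm N T u = sqrt (LINT t|lebesgue_on {0..T}. (N (u t))\<^sup>2)"

definition Linf_time_norm :: "(field \<Rightarrow> real) \<Rightarrow> real \<Rightarrow> (real \<Rightarrow> field) \<Rightarrow> ereal" where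
  "Linf_time_norm N T u = esssup (lebesgue_on {0..T}) (\<lambda>t. ereal (N (u t)))"

definition C_time :: "field set \<Rightarrow> (field \<Rightarrow> real) \<Rightarrow> real \<Rightarrow> (real \<Rightarrow> field) set" where
  "C_time X N T = {u. \<forall>t\<in>{0..T}. u t \<in> X \<and> ((\<lambda>s. N (u s - u t)) \<longlongrightarrow> 0) (at t within {0..T})}"

(* The identity  int u psi' = - int u' psi  of V-valued integrals, tested against the
   functionals (grad ., grad g), g in V, which are all of V' by the Riesz theorem. *)
definition weak_time_deriv :: "R3 set \<Rightarrow> real \<Rightarrow> (real \<Rightarrow> field) \<Rightarrow> (real \<Rightarrow> field) \<Rightarrow> bool" where
  "weak_time_deriv \<Omega> T u u' \<longleftrightarrow> (\<forall>g\<in>V_space \<Omega>. \<forall>\<psi>. test_fun {0<..<T} \<psi> \<longrightarrow>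
     (LINT t|lebesgue_on {0..T}. V_inner \<Omega> (u t) g * deriv \<psi> t)
       = - (LINT t|lebesgue_on {0..T}. V_inner \<Omega> (u' t) g * \<psi> t))"

definition H1_time_V :: "R3 set \<Rightarrow> real \<Rightarrow> (real \<Rightarrow> field) set" where
  "H1_time_V \<Omega> T = {u \<in> L2_time (V_space \<Omega>) (V_norm \<Omega>) T.
     \<exists>u'\<in>L2_time (V_space \<Omega>) (V_norm \<Omega>) T. weak_time_deriv \<Omega> T u u'}"

definition time_deriv :: "R3 set \<Rightarrow> real \<Rightarrow> (real \<Rightarrow> field) \<Rightarrow> real \<Rightarrow> field" where
  "time_deriv \<Omega> T u = (SOME u'. u' \<in> L2_time (V_space \<Omega>) (V_norm \<Omega>) T \<and> weak_time_deriv \<Omega> T u u')"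

definition Linf_cylinder :: "R3 set \<Rightarrow> real \<Rightarrow> (real \<Rightarrow> field) set" where
  "Linf_cylinder \<Omega> T = {w. (\<lambda>(t, x). w t x) \<in> borel_measurable (lebesgue_on ({0<..T} \<times> \<Omega>)) \<and>
     (\<exists>B. AE (t, x) in lebesgue_on ({0<..T} \<times> \<Omega>). norm (w t x) \<le> B)}"


section \<open>State equation, adjoint equation, cost functional\<close>

definition b_form :: "R3 set \<Rightarrow> field \<Rightarrow> field \<Rightarrow> field \<Rightarrow> real" where
  "b_form \<Omega> u v w = (LINT x|lebesgue_on \<Omega>. (vgrad \<Omega> v x *v u x) \<bullet> w x)"

(* For r = 1 and z = 0 the library convention 0 powr 0 = 0 is harmless, as z is a factor. *)
definition damping :: "real \<Rightarrow> R3 \<Rightarrow> R3" where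
  "damping r z = (norm z powr (r - 1)) *\<^sub>R z"

definition damping_deriv :: "real \<Rightarrow> R3 \<Rightarrow> R3 \<Rightarrow> R3" where
  "damping_deriv r z w =
     (if r = 1 then w
      else if r < 3 \<and> z = 0 then 0
      else ((r - 1) * norm z powr (r - 3) * (z \<bullet> w)) *\<^sub>R z + (norm z powr (r - 1)) *\<^sub>R w)"

(* Membership in H^1(0,T;V) gives a meaning to u_t in the equation. *)
definition weak_solution ::
  "R3 set \<Rightarrow> real \<Rightarrow> real \<Rightarrow> real \<Rightarrow> real \<Rightarrow> real \<Rightarrow> real \<Rightarrow> field \<Rightarrow> (real \<Rightarrow> field) \<Rightarrow> (real \<Rightarrow> field) \<Rightarrow> bool" where
  "weak_solution \<Omega> T \<mu> \<nu> \<alpha> \<beta> r u0 U u \<longleftrightarrow>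
     u \<in> C_time (V_space \<Omega>) (V_norm \<Omega>) T \<and> u \<in> H1_time_V \<Omega> T \<and>
     (AE x in lebesgue_on \<Omega>. u 0 x = u0 x) \<and>
     (\<forall>v\<in>V_space \<Omega>. AE t in lebesgue_on {0..T}.
        L2_inner \<Omega> (time_deriv \<Omega> T u t) v + \<mu> * V_inner \<Omega> (time_deriv \<Omega> T u t) v
        + \<nu> * V_inner \<Omega> (u t) v + b_form \<Omega> (u t) (u t) v + \<alpha> * L2_inner \<Omega> (u t) v
        + \<beta> * L2_inner \<Omega> (\<lambda>x. damping r (u t x)) v
        = L2_inner \<Omega> (U t) v)"

(* Here phi is the representative in C([0,T];V), so that phi(T) makes sense. *)
definition adjoint_state ::
  "R3 set \<Rightarrow> real \<Rightarrow> real \<Rightarrow> real \<Rightarrow> real \<Rightarrow> real \<Rightarrow> real \<Rightarrow> real \<Rightarrow> (real \<Rightarrow> field) \<Rightarrow> (real \<Rightarrow> field)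
     \<Rightarrow> (real \<Rightarrow> field) \<Rightarrow> bool" where
  "adjoint_state \<Omega> T \<mu> \<nu> \<alpha> \<beta> r \<kappa> ud u \<phi> \<longleftrightarrow>
     \<phi> \<in> C_time (V_space \<Omega>) (V_norm \<Omega>) T \<and> \<phi> \<in> H1_time_V \<Omega> T \<and>
     (\<forall>v\<in>V_space \<Omega>. AE t in lebesgue_on {0..T}.
        - L2_inner \<Omega> (time_deriv \<Omega> T \<phi> t) v - \<mu> * V_inner \<Omega> (time_deriv \<Omega> T \<phi> t) v
        + \<nu> * V_inner \<Omega> (\<phi> t) v + b_form \<Omega> v (u t) (\<phi> t) - b_form \<Omega> (u t) (\<phi> t) v
        + \<alpha> * L2_inner \<Omega> (\<phi> t) v
        + \<beta> * L2_inner \<Omega> (\<lambda>x. damping_deriv r (u t x) (\<phi> t x)) v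
        = \<kappa> * V_inner \<Omega> (u t - ud t) v) \<and>
     (\<forall>v\<in>V_space \<Omega>. L2_inner \<Omega> (\<phi> T) v + \<mu> * V_inner \<Omega> (\<phi> T) v = 0)"

(* "A.e. in Omega_T" is read as a.e. t, a.e. x: for jointly measurable representatives this is
   the same by Fubini, and it does not depend on the representative of U in L^2(0,T;H). *)
definition U_ad :: "R3 set \<Rightarrow> real \<Rightarrow> (real \<Rightarrow> field) \<Rightarrow> (real \<Rightarrow> field) \<Rightarrow> (real \<Rightarrow> field) set" where
  "U_ad \<Omega> T Umin Umax = {U \<in> L2_time (H_space \<Omega>) (H_norm \<Omega>) T.
     AE t in lebesgue_on {0..T}. AE x in lebesgue_on \<Omega>.
       \<forall>i. Umin t x $ i \<le> U t x $ i \<and> U t x $ i \<le> Umax t x $ i}"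

definition bounded_open_control_set :: "R3 set \<Rightarrow> real \<Rightarrow> (real \<Rightarrow> field) set \<Rightarrow> bool" where
  "bounded_open_control_set \<Omega> T \<U> \<longleftrightarrow>
     \<U> \<subseteq> L2_time (H_space \<Omega>) (H_norm \<Omega>) T \<and> \<U> \<noteq> {} \<and>
     (\<exists>B. \<forall>U\<in>\<U>. L2_time_norm (H_norm \<Omega>) T U \<le> B) \<and>
     (\<forall>U\<in>\<U>. \<exists>\<epsilon>>0. \<forall>W\<in>L2_time (H_space \<Omega>) (H_norm \<Omega>) T.
        L2_time_norm (H_norm \<Omega>) T (W - U) < \<epsilon> \<longrightarrow> W \<in> \<U>)"

(* S is the control-to-state map U |-> u_U. *)
definition cost ::
  "R3 set \<Rightarrow> real \<Rightarrow> real \<Rightarrow> real \<Rightarrow> (real \<Rightarrow> field) \<Rightarrow> ((real \<Rightarrow> field) \<Rightarrow> real \<Rightarrow> field)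
     \<Rightarrow> (real \<Rightarrow> field) \<Rightarrow> real" where
  "cost \<Omega> T \<kappa> lam ud S U =
     \<kappa> / 2 * (LINT t|lebesgue_on {0..T}. (Lp_norm 2 \<Omega> (vgrad \<Omega> (S U t - ud t)))\<^sup>2)
     + lam / 2 * (LINT t|lebesgue_on {0..T}. (H_norm \<Omega> (U t))\<^sup>2)"

definition energy_bound ::
  "R3 set \<Rightarrow> real \<Rightarrow> real \<Rightarrow> real \<Rightarrow> real \<Rightarrow> real \<Rightarrow> real \<Rightarrow> (real \<Rightarrow> field) \<Rightarrow> real \<Rightarrow> bool" where
  "energy_bound \<Omega> T \<mu> \<nu> \<alpha> \<beta> r u K \<longleftrightarrow>
     (SUP t\<in>{0<..T}. ereal (\<alpha> * (H_norm \<Omega> (u t))\<^sup>2 + \<nu> * (V_norm \<Omega> (u t))\<^sup>2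
                            + 2 * \<beta> / (r + 1) * Lp_norm (r + 1) \<Omega> (u t) powr (r + 1)))
     + ereal (\<mu> * (LINT t|lebesgue_on {0..T}. (V_norm \<Omega> (time_deriv \<Omega> T u t))\<^sup>2)) \<le> ereal K"

(* Membership in L^p is part of the embedding, since Lp_norm is only meaningful there. *)
definition embedding_const :: "R3 set \<Rightarrow> real \<Rightarrow> real \<Rightarrow> bool" where
  "embedding_const \<Omega> p c \<longleftrightarrow> (\<forall>v\<in>V_space \<Omega>. v \<in> Lp p \<Omega> \<and> Lp_norm p \<Omega> v \<le> c * V_norm \<Omega> v)"

(* The right-hand side of the condition on kappa/2. *)
definition kappa_threshold ::
  "R3 set \<Rightarrow> real \<Rightarrow> real \<Rightarrow> real \<Rightarrow> real \<Rightarrow> real \<Rightarrow> real \<Rightarrow> real \<Rightarrow> (real \<Rightarrow> field) \<Rightarrow> ereal" where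
  "kappa_threshold \<Omega> T \<beta> r C C5 Cr Chat \<phi> =
     (if 2 < r then
        ereal (C + 2 * \<beta> * C5 * Cr * Chat powr (r - 2)) * Linf_time_norm (V_norm \<Omega>) T \<phi>
      else if r = 2 then
        ereal C * (Linf_time_norm (V_norm \<Omega>) T \<phi> + ereal (4 * \<beta>) * Linf_time_norm (H_norm \<Omega>) T \<phi>)
      else
        ereal C * Linf_time_norm (V_norm \<Omega>) T \<phi>)"

end

theory Submission
 imports Defs "HOL-Complex_Analysis.Great_Picard"
begin

text \<open>The cost is quadratic in the state and in the control, so \<open>J(U) - J(Ut)\<close> is an exact expression in the
differences \<open>w\<close> of the states and \<open>h\<close> of the controls. Testing the adjoint equation with \<open>w\<close> and the
difference of the two state equations with the adjoint state, and integrating by parts in time, turns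
the part that is linear in \<open>w\<close> into the variational inequality for \<open>h\<close>, up to the second-order remainder
of the nonlinear terms. The remainder is quadratic in \<open>w\<close>: for the convection term it is
\<open>b(w, w, \<phi>)\<close>, for the damping term it is a Taylor remainder of \<open>|u|^(r-1) u\<close> paired with the adjoint
state. By the embedding constants it is at most the threshold times the squared energy norm of \<open>w\<close>,
which gives the lower bound \<open>(\<kappa> / 2 - K) * \<integral> |w|_V^2\<close> for \<open>J(U) - J(Ut)\<close> in \<open>cost_difference\<close>
whenever \<open>K\<close> is not below the threshold. Global optimality is the case \<open>K = \<kappa> / 2\<close>. The Taylor remainder
is estimated pointwise in \<open>damping_remainder_bound\<close> with the constant \<open>(r - 1) * (r + 3)\<close>, which is the
constant \<open>Cr\<close> of the theorem, and \<open>remainder_le_threshold\<close> assembles the bounds.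

For uniqueness a \<open>K\<close> strictly below \<open>\<kappa> / 2\<close> is available, so another optimal control has the same state.
Then the state equations force the difference \<open>h\<close> of the controls to be orthogonal to all of \<open>V_space\<close>
for almost every time (\<open>same_state_orthogonal\<close>). Exceptional null sets of times depend on the test field,
so only countably many test fields can be used at one time. The remaining step is a Helmholtz argument
(\<open>orthogonal_to_loops_zero\<close>): a bounded field \<open>h\<close> with vanishing divergence and normal trace which is orthogonal
to a suitable countable set of divergence-free test fields is zero. The test fields are mollifications of
closed axis-parallel polygonal paths with rational vertices; orthogonality to them says that mollifications of \<open>h\<close> have no
circulation, so that integrating along paths defines potentials on increasing parts of the domain. These are locally uniformly
Lipschitz continuous because \<open>h\<close> is bounded, which is where the bounds on the controls enter, and a
subsequence converges to a potential \<open>P\<close> with gradient \<open>h\<close>. The function \<open>arctan P\<close> is bounded and hence in \<open>H1\<close>,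
with gradient \<open>h / (1 + P^2)\<close>; testing the vanishing normal trace with it yields
\<open>\<integral> |h|^2 / (1 + P^2) = 0\<close>.\<close>

abbreviation leb :: "'a::euclidean_space set => 'a measure" where "leb \<equiv> lebesgue_on"

abbreviation bmeas :: "'a measure => ('a => 'b::topological_space) set" where "bmeas \<equiv> borel_measurable"

abbreviation tmeas :: "real => real measure" where "tmeas T \<equiv> lebesgue_on {0..T}"

abbreviation lims :: "(nat => 'a::topological_space) => 'a => bool" (infix "---->" 60) where "lims \<equiv> LIMSEQ"

section \<open>A calculus of smooth functions\<close>

abbreviation smooth :: "('a::real_normed_vector => real) => bool" where
 "smooth \<equiv> smooth_on UNIV"

lemma dir_derivs_append: "dir_derivs (vs @ ws) f = dir_derivs vs (dir_derivs ws f)"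
 by (induction vs) auto

lemma smooth_differentiable: "smooth f ==> f differentiable (at x)"
 unfolding smooth_on_def by (metis UNIV_I dir_derivs.simps(1))

lemma smooth_frechet: "smooth f ==> smooth (%x. frechet_derivative f (at x) v)"
 unfolding smooth_on_def using dir_derivs_append[of _ "[v]" f] by simp metis

lemma smooth_has_derivative: "smooth f ==> (f has_derivative frechet_derivative f (at x)) (at x)"
 using smooth_differentiable frechet_derivative_works by blast

text \<open>Smoothness quantifies over all iterated directional derivatives, so it is proved by exhibiting a class of functions closed under one differentiation.\<close>

lemma smooth_coinduct:
 assumes "A f" "!!f x. A f ==> f differentiable (at x)"
  "!!f v. A f ==> A (%x. frechet_derivative f (at x) v)"
 shows "smooth f"
proof -
 have "A (dir_derivs vs f)" for vs
  by (induction vs) (use assms in auto)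
 then show ?thesis unfolding smooth_on_def using assms(2) by blast
qed

text \<open>Products and compositions of smooth functions are not by themselves a class closed under differentiation; the algebra generated by them is.\<close>

inductive gen :: "('a::real_normed_vector => real) => bool" where
 base: "smooth f ==> gen f"
| linear: "bounded_linear f ==> gen f"
| const: "gen (%x. c)"
| add: "gen f ==> gen g ==> gen (%x. f x + g x)"
| mult: "gen f ==> gen g ==> gen (%x. f x * g x)"
| comp: "smooth (h::real => real) ==> gen f ==> gen (%x. h (f x))"

lemma gen_derivative:
 assumes "gen f"
 shows "(\<forall>x. f differentiable (at x)) \<and> (\<forall>v. gen (%x. frechet_derivative f (at x) v))"
 using assms
proof induction
 case (base f)
 then show ?case by (auto intro: gen.base smooth_differentiable smooth_frechet)
next
 case (linear f)
 then have "(f has_derivative f) (at x)" for x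
  by (rule bounded_linear_imp_has_derivative)
 moreover from this have "frechet_derivative f (at x) = f" for x
  by (metis frechet_derivative_at)
 ultimately show ?case
  by (auto simp: differentiable_def intro: gen.const)
next
 case (const c)
 have "frechet_derivative (%x::'a. c) (at x) = (%v. 0)" for x
  by (metis frechet_derivative_at has_derivative_const)
 then show ?case by (auto intro: gen.const)
next
 case (add f g)
 have "((%x. f x + g x) has_derivative
   (%v. frechet_derivative f (at x) v + frechet_derivative g (at x) v)) (at x)" for x
  by (intro derivative_intros) (use add in \<open>auto simp: frechet_derivative_works\<close>)
 then have "frechet_derivative (%x. f x + g x) (at x)
   = (%v. frechet_derivative f (at x) v + frechet_derivative g (at x) v)" for x
  using frechet_derivative_at by metis
 then show ?case using add by (auto intro: gen.add)
next
 case (mult f g)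
 have "((%x. f x * g x) has_derivative
   (%v. f x * frechet_derivative g (at x) v + frechet_derivative f (at x) v * g x)) (at x)" for x
  by (intro derivative_intros) (use mult in \<open>auto simp: frechet_derivative_works\<close>)
 then have "frechet_derivative (%x. f x * g x) (at x)
   = (%v. f x * frechet_derivative g (at x) v + frechet_derivative f (at x) v * g x)" for x
  using frechet_derivative_at by metis
 then show ?case using mult by (auto intro!: gen.add gen.mult)
next
 case (comp h f)
 let ?h' = "%t. frechet_derivative h (at t) 1"
 have c1: "((%x. h (f x)) has_derivative
   (%v. frechet_derivative h (at (f x)) (frechet_derivative f (at x) v))) (at x)" for x
  by (rule has_derivative_compose[OF _ smooth_has_derivative])
   (use comp in \<open>auto simp: frechet_derivative_works\<close>)
 have hl: "frechet_derivative h (at t) s = s * ?h' t" for t s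
  using linear_cmul[OF has_derivative_linear[OF smooth_has_derivative[OF comp(1), of t]], of s 1]
  by simp
 have *: "((%x. h (f x)) has_derivative
   (%v. frechet_derivative f (at x) v * ?h' (f x))) (at x)" for x
  by (rule has_derivative_eq_rhs[OF c1]) (rule ext, rule hl)
 then have fd: "frechet_derivative (%x. h (f x)) (at x)
   = (%v. frechet_derivative f (at x) v * ?h' (f x))" for x
  using frechet_derivative_at by metis
 have g1: "gen (%x. ?h' (f x))"
  by (rule gen.comp[OF smooth_frechet[OF comp(1)] comp(2)])
 have g2: "gen (%x. frechet_derivative f (at x) v * ?h' (f x))" for v
  by (rule gen.mult[OF _ g1]) (use comp in blast)
 show ?case
 proof (intro conjI allI)
  show "(%x. h (f x)) differentiable at x" for x
   using * unfolding differentiable_def by blast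
  show "gen (%x. frechet_derivative (%x. h (f x)) (at x) v)" for v
   unfolding fd by (rule g2)
 qed
qed

lemma gen_smooth: "gen f ==> smooth f"
 by (rule smooth_coinduct[of gen]) (auto dest: gen_derivative)

lemma smooth_add: "smooth f ==> smooth g ==> smooth (%x. f x + g x)"
 and smooth_mult: "smooth f ==> smooth g ==> smooth (%x. f x * g x)"
 and smooth_comp: "smooth (h::real=>real) ==> smooth f ==> smooth (%x. h (f x))"
 and smooth_const: "smooth (%x. c)"
 and smooth_linear: "bounded_linear f ==> smooth f"
 subgoal by (rule gen_smooth, rule gen.add) (rule gen.base, assumption)+
 subgoal by (rule gen_smooth, rule gen.mult) (rule gen.base, assumption)+
 subgoal by (rule gen_smooth, rule gen.comp) (assumption, rule gen.base)
 subgoal by (rule gen_smooth, rule gen.const)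
 subgoal by (rule gen_smooth, rule gen.linear)
 done

lemma smooth_cmult: "smooth f ==> smooth (%x. c * f x)"
 by (intro smooth_mult smooth_const)

lemma smooth_diff: "smooth f ==> smooth g ==> smooth (%x. f x - g x)"
 using smooth_add[OF _ smooth_cmult[of g "-1"]] by fastforce

lemma smooth_prod: "(!!i. i \<in> I ==> smooth (f i)) ==> smooth (%x. \<Prod>i\<in>I. f i x)"
 by (induction I rule: infinite_finite_induct) (auto intro: smooth_const smooth_mult)

lemma smooth_continuous: "smooth f ==> continuous_on S f"
 by (meson continuous_at_imp_continuous_on differentiable_imp_continuous_within smooth_differentiable)

text \<open>In one variable a function is smooth as soon as it is a primitive of a smooth function.\<close>

lemma smooth_primitive:
 assumes "!!t::real. (f has_real_derivative f' t) (at t)" "smooth f'"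
 shows "smooth f"
proof -
 have fd: "(f has_derivative (%v. f' t * v)) (at t)" for t
  using assms(1) by (simp add: has_field_derivative_def mult_commute_abs)
 then have eq: "frechet_derivative f (at t) = (%v. f' t * v)" for t
  using frechet_derivative_at by metis
 show ?thesis
 proof (rule smooth_coinduct[of "%g. g = f \<or> smooth g"])
  show "g differentiable (at x)" if "g = f \<or> smooth g" for g x
   using that fd smooth_differentiable by (auto simp: differentiable_def)
  show "(%x. frechet_derivative g (at x) v) = f \<or> smooth (%x. frechet_derivative g (at x) v)"
   if "g = f \<or> smooth g" for g v
   using that smooth_mult[OF assms(2) smooth_const[of v]] by (auto simp: eq intro: smooth_frechet)
 qed auto
qed

lemma smooth_sin: "smooth (sin :: real => real)"
proof (rule smooth_coinduct[of "%g. \<exists>a b. g = (%x. a * sin x + b * cos (x::real))"])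
 have d: "((%x. a * sin x + b * cos x) has_derivative (%v. (a * cos x - b * sin x) * v)) (at x)"
  for a b x :: real
  by (auto intro!: derivative_eq_intros simp: algebra_simps)
 show "\<exists>a b. sin = (%x::real. a * sin x + b * cos x)"
  by (rule exI[of _ 1], rule exI[of _ 0]) auto
 show "g differentiable (at x)" if "\<exists>a b. g = (%x. a * sin x + b * cos x)" for g and x :: real
  using that d by (auto simp: differentiable_def)
 fix g v assume "\<exists>a b. g = (%x. a * sin x + b * cos (x::real))"
 then obtain a b where g: "g = (%x. a * sin x + b * cos (x::real))" by auto
 have "frechet_derivative g (at x) = (%v. (a * cos x - b * sin x) * v)" for x
  using frechet_derivative_at d g by metis
 then show "\<exists>a b. (%x. frechet_derivative g (at x) v) = (%x. a * sin x + b * cos x)"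
  by (intro exI[of _ "- b * v"] exI[of _ "a * v"]) (auto simp: algebra_simps)
qed

subsection \<open>A bump function on the line and its primitive\<close>

definition flat :: "nat => real => real" where
 "flat k t = (if 0 < t then exp (- 1 / t) / t ^ k else 0)"

lemma flat_tendsto: "(flat k \<longlongrightarrow> 0) (at 0)"
proof -
 have "((%t. exp (- 1 / t) / t ^ k) \<longlongrightarrow> 0) (at_right (0::real))"
 proof -
  have "((%x::real. x ^ k / exp x) \<longlongrightarrow> 0) at_top"
   by (rule tendsto_power_div_exp_0)
  then have "((%t::real. (inverse t) ^ k / exp (inverse t)) \<longlongrightarrow> 0) (at_right 0)"
   using filterlim_compose filterlim_inverse_at_top_right by blast
  then show ?thesis
   by (simp add: exp_minus field_simps)
 qed
 then have "(flat k \<longlongrightarrow> 0) (at_right 0)"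
  by (rule Lim_transform_eventually) (auto simp: eventually_at_filter flat_def)
 moreover have "(flat k \<longlongrightarrow> 0) (at_left 0)"
  by (rule tendsto_eventually) (auto simp: eventually_at_filter flat_def)
 ultimately show ?thesis using filterlim_split_at by blast
qed

lemma flat_deriv: "(flat k has_real_derivative flat (k + 2) t - real k * flat (k + 1) t) (at t)"
proof -
 consider "t < 0" | "t = 0" | "t > 0" by linarith
 then show ?thesis
 proof cases
  case 1
  have "((%t. 0) has_real_derivative 0) (at t)" by simp
  then have "(flat k has_real_derivative 0) (at t)"
   by (rule has_field_derivative_transform_within_open[of _ _ _ "{..<0}"])
    (use 1 in \<open>auto simp: flat_def\<close>)
  then show ?thesis using 1 by (simp add: flat_def)
 next
  case 2
  have "((%y. (flat k y - flat k 0) / (y - 0)) \<longlongrightarrow> 0) (at 0)"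
   by (rule Lim_transform_eventually[OF flat_tendsto[of "k + 1"]])
    (auto simp: eventually_at_filter flat_def)
  then show ?thesis using 2 by (simp add: has_field_derivative_iff flat_def)
 next
  case 3
  have "((%t. exp (- 1 / t) / t ^ k) has_real_derivative
   exp (- 1 / t) / t ^ (k + 2) - real k * (exp (- 1 / t) / t ^ (k + 1))) (at t)"
  proof (cases k)
   case 0
   then show ?thesis using 3
    by (auto intro!: derivative_eq_intros simp: power2_eq_square)
  next
   case (Suc m)
   have "((%t. exp (- 1 / t) / t ^ k) has_real_derivative
    ((exp (- 1 / t) * (1 / t^2)) * t ^ k - exp (- 1 / t) * (real k * t ^ m)) / (t ^ k * t ^ k)) (at t)"
    using 3 Suc by (auto intro!: derivative_eq_intros simp: power2_eq_square simp del: power_Suc)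
   moreover have "((exp (- 1 / t) * (1 / t^2)) * t ^ k - exp (- 1 / t) * (real k * t ^ m)) / (t ^ k * t ^ k)
    = exp (- 1 / t) / t ^ (k + 2) - real k * (exp (- 1 / t) / t ^ (k + 1))"
    using 3 Suc by (simp add: field_simps power2_eq_square)
   moreover have "real (Suc m) * t ^ m = t ^ m + real m * t ^ (m - Suc 0) * t"
    by (cases m) (auto simp: algebra_simps)
   ultimately show ?thesis by simp
  qed
  then have "(flat k has_real_derivative exp (- 1 / t) / t ^ (k + 2) - real k * (exp (- 1 / t) / t ^ (k + 1))) (at t)"
   by (rule has_field_derivative_transform_within_open[of _ _ _ "{0<..}"])
    (use 3 in \<open>auto simp: flat_def\<close>)
  then show ?thesis using 3 by (simp add: flat_def)
 qed
qed

inductive flat_span :: "(real => real) => bool" where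
 "flat_span (flat k)"
| "flat_span f ==> flat_span g ==> flat_span (%x. c * f x + d * g x)"

text \<open>Differentiating \<open>flat k\<close> produces a combination of \<open>flat (k + 1)\<close> and \<open>flat (k + 2)\<close>, so the span of these functions is closed under differentiation.\<close>

lemma flat_span_deriv:
 "flat_span f ==> \<exists>f'. flat_span f' \<and> (\<forall>t. (f has_real_derivative f' t) (at t))"
proof (induction rule: flat_span.induct)
 case (1 k)
 have "flat_span (%t. 1 * flat (k + 2) t + (- real k) * flat (k + 1) t)"
  by (intro flat_span.intros)
 then show ?case using flat_deriv[of k] by fastforce
next
 case (2 f g c d)
 then obtain f' g' where *: "flat_span f'" "!!t. (f has_real_derivative f' t) (at t)"
  "flat_span g'" "!!t. (g has_real_derivative g' t) (at t)" by auto
 then have "flat_span (%t. c * f' t + d * g' t)"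
  by (intro flat_span.intros)
 moreover have "((%x. c * f x + d * g x) has_real_derivative c * f' t + d * g' t) (at t)" for t
  using * by (auto intro!: derivative_eq_intros)
 ultimately show ?case by blast
qed

lemma smooth_flat: "smooth (flat k)"
proof (rule smooth_coinduct[of flat_span])
 show "f differentiable (at x)" if "flat_span f" for f x
  using flat_span_deriv[OF that] by (auto simp: has_field_derivative_def differentiable_def)
 show "flat_span (%x. frechet_derivative f (at x) v)" if "flat_span f" for f v
 proof -
  obtain f' where *: "flat_span f'" "!!t. (f has_real_derivative f' t) (at t)"
   using flat_span_deriv[OF \<open>flat_span f\<close>] by auto
  have "frechet_derivative f (at t) = (%v. f' t * v)" for t
   using *(2) frechet_derivative_at unfolding has_field_derivative_def by metis
  then have "(%x. frechet_derivative f (at x) v) = (%x. v * f' x + 0 * f' x)" by auto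
  then show ?thesis using flat_span.intros(2)[OF *(1) *(1), of v 0] by simp
 qed
qed (auto intro: flat_span.intros)

definition bump0 :: "real => real" where "bump0 t = flat 0 (1 + t) * flat 0 (1 - t)"

lemma smooth_affine1: "smooth f ==> smooth (%t::real. f (a + b * t))"
 using smooth_add[OF smooth_const[of a] smooth_cmult[OF smooth_linear[OF bounded_linear_ident], of b]]
 by (rule smooth_comp[rotated])

lemma smooth_bump0: "smooth bump0"
 unfolding bump0_def using smooth_affine1[OF smooth_flat[of 0], of 1 1] smooth_affine1[OF smooth_flat[of 0], of 1 "-1"]
 by (intro smooth_mult) auto

lemma bump0_pos: "\<bar>t\<bar> < 1 ==> 0 < bump0 t" and bump0_zero: "1 <= \<bar>t\<bar> ==> bump0 t = 0"
 by (auto simp: bump0_def flat_def)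

lemma bump0_nonneg: "0 <= bump0 t"
 by (auto simp: bump0_def flat_def)

lemma bump0_integral_pos: "0 < integral {-2..2} bump0"
proof -
 have c: "continuous_on S bump0" for S using smooth_bump0 smooth_continuous by blast
 have "box (-2) (2::real) \<noteq> {}" by simp
 then have "integral (cbox (-2) 2) bump0 \<noteq> 0"
  using integral_cbox_eq_0_iff[OF c, of "-2" 2] bump0_nonneg bump0_pos[of 0] by force
 moreover have "0 <= integral {-2..2} bump0"
  by (rule integral_nonneg) (auto intro!: integrable_continuous_interval c bump0_nonneg)
 ultimately show ?thesis by simp
qed

text \<open>The normalised bump and its primitive, a smooth step from \<open>0\<close> (left of \<open>-1\<close>)
 to \<open>1\<close> (right of \<open>1\<close>).\<close>

definition bump :: "real => real" where "bump t = bump0 t / integral {-2..2} bump0"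

definition step :: "real => real" where "step t = integral {-2..t} bump"

lemma smooth_bump: "smooth bump"
 using smooth_cmult[OF smooth_bump0, of "1 / integral {-2..2} bump0"] unfolding bump_def by simp

lemma bump_nonneg: "0 <= bump t"
 using bump0_nonneg bump0_integral_pos by (simp add: bump_def)

lemma bump_zero: "1 <= \<bar>t\<bar> ==> bump t = 0"
 by (simp add: bump_def bump0_zero)

lemma bump_integrable_on: "bump integrable_on {a..b}"
 by (intro integrable_continuous_interval smooth_continuous smooth_bump)

lemma step_left: assumes "t <= -1" shows "step t = 0"
proof -
 have "step t = integral {-2..t} (%x. 0)"
  unfolding step_def by (rule integral_cong) (use assms in \<open>auto intro: bump_zero\<close>)
 then show ?thesis by simp
qed

lemma step_right: assumes "1 <= t" shows "step t = 1"
proof -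
 have one: "integral {-2..2} bump = 1"
  unfolding bump_def using bump0_integral_pos by simp
 have z: "integral {1..s} bump = 0" for s
 proof -
  have "integral {1..s} bump = integral {1..s} (%x. 0)"
   by (rule integral_cong) (auto intro: bump_zero)
  then show ?thesis by simp
 qed
 have "integral {-2..1} bump + integral {1..t} bump = integral {-2..t} bump"
  by (rule Henstock_Kurzweil_Integration.integral_combine) (use assms bump_integrable_on in auto)
 moreover have "integral {-2..1} bump + integral {1..2} bump = integral {-2..2} bump"
  by (rule Henstock_Kurzweil_Integration.integral_combine) (use bump_integrable_on in auto)
 ultimately show ?thesis using z one by (simp add: step_def)
qed

lemma step_deriv: "(step has_real_derivative bump t) (at t)"
proof (cases "t < -1")
 case True
 have "((%t. 0) has_real_derivative 0) (at t)" by simp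
 then have "(step has_real_derivative 0) (at t)"
  by (rule has_field_derivative_transform_within_open[of _ _ _ "{..<-1}"])
   (use True in \<open>auto simp: step_left\<close>)
 then show ?thesis using True bump_zero[of t] by simp
next
 case False
 have "((%u. integral {-2..u} bump) has_real_derivative bump t) (at t within {-2..t+1})"
  by (rule integral_has_real_derivative) (use False in \<open>auto intro: smooth_continuous smooth_bump\<close>)
 then have "(step has_real_derivative bump t) (at t within {-2<..<t+1})"
  unfolding step_def[abs_def] by (rule DERIV_subset) auto
 then show ?thesis using False by (subst (asm) at_within_open) auto
qed

lemma smooth_step: "smooth step"
 by (rule smooth_primitive[OF step_deriv smooth_bump])

lemma step_mono: "s <= t ==> step s <= step t"
 by (rule DERIV_nonneg_imp_nondecreasing[of s t step]) (use step_deriv bump_nonneg in auto)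

lemma step_bounds: "0 <= step t" "step t <= 1"
 using step_mono[of "min t (-1)" t] step_mono[of t "max t 1"] step_left[of "min t (-1)"] step_right[of "max t 1"]
 by auto

lemma bump_bounded: obtains G where "0 < G" "!!t. bump t <= G"
proof -
 have "compact (bump ` {-1..1})"
  by (intro compact_continuous_image smooth_continuous smooth_bump) auto
 then obtain G where G: "!!t. t \<in> {-1..1} ==> norm (bump t) <= G" "0 < G"
  unfolding bounded_pos using compact_imp_bounded bounded_pos by (metis imageI)
 have "bump t <= G" for t
  using G(1)[of t] G(2) bump_zero[of t] by (cases "\<bar>t\<bar> <= 1") (auto simp: abs_le_iff)
 then show ?thesis using that G by blast
qed

section \<open>Test functions and the fundamental lemma\<close>

lemma test_funI:
 assumes "smooth \<psi>" "!!x. x \<notin> K ==> \<psi> x = 0" "compact K" "K \<subseteq> S"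
 shows "test_fun S \<psi>"
proof -
 have "closure {x. \<psi> x \<noteq> 0} \<subseteq> K"
  by (rule closure_minimal) (use assms compact_imp_closed in auto)
 moreover from this have "compact (closure {x. \<psi> x \<noteq> 0})"
  using compact_Int_closed[OF \<open>compact K\<close> closed_closure[of "{x. \<psi> x \<noteq> 0}"]] by (simp add: Int_absorb1)
 ultimately show ?thesis
  unfolding test_fun_def using assms by auto
qed

lemma test_fun_supportE:
 assumes "test_fun S \<psi>"
 obtains K where "compact K" "K \<subseteq> S" "!!x. x \<notin> K ==> \<psi> x = 0"
 using assms closure_subset[of "{x. \<psi> x \<noteq> 0}"] unfolding test_fun_def by blast

lemma test_fun_smooth: "test_fun S \<psi> ==> smooth \<psi>"
 by (simp add: test_fun_def)

lemma test_fun_mult: assumes "test_fun S \<psi>" "smooth f" shows "test_fun S (%x. \<psi> x * f x)"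
proof -
 obtain K where "compact K" "K \<subseteq> S" "!!x. x \<notin> K ==> \<psi> x = 0" using assms test_fun_supportE by blast
 then show ?thesis using assms by (intro test_funI[of _ K]) (use smooth_mult[OF test_fun_smooth[OF assms(1)] assms(2)] in auto)
qed

lemma test_fun_add: assumes "test_fun S \<psi>" "test_fun S \<phi>" shows "test_fun S (%x. \<psi> x + \<phi> x)"
proof -
 obtain K where K: "compact K" "K \<subseteq> S" "!!x. x \<notin> K ==> \<psi> x = 0" using assms test_fun_supportE by blast
 obtain L where L: "compact L" "L \<subseteq> S" "!!x. x \<notin> L ==> \<phi> x = 0" using assms test_fun_supportE by blast
 show ?thesis using assms K L by (intro test_funI[of _ "K \<union> L"]) (use smooth_add[OF test_fun_smooth[OF assms(1)] test_fun_smooth[OF assms(2)]] in auto)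
qed

lemma test_fun_cmult: "test_fun S \<psi> ==> test_fun S (%x. c * \<psi> x)"
 using test_fun_mult[OF _ smooth_const[of c]] by (simp add: mult.commute)

lemma test_fun_zero: "test_fun S (%x. 0)"
 by (rule test_funI[of _ "{}"]) (auto intro: smooth_const)

lemma test_fun_comp:
 assumes "test_fun S \<psi>" "smooth (h::real=>real)" "h 0 = 0" shows "test_fun S (%x. h (\<psi> x))"
proof -
 obtain K where "compact K" "K \<subseteq> S" "!!x. x \<notin> K ==> \<psi> x = 0" using assms test_fun_supportE by blast
 then show ?thesis using assms by (intro test_funI[of _ K]) (use smooth_comp[OF assms(2) test_fun_smooth[OF assms(1)]] in auto)
qed

lemma smooth_coordinate:
 fixes i :: "'a::euclidean_space"
 shows "smooth h ==> smooth (%x. h (a + b * (x \<bullet> i)))"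
 using smooth_comp[OF smooth_affine1[of h a b] smooth_linear[OF bounded_linear_inner_left[of i]]] by simp

text \<open>Products of smooth steps in the coordinates approximate the indicator of a box.\<close>

lemma test_fun_box_approx:
 fixes a b :: "'a::euclidean_space"
 assumes "cbox a b \<subseteq> S"
 obtains \<psi> :: "nat => 'a => real" where "!!k. test_fun S (\<psi> k)" "!!k x. 0 <= \<psi> k x" "!!k x. \<psi> k x <= 1"
  "!!x. (%k. \<psi> k x) ----> indicator (box a b) x"
proof -
 define \<psi> where "\<psi> k x = (\<Prod>i\<in>Basis. step (real k * (x \<bullet> i - a \<bullet> i) - 1) * step (real k * (b \<bullet> i - x \<bullet> i) - 1))"
  for k and x :: 'a
 have z: "step (real k * (x \<bullet> i - a \<bullet> i) - 1) * step (real k * (b \<bullet> i - x \<bullet> i) - 1) = 0"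
  if "\<not> (a \<bullet> i < x \<bullet> i \<and> x \<bullet> i < b \<bullet> i)" for k x i
 proof -
  have "real k * (x \<bullet> i - a \<bullet> i) <= 0 \<or> real k * (b \<bullet> i - x \<bullet> i) <= 0"
   using that by (auto simp: not_less mult_le_0_iff)
  then show ?thesis by (auto simp: step_left)
 qed
 have supp: "\<psi> k x = 0" if "x \<notin> box a b" for k x
  using that z unfolding \<psi>_def mem_box by (intro prod_zero) auto
 have "smooth (\<psi> k)" for k
  unfolding \<psi>_def
 proof (intro smooth_prod smooth_mult)
  fix i :: 'a
  show "smooth (%x. step (real k * (x \<bullet> i - a \<bullet> i) - 1))"
   using smooth_coordinate[OF smooth_step, of "- real k * (a \<bullet> i) - 1" "real k" i] by (simp add: algebra_simps)
  show "smooth (%x. step (real k * (b \<bullet> i - x \<bullet> i) - 1))"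
   using smooth_coordinate[OF smooth_step, of "real k * (b \<bullet> i) - 1" "- real k" i] by (simp add: algebra_simps)
 qed
 moreover have "\<psi> k x = 0" if "x \<notin> cbox a b" for k x
  using that supp box_subset_cbox by blast
 ultimately have 1: "test_fun S (\<psi> k)" for k
  using assms by (intro test_funI[of _ "cbox a b"]) auto
 have 2: "0 <= \<psi> k x" "\<psi> k x <= 1" for k x
  unfolding \<psi>_def by (intro prod_nonneg ballI prod_le_1 conjI mult_nonneg_nonneg mult_le_one step_bounds)+
 have 3: "(%k. \<psi> k x) ----> indicator (box a b) x" for x
 proof (cases "x \<in> box a b")
  case False
  then show ?thesis using supp by simp
 next
  case True
  have "(%k. step (real k * c - 1)) ----> 1" if "c > 0" for c
  proof -
   obtain N :: nat where "2 / c < real N" using reals_Archimedean2 by blast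
   then have "2 < real N * c" using that by (simp add: field_simps)
   moreover have "real N * c <= real k * c" if "N <= k" for k using that \<open>c > 0\<close> by simp
   ultimately have "\<forall>k\<ge>N. step (real k * c - 1) = 1" by (force intro: step_right)
   then show ?thesis by (intro tendsto_eventually) (auto simp: eventually_sequentially)
  qed
  then have "(%k. \<psi> k x) ----> (\<Prod>i\<in>(Basis::'a set). 1 * 1)"
   unfolding \<psi>_def using True by (intro tendsto_prod tendsto_mult) (auto simp: mem_box)
  then show ?thesis using True by simp
 qed
 show ?thesis using that 1 2 3 by blast
qed

text \<open>The boxes form a generator of the Borel sets that is stable under intersection.\<close>

lemma AE_zero_if_zero_on_boxes:
 fixes f :: "'a::euclidean_space => real"
 assumes int: "integrable lborel f" and zero: "!!a b. (LINT x|lborel. indicator (box a b) x * f x) = 0"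
 shows "AE x in lborel. f x = 0"
proof -
 have [measurable]: "f \<in> bmeas borel" using int by auto
 let ?p = "%x. ennreal (f x)" and ?n = "%x. ennreal (- f x)"
 have eq: "emeasure (density lborel ?p) (box a b) = emeasure (density lborel ?n) (box a b)"
  and fin: "emeasure (density lborel ?p) (box a b) \<noteq> \<infinity>" for a b :: 'a
 proof -
  let ?g = "%x. indicator (box a b) x * f x"
  have g: "integrable lborel ?g"
   using integrable_mult_indicator[OF _ int, of "box a b"] by simp
  have e: "(%x. ennreal (?g x)) = (%x. ?p x * indicator (box a b) x)"
   "(%x. ennreal (- ?g x)) = (%x. ?n x * indicator (box a b) x)"
   by (auto simp: indicator_def)
  have f: "(\<integral>\<^sup>+x. ?p x * indicator (box a b) x \<partial>lborel) < \<infinity>" "(\<integral>\<^sup>+x. ?n x * indicator (box a b) x \<partial>lborel) < \<infinity>"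
   using g[unfolded real_integrable_def] unfolding e by (auto simp: top.not_eq_extremum)
  have "enn2real (\<integral>\<^sup>+x. ?p x * indicator (box a b) x \<partial>lborel) = enn2real (\<integral>\<^sup>+x. ?n x * indicator (box a b) x \<partial>lborel)"
   using real_lebesgue_integral_def[OF g] zero[of a b] unfolding e by simp
  then have "(\<integral>\<^sup>+x. ?p x * indicator (box a b) x \<partial>lborel) = (\<integral>\<^sup>+x. ?n x * indicator (box a b) x \<partial>lborel)"
   using f by (metis ennreal_enn2real infinity_ennreal_def)
  then show "emeasure (density lborel ?p) (box a b) = emeasure (density lborel ?n) (box a b)"
   "emeasure (density lborel ?p) (box a b) \<noteq> \<infinity>"
   using f by (auto simp: emeasure_density)
 qed
 have "density lborel ?p = density lborel ?n"
 proof (rule measure_eqI_generator_eq)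
  let ?E = "range (%(a, b). box a b :: 'a set)"
  show "Int_stable ?E" by (auto simp: Int_stable_def Int_interval box_Int_box)
  show "?E \<subseteq> Pow UNIV" by simp
  show "sets (density lborel ?p) = sigma_sets UNIV ?E" "sets (density lborel ?n) = sigma_sets UNIV ?E"
   by (simp_all add: borel_eq_box)
  let ?A = "%n::nat. box (- real n *\<^sub>R One) (real n *\<^sub>R One) :: 'a set"
  show "range ?A \<subseteq> ?E" "(\<Union>i. ?A i) = UNIV"
   using UN_box_eq_UNIV by auto
  show "emeasure (density lborel ?p) (?A i) \<noteq> \<infinity>" for i using fin .
 qed (use eq in auto)
 then have "AE x in lborel. ?p x = ?n x"
  by (intro sigma_finite_measure.density_unique[OF sigma_finite_lborel]) auto
 then show ?thesis
 proof eventually_elim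
  case (elim x)
  then show ?case
   by (metis ennreal_eq_0_iff ennreal_neg linorder_le_cases neg_le_0_iff_le order_antisym neg_0_le_iff_le)
 qed
qed

lemma LINT_lebesgue_on:
 fixes f :: "'a::euclidean_space => 'b::{banach,second_countable_topology}"
 assumes "Om \<in> sets lebesgue"
 shows "(LINT x|leb Om. f x) = (LINT x|lebesgue. indicator Om x *\<^sub>R f x)"
  and "integrable (leb Om) f \<longleftrightarrow> integrable lebesgue (%x. indicator Om x *\<^sub>R f x)"
 using assms by (auto simp: integral_restrict_space integrable_restrict_space)

lemma AE_lebesgue_on:
 assumes "Om \<in> sets lebesgue"
 shows "(AE x in leb Om. P x) \<longleftrightarrow> (AE x in lebesgue. x \<in> Om --> P x)"
 using assms by (simp add: AE_restrict_space_iff)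

lemma lebesgue_borel_representative:
 fixes f :: "'a::euclidean_space => real"
 assumes "f \<in> bmeas lebesgue"
 obtains g where "g \<in> bmeas borel" "AE x in lebesgue. f x = g x"
proof -
 obtain g where "g \<in> bmeas lborel" "AE x in lborel. f x = g x"
  using completion_ex_borel_measurable_real assms by blast
 then show ?thesis using that AE_completion by (auto simp del: AE_completion_iff)
qed

lemma AE_zero_if_zero_on_inner_boxes:
 fixes f :: "'a::euclidean_space => real"
 assumes "open Om" and int: "integrable (leb Om) f"
  and zero: "!!a b. cbox a b \<subseteq> Om ==> (LINT x|leb Om. indicator (box a b) x * f x) = 0"
 shows "AE x in leb Om. f x = 0"
proof -
 have [measurable]: "Om \<in> sets lebesgue" "Om \<in> sets borel" using assms by auto
 have F: "integrable lebesgue (%x. indicator Om x *\<^sub>R f x)"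
  using LINT_lebesgue_on(2)[of Om f] int by simp
 then obtain g where g[measurable]: "g \<in> bmeas borel" and gF: "AE x in lebesgue. indicator Om x *\<^sub>R f x = g x"
  using lebesgue_borel_representative[OF borel_measurable_integrable[OF F]] by metis
 have gi: "integrable lborel g"
 proof -
  have "integrable lebesgue g" using F gF by (subst integrable_cong_AE[symmetric, OF _ _ gF]) (auto simp: measurable_completion)
  then show ?thesis using integrable_completion[of g lborel] by simp
 qed
 have box0: "AE x in lborel. x \<in> box a b --> g x = 0" if ab: "cbox a b \<subseteq> Om" for a b
 proof -
  have "AE x in lborel. indicator (box a b) x * g x = 0"
  proof (rule AE_zero_if_zero_on_boxes)
   show "integrable lborel (%x. indicator (box a b) x * g x)"
    using integrable_mult_indicator[OF _ gi, of "box a b"] by simp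
   fix c d
   obtain c' d' where cd: "box c d \<inter> box a b = box c' d'" using that[OF box_Int_box] .
   have ss: "box c' d' \<subseteq> box a b" using cd by blast
   have "(LINT x|lborel. indicator (box c d) x * (indicator (box a b) x * g x)) = (LINT x|lborel. indicator (box c' d') x * g x)"
    by (rule Bochner_Integration.integral_cong) (auto simp: cd[symmetric] indicator_def)
   also have "\<dots> = (LINT x|lebesgue. indicator (box c' d') x * g x)"
    by (rule integral_completion[symmetric]) auto
   also have "\<dots> = (LINT x|lebesgue. indicator Om x *\<^sub>R (indicator (box c' d') x * f x))"
   proof (rule integral_cong_AE)
    show "(%x. indicator Om x *\<^sub>R (indicator (box c' d') x * f x)) \<in> bmeas lebesgue"
    proof -
     have "(%x. indicator (box c' d') x * (indicator Om x *\<^sub>R f x)) \<in> bmeas lebesgue"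
      using F by (intro borel_measurable_times) (auto intro!: measurable_completion)
     then show ?thesis by (simp add: mult.left_commute)
    qed
    show "AE x in lebesgue. indicator (box c' d') x * g x = indicator Om x *\<^sub>R (indicator (box c' d') x * f x)"
     using gF by eventually_elim (auto simp: indicator_def split: if_splits)
   qed (auto simp: measurable_completion)
   also have "\<dots> = (LINT x|leb Om. indicator (box c' d') x * f x)"
    by (simp add: LINT_lebesgue_on)
   also have "\<dots> = 0"
   proof (cases "box c' d' = {}")
    case True then show ?thesis by simp
   next
    case False
    then have "closure (box c' d') = cbox c' d'" "closure (box a b) = cbox a b"
     using ss closure_box by blast+
    then have "cbox c' d' \<subseteq> cbox a b" using closure_mono[OF ss] by simp
    then show ?thesis using ab zero by blast
   qed
   finally show "(LINT x|lborel. indicator (box c d) x * (indicator (box a b) x * g x)) = 0" .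
  qed
  then show ?thesis by eventually_elim (auto simp: indicator_def split: if_splits)
 qed
 obtain D where D: "countable D" "D \<subseteq> Pow Om" "!!X. X \<in> D ==> \<exists>a b. X = cbox a b" "\<Union>D = Om"
  using open_countable_Union_open_cbox[OF \<open>open Om\<close>] by metis
 have "AE x in lborel. \<forall>X\<in>D. x \<in> X --> g x = 0"
 proof (subst AE_ball_countable[OF D(1)], rule ballI)
  fix X assume X: "X \<in> D"
  then obtain a b where ab: "X = cbox a b" "cbox a b \<subseteq> Om" using D by blast
  have "AE x in lborel. x \<notin> cbox a b - box a b"
   using negligible_frontier_interval[of a b]
   by (intro AE_not_in) (simp add: negligible_iff_null_sets null_sets_completion_iff)
  with box0[OF ab(2)] show "AE x in lborel. x \<in> X --> g x = 0"
   by eventually_elim (auto simp: ab)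
 qed
 then have "AE x in lebesgue. x \<in> Om --> g x = 0"
  by (intro AE_completion, eventually_elim) (use D in blast)
 with gF have "AE x in lebesgue. x \<in> Om --> f x = 0"
  by eventually_elim auto
 then show ?thesis by (simp add: AE_lebesgue_on)
qed

lemma smooth_borel: "smooth (f::'a::euclidean_space=>real) ==> f \<in> bmeas borel"
 by (intro borel_measurable_continuous_onI smooth_continuous)

lemma borel_imp_lebesgue_on:
 "f \<in> bmeas borel ==> f \<in> bmeas (leb S)"
 by (intro measurable_restrict_space1 measurable_completion) simp

lemma test_fun_bounded:
 fixes \<psi> :: "'a::euclidean_space => real"
 assumes "test_fun S \<psi>" obtains B where "!!x. \<bar>\<psi> x\<bar> <= B" "0 <= B"
proof -
 obtain K where K: "compact K" "K \<subseteq> S" "!!x. x \<notin> K ==> \<psi> x = 0" using assms test_fun_supportE by blast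
 have "compact (\<psi> ` K)"
  using K assms by (intro compact_continuous_image smooth_continuous test_fun_smooth)
 then obtain B where B: "!!x. x \<in> K ==> norm (\<psi> x) <= B" "0 < B"
  using compact_imp_bounded bounded_pos by (metis imageI)
 have "\<bar>\<psi> x\<bar> <= B" for x using B K(3)[of x] by (cases "x \<in> K") auto
 then show ?thesis using that B by force
qed

lemma fundamental_lemma:
 fixes f :: "'a::euclidean_space => real"
 assumes "open Om" and int: "integrable (leb Om) f"
  and zero: "!!\<psi>. test_fun Om \<psi> ==> (LINT x|leb Om. f x * \<psi> x) = 0"
 shows "AE x in leb Om. f x = 0"
proof (rule AE_zero_if_zero_on_inner_boxes[OF assms(1,2)])
 fix a b :: 'a assume ab: "cbox a b \<subseteq> Om"
 obtain \<psi> :: "nat => 'a => real" where \<psi>: "!!k. test_fun Om (\<psi> k)" "!!k x. 0 <= \<psi> k x" "!!k x. \<psi> k x <= 1"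
  "!!x. (%k. \<psi> k x) ----> indicator (box a b) x"
  using test_fun_box_approx[OF ab] by metis
 have [measurable]: "f \<in> bmeas (leb Om)" using int by auto
 have "(%k. LINT x|leb Om. f x * \<psi> k x) ----> (LINT x|leb Om. f x * indicator (box a b) x)"
 proof (rule integral_dominated_convergence[where w="%x. norm (f x)"])
  show "(%x. f x * indicator (box a b) x) \<in> bmeas (leb Om)"
   by (intro borel_measurable_times borel_imp_lebesgue_on[of "indicator (box a b)"]) auto
  show "(%x. f x * \<psi> k x) \<in> bmeas (leb Om)" for k
   by (intro borel_measurable_times borel_imp_lebesgue_on[of "\<psi> k"] smooth_borel test_fun_smooth[OF \<psi>(1)]) auto
  show "AE x in leb Om. (%k. f x * \<psi> k x) ----> f x * indicator (box a b) x"
   by (intro always_eventually allI tendsto_mult \<psi>(4)) auto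
  show "AE x in leb Om. norm (f x * \<psi> k x) <= norm (f x)" for k
   using \<psi>(2,3)[of k] by (auto simp: abs_mult mult_left_le intro!: always_eventually)
 qed (use int in auto)
 then have "(LINT x|leb Om. f x * indicator (box a b) x) = 0"
  using zero[OF \<psi>(1)] by (simp add: LIMSEQ_const_iff)
 then show "(LINT x|leb Om. indicator (box a b) x * f x) = 0"
  by (simp add: mult.commute)
qed

lemma lborel_translate:
 fixes F :: "'a::euclidean_space => real"
 assumes "integrable lborel F"
 shows "integrable lborel (%x. F (c + x))" "(LINT x|lborel. F (c + x)) = (LINT x|lborel. F x)"
proof -
 have [measurable]: "F \<in> bmeas borel" using assms by auto
 have "integrable (distr lborel borel ((+) c)) F" by (simp add: lborel_distr_plus assms)
 then show "integrable lborel (%x. F (c + x))" by (subst (asm) integrable_distr_eq) auto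
 have "(LINT x|lborel. F x) = (LINT x|distr lborel borel ((+) c). F x)" by (simp add: lborel_distr_plus)
 also have "\<dots> = (LINT x|lborel. F (c + x))" by (subst integral_distr) auto
 finally show "(LINT x|lborel. F (c + x)) = (LINT x|lborel. F x)" ..
qed

text \<open>The difference quotients of a compactly supported function integrate to zero by translation
 invariance, hence so does a bounded directional derivative.\<close>

lemma integral_directional_derivative_zero:
 fixes F G :: "'a::euclidean_space => real"
 assumes deriv: "!!x. ((%t. F (x + t *\<^sub>R e)) has_real_derivative G x) (at 0)"
  and F: "integrable lborel F" and G[measurable]: "G \<in> bmeas borel"
  and GB: "!!x. \<bar>G x\<bar> <= B" and supp: "!!x. R < norm x ==> F x = 0"
 shows "(LINT x|lborel. G x) = 0"
proof -
 have [measurable]: "F \<in> bmeas borel" using F by auto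
 define D where "D n x = (F (x + inverse (real (Suc n)) *\<^sub>R e) - F x) * real (Suc n)" for n x
 have d: "((%t. F (x + t *\<^sub>R e)) has_real_derivative G (x + s *\<^sub>R e)) (at s)" for x s
 proof -
  have "((%t. F ((x + s *\<^sub>R e) + t *\<^sub>R e)) has_real_derivative G (x + s *\<^sub>R e)) (at (s - s))"
   using deriv by simp
  then have "((%t. F ((x + s *\<^sub>R e) + (t - s) *\<^sub>R e)) has_real_derivative G (x + s *\<^sub>R e)) (at s)"
   using DERIV_shift[of "%t. F ((x + s *\<^sub>R e) + t *\<^sub>R e)" "G (x + s *\<^sub>R e)" s "- s"] by simp
  then show ?thesis by (simp add: algebra_simps)
 qed
 have "(%n. LINT x|lborel. D n x) ----> (LINT x|lborel. G x)"
 proof (rule integral_dominated_convergence[where w="%x. B * indicator (cball 0 (R + norm e)) x"])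
  show "G \<in> bmeas lborel" by simp
  show "D n \<in> bmeas lborel" for n unfolding D_def by measurable
  show "integrable lborel (%x. B * indicator (cball (0::'a) (R + norm e)) x)"
   using emeasure_lborel_cball_finite[of "0::'a" "R + norm e"]
   by (intro integrable_mult_right integrable_real_indicator) auto
  show "AE x in lborel. (%n. D n x) ----> G x"
  proof (rule always_eventually, rule allI)
   fix x
   have "((%h. (F (x + h *\<^sub>R e) - F x) / h) \<longlongrightarrow> G x) (at 0)"
    using deriv[of x] by (simp add: DERIV_def)
   moreover have "filterlim (%n. inverse (real (Suc n))) (at 0) sequentially"
    unfolding filterlim_at using LIMSEQ_inverse_real_of_nat by auto
   ultimately have "(%n. (F (x + inverse (real (Suc n)) *\<^sub>R e) - F x) / inverse (real (Suc n))) ----> G x"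
    by (rule filterlim_compose)
   then show "(%n. D n x) ----> G x" by (simp add: D_def divide_inverse)
  qed
  show "AE x in lborel. norm (D n x) <= B * indicator (cball 0 (R + norm e)) x" for n
  proof (rule always_eventually, rule allI)
   fix x :: 'a
   let ?h = "inverse (real (Suc n))"
   have h: "0 < ?h" "?h <= 1" by (auto simp: field_simps)
   have B0: "0 <= B" using GB[of 0] by linarith
   show "norm (D n x) <= B * indicator (cball 0 (R + norm e)) x"
   proof (cases "norm x <= R + norm e")
    case True
    obtain z where z: "0 < z" "z < ?h" "F (x + ?h *\<^sub>R e) - F (x + 0 *\<^sub>R e) = (?h - 0) * G (x + z *\<^sub>R e)"
     using MVT2[OF h(1), of "%t. F (x + t *\<^sub>R e)" "%s. G (x + s *\<^sub>R e)"] d by metis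
    then have "D n x = G (x + z *\<^sub>R e)" by (simp add: D_def field_simps)
    then show ?thesis using True GB by simp
   next
    case False
    have "norm (?h *\<^sub>R e) <= norm e" using h by (simp add: mult_left_le_one_le)
    moreover have "norm x <= norm (x + ?h *\<^sub>R e) + norm (?h *\<^sub>R e)"
     using norm_triangle_sub[of x "x + ?h *\<^sub>R e"] by simp
    ultimately have "R < norm (x + ?h *\<^sub>R e)" "R < norm x" using False norm_ge_zero[of e] by linarith+
    then show ?thesis using False B0 by (simp add: D_def supp)
   qed
  qed
 qed
 moreover have "(LINT x|lborel. D n x) = 0" for n
  using lborel_translate[OF F, of "inverse (real (Suc n)) *\<^sub>R e"] F
  by (simp add: D_def add.commute)
 ultimately show ?thesis by (simp add: LIMSEQ_const_iff)
qed

section \<open>Hoelder's inequality\<close>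

lemma powr_amgm3:
 fixes a b c p q r :: real
 assumes "0 <= a" "0 <= b" "0 <= c" "0 < p" "0 < q" "0 < r" "p + q + r = 1"
 shows "a powr p * b powr q * c powr r <= p * a + q * b + r * c"
proof (cases "a = 0 \<or> b = 0 \<or> c = 0")
 case True
 then show ?thesis using assms by (auto intro!: add_nonneg_nonneg)
next
 case False
 then have pos: "0 < a" "0 < b" "0 < c" using assms by auto
 define s where "s = q + r"
 have s: "0 < s" "p + s = 1" "q / s + r / s = 1" using assms by (auto simp: s_def add_divide_distrib[symmetric])
 define d where "d = b powr (q / s) * c powr (r / s)"
 have d: "0 < d" "d powr s = b powr q * c powr r"
  using pos s by (auto simp: d_def powr_mult powr_powr)
 have "a powr p * d powr s <= p * a + s * d"
  using Youngs_inequality_0[of p s a d] pos d s assms by auto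
 also have "s * d <= s * (q / s * b + r / s * c)"
  unfolding d_def using Youngs_inequality_0[of "q/s" "r/s" b c] pos s assms by (intro mult_left_mono) auto
 also have "s * (q / s * b + r / s * c) = q * b + r * c"
  using s by (simp add: distrib_left)
 finally show ?thesis using d by (simp add: mult.assoc)
qed

lemma Holder3:
 fixes F G H :: "'a => real"
 assumes int: "integrable M F" "integrable M G" "integrable M H"
  and nn: "!!x. 0 <= F x" "!!x. 0 <= G x" "!!x. 0 <= H x"
  and e: "0 < p" "0 < q" "0 < r" "p + q + r = 1"
 shows "integrable M (%x. F x powr p * G x powr q * H x powr r)" (is ?int)
  and "(LINT x|M. F x powr p * G x powr q * H x powr r)
   <= (LINT x|M. F x) powr p * (LINT x|M. G x) powr q * (LINT x|M. H x) powr r" (is ?le)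
proof -
 have [measurable]: "F \<in> bmeas M" "G \<in> bmeas M" "H \<in> bmeas M"
  using int by auto
 have bd: "F x powr p * G x powr q * H x powr r <= p * F x + q * G x + r * H x" for x
  by (rule powr_amgm3[OF nn(1) nn(2) nn(3) e])
 have ib: "integrable M (%x. p * F x + q * G x + r * H x)" using int by auto
 show int': ?int
 proof (rule Bochner_Integration.integrable_bound[OF ib])
  show "AE x in M. norm (F x powr p * G x powr q * H x powr r) <= norm (p * F x + q * G x + r * H x)"
   using bd nn e by (intro always_eventually allI) (simp add: abs_mult abs_of_nonneg add_nonneg_nonneg)
 qed measurable
 let ?a = "LINT x|M. F x" and ?b = "LINT x|M. G x" and ?c = "LINT x|M. H x"
 have abc: "0 <= ?a" "0 <= ?b" "0 <= ?c" using nn by auto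
 show ?le
 proof (cases "?a = 0 \<or> ?b = 0 \<or> ?c = 0")
  case True
  then have "(AE x in M. F x = 0) \<or> (AE x in M. G x = 0) \<or> (AE x in M. H x = 0)"
   using int nn by (auto simp: integral_nonneg_eq_0_iff_AE)
  then have "AE x in M. F x powr p * G x powr q * H x powr r = 0"
   by (auto elim: eventually_mono)
  then have "(LINT x|M. F x powr p * G x powr q * H x powr r) = (LINT x|M. 0)"
   by (intro integral_cong_AE) auto
  then show ?thesis using abc by simp
 next
  case False
  then have pos: "0 < ?a" "0 < ?b" "0 < ?c" using abc by auto
  define P where "P = ?a powr p * ?b powr q * ?c powr r"
  have P: "0 < P" using pos by (simp add: P_def)
  have "F x powr p * G x powr q * H x powr r / P <= p / ?a * F x + q / ?b * G x + r / ?c * H x" for x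
  proof -
   have "F x powr p * G x powr q * H x powr r / P = (F x / ?a) powr p * (G x / ?b) powr q * (H x / ?c) powr r"
    using nn[of x] pos by (simp add: P_def powr_divide)
   also have "\<dots> <= p * (F x / ?a) + q * (G x / ?b) + r * (H x / ?c)"
    by (rule powr_amgm3) (use nn pos e in auto)
   finally show ?thesis by simp
  qed
  then have "(LINT x|M. F x powr p * G x powr q * H x powr r / P)
   <= (LINT x|M. p / ?a * F x + q / ?b * G x + r / ?c * H x)"
   using int int' by (intro integral_mono) auto
  also have "\<dots> = p + q + r" using int pos by simp
  finally have "(LINT x|M. F x powr p * G x powr q * H x powr r) / P <= 1" using e by simp
  then show ?thesis using P unfolding P_def by (simp add: pos_divide_le_eq)
 qed
qed

section \<open>Spaces of functions with a semi-inner product\<close>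

text \<open>Elements of function spaces are functions up to null sets, so the inner products are only semi-definite and addition is pointwise addition of representatives.\<close>

locale pre_inner =
 fixes X :: "('a => 'b::real_vector) set" and B :: "('a => 'b) => ('a => 'b) => real"
 assumes zero_mem: "(%x. 0) \<in> X"
  and add_mem: "f \<in> X ==> g \<in> X ==> (%x. f x + g x) \<in> X"
  and scale_mem: "f \<in> X ==> (%x. c *\<^sub>R f x) \<in> X"
  and B_add: "f \<in> X ==> g \<in> X ==> h \<in> X ==> B (%x. f x + g x) h = B f h + B g h"
  and B_scale: "f \<in> X ==> h \<in> X ==> B (%x. c *\<^sub>R f x) h = c * B f h"
  and B_sym: "f \<in> X ==> g \<in> X ==> B f g = B g f"
  and B_nonneg: "f \<in> X ==> 0 <= B f f"
begin

definition N where "N f = sqrt (B f f)"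

lemma N_nonneg: "f \<in> X ==> 0 <= N f" and N_square: "f \<in> X ==> (N f)\<^sup>2 = B f f"
 by (auto simp: N_def B_nonneg)

lemma diff_eq: fixes f g :: "'a => 'b" shows "f - g = (%x. f x + (-1) *\<^sub>R g x)"
 by (rule ext) simp

lemma diff_mem: "f \<in> X ==> g \<in> X ==> f - g \<in> X"
 unfolding diff_eq by (intro add_mem scale_mem)

lemma B_diff: "f \<in> X ==> g \<in> X ==> h \<in> X ==> B (f - g) h = B f h - B g h"
 unfolding diff_eq using B_add[OF _ scale_mem[of g "-1"]] B_scale[of g h "-1"] by simp

lemma B_zero: "h \<in> X ==> B (%x. 0) h = 0"
 using B_scale[OF zero_mem, of h 0] by simp

lemma B_add_right: assumes "f \<in> X" "g \<in> X" "h \<in> X" shows "B h (%x. f x + g x) = B h f + B h g"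
 using B_add[OF assms] B_sym[OF assms(3) add_mem[OF assms(1,2)]] B_sym[OF assms(3,1)] B_sym[OF assms(3,2)] by simp

lemma B_scale_right: assumes "f \<in> X" "h \<in> X" shows "B h (%x. c *\<^sub>R f x) = c * B h f"
 using B_scale[OF assms] B_sym[OF assms(2) scale_mem[OF assms(1)]] B_sym[OF assms(2,1)] by simp

lemma B_diff_right: assumes "f \<in> X" "g \<in> X" "h \<in> X" shows "B h (f - g) = B h f - B h g"
 using B_diff[OF assms] B_sym[OF assms(3) diff_mem[OF assms(1,2)]] B_sym[OF assms(3,1)] B_sym[OF assms(3,2)] by simp

lemma sum_mem:
 assumes "finite W" "W \<subseteq> X"
 shows "(%x. \<Sum>w\<in>W. c w *\<^sub>R w x) \<in> X"
  and "h \<in> X ==> B (%x. \<Sum>w\<in>W. c w *\<^sub>R w x) h = (\<Sum>w\<in>W. c w * B w h)"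
proof -
 have *: "(%x. \<Sum>w\<in>W. c w *\<^sub>R w x) \<in> X \<and> (\<forall>h\<in>X. B (%x. \<Sum>w\<in>W. c w *\<^sub>R w x) h = (\<Sum>w\<in>W. c w * B w h))"
  using assms
 proof induction
  case empty
  then show ?case by (simp add: zero_mem B_zero)
 next
  case (insert w W)
  then have IH: "(%x. \<Sum>w\<in>W. c w *\<^sub>R w x) \<in> X" "w \<in> X"
   "!!h. h \<in> X ==> B (%x. \<Sum>w\<in>W. c w *\<^sub>R w x) h = (\<Sum>w\<in>W. c w * B w h)" by auto
  have eq: "(%x. \<Sum>w\<in>insert w W. c w *\<^sub>R w x) = (%x. c w *\<^sub>R w x + (\<Sum>w\<in>W. c w *\<^sub>R w x))"
   using insert.hyps by (intro ext) simp
  show ?case unfolding eq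
  proof (intro conjI ballI)
   show "(%x. c w *\<^sub>R w x + (\<Sum>w\<in>W. c w *\<^sub>R w x)) \<in> X"
    by (rule add_mem[OF scale_mem[OF IH(2)] IH(1)])
   fix h assume h: "h \<in> X"
   show "B (%x. c w *\<^sub>R w x + (\<Sum>w\<in>W. c w *\<^sub>R w x)) h = (\<Sum>w\<in>insert w W. c w * B w h)"
    unfolding B_add[OF scale_mem[OF IH(2)] IH(1) h] B_scale[OF IH(2) h] IH(3)[OF h]
    using insert.hyps by simp
  qed
 qed
 show "(%x. \<Sum>w\<in>W. c w *\<^sub>R w x) \<in> X" by (rule conjunct1[OF *])
 show "B (%x. \<Sum>w\<in>W. c w *\<^sub>R w x) h = (\<Sum>w\<in>W. c w * B w h)" if "h \<in> X"
  by (rule bspec[OF conjunct2[OF *] that])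
qed

lemma N_diff_square: assumes "f \<in> X" "g \<in> X" shows "(N (f - g))\<^sup>2 = (N f)\<^sup>2 - 2 * B f g + (N g)\<^sup>2"
 unfolding N_square[OF assms(1)] N_square[OF assms(2)] N_square[OF diff_mem[OF assms]]
  B_diff[OF assms diff_mem[OF assms]] B_diff_right[OF assms assms(1)] B_diff_right[OF assms assms(2)]
  B_sym[OF assms(2,1)] by simp

lemma N_add_square: assumes "f \<in> X" "g \<in> X" shows "(N (%x. f x + g x))\<^sup>2 = (N f)\<^sup>2 + 2 * B f g + (N g)\<^sup>2"
 unfolding N_square[OF assms(1)] N_square[OF assms(2)] N_square[OF add_mem[OF assms]]
  B_add[OF assms add_mem[OF assms]] B_add_right[OF assms assms(1)] B_add_right[OF assms assms(2)]
  B_sym[OF assms(2,1)] by simp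

lemma cauchy_schwarz:
 assumes f: "f \<in> X" and g: "g \<in> X"
 shows "\<bar>B f g\<bar> <= N f * N g"
proof -
 have q: "0 <= B f f + 2 * t * B f g + t\<^sup>2 * B g g" for t
 proof -
  have "0 <= (N (%x. f x + t *\<^sub>R g x))\<^sup>2" by simp
  also have "\<dots> = (N f)\<^sup>2 + 2 * B f (%x. t *\<^sub>R g x) + (N (%x. t *\<^sub>R g x))\<^sup>2"
   using N_add_square[OF f scale_mem[OF g]] .
  also have "\<dots> = B f f + 2 * t * B f g + t\<^sup>2 * B g g"
   using f g by (simp add: N_square scale_mem B_scale_right B_scale) (simp add: power2_eq_square)
  finally show ?thesis .
 qed
 have "(B f g)\<^sup>2 <= B f f * B g g"
 proof (cases "B g g = 0")
  case True
  have "B f g = 0"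
  proof (rule ccontr)
   assume "B f g \<noteq> 0"
   then show False using q[of "- (B f f + 1) / (2 * B f g)"] True by (simp add: field_simps)
  qed
  then show ?thesis using True by simp
 next
  case False
  then have "0 < B g g" using B_nonneg[OF g] by simp
  then show ?thesis using q[of "- B f g / B g g"]
   by (simp add: field_simps power2_eq_square)
 qed
 then have "sqrt ((B f g)\<^sup>2) <= sqrt (B f f * B g g)" by (rule real_sqrt_le_mono)
 then show ?thesis by (simp add: N_def real_sqrt_mult)
qed

lemma N_triangle: assumes f: "f \<in> X" and g: "g \<in> X" shows "N (%x. f x + g x) <= N f + N g"
proof -
 have "(N (%x. f x + g x))\<^sup>2 <= (N f + N g)\<^sup>2"
  using N_add_square[OF f g] cauchy_schwarz[OF f g] unfolding power2_sum by linarith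
 then show ?thesis
  by (rule power2_le_imp_le) (intro add_nonneg_nonneg N_nonneg f g)
qed

lemma N_scale: "f \<in> X ==> N (%x. c *\<^sub>R f x) = \<bar>c\<bar> * N f"
 by (simp add: N_def B_scale B_scale_right scale_mem real_sqrt_mult real_sqrt_abs2 mult.assoc[symmetric])

lemma N_triangle_diff: assumes "f \<in> X" "g \<in> X" "h \<in> X" shows "N (f - h) <= N (f - g) + N (g - h)"
proof -
 have "f - h = (%x. (f - g) x + (g - h) x)" by (rule ext) simp
 then show ?thesis using N_triangle[of "f - g" "g - h"] assms diff_mem by metis
qed

lemma N_minus: "f \<in> X ==> g \<in> X ==> N (f - g) = N (g - f)"
proof -
 assume fg: "f \<in> X" "g \<in> X"
 have "f - g = (%x. (-1) *\<^sub>R (g - f) x)" by (rule ext) simp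
 then show ?thesis using N_scale[OF diff_mem[OF fg(2,1)], of "-1"] by simp
qed

lemma N_bound: assumes "f \<in> X" "g \<in> X" shows "N f <= N (f - g) + N g"
proof -
 have "f = (%x. (f - g) x + g x)" by (rule ext) simp
 then show ?thesis using N_triangle[of "f - g" g] assms diff_mem by metis
qed

end

section \<open>Square-integrable functions\<close>

lemma norm_powr_2: "norm x powr 2 = (norm x)\<^sup>2"
 by (simp add: powr_numeral)

lemma Lp2_iff: "f \<in> Lp 2 Om \<longleftrightarrow> f \<in> bmeas (leb Om) \<and> integrable (leb Om) (%x. (norm (f x))\<^sup>2)"
 by (simp add: Lp_def norm_powr_2)

lemma Lp2_norm: "Lp_norm 2 Om f = sqrt (LINT x|leb Om. (norm (f x))\<^sup>2)"
 by (simp add: Lp_norm_def norm_powr_2 powr_half_sqrt)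

lemma Lp_measurable: "f \<in> Lp p Om ==> f \<in> bmeas (leb Om)"
 by (simp add: Lp_def)

lemma Lp_norm_nonneg: "0 <= Lp_norm p Om f"
 by (simp add: Lp_norm_def)

lemma L2_integrable_inner:
 fixes f g :: "R3 => 'b::euclidean_space"
 assumes "f \<in> Lp 2 Om" "g \<in> Lp 2 Om"
 shows "integrable (leb Om) (%x. f x \<bullet> g x)"
proof (rule Bochner_Integration.integrable_bound)
 show "integrable (leb Om) (%x. (norm (f x))\<^sup>2 + (norm (g x))\<^sup>2)"
  using assms by (auto simp: Lp2_iff)
 show "(%x. f x \<bullet> g x) \<in> bmeas (leb Om)"
  using assms by (intro borel_measurable_inner Lp_measurable)
 show "AE x in leb Om. norm (f x \<bullet> g x) <= norm ((norm (f x))\<^sup>2 + (norm (g x))\<^sup>2)"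
 proof (intro always_eventually allI)
  fix x
  have "\<bar>f x \<bullet> g x\<bar> <= norm (f x) * norm (g x)" by (rule Cauchy_Schwarz_ineq2)
  also have "\<dots> <= (norm (f x))\<^sup>2 + (norm (g x))\<^sup>2"
   using sum_squares_bound[of "norm (f x)" "norm (g x)"]
   mult_nonneg_nonneg[OF norm_ge_zero norm_ge_zero, of "f x" "g x"] by linarith
  finally show "norm (f x \<bullet> g x) <= norm ((norm (f x))\<^sup>2 + (norm (g x))\<^sup>2)" by simp
 qed
qed

interpretation L2: pre_inner "Lp 2 Om :: (R3 => 'b::euclidean_space) set" "L2_inner Om" for Om
proof
 show "(%x. 0) \<in> Lp 2 Om" by (simp add: Lp2_iff)
 show "(%x. f x + g x) \<in> Lp 2 Om" if f: "f \<in> Lp 2 Om" "g \<in> Lp 2 Om" for f g :: "R3 => 'b"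
 proof -
  have "integrable (leb Om) (%x. (norm (f x))\<^sup>2 + 2 * (f x \<bullet> g x) + (norm (g x))\<^sup>2)"
   using f L2_integrable_inner[OF f] by (auto simp: Lp2_iff)
  then have "integrable (leb Om) (%x. (norm (f x + g x))\<^sup>2)"
   by (rule Bochner_Integration.integrable_cong[THEN iffD1, rotated -1])
    (auto simp: power2_norm_eq_inner inner_add_left inner_add_right inner_commute)
  then show ?thesis using f by (auto simp: Lp2_iff)
 qed
 show "(%x. c *\<^sub>R f x) \<in> Lp 2 Om" if "f \<in> Lp 2 Om" for f :: "R3 => 'b" and c
  using that by (auto simp: Lp2_iff power_mult_distrib)
 show "L2_inner Om (%x. f x + g x) h = L2_inner Om f h + L2_inner Om g h"
  if "f \<in> Lp 2 Om" "g \<in> Lp 2 Om" "h \<in> Lp 2 Om" for f g h :: "R3 => 'b"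
  using that by (simp add: L2_inner_def inner_add_left L2_integrable_inner)
 show "L2_inner Om (%x. c *\<^sub>R f x) h = c * L2_inner Om f h" for f h :: "R3 => 'b" and c
  by (simp add: L2_inner_def)
qed (auto simp: L2_inner_def inner_commute)

lemma L2_N: "L2.N Om f = Lp_norm 2 Om f"
 by (simp add: L2.N_def L2_inner_def Lp2_norm power2_norm_eq_inner)

lemma Lp2_norm_cong:
 assumes "AE x in leb Om. f x = g x" "f \<in> Lp 2 Om" "g \<in> Lp 2 Om"
 shows "Lp_norm 2 Om f = Lp_norm 2 Om g"
 unfolding Lp2_norm
 by (rule arg_cong[where f=sqrt], rule integral_cong_AE) (use assms in \<open>auto simp: Lp2_iff\<close>)

lemma L2_inner_cong:
 assumes "AE x in leb Om. f x = f' x" "AE x in leb Om. g x = g' x"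
  "f \<in> Lp 2 Om" "g \<in> Lp 2 Om" "f' \<in> Lp 2 Om" "g' \<in> Lp 2 Om"
 shows "L2_inner Om f g = L2_inner Om f' g'"
 unfolding L2_inner_def
proof (rule integral_cong_AE)
 show "AE x in leb Om. f x \<bullet> g x = f' x \<bullet> g' x" using assms(1,2) by eventually_elim auto
qed (use assms in \<open>auto simp: Lp2_iff\<close>)

lemma Lp2_norm_zero_iff:
 assumes "f \<in> Lp 2 Om"
 shows "Lp_norm 2 Om f = 0 \<longleftrightarrow> (AE x in leb Om. f x = 0)"
 using assms by (auto simp: Lp2_norm Lp2_iff integral_nonneg_eq_0_iff_AE)

lemma borel_measurable_vec_iff:
 fixes f :: "'a => 'b::euclidean_space ^ 'n"
 shows "f \<in> bmeas M \<longleftrightarrow> (\<forall>i. (%x. f x $ i) \<in> bmeas M)"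
proof
 assume f: "f \<in> bmeas M"
 show "\<forall>i. (%x. f x $ i) \<in> bmeas M"
  by (intro allI borel_measurable_continuous_on[OF _ f]) (auto intro: continuous_intros)
next
 assume f: "\<forall>i. (%x. f x $ i) \<in> bmeas M"
 show "f \<in> bmeas M"
  by (subst borel_measurable_euclidean_space)
   (use f in \<open>auto simp: Basis_vec_def inner_axis intro!: borel_measurable_inner\<close>)
qed

lemma norm_vec_square: "(norm (v :: 'b::real_inner ^ 'n))\<^sup>2 = (\<Sum>i\<in>UNIV. (norm (v $ i))\<^sup>2)"
 by (simp add: power2_norm_eq_inner inner_vec_def)

lemma Lp2_vec_iff:
 fixes f :: "R3 => 'b::euclidean_space ^ 'n"
 shows "f \<in> Lp 2 Om \<longleftrightarrow> (\<forall>i. (%x. f x $ i) \<in> Lp 2 Om)"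
proof
 assume f: "f \<in> Lp 2 Om"
 show "\<forall>i. (%x. f x $ i) \<in> Lp 2 Om"
 proof
  fix i
  have m: "(%x. f x $ i) \<in> bmeas (leb Om)" using f by (auto simp: Lp2_iff borel_measurable_vec_iff)
  have "integrable (leb Om) (%x. (norm (f x $ i))\<^sup>2)"
   by (rule Bochner_Integration.integrable_bound[of _ "%x. (norm (f x))\<^sup>2"])
    (use f m in \<open>auto simp: Lp2_iff intro!: always_eventually power_mono Finite_Cartesian_Product.norm_nth_le\<close>)
  then show "(%x. f x $ i) \<in> Lp 2 Om" using m by (simp add: Lp2_iff)
 qed
next
 assume "\<forall>i. (%x. f x $ i) \<in> Lp 2 Om"
 then show "f \<in> Lp 2 Om" by (auto simp: Lp2_iff borel_measurable_vec_iff norm_vec_square)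
qed

section \<open>Weak gradients\<close>

lemma AE_all_finite: "(!!i::'i::finite. AE x in M. P i x) ==> AE x in M. \<forall>i. P i x"
 using eventually_ball_finite[of UNIV "%x i. P i x" "ae_filter M"] by simp

lemma gradient_nth: "gradient f x $ j = frechet_derivative f (at x) (axis j 1)"
 by (simp add: gradient_def)

lemma gradient_eqI: assumes "(f has_derivative f') (at x)" shows "gradient f x $ j = f' (axis j 1)"
 unfolding gradient_nth using frechet_derivative_at[OF assms] by simp

lemma gradient_mult:
 assumes "smooth f" "smooth g"
 shows "gradient (%x. f x * g x) x $ j = f x * gradient g x $ j + gradient f x $ j * g x"
proof -
 have "((%x. f x * g x) has_derivative (%v. f x * frechet_derivative g (at x) v + frechet_derivative f (at x) v * g x)) (at x)"
  by (intro has_derivative_mult smooth_has_derivative assms)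
 from gradient_eqI[OF this] show ?thesis by (simp add: gradient_nth)
qed

lemma gradient_comp:
 assumes "smooth f" "(h has_real_derivative h') (at (f x))"
 shows "gradient (%x. h (f x)) x $ j = h' * gradient f x $ j"
proof -
 have "((%x. h (f x)) has_derivative (%v. h' * frechet_derivative f (at x) v)) (at x)"
  using has_derivative_compose[OF smooth_has_derivative[OF assms(1)]] assms(2)
  unfolding has_field_derivative_def by blast
 from gradient_eqI[OF this] show ?thesis by (simp add: gradient_nth)
qed

lemma smooth_gradient: "smooth f ==> smooth (%x. gradient f x $ j)"
 unfolding gradient_nth by (rule smooth_frechet)

lemma test_fun_gradient: assumes "test_fun S \<psi>" shows "test_fun S (%x. gradient \<psi> x $ j)"
proof -
 obtain K where K: "compact K" "K \<subseteq> S" "!!x. x \<notin> K ==> \<psi> x = 0" using test_fun_supportE[OF assms] by metis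
 show ?thesis
 proof (rule test_funI[OF smooth_gradient[OF test_fun_smooth[OF assms]] _ K(1,2)])
  fix x assume x: "x \<notin> K"
  have "((%x. 0) has_derivative (%v. 0)) (at x)" by simp
  then have "(\<psi> has_derivative (%v. 0)) (at x)"
   by (rule has_derivative_transform_within_open[of _ _ _ _ "- K"])
    (use K x compact_imp_closed in auto)
  from gradient_eqI[OF this] show "gradient \<psi> x $ j = 0" by simp
 qed
qed

lemma smooth_directional:
 assumes "smooth f"
 shows "((%t. f (x + t *\<^sub>R axis j 1)) has_real_derivative gradient f x $ j) (at 0)"
proof -
 have "((%t. x + t *\<^sub>R axis j 1) has_derivative (%t. t *\<^sub>R axis j 1)) (at 0)"
  by (auto intro!: derivative_eq_intros)
 moreover have "(f has_derivative frechet_derivative f (at x)) (at (x + 0 *\<^sub>R axis j 1))"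
  using smooth_has_derivative[OF assms] by simp
 ultimately have "((%t. f (x + t *\<^sub>R axis j 1)) has_derivative (%t. frechet_derivative f (at x) (t *\<^sub>R axis j 1))) (at 0)"
  by (rule has_derivative_compose)
 moreover have "frechet_derivative f (at x) (t *\<^sub>R axis j 1) = gradient f x $ j * t" for t
  using linear_cmul[OF has_derivative_linear[OF smooth_has_derivative[OF assms, of x]], of t "axis j 1"]
  by (simp add: gradient_nth)
 ultimately show ?thesis by (simp add: has_field_derivative_def)
qed

lemma test_fun_integrable_lborel:
 fixes \<psi> :: "'a::euclidean_space => real"
 assumes "test_fun S \<psi>" shows "integrable lborel \<psi>"
proof -
 obtain K where K: "compact K" "K \<subseteq> S" "!!x. x \<notin> K ==> \<psi> x = 0" using test_fun_supportE[OF assms] by metis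
 have "integrable lborel (%x. indicator K x *\<^sub>R \<psi> x)"
  by (rule borel_integrable_compact[OF K(1)]) (rule smooth_continuous[OF test_fun_smooth[OF assms]])
 moreover have "(%x. indicator K x *\<^sub>R \<psi> x) = \<psi>" using K(3) by (auto simp: indicator_def fun_eq_iff)
 ultimately show ?thesis by simp
qed

lemma LINT_lebesgue_on_support:
 fixes f :: "'a::euclidean_space => real"
 assumes "S \<in> sets lebesgue" "f \<in> bmeas borel" "!!x. x \<notin> S ==> f x = 0"
 shows "(LINT x|leb S. f x) = (LINT x|lborel. f x)"
  "integrable (leb S) f \<longleftrightarrow> integrable lborel f"
proof -
 have eq: "(%x. indicator S x *\<^sub>R f x) = f" using assms(3) by (auto simp: indicator_def fun_eq_iff)
 show "(LINT x|leb S. f x) = (LINT x|lborel. f x)"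
  using LINT_lebesgue_on(1)[OF assms(1), of f] integral_completion[of f lborel] assms(2) unfolding eq by simp
 show "integrable (leb S) f \<longleftrightarrow> integrable lborel f"
  using LINT_lebesgue_on(2)[OF assms(1), of f] integrable_completion[of f lborel] assms(2) unfolding eq by simp
qed

lemma integral_gradient_test_fun:
 assumes "test_fun S (\<psi> :: R3 => real)"
 shows "(LINT x|lborel. gradient \<psi> x $ j) = 0"
proof -
 obtain K where K: "compact K" "K \<subseteq> S" "!!x. x \<notin> K ==> \<psi> x = 0" using test_fun_supportE[OF assms] by metis
 obtain R where R: "!!x. x \<in> K ==> norm x <= R" using compact_imp_bounded[OF K(1)] unfolding bounded_iff by blast
 obtain B where B: "!!x. \<bar>gradient \<psi> x $ j\<bar> <= B" using test_fun_bounded[OF test_fun_gradient[OF assms]] by metis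
 show ?thesis
 proof (rule integral_directional_derivative_zero[OF smooth_directional[OF test_fun_smooth[OF assms]]
    test_fun_integrable_lborel[OF assms] _ B])
  show "(%x. gradient \<psi> x $ j) \<in> bmeas borel"
   by (rule smooth_borel[OF smooth_gradient[OF test_fun_smooth[OF assms]]])
  show "\<psi> x = 0" if "R < norm x" for x using R[of x] K(3)[of x] that by force
 qed
qed

lemma integration_by_parts_test_fun:
 assumes f: "smooth f" and \<psi>: "test_fun S (\<psi> :: R3 => real)"
 shows "(LINT x|lborel. f x * gradient \<psi> x $ j) = - (LINT x|lborel. gradient f x $ j * \<psi> x)"
proof -
 have 1: "test_fun S (%x. \<psi> x * f x)" by (rule test_fun_mult[OF \<psi> f])
 have 2: "test_fun S (%x. gradient \<psi> x $ j * f x)" by (rule test_fun_mult[OF test_fun_gradient[OF \<psi>] f])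
 have 3: "test_fun S (%x. \<psi> x * gradient f x $ j)" by (rule test_fun_mult[OF \<psi> smooth_gradient[OF f]])
 have "0 = (LINT x|lborel. gradient (%x. \<psi> x * f x) x $ j)"
  using integral_gradient_test_fun[OF 1] by simp
 also have "\<dots> = (LINT x|lborel. \<psi> x * gradient f x $ j + gradient \<psi> x $ j * f x)"
  by (simp add: gradient_mult[OF test_fun_smooth[OF \<psi>] f])
 also have "\<dots> = (LINT x|lborel. \<psi> x * gradient f x $ j) + (LINT x|lborel. gradient \<psi> x $ j * f x)"
  using test_fun_integrable_lborel[OF 2] test_fun_integrable_lborel[OF 3] by simp
 finally show ?thesis by (simp add: mult.commute)
qed

lemma weak_gradient_smooth:
 assumes "open Om" "smooth f" shows "weak_gradient Om f (gradient f)"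
 unfolding weak_gradient_def
proof (intro allI impI)
 fix \<psi> :: "R3 => real" and j assume \<psi>: "test_fun Om \<psi>"
 have O: "Om \<in> sets lebesgue" using assms by auto
 have z: "\<psi> x = 0" "gradient \<psi> x $ j = 0" if "x \<notin> Om" for x
  using that test_fun_supportE[OF \<psi>] test_fun_supportE[OF test_fun_gradient[OF \<psi>, of j]] by (metis subsetD)+
 have m: "f \<in> bmeas borel" "\<psi> \<in> bmeas borel"
  "(%x. gradient f x $ j) \<in> bmeas borel" "(%x. gradient \<psi> x $ j) \<in> bmeas borel"
  using smooth_borel smooth_gradient assms(2) test_fun_smooth[OF \<psi>] by blast+
 show "(LINT x|leb Om. f x * gradient \<psi> x $ j) = - (LINT x|leb Om. gradient f x $ j * \<psi> x)"
  using integration_by_parts_test_fun[OF assms(2) \<psi>, of j] m z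
  by (simp add: LINT_lebesgue_on_support[OF O])
qed

lemma bounded_L2_test:
 assumes Om: "open Om" "bounded Om" and b: "f \<in> bmeas (leb Om)" "!!x. x \<in> Om ==> norm (f x) <= B"
 shows "f \<in> Lp 2 Om"
proof -
 have fin: "finite_measure (leb Om)"
  using Om by (intro finite_measure_lebesgue_on bounded_set_imp_lmeasurable) auto
 show ?thesis unfolding Lp2_iff
 proof (intro conjI b(1) finite_measure.integrable_const_bound[OF fin])
  show "AE x in leb Om. norm ((norm (f x))\<^sup>2) <= B\<^sup>2"
   using b(2) by (auto simp: AE_lebesgue_on Om intro!: power_mono)
  show "(%x. (norm (f x))\<^sup>2) \<in> bmeas (leb Om)" using b(1) by measurable
 qed
qed

lemma L2_integrable_mult:
 fixes f g :: "R3 => real"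
 shows "f \<in> Lp 2 Om ==> g \<in> Lp 2 Om ==> integrable (leb Om) (%x. f x * g x)"
 using L2_integrable_inner[of f Om g] by simp

locale bounded_open =
 fixes Om :: "R3 set"
 assumes open_dom: "open Om" and bounded_dom: "bounded Om"
begin

lemma dom_sets: "Om \<in> sets lebesgue" using open_dom by auto

lemma finite_measure_dom: "finite_measure (leb Om)"
 using open_dom bounded_dom by (intro finite_measure_lebesgue_on bounded_set_imp_lmeasurable) auto

lemma test_fun_L2: assumes "test_fun S \<psi>" shows "\<psi> \<in> Lp 2 Om"
proof -
 obtain B where "!!x. \<bar>\<psi> x\<bar> <= B" using test_fun_bounded[OF assms] by metis
 then show ?thesis
  by (intro bounded_L2_test[OF open_dom bounded_dom borel_imp_lebesgue_on[OF smooth_borel[OF test_fun_smooth[OF assms]]]]) auto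
qed

lemma test_fun_gradient_L2: "test_fun S \<psi> ==> gradient \<psi> \<in> Lp 2 Om"
 unfolding Lp2_vec_iff using test_fun_gradient test_fun_L2 by blast

lemma L2_integrable: assumes "f \<in> Lp 2 Om" shows "integrable (leb Om) (f :: R3 => real)"
proof -
 have "(%x. 1::real) \<in> Lp 2 Om" by (rule bounded_L2_test[OF open_dom bounded_dom, of _ 1]) auto
 from L2_integrable_mult[OF assms this] show ?thesis by simp
qed

lemma weak_gradient_unique:
 assumes "g \<in> Lp 2 Om" "g' \<in> Lp 2 Om" "weak_gradient Om f g" "weak_gradient Om f g'"
 shows "AE x in leb Om. g x = g' x"
proof -
 have gj: "(%x. g x $ j) \<in> Lp 2 Om" "(%x. g' x $ j) \<in> Lp 2 Om" for j
  using assms by (auto simp: Lp2_vec_iff)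
 have "AE x in leb Om. g x $ j - g' x $ j = 0" for j
 proof (rule fundamental_lemma[OF open_dom])
  show "integrable (leb Om) (%x. g x $ j - g' x $ j)"
   using gj L2_integrable by auto
  fix \<psi> :: "R3 => real" assume \<psi>: "test_fun Om \<psi>"
  show "(LINT x|leb Om. (g x $ j - g' x $ j) * \<psi> x) = 0"
   using assms(3,4) \<psi> L2_integrable_mult[OF gj(1) test_fun_L2[OF \<psi>]] L2_integrable_mult[OF gj(2) test_fun_L2[OF \<psi>]]
   unfolding weak_gradient_def by (simp add: left_diff_distrib)
 qed
 then have "AE x in leb Om. \<forall>j. g x $ j - g' x $ j = 0"
  by (rule AE_all_finite)
 then show ?thesis by eventually_elim (simp add: vec_eq_iff)
qed

lemma weak_gradient_add:
 assumes "f \<in> Lp 2 Om" "f' \<in> Lp 2 Om" "g \<in> Lp 2 Om" "g' \<in> Lp 2 Om" "weak_gradient Om f g" "weak_gradient Om f' g'"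
 shows "weak_gradient Om (%x. f x + f' x) (%x. g x + g' x)"
 unfolding weak_gradient_def
proof (intro allI impI)
 fix \<psi> :: "R3 => real" and j assume \<psi>: "test_fun Om \<psi>"
 have gj: "(%x. g x $ j) \<in> Lp 2 Om" "(%x. g' x $ j) \<in> Lp 2 Om" 
  using assms by (auto simp: Lp2_vec_iff)
 note i = L2_integrable_mult[OF _ test_fun_L2[OF \<psi>]] L2_integrable_mult[OF _ test_fun_L2[OF test_fun_gradient[OF \<psi>, of j]]]
 show "(LINT x|leb Om. (f x + f' x) * gradient \<psi> x $ j) = - (LINT x|leb Om. (g x + g' x) $ j * \<psi> x)"
  using assms(5,6) \<psi> i(1)[OF gj(1)] i(1)[OF gj(2)] i(2)[OF assms(1)] i(2)[OF assms(2)]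
  unfolding weak_gradient_def by (simp add: distrib_right)
qed

lemma weak_gradient_scale:
 assumes "weak_gradient Om f g"
 shows "weak_gradient Om (%x. c * f x) (%x. c *\<^sub>R g x)"
 using assms unfolding weak_gradient_def by (simp add: mult.assoc)

lemma wgrad: assumes "f \<in> H1 Om" shows "wgrad Om f \<in> Lp 2 Om" "weak_gradient Om f (wgrad Om f)"
proof -
 have "\<exists>g. g \<in> Lp 2 Om \<and> weak_gradient Om f g" using assms unfolding H1_def by auto
 from someI_ex[OF this] show "wgrad Om f \<in> Lp 2 Om" "weak_gradient Om f (wgrad Om f)"
  unfolding wgrad_def by auto
qed

lemma H1_L2: "f \<in> H1 Om ==> f \<in> Lp 2 Om" by (simp add: H1_def)

lemma wgrad_eq:
 assumes "f \<in> Lp 2 Om" "g \<in> Lp 2 Om" "weak_gradient Om f g"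
 shows "f \<in> H1 Om" "AE x in leb Om. wgrad Om f x = g x"
proof -
 show *: "f \<in> H1 Om" using assms by (auto simp: H1_def)
 show "AE x in leb Om. wgrad Om f x = g x"
  by (rule weak_gradient_unique[OF wgrad(1)[OF *] assms(2) wgrad(2)[OF *] assms(3)])
qed

lemma wgrad_add:
 assumes "f \<in> H1 Om" "g \<in> H1 Om"
 shows "(%x. f x + g x) \<in> H1 Om" "AE x in leb Om. wgrad Om (%x. f x + g x) x = wgrad Om f x + wgrad Om g x"
 using wgrad_eq[OF L2.add_mem[OF H1_L2[OF assms(1)] H1_L2[OF assms(2)]] L2.add_mem[OF wgrad(1)[OF assms(1)] wgrad(1)[OF assms(2)]]
  weak_gradient_add[OF H1_L2[OF assms(1)] H1_L2[OF assms(2)] wgrad(1)[OF assms(1)] wgrad(1)[OF assms(2)] wgrad(2)[OF assms(1)] wgrad(2)[OF assms(2)]]]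
 by auto

lemma wgrad_scale:
 assumes "f \<in> H1 Om"
 shows "(%x. c * f x) \<in> H1 Om" "AE x in leb Om. wgrad Om (%x. c * f x) x = c *\<^sub>R wgrad Om f x"
 using wgrad_eq[OF L2.scale_mem[OF H1_L2[OF assms(1)], of c, simplified] L2.scale_mem[OF wgrad(1)[OF assms(1)]]
  weak_gradient_scale[OF wgrad(2)[OF assms(1)]]]
 by auto

lemma wgrad_test_fun:
 assumes "test_fun S \<psi>"
 shows "\<psi> \<in> H1 Om" "AE x in leb Om. wgrad Om \<psi> x = gradient \<psi> x"
 using wgrad_eq[OF test_fun_L2[OF assms] test_fun_gradient_L2[OF assms] weak_gradient_smooth[OF open_dom test_fun_smooth[OF assms]]]
 by auto

lemma vgrad_nth: "vgrad Om v x $ i = wgrad Om (%y. v y $ i) x"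
 by (simp add: vgrad_def)

lemma H1_vecD: "v \<in> H1_vec Om ==> (%x. v x $ i) \<in> H1 Om" by (simp add: H1_vec_def)

lemma vgrad_L2: "v \<in> H1_vec Om ==> vgrad Om v \<in> Lp 2 Om"
 unfolding Lp2_vec_iff[of "vgrad Om v"] vgrad_nth by (intro allI wgrad(1) H1_vecD)

lemma H1_vec_L2: "v \<in> H1_vec Om ==> v \<in> Lp 2 Om"
 unfolding Lp2_vec_iff by (intro allI H1_L2 H1_vecD)

lemma vgrad_add:
 assumes "v \<in> H1_vec Om" "w \<in> H1_vec Om"
 shows "(%x. v x + w x) \<in> H1_vec Om" "AE x in leb Om. vgrad Om (%x. v x + w x) x = vgrad Om v x + vgrad Om w x"
proof -
 note * = wgrad_add[OF H1_vecD[OF assms(1)] H1_vecD[OF assms(2)]]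
 show "(%x. v x + w x) \<in> H1_vec Om" unfolding H1_vec_def using *(1) by simp
 have "AE x in leb Om. \<forall>i. wgrad Om (%x. v x $ i + w x $ i) x = wgrad Om (%x. v x $ i) x + wgrad Om (%x. w x $ i) x"
  using AE_all_finite[OF *(2)] .
 then show "AE x in leb Om. vgrad Om (%x. v x + w x) x = vgrad Om v x + vgrad Om w x"
  by eventually_elim (subst vec_eq_iff, simp add: vgrad_nth)
qed

lemma vgrad_scale:
 assumes "v \<in> H1_vec Om"
 shows "(%x. c *\<^sub>R v x) \<in> H1_vec Om" "AE x in leb Om. vgrad Om (%x. c *\<^sub>R v x) x = c *\<^sub>R vgrad Om v x"
proof -
 note * = wgrad_scale[OF H1_vecD[OF assms(1)]]
 show "(%x. c *\<^sub>R v x) \<in> H1_vec Om" unfolding H1_vec_def using *(1) by simp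
 have "AE x in leb Om. \<forall>i. wgrad Om (%x. c * v x $ i) x = c *\<^sub>R wgrad Om (%x. v x $ i) x"
  using AE_all_finite[OF *(2)] .
 then show "AE x in leb Om. vgrad Om (%x. c *\<^sub>R v x) x = c *\<^sub>R vgrad Om v x"
  by eventually_elim (subst vec_eq_iff, simp add: vgrad_nth)
qed

lemma vgrad_diff:
 assumes "v \<in> H1_vec Om" "w \<in> H1_vec Om"
 shows "v - w \<in> H1_vec Om" "AE x in leb Om. vgrad Om (v - w) x = vgrad Om v x - vgrad Om w x"
proof -
 have eq: "v - w = (%x. v x + (-1) *\<^sub>R w x)" by (rule ext) simp
 note * = vgrad_add[OF assms(1) vgrad_scale(1)[OF assms(2), of "-1"]] vgrad_scale(2)[OF assms(2), of "-1"]
 show "v - w \<in> H1_vec Om" unfolding eq by (rule *(1))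
 show "AE x in leb Om. vgrad Om (v - w) x = vgrad Om v x - vgrad Om w x"
  unfolding eq using *(2,3) by eventually_elim simp
qed

lemma test_field:
 assumes "!!i. test_fun S (%x. \<Phi> x $ i)"
 shows "\<Phi> \<in> H1_vec Om" "AE x in leb Om. \<forall>i. vgrad Om \<Phi> x $ i = gradient (%x. \<Phi> x $ i) x"
proof -
 show "\<Phi> \<in> H1_vec Om" unfolding H1_vec_def using wgrad_test_fun(1)[OF assms] by simp
 show "AE x in leb Om. \<forall>i. vgrad Om \<Phi> x $ i = gradient (%x. \<Phi> x $ i) x"
  unfolding vgrad_nth by (rule AE_all_finite, rule wgrad_test_fun(2)[OF assms])
qed

subsection \<open>The energy space\<close>

lemma H10_H1: "v \<in> H10_vec Om ==> v \<in> H1_vec Om" by (simp add: H10_vec_def)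

lemma V_H10: "v \<in> V_space Om ==> v \<in> H10_vec Om" by (simp add: V_space_def)

lemma V_H1: "v \<in> V_space Om ==> v \<in> H1_vec Om" by (simp add: V_H10 H10_H1)

lemma V_L2: "v \<in> V_space Om ==> v \<in> Lp 2 Om" by (simp add: V_H1 H1_vec_L2)

lemma V_vgrad_L2: "v \<in> V_space Om ==> vgrad Om v \<in> Lp 2 Om" by (simp add: V_H1 vgrad_L2)

lemma test_field_V:
 assumes "!!i. test_fun Om (%x. \<Phi> x $ i)" "div_free Om \<Phi>"
 shows "\<Phi> \<in> V_space Om"
proof -
 have "Lp_norm 2 Om (\<Phi> - \<Phi>) = 0" "Lp_norm 2 Om (vgrad Om \<Phi> - vgrad Om \<Phi>) = 0"
  by (simp_all add: Lp2_norm)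
 then show ?thesis
  unfolding V_space_def H10_vec_def using assms test_field(1)[OF assms(1)] by (auto intro!: exI[of _ "%n. \<Phi>"])
qed

lemma Lp2_norm_triangle:
 fixes f g h :: "R3 => 'b::euclidean_space"
 assumes "f \<in> Lp 2 Om" "g \<in> Lp 2 Om" "h \<in> Lp 2 Om" "AE x in leb Om. h x = f x + g x"
 shows "Lp_norm 2 Om h <= Lp_norm 2 Om f + Lp_norm 2 Om g"
 using L2.N_triangle[OF assms(1,2)] Lp2_norm_cong[OF assms(4,3) L2.add_mem[OF assms(1,2)]] by (simp add: L2_N)

lemma Lp2_norm_scale:
 fixes f h :: "R3 => 'b::euclidean_space"
 assumes "f \<in> Lp 2 Om" "h \<in> Lp 2 Om" "AE x in leb Om. h x = c *\<^sub>R f x"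
 shows "Lp_norm 2 Om h = \<bar>c\<bar> * Lp_norm 2 Om f"
 using L2.N_scale[OF assms(1)] Lp2_norm_cong[OF assms(3,2) L2.scale_mem[OF assms(1)]] by (simp add: L2_N)

lemma H10_add:
 assumes v: "v \<in> H10_vec Om" and w: "w \<in> H10_vec Om"
 shows "(%x. v x + w x) \<in> H10_vec Om"
proof -
 note v1 = H10_H1[OF v] and w1 = H10_H1[OF w]
 obtain \<Phi> where \<Phi>: "!!n i. test_fun Om (%x. \<Phi> n x $ i)" "(%n. Lp_norm 2 Om (v - \<Phi> n)) ----> 0"
  "(%n. Lp_norm 2 Om (vgrad Om v - vgrad Om (\<Phi> n))) ----> 0" using v by (auto simp: H10_vec_def)
 obtain \<Psi> where \<Psi>: "!!n i. test_fun Om (%x. \<Psi> n x $ i)" "(%n. Lp_norm 2 Om (w - \<Psi> n)) ----> 0"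
  "(%n. Lp_norm 2 Om (vgrad Om w - vgrad Om (\<Psi> n))) ----> 0" using w by (auto simp: H10_vec_def)
 have \<Phi>1: "\<Phi> n \<in> H1_vec Om" and \<Psi>1: "\<Psi> n \<in> H1_vec Om" for n using test_field(1) \<Phi>(1) \<Psi>(1) by blast+
 define Z where "Z n x = \<Phi> n x + \<Psi> n x" for n x
 have Z: "Z n = (%x. \<Phi> n x + \<Psi> n x)" for n by (auto simp: Z_def)
 note vw = vgrad_add[OF v1 w1]
 have Z1: "Z n \<in> H1_vec Om" "AE x in leb Om. vgrad Om (Z n) x = vgrad Om (\<Phi> n) x + vgrad Om (\<Psi> n) x" for n
  unfolding Z by (rule vgrad_add[OF \<Phi>1 \<Psi>1])+
 have "test_fun Om (%x. Z n x $ i)" for n i unfolding Z using test_fun_add[OF \<Phi>(1) \<Psi>(1)] by simp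
 moreover have "(%n. Lp_norm 2 Om ((%x. v x + w x) - Z n)) ----> 0"
 proof (rule tendsto_sandwich[OF _ _ tendsto_const tendsto_add_zero[OF \<Phi>(2) \<Psi>(2)]])
  show "\<forall>\<^sub>F n in sequentially. 0 <= Lp_norm 2 Om ((%x. v x + w x) - Z n)" by (simp add: Lp_norm_nonneg)
  show "\<forall>\<^sub>F n in sequentially. Lp_norm 2 Om ((%x. v x + w x) - Z n) <= Lp_norm 2 Om (v - \<Phi> n) + Lp_norm 2 Om (w - \<Psi> n)"
   by (intro always_eventually allI Lp2_norm_triangle L2.diff_mem H1_vec_L2 v1 w1 \<Phi>1 \<Psi>1 vw Z1) (simp add: Z_def)
 qed
 moreover have "(%n. Lp_norm 2 Om (vgrad Om (%x. v x + w x) - vgrad Om (Z n))) ----> 0"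
 proof (rule tendsto_sandwich[OF _ _ tendsto_const tendsto_add_zero[OF \<Phi>(3) \<Psi>(3)]])
  show "\<forall>\<^sub>F n in sequentially. 0 <= Lp_norm 2 Om (vgrad Om (%x. v x + w x) - vgrad Om (Z n))" by (simp add: Lp_norm_nonneg)
  have "AE x in leb Om. (vgrad Om (%x. v x + w x) - vgrad Om (Z n)) x
    = (vgrad Om v - vgrad Om (\<Phi> n)) x + (vgrad Om w - vgrad Om (\<Psi> n)) x" for n
   using vw(2) Z1(2)[of n] by eventually_elim simp
  then show "\<forall>\<^sub>F n in sequentially. Lp_norm 2 Om (vgrad Om (%x. v x + w x) - vgrad Om (Z n))
    <= Lp_norm 2 Om (vgrad Om v - vgrad Om (\<Phi> n)) + Lp_norm 2 Om (vgrad Om w - vgrad Om (\<Psi> n))"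
   by (intro always_eventually[where F=sequentially] allI Lp2_norm_triangle L2.diff_mem vgrad_L2 v1 w1 \<Phi>1 \<Psi>1 vw(1) Z1(1))
 qed
 ultimately show ?thesis using vw(1) by (auto simp: H10_vec_def)
qed

lemma H10_scale:
 assumes v: "v \<in> H10_vec Om"
 shows "(%x. c *\<^sub>R v x) \<in> H10_vec Om"
proof -
 note v1 = H10_H1[OF v]
 obtain \<Phi> where \<Phi>: "!!n i. test_fun Om (%x. \<Phi> n x $ i)" "(%n. Lp_norm 2 Om (v - \<Phi> n)) ----> 0"
  "(%n. Lp_norm 2 Om (vgrad Om v - vgrad Om (\<Phi> n))) ----> 0" using v by (auto simp: H10_vec_def)
 have \<Phi>1: "\<Phi> n \<in> H1_vec Om" for n using test_field(1) \<Phi>(1) by blast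
 define Z where "Z n x = c *\<^sub>R \<Phi> n x" for n x
 have Z: "Z n = (%x. c *\<^sub>R \<Phi> n x)" for n by (auto simp: Z_def)
 note vw = vgrad_scale[OF v1, of c]
 have Z1: "Z n \<in> H1_vec Om" "AE x in leb Om. vgrad Om (Z n) x = c *\<^sub>R vgrad Om (\<Phi> n) x" for n
  unfolding Z by (rule vgrad_scale[OF \<Phi>1])+
 have "test_fun Om (%x. Z n x $ i)" for n i unfolding Z using test_fun_cmult[OF \<Phi>(1)] by simp
 moreover have "(%n. Lp_norm 2 Om ((%x. c *\<^sub>R v x) - Z n)) ----> 0"
 proof -
  have "Lp_norm 2 Om ((%x. c *\<^sub>R v x) - Z n) = \<bar>c\<bar> * Lp_norm 2 Om (v - \<Phi> n)" for n
   by (intro Lp2_norm_scale L2.diff_mem H1_vec_L2 v1 \<Phi>1 vw Z1) (simp add: Z_def scaleR_diff_right)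
  then show ?thesis using tendsto_mult_right_zero[OF \<Phi>(2)] by simp
 qed
 moreover have "(%n. Lp_norm 2 Om (vgrad Om (%x. c *\<^sub>R v x) - vgrad Om (Z n))) ----> 0"
 proof -
  have "AE x in leb Om. (vgrad Om (%x. c *\<^sub>R v x) - vgrad Om (Z n)) x
    = c *\<^sub>R (vgrad Om v - vgrad Om (\<Phi> n)) x" for n
   using vw(2) Z1(2)[of n] by eventually_elim (simp add: scaleR_diff_right)
  then have "Lp_norm 2 Om (vgrad Om (%x. c *\<^sub>R v x) - vgrad Om (Z n)) = \<bar>c\<bar> * Lp_norm 2 Om (vgrad Om v - vgrad Om (\<Phi> n))" for n
   by (intro Lp2_norm_scale L2.diff_mem vgrad_L2 v1 \<Phi>1 vw(1) Z1(1))
  then show ?thesis using tendsto_mult_right_zero[OF \<Phi>(3)] by simp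
 qed
 ultimately show ?thesis using vw(1) by (auto simp: H10_vec_def)
qed

lemma div_free_add:
 assumes "v \<in> Lp 2 Om" "w \<in> Lp 2 Om" "div_free Om v" "div_free Om w"
 shows "div_free Om (%x. v x + w x)"
 using assms(3,4) unfolding div_free_def
 by (simp add: inner_add_left L2_integrable_inner[OF assms(1) test_fun_gradient_L2] L2_integrable_inner[OF assms(2) test_fun_gradient_L2])

lemma div_free_scale: "div_free Om v ==> div_free Om (%x. c *\<^sub>R v x)"
 unfolding div_free_def by simp

lemma V_add: "v \<in> V_space Om ==> w \<in> V_space Om ==> (%x. v x + w x) \<in> V_space Om"
 using H10_add div_free_add V_L2 by (auto simp: V_space_def)

lemma V_scale: "v \<in> V_space Om ==> (%x. c *\<^sub>R v x) \<in> V_space Om"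
 using H10_scale div_free_scale by (auto simp: V_space_def)

lemma V_zero: "(%x. 0) \<in> V_space Om"
 by (rule test_field_V) (auto simp: test_fun_zero div_free_def)

sublocale V: pre_inner "V_space Om" "V_inner Om"
proof
 show "(%x. 0) \<in> V_space Om" by (rule V_zero)
 show "V_inner Om (%x. f x + g x) h = V_inner Om f h + V_inner Om g h"
  if "f \<in> V_space Om" "g \<in> V_space Om" "h \<in> V_space Om" for f g h
 proof -
  note m = that[THEN V_vgrad_L2]
  have "V_inner Om (%x. f x + g x) h = L2_inner Om (%x. vgrad Om f x + vgrad Om g x) (vgrad Om h)"
   unfolding V_inner_def
   by (intro L2_inner_cong vgrad_add V_H1 that L2.add_mem m V_vgrad_L2 V_add) simp
  then show ?thesis using L2.B_add[OF m] by (simp add: V_inner_def)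
 qed
 show "V_inner Om (%x. c *\<^sub>R f x) h = c * V_inner Om f h"
  if "f \<in> V_space Om" "h \<in> V_space Om" for f h c
 proof -
  note m = that[THEN V_vgrad_L2]
  have "V_inner Om (%x. c *\<^sub>R f x) h = L2_inner Om (%x. c *\<^sub>R vgrad Om f x) (vgrad Om h)"
   unfolding V_inner_def
   by (intro L2_inner_cong vgrad_scale V_H1 that L2.scale_mem m V_vgrad_L2 V_scale) simp
  then show ?thesis using L2.B_scale[OF m] by (simp add: V_inner_def)
 qed
 show "V_inner Om f g = V_inner Om g f" for f g by (simp add: V_inner_def L2_inner_def inner_commute)
 show "0 <= V_inner Om f f" for f by (simp add: V_inner_def L2_inner_def)
qed (auto intro: V_add V_scale)

lemma V_N: "V.N f = V_norm Om f"
 by (simp add: V.N_def V_norm_def V_inner_def L2_inner_def Lp2_norm power2_norm_eq_inner)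

end

section \<open>The second-order remainder of the damping term\<close>

lemma powr_diff_bound:
 fixes x y a :: real
 assumes "0 <= x" "0 <= y" "1 <= a"
 shows "\<bar>x powr a - y powr a\<bar> <= a * (max x y) powr (a - 1) * \<bar>x - y\<bar>"
proof -
 have *: "\<bar>x powr a - y powr a\<bar> <= a * y powr (a - 1) * \<bar>x - y\<bar>" if xy: "0 <= x" "x < y" for x y :: real
 proof (cases "x = 0")
  case True
  have "y powr a = y powr (a - 1) * y"
   using that powr_mult_base[of y "a - 1"] by (simp add: mult.commute)
  moreover have "1 * (y powr (a - 1) * y) <= a * (y powr (a - 1) * y)"
   using assms that by (intro mult_right_mono) auto
  ultimately show ?thesis using True that by (simp add: mult.assoc)
 next
  case False
  then have x: "0 < x" using xy by simp
  have d: "((%t. t powr a) has_real_derivative a * t powr (a - 1)) (at t)" if "0 < t" for t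
   using that by (auto intro!: derivative_eq_intros simp: powr_diff)
  obtain z where z: "x < z" "z < y" "y powr a - x powr a = (y - x) * (a * z powr (a - 1))"
   using MVT2[OF xy(2), of "%t. t powr a" "%t. a * t powr (a - 1)"] d x by auto
  have "a * z powr (a - 1) <= a * y powr (a - 1)"
   using z x assms by (intro mult_left_mono powr_mono2) auto
  then have "(y - x) * (a * z powr (a - 1)) <= (y - x) * (a * y powr (a - 1))"
   by (rule mult_left_mono) (use xy in simp)
  moreover have "0 <= (y - x) * (a * z powr (a - 1))" using that assms by simp
  moreover have "\<bar>x powr a - y powr a\<bar> = \<bar>(y - x) * (a * z powr (a - 1))\<bar>"
   unfolding z(3)[symmetric] by (rule abs_minus_commute)
  moreover have "\<bar>x - y\<bar> = y - x" using that by simp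
  ultimately show ?thesis by (simp add: mult.commute)
 qed
 consider "x < y" | "y < x" | "x = y" by linarith
 then show ?thesis
 proof cases
  case 1 then show ?thesis using *[OF assms(1) 1] by (simp add: max_def)
 next
  case 2 then show ?thesis using *[OF assms(2) 2] by (simp add: max_def abs_minus_commute)
 qed auto
qed

lemma powr_taylor_bound:
 fixes x y a :: real
 assumes "0 <= x" "0 < y" "2 <= a"
 shows "\<bar>x powr a - y powr a - a * y powr (a - 1) * (x - y)\<bar> <= a * (a - 1) * (max x y) powr (a - 2) * (x - y)\<^sup>2"
proof (cases "x = y \<or> x = 0")
 case xy: False
 have "\<exists>z. min x y <= z \<and> z <= max x y \<and> x powr a - y powr a = a * z powr (a - 1) * (x - y)"
 proof -
  have x: "x \<noteq> 0" "x \<noteq> y" using xy by auto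
  have d: "((%t. t powr a) has_real_derivative a * t powr (a - 1)) (at t)" if "0 < t" for t
   using that by (auto intro!: derivative_eq_intros simp: powr_diff)
  show ?thesis
  proof (cases "x < y")
   case True
   obtain z where "x < z" "z < y" "y powr a - x powr a = (y - x) * (a * z powr (a - 1))"
    using MVT2[OF True, of "%t. t powr a" "%t. a * t powr (a - 1)"] d x assms by auto
   then show ?thesis by (intro exI[of _ z]) (auto simp: algebra_simps)
  next
   case False
   then have yx: "y < x" using \<open>x \<noteq> y\<close> by simp
   obtain z where "y < z" "z < x" "x powr a - y powr a = (x - y) * (a * z powr (a - 1))"
    using MVT2[OF yx, of "%t. t powr a" "%t. a * t powr (a - 1)"] d assms by auto
   then show ?thesis by (intro exI[of _ z]) (auto simp: algebra_simps)
  qed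
 qed
 then obtain z where z: "min x y <= z" "z <= max x y" "x powr a - y powr a = a * z powr (a - 1) * (x - y)" by blast
 have z0: "0 <= z" using z(1) assms by (simp add: min_def split: if_splits)
 have "\<bar>z powr (a - 1) - y powr (a - 1)\<bar> <= (a - 1) * (max z y) powr (a - 2) * \<bar>z - y\<bar>"
  using powr_diff_bound[OF z0, of y "a - 1"] assms by simp
 also have "\<dots> <= (a - 1) * (max x y) powr (a - 2) * \<bar>x - y\<bar>"
 proof (intro mult_mono mult_left_mono powr_mono2)
  show "\<bar>z - y\<bar> <= \<bar>x - y\<bar>" using z by (simp add: min_def max_def split: if_splits)
 qed (use z z0 assms in auto)
 finally have b: "\<bar>z powr (a - 1) - y powr (a - 1)\<bar> <= (a - 1) * (max x y) powr (a - 2) * \<bar>x - y\<bar>" .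
 have "\<bar>x powr a - y powr a - a * y powr (a - 1) * (x - y)\<bar> = a * \<bar>z powr (a - 1) - y powr (a - 1)\<bar> * \<bar>x - y\<bar>"
 proof -
  have "x powr a - y powr a - a * y powr (a - 1) * (x - y) = a * (z powr (a - 1) - y powr (a - 1)) * (x - y)"
   unfolding z(3) by (simp add: algebra_simps)
  then show ?thesis using assms by (simp add: abs_mult)
 qed
 also have "\<dots> <= a * ((a - 1) * (max x y) powr (a - 2) * \<bar>x - y\<bar>) * \<bar>x - y\<bar>"
  using b assms by (intro mult_right_mono mult_left_mono) auto
 also have "\<dots> = a * (a - 1) * (max x y) powr (a - 2) * (x - y)\<^sup>2"
  by (simp add: power2_eq_square abs_mult_self_eq mult.assoc)
 finally show ?thesis .
next
 case True
 then consider "x = y" | "x = 0" by blast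
 then show ?thesis
 proof cases
  case 2
  have "y powr (a - 2) * y * y = y powr (a - 1) * y" "y powr (a - 1) * y = y powr a"
   using assms powr_mult_base[of y "a - 2"] powr_mult_base[of y "a - 1"] by (simp_all add: mult.commute)
  then have e: "y powr a = y powr (a - 2) * y\<^sup>2" "a * y powr (a - 1) * y = a * (y powr (a - 2) * y\<^sup>2)"
   by (simp_all add: power2_eq_square mult.assoc)
  have "\<bar>x powr a - y powr a - a * y powr (a - 1) * (x - y)\<bar> = \<bar>(a - 1) * (y powr (a - 2) * y\<^sup>2)\<bar>"
   using 2 e assms by (simp add: algebra_simps)
  also have "\<dots> = (a - 1) * (y powr (a - 2) * y\<^sup>2)" using assms by simp
  also have "\<dots> <= a * ((a - 1) * (y powr (a - 2) * y\<^sup>2))"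
   using mult_right_mono[of 1 a "(a - 1) * (y powr (a - 2) * y\<^sup>2)"] assms by simp
  finally show ?thesis using 2 assms by (simp add: max_def mult.assoc)
 qed simp
qed

text \<open>The inner product of \<open>z\<close> and \<open>w\<close> in the derivative differs from the product of \<open>norm z\<close> with the increment of the norm by this second-order quantity.\<close>

lemma norm_defect_bounds:
 fixes z w :: "'a::real_inner"
 shows "0 <= norm (z + w) * norm z - z \<bullet> (z + w)" "norm (z + w) * norm z - z \<bullet> (z + w) <= (norm w)\<^sup>2 / 2"
proof -
 show "0 <= norm (z + w) * norm z - z \<bullet> (z + w)"
  using norm_cauchy_schwarz[of z "z + w"] by (simp add: mult.commute)
 have "(norm w)\<^sup>2 = (norm (z + w))\<^sup>2 - 2 * (z \<bullet> (z + w)) + (norm z)\<^sup>2"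
  by (simp add: power2_norm_eq_inner algebra_simps inner_commute)
 moreover have "2 * (norm (z + w) * norm z) <= (norm (z + w))\<^sup>2 + (norm z)\<^sup>2"
  using sum_squares_bound[of "norm (z + w)" "norm z"] by (simp add: mult.assoc)
 ultimately show "norm (z + w) * norm z - z \<bullet> (z + w) <= (norm w)\<^sup>2 / 2" by linarith
qed

lemma damping_zero: "damping r 0 = 0" "1 < r ==> damping_deriv r 0 w = 0"
 by (auto simp: damping_def damping_deriv_def)

text \<open>The remainder splits into a first-order difference of the weight along \<open>w\<close> and a scalar Taylor remainder along \<open>z\<close>.\<close>

lemma damping_remainder_eq:
 assumes "1 < r" "z \<noteq> 0"
 shows "damping r (z + w) - damping r z - damping_deriv r z w
  = (norm (z + w) powr (r - 1) - norm z powr (r - 1)) *\<^sub>R w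
   + (norm (z + w) powr (r - 1) - norm z powr (r - 1) - (r - 1) * norm z powr (r - 3) * (z \<bullet> w)) *\<^sub>R z"
 using assms by (simp add: damping_def damping_deriv_def algebra_simps)

lemma damping_remainder_bound_2:
 "norm (damping 2 (z + w) - damping 2 z - damping_deriv 2 z w) <= 4 * (norm w)\<^sup>2"
proof (cases "z = 0")
 case True
 then show ?thesis by (simp add: damping_zero damping_def power2_eq_square)
next
 case False
 let ?\<rho> = "norm (z + w)" and ?\<sigma> = "norm z"
 have s: "0 < ?\<sigma>" using False by simp
 have d: "\<bar>?\<rho> - ?\<sigma>\<bar> <= norm w" using norm_triangle_ineq3[of "z + w" z] by simp
 have "norm z powr (-1) = inverse ?\<sigma>" using s by (simp add: powr_minus)
 then have e: "damping 2 (z + w) - damping 2 z - damping_deriv 2 z w = (?\<rho> - ?\<sigma>) *\<^sub>R w + (?\<rho> - ?\<sigma> - inverse ?\<sigma> * (z \<bullet> w)) *\<^sub>R z"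
  using damping_remainder_eq[of 2 z w] False by simp
 have "norm ((?\<rho> - ?\<sigma> - inverse ?\<sigma> * (z \<bullet> w)) *\<^sub>R z) = \<bar>?\<sigma> * (?\<rho> - ?\<sigma> - inverse ?\<sigma> * (z \<bullet> w))\<bar>"
  by (simp add: abs_mult mult.commute)
 also have "?\<sigma> * (?\<rho> - ?\<sigma> - inverse ?\<sigma> * (z \<bullet> w)) = ?\<rho> * ?\<sigma> - z \<bullet> (z + w)"
  using s by (simp add: algebra_simps dot_square_norm power2_eq_square)
 also have "\<bar>?\<rho> * ?\<sigma> - z \<bullet> (z + w)\<bar> <= (norm w)\<^sup>2 / 2" using norm_defect_bounds[of z w] by simp
 finally have 1: "norm ((?\<rho> - ?\<sigma> - inverse ?\<sigma> * (z \<bullet> w)) *\<^sub>R z) <= (norm w)\<^sup>2 / 2" .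
 have 2: "norm ((?\<rho> - ?\<sigma>) *\<^sub>R w) <= (norm w)\<^sup>2"
  using mult_right_mono[OF d, of "norm w"] by (simp add: power2_eq_square)
 show ?thesis unfolding e using norm_triangle_ineq[of "(?\<rho> - ?\<sigma>) *\<^sub>R w" "(?\<rho> - ?\<sigma> - inverse ?\<sigma> * (z \<bullet> w)) *\<^sub>R z"] 1 2
   zero_le_power2[of "norm w"] by linarith
qed

text \<open>The scalar Taylor remainder of \<open>t \<mapsto> t powr q\<close> at \<open>\<sigma>\<close> is singular for \<open>\<sigma> \<rightarrow> 0\<close>
 when \<open>q < 2\<close>. Multiplied by \<open>\<sigma>\<close> it becomes the remainder of \<open>t \<mapsto> t powr (q + 1)\<close> up to a
 quadratic term, which explains why no case distinction at \<open>r = 3\<close> occurs.\<close>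

lemma damping_remainder_bound:
 assumes r: "2 < r"
 shows "norm (damping r (z + w) - damping r z - damping_deriv r z w)
  <= (r - 1) * (r + 3) * (norm (z + w) powr (r - 2) + norm z powr (r - 2)) * (norm w)\<^sup>2"
proof (cases "z = 0")
 case True
 have "norm w powr (r - 1) * norm w = norm w powr (r - 2) * (norm w)\<^sup>2"
 proof (cases "w = 0")
  case False
  then show ?thesis
   using powr_mult_base[of "norm w" "r - 2"] by (simp add: power2_eq_square algebra_simps)
 qed simp
 moreover have "1 * (norm w powr (r - 2) * (norm w)\<^sup>2) <= (r - 1) * (r + 3) * (norm w powr (r - 2) * (norm w)\<^sup>2)"
 proof (intro mult_right_mono)
  have "1 * 1 <= (r - 1) * (r + 3)" using r by (intro mult_mono) auto
  then show "1 <= (r - 1) * (r + 3)" by simp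
 qed auto
 ultimately show ?thesis using True r by (simp add: damping_zero damping_def mult.assoc)
next
 case False
 define q where "q = r - 1"
 let ?\<rho> = "norm (z + w)" and ?\<sigma> = "norm z"
 define M where "M = (max ?\<rho> ?\<sigma>) powr (r - 2)"
 have q: "1 < q" using r by (simp add: q_def)
 have s: "0 < ?\<sigma>" using False by simp
 have d: "\<bar>?\<rho> - ?\<sigma>\<bar> <= norm w" using norm_triangle_ineq3[of "z + w" z] by simp
 then have d2: "(?\<rho> - ?\<sigma>)\<^sup>2 <= (norm w)\<^sup>2" by (simp add: abs_le_square_iff[symmetric])
 have M: "0 <= M" by (simp add: M_def)
 let ?P = "?\<rho> powr q - ?\<sigma> powr q"
 have P: "\<bar>?P\<bar> <= q * M * \<bar>?\<rho> - ?\<sigma>\<bar>"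
  using powr_diff_bound[of ?\<rho> ?\<sigma> q] q by (simp add: M_def q_def)
 have P': "\<bar>?P\<bar> <= q * M * norm w"
 proof -
  have "q * M * \<bar>?\<rho> - ?\<sigma>\<bar> <= q * M * norm w" using d M q by (intro mult_left_mono) auto
  then show ?thesis using P by linarith
 qed
 have 1: "norm (?P *\<^sub>R w) <= q * M * (norm w)\<^sup>2"
  using mult_right_mono[OF P', of "norm w"] by (simp add: power2_eq_square mult.assoc)
 let ?X = "?P - q * ?\<sigma> powr (q - 1) * (?\<rho> - ?\<sigma>)"
 have sx: "?\<sigma> * ?\<sigma> powr (q - 1) = ?\<sigma> powr q" "?\<sigma> * ?\<sigma> powr q = ?\<sigma> powr (q + 1)"  "?\<rho> * ?\<rho> powr q = ?\<rho> powr (q + 1)"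
  using powr_mult_base[of ?\<sigma> "q - 1"] powr_mult_base[of ?\<sigma> q] powr_mult_base[of ?\<rho> q] by (simp_all add: add.commute)
 have "?\<sigma> * ?X = (?\<rho> powr (q + 1) - ?\<sigma> powr (q + 1) - (q + 1) * ?\<sigma> powr q * (?\<rho> - ?\<sigma>)) - (?\<rho> - ?\<sigma>) * ?P"
 proof -
  have "?\<sigma> * ?X = ?\<sigma> * ?P - q * (?\<sigma> * ?\<sigma> powr (q - 1)) * (?\<rho> - ?\<sigma>)" by (simp add: algebra_simps)
  then show ?thesis unfolding sx(1) sx(2)[symmetric] sx(3)[symmetric] by (simp add: algebra_simps)
 qed
 moreover have "\<bar>?\<rho> powr (q + 1) - ?\<sigma> powr (q + 1) - (q + 1) * ?\<sigma> powr q * (?\<rho> - ?\<sigma>)\<bar> <= (q + 1) * q * M * (norm w)\<^sup>2"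
 proof -
  have "\<bar>?\<rho> powr (q + 1) - ?\<sigma> powr (q + 1) - (q + 1) * ?\<sigma> powr q * (?\<rho> - ?\<sigma>)\<bar> <= (q + 1) * q * M * (?\<rho> - ?\<sigma>)\<^sup>2"
   using powr_taylor_bound[of ?\<rho> ?\<sigma> "q + 1"] q s by (simp add: M_def q_def)
  also have "\<dots> <= (q + 1) * q * M * (norm w)\<^sup>2"
   using d2 M q by (intro mult_left_mono) auto
  finally show ?thesis .
 qed
 moreover have "\<bar>(?\<rho> - ?\<sigma>) * ?P\<bar> <= q * M * (norm w)\<^sup>2"
 proof -
  have "\<bar>?\<rho> - ?\<sigma>\<bar> * \<bar>?P\<bar> <= norm w * (q * M * norm w)"
   by (intro mult_mono d P') auto
  then show ?thesis by (simp only: abs_mult power2_eq_square mult_ac)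
 qed
 ultimately have X: "\<bar>?\<sigma> * ?X\<bar> <= (q + 1) * q * M * (norm w)\<^sup>2 + q * M * (norm w)\<^sup>2" by linarith
 have sm: "?\<sigma> powr (q - 2) * ?\<sigma> = ?\<sigma> powr (q - 1)"
  using powr_mult_base[of ?\<sigma> "q - 2"] by (simp add: mult.commute)
 let ?Y = "?P - q * ?\<sigma> powr (q - 2) * (z \<bullet> w)"
 have "?\<sigma> * ?Y = ?\<sigma> * ?X + q * (?\<sigma> powr (q - 2) * ?\<sigma>) * (?\<rho> * ?\<sigma> - z \<bullet> (z + w))"
  unfolding sm[symmetric] by (simp add: algebra_simps dot_square_norm power2_eq_square)
 moreover have "\<bar>q * (?\<sigma> powr (q - 2) * ?\<sigma>) * (?\<rho> * ?\<sigma> - z \<bullet> (z + w))\<bar> <= q * M * ((norm w)\<^sup>2 / 2)"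
 proof -
  have "?\<sigma> powr (q - 1) <= M" unfolding M_def q_def using r by (auto intro!: powr_mono2)
  then have "q * ?\<sigma> powr (q - 1) * (?\<rho> * ?\<sigma> - z \<bullet> (z + w)) <= q * M * ((norm w)\<^sup>2 / 2)"
   using norm_defect_bounds[of z w] q M by (intro mult_mono) auto
  moreover have "0 <= q * ?\<sigma> powr (q - 1) * (?\<rho> * ?\<sigma> - z \<bullet> (z + w))"
   using norm_defect_bounds[of z w] q by simp
  ultimately show ?thesis unfolding sm by simp
 qed
 ultimately have Y: "\<bar>?\<sigma> * ?Y\<bar> <= (q + 1) * q * M * (norm w)\<^sup>2 + q * M * (norm w)\<^sup>2 + q * M * ((norm w)\<^sup>2 / 2)"
  using X by linarith
 have D: "damping r (z + w) - damping r z - damping_deriv r z w = ?P *\<^sub>R w + ?Y *\<^sub>R z"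
  using damping_remainder_eq[of r z w] r False by (simp add: q_def)
 have nY: "norm (?Y *\<^sub>R z) = \<bar>?\<sigma> * ?Y\<bar>" by (simp add: abs_mult mult.commute)
 have "norm (damping r (z + w) - damping r z - damping_deriv r z w) <= norm (?P *\<^sub>R w) + norm (?Y *\<^sub>R z)"
  unfolding D by (rule norm_triangle_ineq)
 also have "\<dots> <=
  q * M * (norm w)\<^sup>2 + ((q + 1) * q * M * (norm w)\<^sup>2 + q * M * (norm w)\<^sup>2 + q * M * ((norm w)\<^sup>2 / 2))"
  unfolding nY by (rule add_mono[OF 1 Y])
 also have "\<dots> = q * (q + 7/2) * (M * (norm w)\<^sup>2)" by (simp add: algebra_simps)
 also have "\<dots> <= q * (q + 4) * (M * (norm w)\<^sup>2)"
  using q M by (intro mult_right_mono mult_left_mono) auto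
 also have "\<dots> <= q * (q + 4) * ((?\<rho> powr (r - 2) + ?\<sigma> powr (r - 2)) * (norm w)\<^sup>2)"
 proof (intro mult_left_mono mult_right_mono)
  show "M <= ?\<rho> powr (r - 2) + ?\<sigma> powr (r - 2)" by (simp add: M_def max_def)
 qed (use q in auto)
 finally show ?thesis by (simp add: q_def mult.assoc algebra_simps)
qed

lemma damping_deriv_sym: "damping_deriv r z a \<bullet> b = damping_deriv r z b \<bullet> a"
 by (simp add: damping_deriv_def inner_add_left inner_commute algebra_simps)

lemma norm_damping: "norm (damping r z) = norm z powr (r - 1) * norm z"
 by (simp add: damping_def)

lemma norm_damping_deriv: assumes "1 <= r" shows "norm (damping_deriv r z w) <= max 1 (r * norm z powr (r - 1)) * norm w"
proof -
 consider "r = 1" | "r \<noteq> 1" "z = 0" | "r \<noteq> 1" "z \<noteq> 0" by blast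
 then show ?thesis
 proof cases
  case 1 then show ?thesis by (simp add: damping_deriv_def mult_right_mono)
 next
  case 2 then show ?thesis using assms by (simp add: damping_zero)
 next
  case 3
  then have z: "0 < norm z" by simp
  have "norm z powr (r - 3) * norm z * norm z = norm z powr (r - 1)"
   using z powr_mult_base[of "norm z" "r - 3"] powr_mult_base[of "norm z" "r - 2"] by (simp add: mult.commute)
  then have e: "(r - 1) * norm z powr (r - 3) * (norm z * norm w) * norm z = (r - 1) * norm z powr (r - 1) * norm w"
   by (metis (no_types) mult.assoc mult.commute)
  have "norm (((r - 1) * norm z powr (r - 3) * (z \<bullet> w)) *\<^sub>R z) <= (r - 1) * norm z powr (r - 3) * (norm z * norm w) * norm z"
   using assms Cauchy_Schwarz_ineq2[of z w] by (simp add: abs_mult mult_left_mono mult_right_mono)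
  then have "norm (damping_deriv r z w) <= (r - 1) * norm z powr (r - 1) * norm w + norm z powr (r - 1) * norm w"
   unfolding damping_deriv_def e using 3 norm_triangle_ineq[of "((r - 1) * norm z powr (r - 3) * (z \<bullet> w)) *\<^sub>R z" "(norm z powr (r - 1)) *\<^sub>R w"]
   by simp
  also have "\<dots> = r * norm z powr (r - 1) * norm w" by (simp add: algebra_simps)
  also have "\<dots> <= max 1 (r * norm z powr (r - 1)) * norm w" by (intro mult_right_mono) auto
  finally show ?thesis .
 qed
qed

section \<open>Sobolev embeddings and the convection term\<close>

lemma Lp_integral_powr:
 assumes "0 < p"
 shows "(LINT x|leb Om. norm (f x) powr p) powr \<theta> = Lp_norm p Om f powr (p * \<theta>)"
 using assms by (simp add: Lp_norm_def powr_powr)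

text \<open>The exponents \<open>a\<close>, \<open>b\<close>, \<open>c\<close> are kept free so that powers of one function, such as \<open>norm u powr (r - 2)\<close>, can be estimated in the space in which \<open>u\<close> is known to be bounded.\<close>

lemma Lp_Holder3:
 fixes f :: "R3 => 'b::euclidean_space" and g :: "R3 => 'c::euclidean_space" and h :: "R3 => 'd::euclidean_space"
 assumes "f \<in> Lp p Om" "g \<in> Lp q Om" "h \<in> Lp s Om" "0 < p" "0 < q" "0 < s" "0 < a" "0 < b" "0 < c"
  "a / p + b / q + c / s = 1"
 shows "integrable (leb Om) (%x. norm (f x) powr a * norm (g x) powr b * norm (h x) powr c)"
  and "(LINT x|leb Om. norm (f x) powr a * norm (g x) powr b * norm (h x) powr c)
   <= Lp_norm p Om f powr a * Lp_norm q Om g powr b * Lp_norm s Om h powr c"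
proof -
 have i: "integrable (leb Om) (%x. norm (f x) powr p)" "integrable (leb Om) (%x. norm (g x) powr q)"
  "integrable (leb Om) (%x. norm (h x) powr s)" using assms by (auto simp: Lp_def)
 note H = Holder3[OF i, of "a/p" "b/q" "c/s"]
 have e: "(norm (f x) powr p) powr (a / p) = norm (f x) powr a" "(norm (g x) powr q) powr (b / q) = norm (g x) powr b"
  "(norm (h x) powr s) powr (c / s) = norm (h x) powr c" for x
  using assms by (auto simp: powr_powr)
 show "integrable (leb Om) (%x. norm (f x) powr a * norm (g x) powr b * norm (h x) powr c)"
  using H(1) assms by (simp add: e)
 show "(LINT x|leb Om. norm (f x) powr a * norm (g x) powr b * norm (h x) powr c)
   <= Lp_norm p Om f powr a * Lp_norm q Om g powr b * Lp_norm s Om h powr c"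
  using H(2) assms by (simp add: e Lp_integral_powr)
qed

lemma Holder_4_2_4:
 fixes f :: "R3 => 'b::euclidean_space" and g :: "R3 => 'c::euclidean_space" and h :: "R3 => 'd::euclidean_space"
 assumes "f \<in> Lp 4 Om" "g \<in> Lp 2 Om" "h \<in> Lp 4 Om"
 shows "integrable (leb Om) (%x. norm (f x) * norm (g x) * norm (h x))"
  and "(LINT x|leb Om. norm (f x) * norm (g x) * norm (h x)) <= Lp_norm 4 Om f * Lp_norm 2 Om g * Lp_norm 4 Om h"
 using Lp_Holder3[OF assms, of 1 1 1] by (simp_all add: Lp_norm_nonneg)

lemma integrable_dominated:
 fixes f :: "'a => real"
 assumes "integrable M g" "f \<in> bmeas M" "!!x. \<bar>f x\<bar> <= g x"
 shows "integrable M f" "\<bar>LINT x|M. f x\<bar> <= (LINT x|M. g x)"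
proof -
 show i: "integrable M f"
  by (rule Bochner_Integration.integrable_bound[OF assms(1,2)])
   (use assms(3) in \<open>auto intro!: always_eventually simp: order_trans[OF _ abs_ge_self]\<close>)
 have "\<bar>LINT x|M. f x\<bar> <= (LINT x|M. \<bar>f x\<bar>)" by (rule integral_abs_bound)
 also have "\<dots> <= (LINT x|M. g x)" by (rule integral_mono) (use i assms in auto)
 finally show "\<bar>LINT x|M. f x\<bar> <= (LINT x|M. g x)" .
qed

lemma norm_matrix_vector: fixes A :: "real^3^3" shows "norm (A *v x) <= norm A * norm x"
proof -
 have "(norm (A *v x))\<^sup>2 = (\<Sum>i\<in>UNIV. (A $ i \<bullet> x)\<^sup>2)"
  by (simp add: norm_vec_square matrix_vector_mult_def inner_vec_def)
 also have "\<dots> <= (\<Sum>i\<in>UNIV. (norm (A $ i))\<^sup>2 * (norm x)\<^sup>2)"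
  using Cauchy_Schwarz_ineq by (intro sum_mono) (simp add: power2_norm_eq_inner)
 also have "\<dots> = (norm A * norm x)\<^sup>2"
  by (simp add: power_mult_distrib norm_vec_square[of A] sum_distrib_right)
 finally show ?thesis by (rule power2_le_imp_le) simp
qed

lemma matrix_vector_nth: "((A::real^3^3) *v x) $ i = A $ i \<bullet> x"
 by (simp add: matrix_vector_mult_def inner_vec_def)

lemma norm_convection: fixes A :: "real^3^3" shows "\<bar>(A *v x) \<bullet> y\<bar> <= norm x * norm A * norm y"
proof -
 have "\<bar>(A *v x) \<bullet> y\<bar> <= norm (A *v x) * norm y" by (rule Cauchy_Schwarz_ineq2)
 also have "\<dots> <= norm A * norm x * norm y" by (intro mult_right_mono norm_matrix_vector) auto
 finally show ?thesis by (simp add: mult.commute)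
qed

lemma convection_measurable:
 fixes A :: "R3 => real^3^3"
 assumes "A \<in> bmeas M" "u \<in> bmeas M" "v \<in> bmeas M"
 shows "(%x. (A x *v u x) \<bullet> v x) \<in> bmeas M"
proof (intro borel_measurable_inner assms(3))
 show "(%x. A x *v u x) \<in> bmeas M"
  unfolding borel_measurable_vec_iff matrix_vector_nth
  using assms(1,2) by (auto simp: borel_measurable_vec_iff intro!: borel_measurable_inner)
qed

lemma Lp2_norm_mono:
 fixes f :: "R3 => 'b::euclidean_space" and g :: "R3 => 'c::euclidean_space"
 assumes "f \<in> Lp 2 Om" "g \<in> Lp 2 Om" "AE x in leb Om. norm (f x) <= norm (g x)"
 shows "Lp_norm 2 Om f <= Lp_norm 2 Om g"
 unfolding Lp2_norm
proof (rule real_sqrt_le_mono, rule integral_mono_AE)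
 show "AE x in leb Om. (norm (f x))\<^sup>2 <= (norm (g x))\<^sup>2"
  using assms(3) by eventually_elim (simp add: power_mono)
qed (use assms in \<open>auto simp: Lp2_iff\<close>)

text \<open>Only the factor that converges almost everywhere has to be bounded; the gradients converge in mean square.\<close>

lemma tendsto_L2_inner_bounded_factor:
 fixes P :: "R3 => R3"
 assumes u: "u \<in> Lp 2 Om" and P: "P \<in> Lp 2 Om" "!!n. Pn n \<in> Lp 2 Om" "(%n. Lp_norm 2 Om (P - Pn n)) ----> 0"
  and m: "!!n. mn n \<in> bmeas (leb Om)" "m \<in> bmeas (leb Om)"
   "!!n x. \<bar>mn n x\<bar> <= (K::real)" "AE x in leb Om. (%n. mn n x) ----> m x"
 shows "(%n. LINT x|leb Om. mn n x * (Pn n x \<bullet> u x)) ----> (LINT x|leb Om. m x * (P x \<bullet> u x))"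
proof -
 have K: "0 <= K" using m(3)[of 0 0] by linarith
 have [measurable]: "u \<in> bmeas (leb Om)" "P \<in> bmeas (leb Om)"
  "Pn n \<in> bmeas (leb Om)" "mn n \<in> bmeas (leb Om)" "m \<in> bmeas (leb Om)" for n
  using assms by (auto simp: Lp2_iff)
 have i: "integrable (leb Om) (%x. \<bar>Q x \<bullet> u x\<bar>)" if "Q \<in> Lp 2 Om" for Q :: "R3 => R3"
  using L2_integrable_inner[OF that u] by simp
 have im: "integrable (leb Om) (%x. mn n x * (Q x \<bullet> u x))" 
  "\<bar>LINT x|leb Om. mn n x * (Q x \<bullet> u x)\<bar> <= K * (LINT x|leb Om. \<bar>Q x \<bullet> u x\<bar>)" if "Q \<in> Lp 2 Om" for Q :: "R3 => R3" and n
 proof -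
  have [measurable]: "Q \<in> bmeas (leb Om)" using that by (auto simp: Lp2_iff)
  have d: "integrable (leb Om) (%x. K * \<bar>Q x \<bullet> u x\<bar>)" using i[OF that] by simp
  have e: "(%x. mn n x * (Q x \<bullet> u x)) \<in> bmeas (leb Om)" by measurable
  have f: "\<bar>mn n x * (Q x \<bullet> u x)\<bar> <= K * \<bar>Q x \<bullet> u x\<bar>" for x
   using m(3)[of n x] by (simp add: abs_mult mult_right_mono)
  show "integrable (leb Om) (%x. mn n x * (Q x \<bullet> u x))" by (rule integrable_dominated(1)[OF d e f])
  show "\<bar>LINT x|leb Om. mn n x * (Q x \<bullet> u x)\<bar> <= K * (LINT x|leb Om. \<bar>Q x \<bullet> u x\<bar>)"
   using integrable_dominated(2)[OF d e f] by simp
 qed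
 have 1: "(%n. LINT x|leb Om. mn n x * (P x \<bullet> u x)) ----> (LINT x|leb Om. m x * (P x \<bullet> u x))"
 proof (rule integral_dominated_convergence[where w="%x. K * \<bar>P x \<bullet> u x\<bar>"])
  show "AE x in leb Om. (%n. mn n x * (P x \<bullet> u x)) ----> m x * (P x \<bullet> u x)"
   using m(4) by eventually_elim (intro tendsto_mult tendsto_const)
  show "AE x in leb Om. norm (mn n x * (P x \<bullet> u x)) <= K * \<bar>P x \<bullet> u x\<bar>" for n
   using m(3)[of n] by (auto simp: abs_mult mult_right_mono intro!: always_eventually)
 qed (use i[OF P(1)] in auto)
 have L2abs: "(LINT x|leb Om. \<bar>Q x \<bullet> u x\<bar>) <= Lp_norm 2 Om Q * Lp_norm 2 Om u" if "Q \<in> Lp 2 Om" for Q :: "R3 => R3"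
 proof -
  let ?q = "%x. norm (Q x)" and ?u = "%x. norm (u x)"
  have qu: "?q \<in> Lp 2 Om" "?u \<in> Lp 2 Om" using that u by (auto simp: Lp2_iff)
  have "(LINT x|leb Om. \<bar>Q x \<bullet> u x\<bar>) <= L2_inner Om ?q ?u"
   unfolding L2_inner_def using i[OF that] L2_integrable_inner[OF qu] Cauchy_Schwarz_ineq2
   by (intro integral_mono) (auto simp: mult.commute)
  also have "\<dots> <= Lp_norm 2 Om ?q * Lp_norm 2 Om ?u"
   using L2.cauchy_schwarz[OF qu] by (simp add: L2_N)
  finally show ?thesis by (simp add: Lp2_norm)
 qed
 have "(%n. LINT x|leb Om. mn n x * ((P - Pn n) x \<bullet> u x)) ----> 0"
 proof (rule Lim_null_comparison)
  show "\<forall>\<^sub>F n in sequentially. norm (LINT x|leb Om. mn n x * ((P - Pn n) x \<bullet> u x)) <= K * (Lp_norm 2 Om (P - Pn n) * Lp_norm 2 Om u)"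
  proof (intro always_eventually[where F=sequentially] allI)
   fix n
   note d = L2.diff_mem[OF P(1) P(2)[of n]]
   show "norm (LINT x|leb Om. mn n x * ((P - Pn n) x \<bullet> u x)) <= K * (Lp_norm 2 Om (P - Pn n) * Lp_norm 2 Om u)"
    using order_trans[OF im(2)[OF d, of n] mult_left_mono[OF L2abs[OF d] K]] unfolding real_norm_def .
  qed
  show "(%n. K * (Lp_norm 2 Om (P - Pn n) * Lp_norm 2 Om u)) ----> 0"
   using tendsto_mult_right_zero[OF tendsto_mult_left_zero[OF P(3)], of K "Lp_norm 2 Om u"] by simp
 qed
 from tendsto_diff[OF 1 this] show ?thesis
  using im(1)[OF P(1)] im(1)[OF L2.diff_mem[OF P(1,2)]]
  by (simp add: Bochner_Integration.integral_diff[symmetric] right_diff_distrib[symmetric] inner_diff_left[symmetric])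
qed

lemma L2_converges_AE_subseq:
 fixes f :: "R3 => real"
 assumes "bounded_open Om" "f \<in> Lp 2 Om" "!!n. fn n \<in> Lp 2 Om" "(%n. Lp_norm 2 Om (f - fn n)) ----> 0"
 obtains r :: "nat => nat" where "strict_mono r" "AE x in leb Om. (%n. fn (r n) x) ----> f x"
proof -
 interpret bounded_open Om by fact
 have d: "f - fn n \<in> Lp 2 Om" for n using assms L2.diff_mem by blast
 have one: "(%x. 1::real) \<in> Lp 2 Om" by (rule bounded_L2_test[OF open_dom bounded_dom, of _ 1]) auto
 have i: "integrable (leb Om) (%x. \<bar>(f - fn n) x\<bar>)" for n by (rule integrable_abs[OF L2_integrable[OF d]])
 have b: "(LINT x|leb Om. norm ((f - fn n) x)) <= Lp_norm 2 Om (f - fn n) * Lp_norm 2 Om (%x. 1::real)" for n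
 proof -
  have a: "(%x. \<bar>(f - fn n) x\<bar>) \<in> Lp 2 Om"
   using d[of n] borel_measurable_integrable[OF i[of n]] by (auto simp: Lp2_iff)
  have "L2_inner Om (%x. \<bar>(f - fn n) x\<bar>) (%x. 1::real) <= Lp_norm 2 Om (%x. \<bar>(f - fn n) x\<bar>) * Lp_norm 2 Om (%x. 1::real)"
   using L2.cauchy_schwarz[OF a one] by (simp add: L2_N)
  then show ?thesis by (simp add: L2_inner_def Lp2_norm)
 qed
 have "(%n. LINT x|leb Om. norm ((f - fn n) x)) ----> 0"
 proof (rule tendsto_sandwich[OF _ _ tendsto_const tendsto_mult_left_zero[OF assms(4)]])
  show "\<forall>\<^sub>F n in sequentially. 0 <= (LINT x|leb Om. norm ((f - fn n) x))" by simp
  show "\<forall>\<^sub>F n in sequentially. (LINT x|leb Om. norm ((f - fn n) x)) <= Lp_norm 2 Om (f - fn n) * Lp_norm 2 Om (%x. 1::real)"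
   using b by simp
 qed
 then obtain r where r: "strict_mono r" "AE x in leb Om. (%n. (f - fn (r n)) x) ----> 0"
  using tendsto_L1_AE_subseq[of "leb Om" "%n. f - fn n"] i L2_integrable[OF d] by auto
 have "AE x in leb Om. (%n. fn (r n) x) ----> f x"
  using r(2)
 proof eventually_elim
  case (elim x)
  from tendsto_diff[OF tendsto_const[of "f x"] elim] show ?case by simp
 qed
 then show ?thesis using that r(1) by blast
qed

text \<open>Truncating by \<open>s \<mapsto> k * sin (s / k)\<close> makes the products of the approximating test functions converge
 boundedly; the truncation is removed afterwards by dominated convergence, the limits being in \<open>Lp 4\<close>.\<close>

lemma convection_antisymmetric_scalar:
 fixes f g :: "R3 => real" and u P Q :: "R3 => R3"
 assumes Om: "bounded_open Om"
  and u: "u \<in> Lp 2 Om" "u \<in> Lp 4 Om" "div_free Om u"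
  and f: "f \<in> Lp 2 Om" "f \<in> Lp 4 Om" "P \<in> Lp 2 Om" "!!n. test_fun Om (fn n)"
   "(%n. Lp_norm 2 Om (f - fn n)) ----> 0" "(%n. Lp_norm 2 Om (P - gradient (fn n))) ----> 0"
  and g: "g \<in> Lp 2 Om" "g \<in> Lp 4 Om" "Q \<in> Lp 2 Om" "!!n. test_fun Om (gn n)"
   "(%n. Lp_norm 2 Om (g - gn n)) ----> 0" "(%n. Lp_norm 2 Om (Q - gradient (gn n))) ----> 0"
 shows "(LINT x|leb Om. g x * (P x \<bullet> u x)) + (LINT x|leb Om. f x * (Q x \<bullet> u x)) = 0"
proof -
 let ?M = "leb Om"
 let ?cs = "%(s::real) (t::real) k. cos (s / k) * (k * sin (t / k))"
 let ?sc = "%(s::real) (t::real) k. k * sin (s / k) * cos (t / k)"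
 interpret bounded_open Om by fact
 note fL = test_fun_L2[OF f(4)] and gL = test_fun_L2[OF g(4)]
 obtain r1 where r1: "strict_mono r1" "AE x in ?M. (%n. fn (r1 n) x) ----> f x"
  by (rule L2_converges_AE_subseq[OF Om f(1) fL f(5)])
 have "(%n. Lp_norm 2 Om (g - gn (r1 n))) ----> 0"
  using LIMSEQ_subseq_LIMSEQ[OF g(5) r1(1)] by (simp add: comp_def)
 then obtain r2 where r2: "strict_mono r2" "AE x in ?M. (%n. gn (r1 (r2 n)) x) ----> g x"
  by (rule L2_converges_AE_subseq[OF Om g(1) gL])
 define F where "F n = fn (r1 (r2 n))" for n
 define G where "G n = gn (r1 (r2 n))" for n
 have mono: "strict_mono (%n. r1 (r2 n))" using strict_mono_o[OF r1(1) r2(1)] by (simp add: comp_def)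
 have F: "test_fun Om (F n)" "(%n. Lp_norm 2 Om (P - gradient (F n))) ----> 0" for n
  using f(4) LIMSEQ_subseq_LIMSEQ[OF f(6) mono] by (simp_all add: F_def comp_def)
 have G: "test_fun Om (G n)" "(%n. Lp_norm 2 Om (Q - gradient (G n))) ----> 0" for n
  using g(4) LIMSEQ_subseq_LIMSEQ[OF g(6) mono] by (simp_all add: G_def comp_def)
 have Ff: "AE x in ?M. (%n. F n x) ----> f x"
  using r1(2) unfolding F_def
 proof eventually_elim
  case (elim x)
  from LIMSEQ_subseq_LIMSEQ[OF elim r2(1)] show ?case by (simp add: comp_def)
 qed
 have Gg: "AE x in ?M. (%n. G n x) ----> g x" using r2(2) by (simp add: G_def)
 have Fs: "smooth (F n)" and Gs: "smooth (G n)" for n using F(1) G(1) test_fun_smooth by blast+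
 have [measurable]: "F n \<in> bmeas (?M)" "G n \<in> bmeas (?M)"
  "f \<in> bmeas (?M)" "g \<in> bmeas (?M)"
  "u \<in> bmeas (?M)" "P \<in> bmeas (?M)" "Q \<in> bmeas (?M)" for n
  using Fs Gs f g u by (auto simp: Lp2_iff intro: borel_imp_lebesgue_on smooth_borel)
 \<comment> \<open>For fixed \<open>k\<close> the truncations are test functions of the approximations, so that the divergence-free field integrates their gradient to zero.\<close>
 have trunc: "(LINT x|?M. (?cs (f x) (g x) k) * (P x \<bullet> u x))
   + (LINT x|?M. (?sc (f x) (g x) k) * (Q x \<bullet> u x)) = 0" if k: "0 < k" for k :: real
 proof -
  have s: "smooth (%s. k * sin (s / k))"
   using smooth_cmult[OF smooth_affine1[OF smooth_sin, of 0 "1/k"], of k] by simp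
  have ds: "((%s. k * sin (s / k)) has_real_derivative cos (s / k)) (at s)" for s
   using k by (auto intro!: derivative_eq_intros)
  have z: "(LINT x|?M. (?cs (F n x) (G n x) k) * (gradient (F n) x \<bullet> u x))
   + (LINT x|?M. (?sc (F n x) (G n x) k) * (gradient (G n) x \<bullet> u x)) = 0" for n
  proof -
   let ?a = "%x. k * sin (F n x / k)" and ?b = "%x. k * sin (G n x / k)"
   have a: "test_fun Om ?a" "smooth ?b"
    using test_fun_comp[OF F(1) s] smooth_comp[OF s Gs] by auto
   have "gradient (%x. ?a x * ?b x) x = (?sc (F n x) (G n x) k) *\<^sub>R gradient (G n) x
     + (?cs (F n x) (G n x) k) *\<^sub>R gradient (F n) x" for x
    unfolding vec_eq_iff
    by (rule allI, simp only: gradient_mult[OF test_fun_smooth[OF a(1)] a(2)]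
     gradient_comp[OF Fs ds] gradient_comp[OF Gs ds], simp add: algebra_simps)
   moreover have "(LINT x|?M. u x \<bullet> gradient (%x. ?a x * ?b x) x) = 0"
    using u(3) test_fun_mult[OF a] unfolding div_free_def by blast
   ultimately have "(LINT x|?M. (?sc (F n x) (G n x) k) * (gradient (G n) x \<bullet> u x)
     + (?cs (F n x) (G n x) k) * (gradient (F n) x \<bullet> u x)) = 0"
    by (simp add: inner_add_right inner_commute)
   moreover have "integrable (?M) (%x. m x * (gradient (H::R3=>real) x \<bullet> u x))"
    if "test_fun Om H" "m \<in> bmeas (?M)" "!!x. \<bar>m x\<bar> <= k" for m H
   proof (rule integrable_dominated(1)[where g="%x. k * \<bar>gradient H x \<bullet> u x\<bar>"])
    note gL2 = test_fun_gradient_L2[OF that(1)]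
    show "integrable (?M) (%x. k * \<bar>gradient H x \<bullet> u x\<bar>)"
     using L2_integrable_inner[OF gL2 u(1)] by simp
    show "(%x. m x * (gradient H x \<bullet> u x)) \<in> bmeas (?M)"
     using that(2) Lp_measurable[OF gL2] by measurable
    show "\<bar>m x * (gradient H x \<bullet> u x)\<bar> <= k * \<bar>gradient H x \<bullet> u x\<bar>" for x
     using that(3)[of x] by (simp add: abs_mult mult_right_mono)
   qed
   note ii = this
   have "integrable (?M) (%x. (?sc (F n x) (G n x) k) * (gradient (G n) x \<bullet> u x))"
    by (rule ii[OF G(1)], measurable) (use k in \<open>simp add: abs_mult mult_le_one mult.assoc\<close>)
   moreover have "integrable (?M) (%x. (?cs (F n x) (G n x) k) * (gradient (F n) x \<bullet> u x))"
    by (rule ii[OF F(1)], measurable) (use k in \<open>simp add: abs_mult mult_le_one mult.left_commute[of _ k]\<close>)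
   ultimately show ?thesis by (simp add: add.commute)
  qed
  have "(%n. (LINT x|?M. (?cs (F n x) (G n x) k) * (gradient (F n) x \<bullet> u x))
   + (LINT x|?M. (?sc (F n x) (G n x) k) * (gradient (G n) x \<bullet> u x)))
   ----> (LINT x|?M. (?cs (f x) (g x) k) * (P x \<bullet> u x))
   + (LINT x|?M. (?sc (f x) (g x) k) * (Q x \<bullet> u x))"
  proof (intro tendsto_add)
   show "(%n. LINT x|?M. (?cs (F n x) (G n x) k) * (gradient (F n) x \<bullet> u x))
    ----> (LINT x|?M. (?cs (f x) (g x) k) * (P x \<bullet> u x))"
   proof (rule tendsto_L2_inner_bounded_factor[OF u(1) f(3) test_fun_gradient_L2[OF F(1)] F(2), where K=k])
    show "AE x in ?M. (%n. ?cs (F n x) (G n x) k) ----> ?cs (f x) (g x) k"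
     using Ff Gg by eventually_elim (use k in \<open>auto intro!: tendsto_intros\<close>)
    show "\<bar>?cs (F n x) (G n x) k\<bar> <= k" for n x
     using k by (simp add: abs_mult mult_le_one mult.left_commute[of _ k])
   qed measurable
   show "(%n. LINT x|?M. (?sc (F n x) (G n x) k) * (gradient (G n) x \<bullet> u x))
    ----> (LINT x|?M. (?sc (f x) (g x) k) * (Q x \<bullet> u x))"
   proof (rule tendsto_L2_inner_bounded_factor[OF u(1) g(3) test_fun_gradient_L2[OF G(1)] G(2), where K=k])
    show "AE x in ?M. (%n. ?sc (F n x) (G n x) k) ----> ?sc (f x) (g x) k"
     using Ff Gg by eventually_elim (use k in \<open>auto intro!: tendsto_intros\<close>)
    show "\<bar>?sc (F n x) (G n x) k\<bar> <= k" for n x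
     using k by (simp add: abs_mult mult_le_one mult.assoc)
   qed measurable
  qed
  then show ?thesis unfolding z by (simp add: LIMSEQ_const_iff)
 qed
 \<comment> \<open>The truncation is removed by letting \<open>k\<close> tend to infinity.\<close>
 define k where "k n = real (Suc n)" for n
 have kinf: "filterlim k at_top sequentially"
  unfolding k_def using filterlim_Suc filterlim_real_sequentially filterlim_compose by blast
 have sinlim: "(%n. k n * sin (s / k n)) ----> s" for s
 proof (cases "s = 0")
  case False
  have "((%h. sin h / h) \<longlongrightarrow> 1) (at (0::real))"
   using DERIV_sin[of 0] by (simp add: DERIV_def)
  moreover have "filterlim (%n. s / k n) (at 0) sequentially"
   unfolding filterlim_at using tendsto_divide_0[OF tendsto_const filterlim_at_top_imp_at_infinity[OF kinf]] False
   by (auto simp: k_def)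
  ultimately have "(%n. sin (s / k n) / (s / k n)) ----> 1" by (rule filterlim_compose)
  then have "(%n. s * (sin (s / k n) / (s / k n))) ----> s * 1" by (intro tendsto_mult tendsto_const)
  then show ?thesis using False by (simp add: field_simps)
 qed simp
 have coslim: "(%n. cos (s / k n)) ----> 1" for s
  using tendsto_cos[OF tendsto_divide_0[OF tendsto_const filterlim_at_top_imp_at_infinity[OF kinf]], of s] by simp
 have kp: "0 < k n" for n by (simp add: k_def)
 have sb: "\<bar>k n * sin (s / k n)\<bar> <= \<bar>s\<bar>" for n s
  using abs_sin_x_le_abs_x[of "s / k n"] kp[of n] by (simp add: abs_mult field_simps)
 have lim: "(%n. LINT x|?M. m n x * (R x \<bullet> u x)) ----> (LINT x|?M. h x * (R x \<bullet> u x))"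
  if R: "R \<in> Lp 2 Om" and h: "h \<in> Lp 4 Om" and m: "!!n x. \<bar>m n x\<bar> <= \<bar>h x\<bar>" "!!x. (%n. m n x) ----> h x"
   "!!n. m n \<in> bmeas (?M)" for R :: "R3 => R3" and h :: "R3 => real" and m
 proof (rule integral_dominated_convergence[where w="%x. norm (h x) * norm (R x) * norm (u x)"])
  have [measurable]: "R \<in> bmeas (?M)" "h \<in> bmeas (?M)" "m n \<in> bmeas (?M)" for n
   using R h m(3) by (auto simp: Lp_def)
  show "integrable (?M) (%x. norm (h x) * norm (R x) * norm (u x))" by (rule Holder_4_2_4[OF h R u(2)])
  show "AE x in ?M. (%n. m n x * (R x \<bullet> u x)) ----> h x * (R x \<bullet> u x)"
   using m(2) by (intro always_eventually allI tendsto_mult tendsto_const)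
  show "AE x in ?M. norm (m n x * (R x \<bullet> u x)) <= norm (h x) * norm (R x) * norm (u x)" for n
  proof (intro always_eventually allI)
   fix x
   have "\<bar>m n x\<bar> * \<bar>R x \<bullet> u x\<bar> <= \<bar>h x\<bar> * (norm (R x) * norm (u x))"
    by (intro mult_mono m(1) Cauchy_Schwarz_ineq2) auto
   then show "norm (m n x * (R x \<bullet> u x)) <= norm (h x) * norm (R x) * norm (u x)" by (simp add: abs_mult mult.assoc)
  qed
  show "(%x. h x * (R x \<bullet> u x)) \<in> bmeas (?M)" by measurable
  show "(%x. m n x * (R x \<bullet> u x)) \<in> bmeas (?M)" for n by measurable
 qed
 have "(%n. (LINT x|?M. (?cs (f x) (g x) (k n)) * (P x \<bullet> u x))
   + (LINT x|?M. (?sc (f x) (g x) (k n)) * (Q x \<bullet> u x)))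
   ----> (LINT x|?M. g x * (P x \<bullet> u x)) + (LINT x|?M. f x * (Q x \<bullet> u x))"
 proof (intro tendsto_add lim f(3) g(3) f(2) g(2))
  show "\<bar>?cs (f x) (g x) (k n)\<bar> <= \<bar>g x\<bar>" for n x
   using mult_mono[OF abs_cos_le_one[of "f x / k n"] sb[of n "g x"]] by (simp add: abs_mult)
  show "\<bar>?sc (f x) (g x) (k n)\<bar> <= \<bar>f x\<bar>" for n x
   using mult_mono[OF sb[of n "f x"] abs_cos_le_one[of "g x / k n"]] by (simp add: abs_mult)
  show "(%n. ?cs (f x) (g x) (k n)) ----> g x" for x
   using tendsto_mult[OF coslim sinlim] by simp
  show "(%n. ?sc (f x) (g x) (k n)) ----> f x" for x
   using tendsto_mult[OF sinlim coslim] by simp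
 qed measurable
 then show ?thesis unfolding trunc[OF kp] by (simp add: LIMSEQ_const_iff)
qed

locale fluid_domain = bounded_open +
 fixes C C7 :: real
 assumes C_pos: "0 < C" and embed4: "embedding_const Om 4 (sqrt C)"
  and C7_pos: "0 < C7" and embed6: "embedding_const Om 6 C7"
begin

lemma V_norm_nonneg: "0 <= V_norm Om v"
 by (simp add: V_norm_def Lp_norm_nonneg)

lemma V_L4: "v \<in> V_space Om ==> v \<in> Lp 4 Om" "v \<in> V_space Om ==> Lp_norm 4 Om v <= sqrt C * V_norm Om v"
 using embed4 by (auto simp: embedding_const_def)

lemma V_L6: "v \<in> V_space Om ==> v \<in> Lp 6 Om" "v \<in> V_space Om ==> Lp_norm 6 Om v <= C7 * V_norm Om v"
 using embed6 by (auto simp: embedding_const_def)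

lemma V_measurable: "v \<in> V_space Om ==> v \<in> bmeas (leb Om)"
 using V_L2 Lp_measurable by blast

definition poincare where "poincare = sqrt C * sqrt (Lp_norm 2 Om (%x. 1::real))"

lemma poincare_nonneg: "0 <= poincare"
 using C_pos by (simp add: poincare_def Lp_norm_nonneg)

lemma poincare: assumes "v \<in> V_space Om" shows "Lp_norm 2 Om v <= poincare * V_norm Om v"
proof -
 have one: "(%x. 1::real) \<in> Lp 2 Om" by (rule bounded_L2_test[OF open_dom bounded_dom, of _ 1]) auto
 have "(LINT x|leb Om. (norm (v x))\<^sup>2) <= Lp_norm 4 Om v * Lp_norm 4 Om v * Lp_norm 2 Om (%x. 1::real)"
  using Lp_Holder3(2)[OF V_L4(1)[OF assms] V_L4(1)[OF assms] one, of 1 1 1]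
  by (simp add: Lp_norm_nonneg power2_eq_square)
 then have "Lp_norm 2 Om v <= sqrt (Lp_norm 4 Om v * Lp_norm 4 Om v * Lp_norm 2 Om (%x. 1::real))"
  unfolding Lp2_norm[of Om v] by (rule real_sqrt_le_mono)
 also have "\<dots> = Lp_norm 4 Om v * sqrt (Lp_norm 2 Om (%x. 1::real))"
  by (simp add: real_sqrt_mult Lp_norm_nonneg)
 also have "\<dots> <= sqrt C * V_norm Om v * sqrt (Lp_norm 2 Om (%x. 1::real))"
  by (intro mult_right_mono V_L4 assms) (simp add: Lp_norm_nonneg)
 finally show ?thesis by (simp add: poincare_def mult_ac)
qed

lemma Lp_subset_L6:
 fixes v :: "R3 => 'b::euclidean_space"
 assumes "v \<in> Lp 6 Om" "0 <= p" "p <= 6" shows "v \<in> Lp p Om"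
proof -
 have [measurable]: "v \<in> bmeas (leb Om)" using assms Lp_measurable by blast
 have "integrable (leb Om) (%x. norm (v x) powr p)"
 proof (rule integrable_dominated(1)[where g="%x. 1 + norm (v x) powr 6"])
  show "integrable (leb Om) (%x. 1 + norm (v x) powr 6)"
   by (intro Bochner_Integration.integrable_add finite_measure.integrable_const[OF finite_measure_dom])
    (use assms in \<open>simp add: Lp_def\<close>)
  show "(%x. norm (v x) powr p) \<in> bmeas (leb Om)" by measurable
  show "\<bar>norm (v x) powr p\<bar> <= 1 + norm (v x) powr 6" for x
  proof (cases "norm (v x) <= 1")
   case True
   then have "norm (v x) powr p <= 1" using assms(2) by (simp add: powr_le1)
   then show ?thesis by (simp add: add_increasing2)
  next
   case False
   then have "norm (v x) powr p <= norm (v x) powr 6" using assms(3) by (intro powr_mono) auto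
   then show ?thesis by simp
  qed
 qed
 then show ?thesis by (simp add: Lp_def)
qed

lemma b_integrable:
 assumes "u \<in> V_space Om" "v \<in> V_space Om" "w \<in> V_space Om"
 shows "integrable (leb Om) (%x. (vgrad Om v x *v u x) \<bullet> w x)"
  and "\<bar>b_form Om u v w\<bar> <= C * V_norm Om u * V_norm Om v * V_norm Om w"
proof -
 note H = Holder_4_2_4[OF V_L4(1)[OF assms(1)] V_vgrad_L2[OF assms(2)] V_L4(1)[OF assms(3)]]
 have m: "(%x. (vgrad Om v x *v u x) \<bullet> w x) \<in> bmeas (leb Om)"
  using assms by (intro convection_measurable V_measurable Lp_measurable[OF V_vgrad_L2])
 note I = integrable_dominated[OF H(1) m norm_convection]
 show "integrable (leb Om) (%x. (vgrad Om v x *v u x) \<bullet> w x)" by (rule I(1))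
 have "\<bar>b_form Om u v w\<bar> <= Lp_norm 4 Om u * Lp_norm 2 Om (vgrad Om v) * Lp_norm 4 Om w"
  unfolding b_form_def using I(2) H(2) by linarith
 also have "\<dots> <= (sqrt C * V_norm Om u) * V_norm Om v * (sqrt C * V_norm Om w)"
  unfolding V_norm_def[of Om v] using C_pos
  by (intro mult_mono V_L4 assms mult_nonneg_nonneg Lp_norm_nonneg V_norm_nonneg) auto
 also have "\<dots> = (sqrt C * sqrt C) * V_norm Om u * V_norm Om v * V_norm Om w" by (simp only: mult_ac)
 finally show "\<bar>b_form Om u v w\<bar> <= C * V_norm Om u * V_norm Om v * V_norm Om w" using C_pos by simp
qed

lemma L2_component_le:
 fixes f :: "R3 => 'b::euclidean_space ^ 'n"
 assumes "f \<in> Lp 2 Om" "h \<in> Lp 2 Om" "AE x in leb Om. h x = f x $ i"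
 shows "Lp_norm 2 Om h <= Lp_norm 2 Om f"
 by (rule Lp2_norm_mono[OF assms(2,1)])
  (use assms(3) in \<open>eventually_elim, simp add: Finite_Cartesian_Product.norm_nth_le\<close>)

text \<open>The definition of \<open>H10_vec\<close> approximates all components simultaneously; the convection form is treated componentwise.\<close>

lemma H10_component_approx:
 assumes v: "v \<in> H10_vec Om"
 obtains f :: "nat => R3 => real" where "!!n. test_fun Om (f n)"
  "(%n. Lp_norm 2 Om ((%x. v x $ i) - f n)) ----> 0" "(%n. Lp_norm 2 Om ((%x. vgrad Om v x $ i) - gradient (f n))) ----> 0"
proof -
 note v1 = H10_H1[OF v]
 obtain \<Phi> where \<Phi>: "!!n i. test_fun Om (%x. \<Phi> n x $ i)" "(%n. Lp_norm 2 Om (v - \<Phi> n)) ----> 0"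
  "(%n. Lp_norm 2 Om (vgrad Om v - vgrad Om (\<Phi> n))) ----> 0" using v by (auto simp: H10_vec_def)
 have \<Phi>1: "\<Phi> n \<in> H1_vec Om" for n by (rule test_field(1)[OF \<Phi>(1)])
 define f where "f n x = \<Phi> n x $ i" for n x
 have f: "f n = (%x. \<Phi> n x $ i)" for n by (auto simp: f_def)
 have t: "test_fun Om (f n)" for n unfolding f by (rule \<Phi>(1))
 have vi: "(%x. v x $ i) \<in> Lp 2 Om" "(%x. vgrad Om v x $ i) \<in> Lp 2 Om"
  using H1_vec_L2[OF v1] vgrad_L2[OF v1] unfolding Lp2_vec_iff[of v] Lp2_vec_iff[of "vgrad Om v"] by auto
 have "(%n. Lp_norm 2 Om ((%x. v x $ i) - f n)) ----> 0"
 proof (rule tendsto_sandwich[OF _ _ tendsto_const \<Phi>(2)])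
  show "\<forall>\<^sub>F n in sequentially. Lp_norm 2 Om ((%x. v x $ i) - f n) <= Lp_norm 2 Om (v - \<Phi> n)"
  proof (intro always_eventually[where F=sequentially] allI L2_component_le L2.diff_mem vi test_fun_L2[OF t] H1_vec_L2 v1 \<Phi>1)
   fix n show "AE x in leb Om. ((%x. v x $ i) - f n) x = (v - \<Phi> n) x $ i" by (simp add: f_def)
  qed
 qed (simp add: Lp_norm_nonneg)
 moreover have "(%n. Lp_norm 2 Om ((%x. vgrad Om v x $ i) - gradient (f n))) ----> 0"
 proof (rule tendsto_sandwich[OF _ _ tendsto_const \<Phi>(3)])
  show "\<forall>\<^sub>F n in sequentially. Lp_norm 2 Om ((%x. vgrad Om v x $ i) - gradient (f n)) <= Lp_norm 2 Om (vgrad Om v - vgrad Om (\<Phi> n))"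
  proof (intro always_eventually[where F=sequentially] allI L2_component_le L2.diff_mem vi test_fun_gradient_L2[OF t] vgrad_L2 v1 \<Phi>1)
   fix n show "AE x in leb Om. ((%x. vgrad Om v x $ i) - gradient (f n)) x = (vgrad Om v - vgrad Om (\<Phi> n)) x $ i"
    using test_field(2)[OF \<Phi>(1), of n] by eventually_elim (simp add: f)
  qed
 qed (simp add: Lp_norm_nonneg)
 ultimately show ?thesis using that t by blast
qed

lemma Lp_component:
 fixes f :: "R3 => 'b::euclidean_space ^ 'n"
 assumes "f \<in> Lp p Om" "0 <= p" shows "(%x. f x $ i) \<in> Lp p Om"
proof -
 have m: "(%x. f x $ i) \<in> bmeas (leb Om)"
  using Lp_measurable[OF assms(1)] by (simp add: borel_measurable_vec_iff)
 have "integrable (leb Om) (%x. norm (f x $ i) powr p)"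
  by (rule integrable_dominated(1)[where g="%x. norm (f x) powr p"])
   (use assms m in \<open>auto simp: Lp_def intro!: powr_mono2 Finite_Cartesian_Product.norm_nth_le\<close>)
 then show ?thesis using m by (simp add: Lp_def)
qed

text \<open>The convection form is skew-symmetric in its last two arguments, because the first one is
 divergence free.\<close>

lemma b_antisymmetric:
 assumes u: "u \<in> V_space Om" and a: "a \<in> V_space Om" and c: "c \<in> V_space Om"
 shows "b_form Om u a c = - b_form Om u c a"
proof -
 have ud: "div_free Om u" using u by (simp add: V_space_def)
 have int: "integrable (leb Om) (%x. c x $ i * (vgrad Om a x $ i \<bullet> u x))" if "a \<in> V_space Om" "c \<in> V_space Om" for i a c
 proof -
  have ai: "(%x. vgrad Om a x $ i) \<in> Lp 2 Om" using V_vgrad_L2[OF that(1)] by (simp add: Lp2_vec_iff[of "vgrad Om a"])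
  have ci: "(%x. c x $ i) \<in> Lp 4 Om" by (rule Lp_component[OF V_L4(1)[OF that(2)]]) simp
  note H = Holder_4_2_4(1)[OF V_L4(1)[OF u] ai ci]
  show ?thesis
  proof (rule integrable_dominated(1)[OF H])
   show "(%x. c x $ i * (vgrad Om a x $ i \<bullet> u x)) \<in> bmeas (leb Om)"
    by (intro borel_measurable_times borel_measurable_inner Lp_measurable[OF ai] Lp_measurable[OF ci] V_measurable[OF u])
   show "\<bar>c x $ i * (vgrad Om a x $ i \<bullet> u x)\<bar> <= norm (u x) * norm (vgrad Om a x $ i) * norm (c x $ i)" for x
   proof -
    have "\<bar>c x $ i\<bar> * \<bar>vgrad Om a x $ i \<bullet> u x\<bar> <= \<bar>c x $ i\<bar> * (norm (vgrad Om a x $ i) * norm (u x))"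
     by (intro mult_left_mono Cauchy_Schwarz_ineq2) auto
    then show ?thesis by (simp add: abs_mult mult_ac)
   qed
  qed
 qed
 have b: "b_form Om u a c = (\<Sum>i\<in>UNIV. (LINT x|leb Om. c x $ i * (vgrad Om a x $ i \<bullet> u x)))"
  if "a \<in> V_space Om" "c \<in> V_space Om" for a c
 proof -
  have "b_form Om u a c = (LINT x|leb Om. (\<Sum>i\<in>UNIV. c x $ i * (vgrad Om a x $ i \<bullet> u x)))"
  proof -
   have "((vgrad Om a x) *v (u x)) \<bullet> (c x) = (\<Sum>i\<in>UNIV. c x $ i * (vgrad Om a x $ i \<bullet> u x))" for x
    by (subst inner_vec_def) (simp add: matrix_vector_nth mult.commute)
   then show ?thesis by (simp add: b_form_def)
  qed
  also have "\<dots> = (\<Sum>i\<in>UNIV. (LINT x|leb Om. c x $ i * (vgrad Om a x $ i \<bullet> u x)))"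
   by (rule Bochner_Integration.integral_sum) (rule int[OF that])
  finally show ?thesis .
 qed
 have "(LINT x|leb Om. c x $ i * (vgrad Om a x $ i \<bullet> u x)) + (LINT x|leb Om. a x $ i * (vgrad Om c x $ i \<bullet> u x)) = 0" for i
 proof -
  obtain f where f: "!!n. test_fun Om (f n)" "(%n. Lp_norm 2 Om ((%x. a x $ i) - f n)) ----> 0"
   "(%n. Lp_norm 2 Om ((%x. vgrad Om a x $ i) - gradient (f n))) ----> 0" by (rule H10_component_approx[OF V_H10[OF a], where i=i]) (rule that)
  obtain g where g: "!!n. test_fun Om (g n)" "(%n. Lp_norm 2 Om ((%x. c x $ i) - g n)) ----> 0"
   "(%n. Lp_norm 2 Om ((%x. vgrad Om c x $ i) - gradient (g n))) ----> 0" by (rule H10_component_approx[OF V_H10[OF c], where i=i]) (rule that)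
  have m: "(%x. vgrad Om a x $ i) \<in> Lp 2 Om" "(%x. vgrad Om c x $ i) \<in> Lp 2 Om"
   "(%x. a x $ i) \<in> Lp 2 Om" "(%x. c x $ i) \<in> Lp 2 Om" "(%x. a x $ i) \<in> Lp 4 Om" "(%x. c x $ i) \<in> Lp 4 Om"
   by (intro Lp_component V_vgrad_L2 V_L2 V_L4 a c; simp)+
  show ?thesis
   by (rule convection_antisymmetric_scalar[OF bounded_open_axioms V_L2[OF u] V_L4(1)[OF u] ud
    m(3) m(5) m(1) f m(4) m(6) m(2) g])
 qed
 then have "b_form Om u a c + b_form Om u c a = 0"
  unfolding b[OF a c] b[OF c a] sum.distrib[symmetric] by simp
 then show ?thesis by simp
qed

subsection \<open>Continuous functionals on the energy space\<close>

text \<open>Bounded linear functionals, with linearity expressed by differences, which is what approximation arguments require.\<close>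

definition cfun :: "(field => real) => bool" where
 "cfun F \<longleftrightarrow> (\<forall>v\<in>V_space Om. \<forall>w\<in>V_space Om. F (v - w) = F v - F w) \<and> (\<exists>K. \<forall>v\<in>V_space Om. \<bar>F v\<bar> <= K * V_norm Om v)"

lemma cfunI:
 assumes "!!v w. v \<in> V_space Om ==> w \<in> V_space Om ==> F (v - w) = F v - F w"
  "!!v. v \<in> V_space Om ==> \<bar>F v\<bar> <= K * V_norm Om v"
 shows "cfun F"
 using assms unfolding cfun_def by blast

lemma cfun_add: assumes "cfun k" "cfun l" shows "cfun (%v. k v + l v)"
proof -
 obtain K where K: "!!v. v \<in> V_space Om ==> \<bar>k v\<bar> <= K * V_norm Om v" using assms(1) unfolding cfun_def by blast
 obtain L where L: "!!v. v \<in> V_space Om ==> \<bar>l v\<bar> <= L * V_norm Om v" using assms(2) unfolding cfun_def by blast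
 show ?thesis
 proof (rule cfunI[where K="K + L"])
  show "k (v - w) + l (v - w) = k v + l v - (k w + l w)" if "v \<in> V_space Om" "w \<in> V_space Om" for v w
   using assms that unfolding cfun_def by simp
  show "\<bar>k v + l v\<bar> <= (K + L) * V_norm Om v" if "v \<in> V_space Om" for v
   using K[OF that] L[OF that] by (simp add: distrib_right)
 qed
qed

lemma cfun_scale: assumes "cfun k" shows "cfun (%v. c * k v)"
proof -
 obtain K where K: "!!v. v \<in> V_space Om ==> \<bar>k v\<bar> <= K * V_norm Om v" using assms(1) unfolding cfun_def by blast
 show ?thesis
 proof (rule cfunI[where K="\<bar>c\<bar> * K"])
  show "c * k (v - w) = c * k v - c * k w" if "v \<in> V_space Om" "w \<in> V_space Om" for v w
   using assms that unfolding cfun_def by (simp add: right_diff_distrib)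
  show "\<bar>c * k v\<bar> <= \<bar>c\<bar> * K * V_norm Om v" if "v \<in> V_space Om" for v
   using mult_left_mono[OF K[OF that], of "\<bar>c\<bar>"] by (simp add: abs_mult mult.assoc)
 qed
qed

lemma cfun_diff: assumes "cfun k" "cfun l" shows "cfun (%v. k v - l v)"
 using cfun_add[OF assms(1) cfun_scale[OF assms(2), of "-1"]] by simp

lemma cfun_L2: assumes "f \<in> Lp 2 Om" shows "cfun (L2_inner Om f)"
proof (rule cfunI[where K="Lp_norm 2 Om f * poincare"])
 show "L2_inner Om f (v - w) = L2_inner Om f v - L2_inner Om f w" if "v \<in> V_space Om" "w \<in> V_space Om" for v w
  by (rule L2.B_diff_right[OF V_L2[OF that(1)] V_L2[OF that(2)] assms])
 show "\<bar>L2_inner Om f v\<bar> <= Lp_norm 2 Om f * poincare * V_norm Om v" if "v \<in> V_space Om" for v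
  using L2.cauchy_schwarz[OF assms V_L2[OF that]] mult_left_mono[OF poincare[OF that] Lp_norm_nonneg[of 2 Om f]]
  by (simp add: L2_N mult.assoc)
qed

lemma cfun_V: assumes "f \<in> V_space Om" shows "cfun (V_inner Om f)"
 by (rule cfunI[where K="V_norm Om f"])
  (use V.B_diff_right[OF _ _ assms] V.cauchy_schwarz[OF assms] in \<open>auto simp: V_N\<close>)

lemma cfun_b3: assumes "u \<in> V_space Om" "v \<in> V_space Om" shows "cfun (b_form Om u v)"
proof (rule cfunI[where K="C * V_norm Om u * V_norm Om v"])
 show "b_form Om u v (a - c) = b_form Om u v a - b_form Om u v c" if "a \<in> V_space Om" "c \<in> V_space Om" for a c
  using b_integrable(1)[OF assms that(1)] b_integrable(1)[OF assms that(2)]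
  by (simp add: b_form_def inner_diff_right)
qed (rule b_integrable(2)[OF assms])

lemma cfun_b1: assumes "v \<in> V_space Om" "w \<in> V_space Om" shows "cfun (%u. b_form Om u v w)"
proof (rule cfunI[where K="C * V_norm Om v * V_norm Om w"])
 show "b_form Om (a - c) v w = b_form Om a v w - b_form Om c v w" if "a \<in> V_space Om" "c \<in> V_space Om" for a c
  using b_integrable(1)[OF that(1) assms] b_integrable(1)[OF that(2) assms]
  by (simp add: b_form_def matrix_vector_mult_diff_distrib inner_diff_left)
 show "\<bar>b_form Om u v w\<bar> <= C * V_norm Om v * V_norm Om w * V_norm Om u" if "u \<in> V_space Om" for u
  using b_integrable(2)[OF that assms] by (simp add: mult_ac)
qed

lemma b_form_expand:
 assumes u: "u \<in> V_space Om" and z: "z \<in> V_space Om" and p: "p \<in> V_space Om"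
 shows "b_form Om u u p - b_form Om z z p - b_form Om (u - z) z p + b_form Om z p (u - z) = b_form Om (u - z) (u - z) p"
proof -
 have w: "u - z \<in> V_space Om" by (rule V.diff_mem[OF u z])
 note i = b_integrable(1)[OF u u p] b_integrable(1)[OF z z p] b_integrable(1)[OF w z p] b_integrable(1)[OF w w p] b_integrable(1)[OF z w p]
 have "b_form Om u u p - b_form Om z z p - b_form Om (u - z) z p
  = (LINT x|leb Om. (vgrad Om u x *v u x) \<bullet> p x - (vgrad Om z x *v z x) \<bullet> p x - (vgrad Om z x *v (u - z) x) \<bullet> p x)"
  unfolding b_form_def using i by simp
 also have "\<dots> = (LINT x|leb Om. (vgrad Om (u - z) x *v (u - z) x) \<bullet> p x + (vgrad Om (u - z) x *v z x) \<bullet> p x)"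
 proof (rule integral_cong_AE)
  show "AE x in leb Om. (vgrad Om u x *v u x) \<bullet> p x - (vgrad Om z x *v z x) \<bullet> p x - (vgrad Om z x *v (u - z) x) \<bullet> p x
   = (vgrad Om (u - z) x *v (u - z) x) \<bullet> p x + (vgrad Om (u - z) x *v z x) \<bullet> p x"
   using vgrad_diff(2)[OF V_H1[OF u] V_H1[OF z]]
  proof eventually_elim
   case (elim x)
   show ?case unfolding elim
    by (simp add: matrix_vector_mult_diff_distrib matrix_vector_mult_diff_rdistrib inner_diff_left)
  qed
 qed (intro borel_measurable_diff borel_measurable_add borel_measurable_integrable i)+
 also have "\<dots> = b_form Om (u - z) (u - z) p + b_form Om z (u - z) p"
  unfolding b_form_def using i by simp
 finally show ?thesis using b_antisymmetric[OF z w p] by simp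
qed

subsection \<open>The damping term\<close>

lemma powr_le_1_plus_4: "0 <= s ==> s <= 4 ==> 0 <= x ==> x powr s <= 1 + x powr (4::real)"
proof (cases "x <= 1")
 case True
 assume "0 <= s" "0 <= x"
 then have "x powr s <= 1" using True by (simp add: powr_le1)
 then show ?thesis using powr_ge_zero[of x 4] by linarith
next
 case False
 assume "s <= 4"
 then have "x powr s <= x powr 4" using False by (intro powr_mono) auto
 then show ?thesis by simp
qed

text \<open>For exponents up to five the damping term and its derivative grow at most like \<open>1 + norm u powr 4\<close> times a field, which the embedding into \<open>Lp 6\<close> makes integrable against a third field.\<close>

lemma damping_type_pairing:
 assumes u: "u \<in> V_space Om" and p: "p \<in> V_space Om"
  and D: "D \<in> bmeas (leb Om)" "!!x. norm (D x) <= K * (1 + norm (u x) powr 4) * norm (p x)" "0 <= K"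
 shows "v \<in> V_space Om ==> integrable (leb Om) (%x. D x \<bullet> v x)" and "cfun (L2_inner Om D)"
proof -
 let ?K = "K * (Lp_norm 2 Om p * poincare + Lp_norm 6 Om u powr 4 * Lp_norm 6 Om p * C7)"
 have *: "integrable (leb Om) (%x. D x \<bullet> v x) \<and> \<bar>L2_inner Om D v\<bar> <= ?K * V_norm Om v" if v: "v \<in> V_space Om" for v
 proof -
  let ?p = "%x. norm (p x)" and ?v = "%x. norm (v x)"
  have pv: "?p \<in> Lp 2 Om" "?v \<in> Lp 2 Om" using V_L2[OF p] V_L2[OF v] by (auto simp: Lp2_iff)
  have i1: "integrable (leb Om) (%x. norm (p x) * norm (v x))" using L2_integrable_inner[OF pv] by (simp add: mult.commute)
  have b1: "(LINT x|leb Om. norm (p x) * norm (v x)) <= Lp_norm 2 Om p * (poincare * V_norm Om v)"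
  proof -
   have "(LINT x|leb Om. norm (p x) * norm (v x)) <= Lp_norm 2 Om p * Lp_norm 2 Om v"
    using L2.cauchy_schwarz[OF pv] by (simp add: L2_N L2_inner_def Lp2_norm mult.commute)
   also have "\<dots> <= Lp_norm 2 Om p * (poincare * V_norm Om v)"
    by (intro mult_left_mono poincare v Lp_norm_nonneg)
   finally show ?thesis .
  qed
  note H = Lp_Holder3[OF V_L6(1)[OF u] V_L6(1)[OF p] V_L6(1)[OF v], of 4 1 1, simplified]
  have b2: "(LINT x|leb Om. norm (u x) powr 4 * norm (p x) * norm (v x)) <= Lp_norm 6 Om u powr 4 * Lp_norm 6 Om p * (C7 * V_norm Om v)"
  proof -
   have "(LINT x|leb Om. norm (u x) powr 4 * norm (p x) * norm (v x)) <= Lp_norm 6 Om u powr 4 * Lp_norm 6 Om p * Lp_norm 6 Om v"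
    using H(2) by (simp add: Lp_norm_nonneg)
   also have "\<dots> <= Lp_norm 6 Om u powr 4 * Lp_norm 6 Om p * (C7 * V_norm Om v)"
    by (intro mult_left_mono V_L6 v mult_nonneg_nonneg Lp_norm_nonneg) auto
   finally show ?thesis .
  qed
  let ?g = "%x. K * (norm (p x) * norm (v x)) + K * (norm (u x) powr 4 * norm (p x) * norm (v x))"
  have g: "integrable (leb Om) ?g" using i1 H(1) by simp
  have m: "(%x. D x \<bullet> v x) \<in> bmeas (leb Om)"
   by (intro borel_measurable_inner D(1) V_measurable v)
  have bd: "\<bar>D x \<bullet> v x\<bar> <= ?g x" for x
  proof -
   have "\<bar>D x \<bullet> v x\<bar> <= norm (D x) * norm (v x)" by (rule Cauchy_Schwarz_ineq2)
   also have "\<dots> <= K * (1 + norm (u x) powr 4) * norm (p x) * norm (v x)" by (intro mult_right_mono D(2)) auto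
   finally show ?thesis by (simp add: algebra_simps)
  qed
  note I = integrable_dominated[OF g m bd]
  have "\<bar>L2_inner Om D v\<bar> <= (LINT x|leb Om. ?g x)" using I(2) by (simp add: L2_inner_def)
  also have "\<dots> = K * (LINT x|leb Om. norm (p x) * norm (v x)) + K * (LINT x|leb Om. norm (u x) powr 4 * norm (p x) * norm (v x))"
   using i1 H(1) by simp
  also have "\<dots> <= K * (Lp_norm 2 Om p * (poincare * V_norm Om v)) + K * (Lp_norm 6 Om u powr 4 * Lp_norm 6 Om p * (C7 * V_norm Om v))"
   by (intro add_mono mult_left_mono b1 b2 D(3))
  finally show ?thesis using I(1) by (simp add: algebra_simps)
 qed
 show i: "v \<in> V_space Om ==> integrable (leb Om) (%x. D x \<bullet> v x)" for v using * by blast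
 show "cfun (L2_inner Om D)"
 proof (rule cfunI[where K="?K"])
  show "L2_inner Om D (a - c) = L2_inner Om D a - L2_inner Om D c" if "a \<in> V_space Om" "c \<in> V_space Om" for a c
   using i[OF that(1)] i[OF that(2)] by (simp add: L2_inner_def inner_diff_right)
 qed (use * in blast)
qed

lemma damping_pairing:
 assumes u: "u \<in> V_space Om" and r: "1 <= r" "r <= 5"
 shows "v \<in> V_space Om ==> integrable (leb Om) (%x. damping r (u x) \<bullet> v x)"
  and "cfun (L2_inner Om (%x. damping r (u x)))"
proof -
 have [measurable]: "u \<in> bmeas (leb Om)" by (rule V_measurable[OF u])
 have m: "(%x. damping r (u x)) \<in> bmeas (leb Om)" unfolding damping_def by measurable
 have b: "norm (damping r (u x)) <= 1 * (1 + norm (u x) powr 4) * norm (u x)" for x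
  unfolding norm_damping mult_1 using r by (intro mult_right_mono powr_le_1_plus_4) auto
 note P = damping_type_pairing[OF u u m b]
 show "v \<in> V_space Om ==> integrable (leb Om) (%x. damping r (u x) \<bullet> v x)"
  "cfun (L2_inner Om (%x. damping r (u x)))" by (rule P; simp)+
qed

lemma damping_deriv_pairing:
 assumes u: "u \<in> V_space Om" and p: "p \<in> V_space Om" and r: "1 <= r" "r <= 5"
 shows "v \<in> V_space Om ==> integrable (leb Om) (%x. damping_deriv r (u x) (p x) \<bullet> v x)"
  and "cfun (L2_inner Om (%x. damping_deriv r (u x) (p x)))"
proof -
 have [measurable]: "u \<in> bmeas (leb Om)" "p \<in> bmeas (leb Om)"
  by (rule V_measurable[OF u] V_measurable[OF p])+
 have m: "(%x. damping_deriv r (u x) (p x)) \<in> bmeas (leb Om)" unfolding damping_deriv_def by measurable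
 have b: "norm (damping_deriv r (u x) (p x)) <= r * (1 + norm (u x) powr 4) * norm (p x)" for x
 proof (rule order_trans[OF norm_damping_deriv[OF r(1)]], rule mult_right_mono)
  have "norm (u x) powr (r - 1) <= 1 + norm (u x) powr 4" using r by (intro powr_le_1_plus_4) auto
  then have "r * norm (u x) powr (r - 1) <= r * (1 + norm (u x) powr 4)" using r by (intro mult_left_mono) auto
  moreover have "1 * 1 <= r * (1 + norm (u x) powr 4)" using r by (intro mult_mono) auto
  ultimately show "max 1 (r * norm (u x) powr (r - 1)) <= r * (1 + norm (u x) powr 4)" by simp
 qed simp
 note P = damping_type_pairing[OF u p m b]
 show "v \<in> V_space Om ==> integrable (leb Om) (%x. damping_deriv r (u x) (p x) \<bullet> v x)"
  "cfun (L2_inner Om (%x. damping_deriv r (u x) (p x)))" by (rule P; use r in simp)+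
qed

end

section \<open>Weak time derivatives\<close>

lemma borel_measurable_AE_cong_lebesgue_on:
 fixes f g :: "'a::euclidean_space => real"
 assumes S: "S \<in> sets lebesgue" and f: "f \<in> bmeas (leb S)"
  and ae: "AE x in leb S. f x = g x"
 shows "g \<in> bmeas (leb S)"
proof -
 have "(%x. indicator S x *\<^sub>R f x) \<in> bmeas lebesgue"
  using f S borel_measurable_restrict_space_iff[of S lebesgue f] by simp
 moreover have "AE x in lebesgue. indicator S x *\<^sub>R f x = indicator S x *\<^sub>R g x"
  using ae unfolding AE_lebesgue_on[OF S] by eventually_elim (auto simp: indicator_def)
 ultimately have "(%x. indicator S x *\<^sub>R g x) \<in> bmeas lebesgue" by (rule borel_measurable_AE)
 then show ?thesis using S borel_measurable_restrict_space_iff[of S lebesgue g] by simp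
qed

lemma borel_measurable_AE_limit:
 fixes f :: "nat => 'a::euclidean_space => real"
 assumes S: "S \<in> sets lebesgue" and f: "!!n. f n \<in> bmeas (leb S)"
  and ae: "AE x in leb S. (%n. f n x) ----> g x"
 shows "g \<in> bmeas (leb S)"
proof (rule borel_measurable_AE_cong_lebesgue_on[OF S])
 show "(%x. lim (%n. f n x)) \<in> bmeas (leb S)"
  by (rule borel_measurable_lim_metric) (rule f)
 show "AE x in leb S. lim (%n. f n x) = g x"
  using ae by eventually_elim (rule limI)
qed

lemma integrable_lborel_bump: "integrable lborel bump" and integral_lborel_bump: "(LINT x|lborel. bump x) = 1"
proof -
 have "(bump has_integral (step 1 - step (-1))) {-1..1}"
  by (rule fundamental_theorem_of_calculus)
   (auto intro!: has_field_derivative_at_within step_deriv simp: has_real_derivative_iff_has_vector_derivative[symmetric])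
 then have hi: "(bump has_integral 1) {-1..1}" by (simp add: step_left step_right)
 have eq: "(%x. indicator {-1..1} x *\<^sub>R bump x) = bump"
 proof (rule ext)
  fix x show "indicator {-1..1} x *\<^sub>R bump x = bump x"
   by (cases "\<bar>x\<bar> <= 1") (auto simp: indicator_def abs_le_iff bump_zero)
 qed
 have i: "integrable lborel (%x. indicator {-1..1} x *\<^sub>R bump x)"
  by (rule borel_integrable_compact) (auto intro: smooth_continuous smooth_bump)
 show b: "integrable lborel bump" using i unfolding eq .
 have "(bump has_integral (LINT x|lborel. bump x)) UNIV" by (rule has_integral_integral_lborel[OF b])
 moreover have "(bump has_integral 1) UNIV"
  by (rule has_integral_on_superset[OF hi]) (auto intro!: bump_zero simp: abs_le_iff)
 ultimately show "(LINT x|lborel. bump x) = 1" by (rule has_integral_unique)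
qed

text \<open>The shift by \<open>-1\<close> and the sign \<open>\<sigma>\<close> place the kernel on the right or on the left of \<open>s\<close>, so that the smoothed indicator whose derivative it is remains inside the interval.\<close>

lemma bump_delta_sequence:
 fixes g :: "real => real"
 assumes g[measurable]: "g \<in> bmeas borel" and B: "!!x. \<bar>g x\<bar> <= B" and c: "isCont g s" and \<sigma>: "\<bar>\<sigma>\<bar> = 1"
 shows "(%n. LINT \<tau>|lborel. g \<tau> * (real (Suc n) * bump (\<sigma> * (real (Suc n) * (\<tau> - s)) - 1))) ----> g s"
proof -
 have [measurable]: "bump \<in> bmeas borel" by (rule smooth_borel[OF smooth_bump])
 have \<sigma>2: "\<sigma> * \<sigma> = 1" using \<sigma> by (metis abs_mult_self_eq mult_1)
 have eq: "(LINT \<tau>|lborel. g \<tau> * (real (Suc n) * bump (\<sigma> * (real (Suc n) * (\<tau> - s)) - 1)))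
   = (LINT x|lborel. g (s + \<sigma> / real (Suc n) + \<sigma> / real (Suc n) * x) * bump x)" for n
 proof -
  let ?k = "real (Suc n)"
  have "?k > 0" by simp
  have "(LINT \<tau>|lborel. g \<tau> * (?k * bump (\<sigma> * (?k * (\<tau> - s)) - 1)))
   = \<bar>\<sigma> / ?k\<bar> *\<^sub>R (LINT x|lborel. g ((s + \<sigma> / ?k) + \<sigma> / ?k * x) * (?k * bump (\<sigma> * (?k * (((s + \<sigma> / ?k) + \<sigma> / ?k * x) - s)) - 1)))"
   by (rule lborel_integral_real_affine) (use \<sigma> in auto)
  moreover have "\<sigma> * (?k * (((s + \<sigma> / ?k) + \<sigma> / ?k * x) - s)) - 1 = x" for x
  proof -
   have "?k * (((s + \<sigma> / ?k) + \<sigma> / ?k * x) - s) = \<sigma> * (1 + x)"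
    using \<open>?k > 0\<close> by (simp add: field_simps del: of_nat_Suc)
   then show ?thesis by (simp add: mult.assoc[symmetric] \<sigma>2)
  qed
  ultimately show ?thesis using \<open>?k > 0\<close> \<sigma> by (simp add: mult.left_commute del: of_nat_Suc)
 qed
 have "(%n. LINT x|lborel. g (s + \<sigma> / real (Suc n) + \<sigma> / real (Suc n) * x) * bump x) ----> (LINT x|lborel. g s * bump x)"
 proof (rule integral_dominated_convergence[where w="%x. B * bump x"])
  show "integrable lborel (%x. B * bump x)" using integrable_lborel_bump by simp
  show "AE x in lborel. (%n. g (s + \<sigma> / real (Suc n) + \<sigma> / real (Suc n) * x) * bump x) ----> g s * bump x"
  proof (intro always_eventually allI tendsto_mult tendsto_const)
   fix x
   have z: "(%n. \<sigma> / real (Suc n)) ----> 0"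
    using tendsto_mult[OF tendsto_const[of \<sigma>] LIMSEQ_inverse_real_of_nat] by (simp add: divide_inverse)
   have "(%n. s + \<sigma> / real (Suc n) + \<sigma> / real (Suc n) * x) ----> s + 0 + 0 * x"
    by (intro tendsto_intros z)
   then show "(%n. g (s + \<sigma> / real (Suc n) + \<sigma> / real (Suc n) * x)) ----> g s"
    using isCont_tendsto_compose[OF c] by simp
  qed
  show "AE x in lborel. norm (g (s + \<sigma> / real (Suc n) + \<sigma> / real (Suc n) * x) * bump x) <= B * bump x" for n
   by (intro always_eventually allI) (simp add: abs_mult bump_nonneg mult_right_mono B)
 qed measurable
 then show ?thesis unfolding eq using integral_lborel_bump by simp
qed

lemma finite_time_measure: "finite_measure (tmeas T)"
 by (intro finite_measure_lebesgue_on) auto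

lemma borel_time_measurable: "f \<in> bmeas borel ==> f \<in> bmeas (tmeas T)"
 by (rule borel_imp_lebesgue_on)

lemma continuous_indicator_borel:
 fixes f :: "real => real"
 assumes "continuous_on {0..T} f"
 shows "(%t. indicator {0..T} t * f t) \<in> bmeas borel"
 using borel_measurable_continuous_on_indicator[OF _ assms] by simp

text \<open>A weak derivative is tested with smoothed indicators of \<open>{s<..<t}\<close>, whose derivatives
 are approximate point evaluations.\<close>

lemma weak_derivative_interior:
 fixes f f' :: "real => real"
 assumes c: "continuous_on {0..T} f" and i: "integrable (tmeas T) f'"
  and w: "!!\<psi>. test_fun {0<..<T} \<psi> ==> (LINT \<tau>|tmeas T. f \<tau> * deriv \<psi> \<tau>) = - (LINT \<tau>|tmeas T. f' \<tau> * \<psi> \<tau>)"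
  and st: "0 < s" "s < t" "t < T"
 shows "f t - f s = (LINT \<tau>|tmeas T. indicator {s<..<t} \<tau> * f' \<tau>)"
proof -
 let ?M = "tmeas T"
 let ?d = "%n \<sigma> a \<tau>. real (Suc n) * bump (\<sigma> * (real (Suc n) * (\<tau> - a)) - 1)"
 have S: "{0..T} \<in> sets lebesgue" by simp
 define \<psi> where "\<psi> n \<tau> = step (real (Suc n) * (\<tau> - s) - 1) * step (real (Suc n) * (t - \<tau>) - 1)" for n \<tau>
 have supp: "\<psi> n \<tau> = 0" if "\<tau> \<notin> {s<..<t}" for n \<tau>
 proof -
  have "real (Suc n) * (\<tau> - s) <= 0 \<or> real (Suc n) * (t - \<tau>) <= 0"
   using that by (auto simp: mult_le_0_iff not_less)
  then show ?thesis by (auto simp: \<psi>_def step_left)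
 qed
 have sm: "smooth (\<psi> n)" for n
 proof -
  have "smooth (%\<tau>. step ((- real (Suc n) * s - 1) + real (Suc n) * \<tau>) * step ((real (Suc n) * t - 1) + (- real (Suc n)) * \<tau>))"
   by (intro smooth_mult smooth_affine1 smooth_step)
  moreover have "(%\<tau>. step ((- real (Suc n) * s - 1) + real (Suc n) * \<tau>) * step ((real (Suc n) * t - 1) + (- real (Suc n)) * \<tau>)) = \<psi> n"
   by (rule ext) (simp add: \<psi>_def algebra_simps)
  ultimately show ?thesis by simp
 qed
 have tf: "test_fun {0<..<T} (\<psi> n)" for n
  by (rule test_funI[OF sm, of "{s..t}"]) (use supp st in auto)
 have lim: "(%n. \<psi> n \<tau>) ----> indicator {s<..<t} \<tau>" for \<tau>
 proof (cases "\<tau> \<in> {s<..<t}")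
  case True
  have "(%n. step (real (Suc n) * d - 1)) ----> 1" if "d > 0" for d
  proof -
   obtain N :: nat where "2 / d < real N" using reals_Archimedean2 by blast
   then have "2 < real N * d" using that by (simp add: field_simps)
   moreover have "real N * d <= real (Suc k) * d" if "N <= k" for k using that \<open>d > 0\<close> by simp
   ultimately have "\<forall>k\<ge>N. step (real (Suc k) * d - 1) = 1" by (force intro: step_right)
   then show ?thesis by (intro tendsto_eventually) (auto simp: eventually_sequentially)
  qed
  then have "(%n. \<psi> n \<tau>) ----> 1 * 1"
   unfolding \<psi>_def using True by (intro tendsto_mult) auto
  then show ?thesis using True by simp
 qed (use supp in simp)
 have R: "(%n. LINT \<tau>|?M. f' \<tau> * \<psi> n \<tau>) ----> (LINT \<tau>|?M. f' \<tau> * indicator {s<..<t} \<tau>)"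
 proof (rule integral_dominated_convergence[where w="%\<tau>. norm (f' \<tau>)"])
  have [measurable]: "f' \<in> bmeas (?M)" using i by auto
  have [measurable]: "\<psi> n \<in> bmeas (?M)" for n
   by (rule borel_time_measurable[OF smooth_borel[OF sm]])
  have [measurable]: "(indicator {s<..<t} :: real => real) \<in> bmeas (?M)"
   by (rule borel_time_measurable) simp
  show "(%\<tau>. f' \<tau> * indicator {s<..<t} \<tau>) \<in> bmeas (?M)" by measurable
  show "(%\<tau>. f' \<tau> * \<psi> n \<tau>) \<in> bmeas (?M)" for n by measurable
  show "AE \<tau> in ?M. (%n. f' \<tau> * \<psi> n \<tau>) ----> f' \<tau> * indicator {s<..<t} \<tau>"
   by (intro always_eventually allI tendsto_mult tendsto_const lim)
  have "\<bar>\<psi> n \<tau>\<bar> <= 1" for n \<tau>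
   using step_bounds by (auto simp: \<psi>_def abs_mult intro!: mult_le_one)
  then show "AE \<tau> in ?M. norm (f' \<tau> * \<psi> n \<tau>) <= norm (f' \<tau>)" for n
   by (intro always_eventually allI) (simp add: abs_mult mult_left_le)
 qed (use i in auto)
 define g where "g \<tau> = indicator {0..T} \<tau> * f \<tau>" for \<tau>
 have g[measurable]: "g \<in> bmeas borel" unfolding g_def by (rule continuous_indicator_borel[OF c])
 obtain B where B: "!!\<tau>. \<bar>g \<tau>\<bar> <= B"
 proof -
  have "compact (f ` {0..T})" by (intro compact_continuous_image c) auto
  then obtain B where "0 < B" "!!\<tau>. \<tau> \<in> {0..T} ==> norm (f \<tau>) <= B"
   using compact_imp_bounded bounded_pos by (metis imageI)
  then show ?thesis by (intro that[of B]) (auto simp: g_def indicator_def)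
 qed
 have gc: "isCont g \<tau>" if "0 < \<tau>" "\<tau> < T" for \<tau>
 proof -
  have "isCont f \<tau>" using continuous_on_interior[OF c, of \<tau>] that by simp
  moreover have "\<forall>\<^sub>F x in nhds \<tau>. g x = f x"
   unfolding eventually_nhds using that by (intro exI[of _ "{0<..<T}"]) (auto simp: g_def)
  ultimately show ?thesis using isCont_cong by blast
 qed
 have d: "(\<psi> n has_real_derivative (?d n 1 s \<tau>) * step (real (Suc n) * (t - \<tau>) - 1)
   - step (real (Suc n) * (\<tau> - s) - 1) * (?d n (-1) t \<tau>)) (at \<tau>)" for n \<tau>
  unfolding \<psi>_def
  by (rule derivative_eq_intros DERIV_chain2[OF step_deriv] refl)+ (simp add: algebra_simps)
 obtain N :: nat where N: "4 / (t - s) < real N" using reals_Archimedean2 by blast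
 have dN: "deriv (\<psi> n) \<tau> = ?d n 1 s \<tau> - ?d n (-1) t \<tau>"
  if "N <= n" for n \<tau>
 proof -
  let ?k = "real (Suc n)"
  have k: "4 < ?k * (t - s)"
  proof -
   have "4 < real N * (t - s)" using N st by (simp add: field_simps)
   also have "\<dots> <= ?k * (t - s)" using that st by (intro mult_right_mono) auto
   finally show ?thesis .
  qed
  have sum: "?k * (\<tau> - s) + ?k * (t - \<tau>) = ?k * (t - s)" by (simp add: algebra_simps)
  have 1: "bump (1 * (?k * (\<tau> - s)) - 1) * step (?k * (t - \<tau>) - 1) = bump (1 * (?k * (\<tau> - s)) - 1)"
  proof (cases "?k * (\<tau> - s) <= 2")
   case True
   then have "1 <= ?k * (t - \<tau>) - 1" using k sum by linarith
   then show ?thesis by (simp add: step_right)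
  next
   case False
   then have "bump (1 * (?k * (\<tau> - s)) - 1) = 0" by (intro bump_zero) linarith
   then show ?thesis by simp
  qed
  have 2: "step (?k * (\<tau> - s) - 1) * bump (-1 * (?k * (\<tau> - t)) - 1) = bump (-1 * (?k * (\<tau> - t)) - 1)"
  proof (cases "?k * (t - \<tau>) <= 2")
   case True
   then have "1 <= ?k * (\<tau> - s) - 1" using k sum by linarith
   then show ?thesis by (simp add: step_right)
  next
   case False
   then have "bump (-1 * (?k * (\<tau> - t)) - 1) = 0" by (intro bump_zero) (simp add: algebra_simps)
   then show ?thesis by simp
  qed
  have "deriv (\<psi> n) \<tau> = ?k * (bump (1 * (?k * (\<tau> - s)) - 1) * step (?k * (t - \<tau>) - 1))
   - ?k * (step (?k * (\<tau> - s) - 1) * bump (-1 * (?k * (\<tau> - t)) - 1))"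
   using DERIV_imp_deriv[OF d[of n \<tau>]] by (simp only: mult_ac)
  then show ?thesis unfolding 1 2 .
 qed
 have bm[measurable]: "bump \<in> bmeas borel" by (rule smooth_borel[OF smooth_bump])
 have L: "(%n. LINT \<tau>|?M. f \<tau> * deriv (\<psi> n) \<tau>) ----> g s - g t"
 proof (rule Lim_transform_eventually)
  show "(%n. (LINT \<tau>|lborel. g \<tau> * (?d n 1 s \<tau>))
   - (LINT \<tau>|lborel. g \<tau> * (?d n (-1) t \<tau>))) ----> g s - g t"
   by (intro tendsto_diff bump_delta_sequence[OF g B gc]) (use st in auto)
  have ii: "integrable lborel (%\<tau>. g \<tau> * (?d n \<sigma> a \<tau>))" if "\<bar>\<sigma>\<bar> = 1" for n \<sigma> a
  proof (rule integrable_dominated(1)[where g="%\<tau>. B * (?d n \<sigma> a \<tau>)"])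
   have "integrable lborel (%x. bump ((- \<sigma> * real (Suc n) * a - 1) + (\<sigma> * real (Suc n)) * x))"
    by (rule lborel_integrable_real_affine[OF integrable_lborel_bump]) (use that in auto)
   then have "integrable lborel (%\<tau>. bump (\<sigma> * (real (Suc n) * (\<tau> - a)) - 1))"
    by (simp add: algebra_simps)
   then show "integrable lborel (%\<tau>. B * (?d n \<sigma> a \<tau>))" by simp
   show "(%\<tau>. g \<tau> * (?d n \<sigma> a \<tau>)) \<in> bmeas lborel" by measurable
   show "\<bar>g \<tau> * (?d n \<sigma> a \<tau>)\<bar> <= B * (?d n \<sigma> a \<tau>)" for \<tau>
    using B[of \<tau>] by (simp add: abs_mult bump_nonneg mult_right_mono)
  qed
  have "(LINT \<tau>|lborel. g \<tau> * (?d n 1 s \<tau>))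
   - (LINT \<tau>|lborel. g \<tau> * (?d n (-1) t \<tau>))
   = (LINT \<tau>|?M. f \<tau> * deriv (\<psi> n) \<tau>)" if "N <= n" for n
  proof -
   let ?h = "%\<tau>. ?d n 1 s \<tau> - ?d n (-1) t \<tau>"
   have "(LINT \<tau>|lborel. g \<tau> * (?d n 1 s \<tau>))
   - (LINT \<tau>|lborel. g \<tau> * (?d n (-1) t \<tau>)) = (LINT \<tau>|lborel. g \<tau> * ?h \<tau>)"
    using ii[of 1 n s] ii[of "-1" n t] unfolding right_diff_distrib
    by (subst Bochner_Integration.integral_diff) auto
   also have "\<dots> = (LINT \<tau>|?M. g \<tau> * ?h \<tau>)"
    by (rule LINT_lebesgue_on_support(1)[OF S, symmetric], measurable) (auto simp: g_def)
   also have "\<dots> = (LINT \<tau>|?M. f \<tau> * deriv (\<psi> n) \<tau>)"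
    by (rule Bochner_Integration.integral_cong) (auto simp: g_def dN[OF that])
   finally show ?thesis .
  qed
  then show "\<forall>\<^sub>F n in sequentially. (LINT \<tau>|lborel. g \<tau> * (?d n 1 s \<tau>))
   - (LINT \<tau>|lborel. g \<tau> * (?d n (-1) t \<tau>))
   = (LINT \<tau>|?M. f \<tau> * deriv (\<psi> n) \<tau>)"
   unfolding eventually_sequentially by blast
 qed
 have "(%n. LINT \<tau>|?M. f \<tau> * deriv (\<psi> n) \<tau>) ----> - (LINT \<tau>|?M. f' \<tau> * indicator {s<..<t} \<tau>)"
  unfolding w[OF tf] by (rule tendsto_minus[OF R])
 from LIMSEQ_unique[OF L this] show ?thesis using st by (simp add: g_def mult.commute)
qed

lemma indicator_time_measurable: "(indicator A :: real => real) \<in> bmeas (tmeas T)" if "A \<in> sets borel"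
 using that by (intro borel_time_measurable) simp

lemma weak_derivative_FTC:
 fixes f f' :: "real => real"
 assumes c: "continuous_on {0..T} f" and i: "integrable (tmeas T) f'"
  and w: "!!\<psi>. test_fun {0<..<T} \<psi> ==> (LINT \<tau>|tmeas T. f \<tau> * deriv \<psi> \<tau>) = - (LINT \<tau>|tmeas T. f' \<tau> * \<psi> \<tau>)"
  and st: "0 <= s" "s <= t" "t <= T"
 shows "f t - f s = (LINT \<tau>|tmeas T. indicator {s<..<t} \<tau> * f' \<tau>)"
proof (cases "s = t")
 case False
 then have lt: "s < t" using st by simp
 define d where "d n = (t - s) / real (n + 3)" for n
 have d: "0 < d n" "d n < (t - s) / 2" for n
  using lt unfolding d_def by (simp, intro divide_strict_left_mono) auto
 have d0: "d ----> 0" unfolding d_def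
  by (rule tendsto_divide_0[OF tendsto_const]) 
   (intro filterlim_at_top_imp_at_infinity filterlim_compose[OF filterlim_real_sequentially] filterlim_add_const_nat_at_top)
 have eq: "f (t - d n) - f (s + d n) = (LINT \<tau>|tmeas T. indicator {s + d n<..<t - d n} \<tau> * f' \<tau>)" for n
  by (rule weak_derivative_interior[OF c i w]) (use d[of n] st in auto)
 have "(%n. f (t - d n) - f (s + d n)) ----> f (t - 0) - f (s + 0)"
 proof (intro tendsto_diff)
  have in': "t - d n \<in> {0..T}" "s + d n \<in> {0..T}" for n
   using d[of n] st lt by auto
  show "(%n. f (t - d n)) ----> f (t - 0)"
  proof (rule continuous_on_tendsto_compose[OF c])
   show "(%n. t - d n) ----> t - 0" by (intro tendsto_diff tendsto_const d0)
  qed (use in' st in auto)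
  show "(%n. f (s + d n)) ----> f (s + 0)"
  proof (rule continuous_on_tendsto_compose[OF c])
   show "(%n. s + d n) ----> s + 0" by (intro tendsto_add tendsto_const d0)
  qed (use in' st in auto)
 qed
 moreover have "(%n. LINT \<tau>|tmeas T. indicator {s + d n<..<t - d n} \<tau> * f' \<tau>) ----> (LINT \<tau>|tmeas T. indicator {s<..<t} \<tau> * f' \<tau>)"
 proof (rule integral_dominated_convergence[where w="%\<tau>. norm (f' \<tau>)"])
  have [measurable]: "f' \<in> bmeas (tmeas T)" using i by auto
  show "(%\<tau>. indicator {s<..<t} \<tau> * f' \<tau>) \<in> bmeas (tmeas T)"
   by (intro borel_measurable_times indicator_time_measurable) auto
  show "(%\<tau>. indicator {s + d n<..<t - d n} \<tau> * f' \<tau>) \<in> bmeas (tmeas T)" for n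
   by (intro borel_measurable_times indicator_time_measurable) auto
  show "AE \<tau> in tmeas T. norm (indicator {s + d n<..<t - d n} \<tau> * f' \<tau>) <= norm (f' \<tau>)" for n
   by (intro always_eventually allI) (simp add: indicator_def)
  show "AE \<tau> in tmeas T. (%n. indicator {s + d n<..<t - d n} \<tau> * f' \<tau>) ----> indicator {s<..<t} \<tau> * f' \<tau>"
  proof (intro always_eventually allI tendsto_mult tendsto_const)
   fix \<tau>
   show "(%n. indicator {s + d n<..<t - d n} \<tau> :: real) ----> indicator {s<..<t} \<tau>"
   proof (cases "\<tau> \<in> {s<..<t}")
    case True
    then have "0 < min (\<tau> - s) (t - \<tau>)" by simp
    then have "\<forall>\<^sub>F n in sequentially. d n < min (\<tau> - s) (t - \<tau>)" using order_tendstoD(2)[OF d0] by blast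
    then have "\<forall>\<^sub>F n in sequentially. indicator {s + d n<..<t - d n} \<tau> = (1::real)"
     by eventually_elim (auto simp: indicator_def)
    then show ?thesis using True by (simp add: tendsto_eventually)
   next
    case False
    have "indicator {s + d n<..<t - d n} \<tau> = (0::real)" for n
     using False d(1)[of n] by (auto simp: indicator_def)
    then show ?thesis using False by simp
   qed
  qed
 qed (use i in auto)
 ultimately show ?thesis unfolding eq using LIMSEQ_unique by fastforce
qed simp

section \<open>Calculus for functions of time with values in a semi-inner product space\<close>

definition simple_time :: "field set => real => (real => field) => bool" where
 "simple_time X T s \<longleftrightarrow> finite (range s) \<and> range s \<subseteq> X \<and> (\<forall>w. {t \<in> {0..T}. s t = w} \<in> sets lebesgue)"

lemma simple_time_indicator_measurable:
 assumes "simple_time X T s"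
 shows "(%t. indicator {w} (s t) :: real) \<in> bmeas (tmeas T)"
proof -
 have "{t \<in> {0..T}. s t = w} \<in> sets (tmeas T)"
  using assms unfolding simple_time_def by (subst sets_restrict_space_iff) auto
 then have "(indicator {t \<in> {0..T}. s t = w} :: real => real) \<in> bmeas (tmeas T)" by simp
 then show ?thesis
  by (rule measurable_cong[THEN iffD1, rotated]) (auto simp: indicator_def)
qed

lemma simple_time_expand:
 assumes "simple_time X T s"
 shows "(F (s t) :: real) = (\<Sum>w\<in>range s. F w * indicator {w} (s t))"
proof -
 have "(\<Sum>w\<in>range s. F w * indicator {w} (s t)) = (\<Sum>w\<in>{s t}. F w * indicator {w} (s t))"
  by (rule sum.mono_neutral_right) (use assms in \<open>auto simp: simple_time_def indicator_def\<close>)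
 then show ?thesis by simp
qed

lemma simple_time_measurable:
 assumes "simple_time X T s"
 shows "(%t. F (s t) :: real) \<in> bmeas (tmeas T)"
 by (subst simple_time_expand[OF assms])
  (intro borel_measurable_sum borel_measurable_times simple_time_indicator_measurable[OF assms] borel_measurable_const)

lemma simple_time_expand2:
 assumes "simple_time X T s" "simple_time Y T r"
 shows "(F (s t) (r \<tau>) :: real) = (\<Sum>w\<in>range s. \<Sum>v\<in>range r. F w v * indicator {w} (s t) * indicator {v} (r \<tau>))"
proof -
 have "F (s t) (r \<tau>) = (\<Sum>w\<in>range s. F w (r \<tau>) * indicator {w} (s t))" by (rule simple_time_expand[OF assms(1)])
 also have "\<dots> = (\<Sum>w\<in>range s. (\<Sum>v\<in>range r. F w v * indicator {v} (r \<tau>)) * indicator {w} (s t))"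
  by (subst simple_time_expand[OF assms(2), of "F _" \<tau>]) simp
 finally show ?thesis by (simp add: sum_distrib_left mult_ac)
qed

lemma simple_time_mem: "simple_time X T s ==> s t \<in> X"
 unfolding simple_time_def by (metis range_subsetD)

lemma strongly_measurableE:
 assumes "strongly_measurable X N T u"
 obtains s where "!!n. simple_time X T (s n)" "AE t in tmeas T. (%n. N (u t - s n t)) ----> 0"
 using assms unfolding strongly_measurable_def simple_time_def by blast

locale bounded_form = pre_inner X B for X :: "field set" and B +
 fixes A :: "field => field => real" and c :: real
 assumes A_add: "f \<in> X ==> g \<in> X ==> h \<in> X ==> A (%x. f x + g x) h = A f h + A g h"
  and A_scale: "f \<in> X ==> h \<in> X ==> A (%x. k *\<^sub>R f x) h = k * A f h"
  and A_sym: "f \<in> X ==> g \<in> X ==> A f g = A g f"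
  and A_bound: "f \<in> X ==> g \<in> X ==> \<bar>A f g\<bar> <= c * N f * N g"
  and c_nonneg: "0 <= c"
begin

lemma A_diff: assumes "f \<in> X" "g \<in> X" "h \<in> X" shows "A (f - g) h = A f h - A g h"
 unfolding diff_eq using A_add[OF assms(1) scale_mem[OF assms(2), of "-1"] assms(3)] A_scale[OF assms(2,3), of "-1"] by simp

lemma A_diff_right: assumes "f \<in> X" "g \<in> X" "h \<in> X" shows "A h (f - g) = A h f - A h g"
 using A_diff[OF assms] A_sym[OF assms(3) diff_mem[OF assms(1,2)]] A_sym[OF assms(3,1)] A_sym[OF assms(3,2)] by simp

text \<open>The norm of \<open>r\<close> is estimated through that of \<open>v\<close>, since in the applications only the limits are bounded.\<close>

lemma A_near:
 assumes "u \<in> X" "v \<in> X" "s \<in> X" "r \<in> X"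
 shows "\<bar>A s r - A u v\<bar> <= c * N (u - s) * (N v + N (v - r)) + c * N u * N (v - r)"
proof -
 have "A s r - A u v = - A (u - s) r - A u (v - r)"
  using assms by (simp add: A_diff A_diff_right)
 moreover have "\<bar>A (u - s) r\<bar> <= c * N (u - s) * N r" by (intro A_bound diff_mem assms)
 moreover have "N r <= N v + N (v - r)" using N_bound[OF assms(4,2)] N_minus[OF assms(2,4)] by linarith
 then have "c * N (u - s) * N r <= c * N (u - s) * (N v + N (v - r))"
  by (intro mult_left_mono mult_nonneg_nonneg c_nonneg N_nonneg diff_mem assms)
 moreover have "\<bar>A u (v - r)\<bar> <= c * N u * N (v - r)" by (intro A_bound diff_mem assms)
 ultimately show ?thesis by linarith
qed

lemma A_tendsto:
 assumes "u \<in> X" "v \<in> X" "!!n. s n \<in> X" "!!n. r n \<in> X" "(%n. N (u - s n)) ----> 0" "(%n. N (v - r n)) ----> 0"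
 shows "(%n. A (s n) (r n)) ----> A u v"
proof (rule LIM_zero_cancel, rule Lim_null_comparison)
 show "\<forall>\<^sub>F n in sequentially. norm (A (s n) (r n) - A u v) <= c * N (u - s n) * (N v + N (v - r n)) + c * N u * N (v - r n)"
  using A_near[OF assms(1,2) assms(3,4)] by simp
 have "(%n. c * N (u - s n) * (N v + N (v - r n)) + c * N u * N (v - r n)) ----> c * 0 * (N v + 0) + c * N u * 0"
  by (intro tendsto_intros assms)
 then show "(%n. c * N (u - s n) * (N v + N (v - r n)) + c * N u * N (v - r n)) ----> 0" by simp
qed

lemma A_zero_left: assumes "f \<in> X" "h \<in> X" "N f = 0" shows "A f h = 0"
 using A_bound[OF assms(1,2)] assms(3) by simp

end

lemma (in bounded_form) L2_time_measurable:
 assumes u: "u \<in> L2_time X N T" and v: "v \<in> L2_time X N T"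
 shows "(%t. A (u t) (v t)) \<in> bmeas (tmeas T)"
proof -
 obtain s where s: "!!n. simple_time X T (s n)" "AE t in tmeas T. (%n. N (u t - s n t)) ----> 0"
  using u strongly_measurableE unfolding L2_time_def by blast
 obtain r where r: "!!n. simple_time X T (r n)" "AE t in tmeas T. (%n. N (v t - r n t)) ----> 0"
  using v strongly_measurableE unfolding L2_time_def by blast
 have X: "s n t \<in> X" "r n t \<in> X" for n t using simple_time_mem[OF s(1)] simple_time_mem[OF r(1)] by auto
 have ae: "AE t in tmeas T. u t \<in> X" "AE t in tmeas T. v t \<in> X" using u v by (auto simp: L2_time_def)
 show ?thesis
 proof (rule borel_measurable_AE_limit)
  show "(%t. A (s n t) (r n t)) \<in> bmeas (tmeas T)" for n
   unfolding simple_time_expand2[OF s(1) r(1)]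
   by (intro borel_measurable_sum borel_measurable_times simple_time_indicator_measurable[OF s(1)]
     simple_time_indicator_measurable[OF r(1)] borel_measurable_const)
  show "AE t in tmeas T. (%n. A (s n t) (r n t)) ----> A (u t) (v t)"
   using s(2) r(2) ae by eventually_elim (rule A_tendsto; (rule X)?)
 qed simp
qed

lemma (in bounded_form) L2_time_integrable:
 assumes u: "u \<in> L2_time X N T" and v: "v \<in> L2_time X N T"
 shows "integrable (tmeas T) (%t. A (u t) (v t))"
proof (rule Bochner_Integration.integrable_bound)
 show "integrable (tmeas T) (%t. c * ((N (u t))\<^sup>2 + (N (v t))\<^sup>2))"
  using u v by (auto simp: L2_time_def)
 show "(%t. A (u t) (v t)) \<in> bmeas (tmeas T)" by (rule L2_time_measurable[OF u v])
 have ae: "AE t in tmeas T. u t \<in> X" "AE t in tmeas T. v t \<in> X" using u v by (auto simp: L2_time_def)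
 then show "AE t in tmeas T. norm (A (u t) (v t)) <= norm (c * ((N (u t))\<^sup>2 + (N (v t))\<^sup>2))"
 proof eventually_elim
  case (elim t)
  have "\<bar>A (u t) (v t)\<bar> <= c * (N (u t) * N (v t))" using A_bound[OF elim] by (simp add: mult.assoc)
  also have "N (u t) * N (v t) <= (N (u t))\<^sup>2 + (N (v t))\<^sup>2"
   using sum_squares_bound[of "N (u t)" "N (v t)"] mult_nonneg_nonneg[OF N_nonneg[OF elim(1)] N_nonneg[OF elim(2)]] by linarith
  finally show ?case using c_nonneg by (simp add: mult_left_mono)
 qed
qed

lemma simple_time_restrict:
 assumes s: "simple_time X T s" and Z: "(%x. 0) \<in> X" and G: "{t \<in> {0..T}. t \<in> G} \<in> sets lebesgue"
 shows "simple_time X T (%t. if t \<in> G then s t else (%x. 0))"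
 unfolding simple_time_def
proof (intro conjI allI)
 let ?s = "%t. if t \<in> G then s t else (%x. 0)"
 have sub: "range ?s \<subseteq> insert (%x. 0) (range s)" by auto
 show "finite (range ?s)" by (rule finite_subset[OF sub]) (use s in \<open>simp add: simple_time_def\<close>)
 show "range ?s \<subseteq> X" using sub s Z by (auto simp: simple_time_def)
 fix w
 have "{t \<in> {0..T}. s t = w} \<in> sets lebesgue" using s by (simp add: simple_time_def)
 moreover have "{t \<in> {0..T}. ?s t = w} = ({t \<in> {0..T}. t \<in> G} \<inter> {t \<in> {0..T}. s t = w}) \<union> (if w = (%x. 0) then {0..T} - {t \<in> {0..T}. t \<in> G} else {})"
  by auto
 moreover have "{0..T} - {t \<in> {0..T}. t \<in> G} \<in> sets lebesgue" by (rule sets.Diff[OF _ G]) simp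
 then have "(if w = (%x. 0) then {0..T} - {t \<in> {0..T}. t \<in> G} else {}) \<in> sets lebesgue"
  by (cases "w = (%x. 0)") (simp_all only: simp_thms if_True if_False sets.empty_sets)
 ultimately show "{t \<in> {0..T}. ?s t = w} \<in> sets lebesgue"
  by (simp only: sets.Un sets.Int G)
qed

lemma simple_time_diff:
 assumes s: "simple_time X T s" and r: "simple_time X T r" and X: "!!f g. f \<in> X ==> g \<in> X ==> f - g \<in> X"
 shows "simple_time X T (%t. s t - r t)"
 unfolding simple_time_def
proof (intro conjI allI)
 let ?d = "%t. s t - r t"
 have sub: "range ?d \<subseteq> (%(a, b). a - b) ` (range s \<times> range r)" by force
 have fin: "finite (range s)" "finite (range r)" using s r by (auto simp: simple_time_def)
 show "finite (range ?d)" by (rule finite_subset[OF sub]) (use fin in auto)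
 show "range ?d \<subseteq> X" using simple_time_mem[OF s] simple_time_mem[OF r] X by auto
 fix w
 have "{t \<in> {0..T}. ?d t = w} = (\<Union>a\<in>range s. \<Union>b\<in>{b \<in> range r. a - b = w}. {t \<in> {0..T}. s t = a} \<inter> {t \<in> {0..T}. r t = b})"
  (is "?L = ?R")
 proof (rule set_eqI, rule iffI)
  fix t assume "t \<in> ?L"
  then show "t \<in> ?R" by (intro UN_I[of "s t"] UN_I[of "r t"]) simp_all
 next
  fix t assume "t \<in> ?R"
  then obtain a b where "a - b = w" "s t = a" "r t = b" "t \<in> {0..T}" unfolding UN_iff by fast
  then show "t \<in> ?L" by simp
 qed
 also have "\<dots> \<in> sets lebesgue"
 proof (intro sets.finite_UN sets.Int)
  show "{t \<in> {0..T}. s t = a} \<in> sets lebesgue" "{t \<in> {0..T}. r t = a} \<in> sets lebesgue" for a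
   using s r by (simp_all add: simple_time_def)
 qed (use fin in simp_all)
 finally show "{t \<in> {0..T}. ?d t = w} \<in> sets lebesgue" .
qed

locale pre_inner_field = pre_inner X B for X :: "field set" and B
begin

lemma N_zero: "N (%x. 0) = 0" by (simp add: N_def B_zero zero_mem)

sublocale self: bounded_form X B B 1
 by unfold_locales (auto simp: B_add B_scale cauchy_schwarz intro: B_sym)

lemma N_measurable: assumes "u \<in> L2_time X N T" shows "(%t. N (u t)) \<in> bmeas (tmeas T)"
 unfolding N_def by (rule measurable_compose[OF self.L2_time_measurable[OF assms assms] borel_measurable_sqrt])

lemma simple_time_L2: assumes "simple_time X T s" shows "s \<in> L2_time X N T"
 unfolding L2_time_def
proof (intro CollectI conjI)
 have m: "s t \<in> X" for t by (rule simple_time_mem[OF assms])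
 show "AE t in tmeas T. s t \<in> X" using m by simp
 have "s t - s t = (%x. 0)" for t by (rule ext) simp
 then show "strongly_measurable X N T s"
  unfolding strongly_measurable_def using assms by (intro exI[of _ "%n. s"]) (auto simp: simple_time_def N_zero)
 show "integrable (tmeas T) (%t. (N (s t))\<^sup>2)"
 proof (rule finite_measure.integrable_const_bound[OF finite_time_measure])
  show "AE t in tmeas T. norm ((N (s t))\<^sup>2) <= (\<Sum>w\<in>range s. (N w)\<^sup>2)"
   using assms by (intro always_eventually allI) (auto simp: simple_time_def intro!: member_le_sum[where f="%w. (N w)\<^sup>2"])
  show "(%t. (N (s t))\<^sup>2) \<in> bmeas (tmeas T)" by (rule simple_time_measurable[OF assms])
 qed
qed

lemma const_L2_time: "g \<in> X ==> (%t. g) \<in> L2_time X N T"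
 by (rule simple_time_L2) (auto simp: simple_time_def)

lemma L2_time_N_integrable:
 assumes "u \<in> L2_time X N T" shows "integrable (tmeas T) (%t. N (u t))"
proof (rule Bochner_Integration.integrable_bound)
 show "integrable (tmeas T) (%t. 1 + (N (u t))\<^sup>2)"
  by (intro Bochner_Integration.integrable_add finite_measure.integrable_const[OF finite_time_measure])
   (use assms in \<open>simp add: L2_time_def\<close>)
 show "AE t in tmeas T. norm (N (u t)) <= norm (1 + (N (u t))\<^sup>2)"
 proof (intro always_eventually allI)
  fix t
  have "2 * \<bar>N (u t)\<bar> <= 1 + (N (u t))\<^sup>2" using sum_squares_bound[of 1 "\<bar>N (u t)\<bar>"] by simp
  then show "norm (N (u t)) <= norm (1 + (N (u t))\<^sup>2)" by simp
 qed
qed (rule N_measurable[OF assms])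

lemma L2_time_diff:
 assumes u: "u \<in> L2_time X N T" and v: "v \<in> L2_time X N T"
 shows "(%t. u t - v t) \<in> L2_time X N T"
 unfolding L2_time_def
proof (intro CollectI conjI)
 obtain s where s: "!!n. simple_time X T (s n)" "AE t in tmeas T. (%n. N (u t - s n t)) ----> 0"
  using u strongly_measurableE unfolding L2_time_def by blast
 obtain r where r: "!!n. simple_time X T (r n)" "AE t in tmeas T. (%n. N (v t - r n t)) ----> 0"
  using v strongly_measurableE unfolding L2_time_def by blast
 have ae: "AE t in tmeas T. u t \<in> X" "AE t in tmeas T. v t \<in> X" using u v by (auto simp: L2_time_def)
 then show "AE t in tmeas T. u t - v t \<in> X" by eventually_elim (rule diff_mem)
 have d: "simple_time X T (%t. s n t - r n t)" for n by (rule simple_time_diff[OF s(1) r(1) diff_mem])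
 have "AE t in tmeas T. (%n. N ((u t - v t) - (s n t - r n t))) ----> 0"
  using s(2) r(2) ae
 proof eventually_elim
  case (elim t)
  have sm: "s n t \<in> X" "r n t \<in> X" for n using simple_time_mem[OF s(1)] simple_time_mem[OF r(1)] by auto
  show ?case
  proof (rule tendsto_sandwich[OF _ _ tendsto_const tendsto_add_zero[OF elim(1,2)]])
   have "N ((u t - v t) - (s n t - r n t)) <= N (u t - s n t) + N (v t - r n t)" for n
   proof -
    have "(u t - v t) - (s n t - r n t) = (u t - s n t) - (v t - r n t)" by (rule ext) simp
    moreover have "N ((u t - s n t) - (v t - r n t)) <= N ((u t - s n t) - (%x. 0)) + N ((%x. 0) - (v t - r n t))"
     by (intro N_triangle_diff diff_mem zero_mem elim sm)
    moreover have "(u t - s n t) - (%x. 0) = u t - s n t" by (rule ext) simp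
    moreover have "N ((%x. 0) - (v t - r n t)) = N ((v t - r n t) - (%x. 0))" by (intro N_minus diff_mem zero_mem elim sm)
    moreover have "(v t - r n t) - (%x. 0) = v t - r n t" by (rule ext) simp
    ultimately show ?thesis by simp
   qed
   then show "\<forall>\<^sub>F n in sequentially. N ((u t - v t) - (s n t - r n t)) <= N (u t - s n t) + N (v t - r n t)" by simp
   show "\<forall>\<^sub>F n in sequentially. 0 <= N ((u t - v t) - (s n t - r n t))"
    using N_nonneg[OF diff_mem[OF diff_mem[OF elim(3,4)] diff_mem[OF sm]]] by simp
  qed
 qed
 then show "strongly_measurable X N T (%t. u t - v t)"
  unfolding strongly_measurable_def using d by (intro exI[of _ "%n t. s n t - r n t"]) (auto simp: simple_time_def)
 have i: "integrable (tmeas T) (%t. (N (u t))\<^sup>2 - 2 * B (u t) (v t) + (N (v t))\<^sup>2)"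
  using u v self.L2_time_integrable[OF u v] by (auto simp: L2_time_def)
 have e: "AE t in tmeas T. (N (u t))\<^sup>2 - 2 * B (u t) (v t) + (N (v t))\<^sup>2 = (N (u t - v t))\<^sup>2"
  using ae by eventually_elim (simp add: N_diff_square)
 have m: "(%t. (N (u t - v t))\<^sup>2) \<in> bmeas (tmeas T)"
  by (rule borel_measurable_AE_cong_lebesgue_on[OF _ borel_measurable_integrable[OF i] e]) simp
 show "integrable (tmeas T) (%t. (N (u t - v t))\<^sup>2)"
  by (rule integrable_cong_AE_imp[OF i m]) (use e in eventually_elim, simp)
qed

text \<open>Strong measurability provides almost everywhere convergent simple functions; cutting them off where their norm exceeds twice that of the limit makes the convergence dominated.\<close>

lemma L2_time_simple_approx:
 assumes u: "u \<in> L2_time X N T"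
 obtains s where "!!n. simple_time X T (s n)" "(%n. LINT t|tmeas T. N (u t - s n t)) ----> 0"
proof -
 obtain s where s: "!!n. simple_time X T (s n)" "AE t in tmeas T. (%n. N (u t - s n t)) ----> 0"
  using u strongly_measurableE unfolding L2_time_def by blast
 have ae: "AE t in tmeas T. u t \<in> X" using u by (auto simp: L2_time_def)
 define G where "G n = {t. N (s n t) <= 2 * N (u t)}" for n
 have G: "{t \<in> {0..T}. t \<in> G n} \<in> sets lebesgue" for n
 proof -
  have [measurable]: "(%t. N (u t)) \<in> bmeas (tmeas T)" "(%t. N (s n t)) \<in> bmeas (tmeas T)"
   using N_measurable[OF u] N_measurable[OF simple_time_L2[OF s(1)]] by auto
  have "{t \<in> space (tmeas T). N (s n t) <= 2 * N (u t)} \<in> sets (tmeas T)" by measurable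
  then show ?thesis by (simp add: G_def sets_restrict_space_iff)
 qed
 define r where "r n t = (if t \<in> G n then s n t else (%x. 0))" for n t
 have r: "simple_time X T (r n)" for n
  unfolding r_def[abs_def] by (rule simple_time_restrict[OF s(1) zero_mem G])
 have d: "(%t. u t - r n t) \<in> L2_time X N T" for n by (rule L2_time_diff[OF u simple_time_L2[OF r]])
 have bound: "N (u t - r n t) <= 3 * N (u t)" if "u t \<in> X" for n t
 proof -
  have "N (u t - r n t) <= N (u t - (%x. 0)) + N ((%x. 0) - r n t)"
   by (intro N_triangle_diff zero_mem that simple_time_mem[OF r])
  moreover have "u t - (%x. 0) = u t" "r n t - (%x. 0) = r n t" by (rule ext, simp)+
  moreover have "N ((%x. 0) - r n t) = N (r n t - (%x. 0))" by (intro N_minus zero_mem simple_time_mem[OF r])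
  moreover have "N (r n t) <= 2 * N (u t)" using N_nonneg[OF that] by (simp add: r_def G_def N_zero)
  ultimately show ?thesis by simp
 qed
 have lim: "AE t in tmeas T. (%n. N (u t - r n t)) ----> 0"
  using s(2) ae
 proof eventually_elim
  case (elim t)
  show ?case
  proof (cases "N (u t) = 0")
   case True
   have "N (u t - r n t) = 0" for n
   proof -
    have "0 <= N (u t - r n t)" by (intro N_nonneg diff_mem elim simple_time_mem[OF r])
    then show ?thesis using bound[OF elim(2), of n] True by simp
   qed
   then show ?thesis by simp
  next
   case False
   then have "0 < N (u t)" using N_nonneg[OF elim(2)] by simp
   then have "\<forall>\<^sub>F n in sequentially. N (u t - s n t) < N (u t)" using order_tendstoD(2)[OF elim(1)] by blast
   then have "\<forall>\<^sub>F n in sequentially. N (u t - s n t) = N (u t - r n t)"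
   proof eventually_elim
    case (elim n)
    have "N (s n t) <= N (s n t - u t) + N (u t)" by (rule N_bound[OF simple_time_mem[OF s(1)] \<open>u t \<in> X\<close>])
    then have "N (s n t) <= 2 * N (u t)" using elim N_minus[OF simple_time_mem[OF s(1)] \<open>u t \<in> X\<close>] by simp
    then show ?case by (simp add: r_def G_def)
   qed
   with elim(1) show ?thesis by (rule Lim_transform_eventually)
  qed
 qed
 have "(%n. LINT t|tmeas T. N (u t - r n t)) ----> (LINT t|tmeas T. 0)"
 proof (rule integral_dominated_convergence[where w="%t. 3 * N (u t)"])
  show "AE t in tmeas T. norm (N (u t - r n t)) <= 3 * N (u t)" for n
   using ae by eventually_elim (use bound N_nonneg[OF diff_mem[OF _ simple_time_mem[OF r]]] in force)
 qed (use lim N_measurable[OF d] L2_time_N_integrable[OF u] in auto)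
 then show ?thesis by (intro that[OF r]) simp
qed

definition primitive :: "real => (real => field) => (real => field) => bool" where
 "primitive T u u' \<longleftrightarrow> u \<in> C_time X N T \<and> u \<in> L2_time X N T \<and> u' \<in> L2_time X N T \<and>
  (\<forall>g\<in>X. \<forall>s t. 0 <= s --> s <= t --> t <= T -->
   B (u t - u s) g = (LINT \<tau>|tmeas T. indicator {s<..<t} \<tau> * B (u' \<tau>) g))"

lemma C_time_mem: "u \<in> C_time X N T ==> t \<in> {0..T} ==> u t \<in> X"
 by (simp add: C_time_def)

lemma primitiveI:
 assumes u: "u \<in> C_time X N T" "u \<in> L2_time X N T" "u' \<in> L2_time X N T"
  and w: "!!g \<psi>. g \<in> X ==> test_fun {0<..<T} \<psi> ==>
   (LINT t|tmeas T. B (u t) g * deriv \<psi> t) = - (LINT t|tmeas T. B (u' t) g * \<psi> t)"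
 shows "primitive T u u'"
 unfolding primitive_def
proof (intro conjI u ballI allI impI)
 fix g s t assume g: "g \<in> X" and st: "0 <= s" "s <= t" "t <= (T::real)"
 have c: "continuous_on {0..T} (%t. B (u t) g)"
  unfolding continuous_on_def
 proof
  fix t assume t: "t \<in> {0..T}"
  have lim: "((%s. N (u s - u t)) \<longlongrightarrow> 0) (at t within {0..T})" using u(1) t by (simp add: C_time_def)
  show "((%s. B (u s) g) \<longlongrightarrow> B (u t) g) (at t within {0..T})"
  proof (rule LIM_zero_cancel, rule Lim_null_comparison)
   show "((%s. N (u s - u t) * N g) \<longlongrightarrow> 0) (at t within {0..T})" by (rule tendsto_mult_left_zero[OF lim])
   show "\<forall>\<^sub>F s in at t within {0..T}. norm (B (u s) g - B (u t) g) <= N (u s - u t) * N g"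
    unfolding eventually_at_filter
   proof (intro always_eventually allI impI)
    fix s assume "s \<noteq> t" "s \<in> {0..T}"
    then have m: "u s \<in> X" "u t \<in> X" using C_time_mem[OF u(1)] t by auto
    show "norm (B (u s) g - B (u t) g) <= N (u s - u t) * N g"
     using cauchy_schwarz[OF diff_mem[OF m] g] by (simp add: B_diff[OF m g])
   qed
  qed
 qed
 have "B (u t) g - B (u s) g = (LINT \<tau>|tmeas T. indicator {s<..<t} \<tau> * B (u' \<tau>) g)"
  by (rule weak_derivative_FTC[OF c self.L2_time_integrable[OF u(3) const_L2_time[OF g]] w[OF g] st])
 then show "B (u t - u s) g = (LINT \<tau>|tmeas T. indicator {s<..<t} \<tau> * B (u' \<tau>) g)"
  using B_diff[OF C_time_mem[OF u(1)] C_time_mem[OF u(1)] g] st by simp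
qed

end

lemma AE_time_neq: "AE t in tmeas T. t \<noteq> a"
proof -
 have "AE t in lebesgue. t \<noteq> a" by (rule AE_completion[OF AE_lborel_singleton])
 then have "AE t in lebesgue. t \<in> {0..T} --> t \<noteq> a" by eventually_elim simp
 then show ?thesis using AE_lebesgue_on[of "{0..T}" "%t. t \<noteq> a"] by simp
qed

locale bounded_form_field = pre_inner_field X B + bounded_form X B A c for X B A c
begin

lemma primitive_mem:
 assumes "primitive T u u'" "t \<in> {0..T}" shows "u t \<in> X"
 using assms C_time_mem unfolding primitive_def by blast

text \<open>The weak derivative is defined by testing with \<open>B\<close>. Approximating \<open>u'\<close> by simple functions
 and \<open>u t - u s\<close> by their (finite) integrals shows that the fundamental theorem holds after
 testing with any other bounded form.\<close>

lemma primitive_form: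
 assumes u: "primitive T u u'" and v: "v \<in> X" and st: "0 <= s" "s <= t" "t <= T"
 shows "A (u t - u s) v = (LINT \<tau>|tmeas T. indicator {s<..<t} \<tau> * A (u' \<tau>) v)"
proof -
 have u': "u' \<in> L2_time X N T" using u by (simp add: primitive_def)
 have ae: "AE t in tmeas T. u' t \<in> X" using u' by (simp add: L2_time_def)
 have uts: "u t \<in> X" "u s \<in> X" using primitive_mem[OF u] st by auto
 have dts: "u t - u s \<in> X" by (rule diff_mem[OF uts])
 obtain r where r: "!!n. simple_time X T (r n)" "(%n. LINT t|tmeas T. N (u' t - r n t)) ----> 0"
  by (rule L2_time_simple_approx[OF u']) (rule that)
 have rX: "r n t \<in> X" for n t by (rule simple_time_mem[OF r(1)])
 have rL: "r n \<in> L2_time X N T" for n by (rule simple_time_L2[OF r(1)])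
 have dL: "(%t. u' t - r n t) \<in> L2_time X N T" for n by (rule L2_time_diff[OF u' rL])
 define e where "e n = (LINT t|tmeas T. N (u' t - r n t))" for n
 define I where "I n = (%x. \<Sum>w\<in>range (r n). (LINT \<tau>|tmeas T. indicator {s<..<t} \<tau> * indicator {w} (r n \<tau>)) *\<^sub>R w x)" for n
 have fin: "finite (range (r n))" "range (r n) \<subseteq> X" for n using r(1)[of n] by (auto simp: simple_time_def)
 have IX: "I n \<in> X" for n unfolding I_def by (rule sum_mem(1)[OF fin])
 have im: "(indicator {s<..<t} :: real => real) \<in> bmeas (tmeas T)"
  by (rule indicator_time_measurable) simp
 have ii: "integrable (tmeas T) (%\<tau>. indicator {s<..<t} \<tau> * h \<tau>)" if "integrable (tmeas T) h" for h :: "real => real"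
 proof (rule Bochner_Integration.integrable_bound[OF that])
  show "(%\<tau>. indicator {s<..<t} \<tau> * h \<tau>) \<in> bmeas (tmeas T)"
   by (intro borel_measurable_times im borel_measurable_integrable that)
  show "AE \<tau> in tmeas T. norm (indicator {s<..<t} \<tau> * h \<tau>) <= norm (h \<tau>)"
   by (intro always_eventually allI) (simp add: indicator_def)
 qed
 have iw: "integrable (tmeas T) (%\<tau>. indicator {s<..<t} \<tau> * indicator {w} (r n \<tau>) :: real)" for n w
  by (rule ii, rule finite_measure.integrable_const_bound[OF finite_time_measure, of _ 1])
   (use simple_time_indicator_measurable[OF r(1)] in \<open>auto simp: indicator_def\<close>)
 have form_I: "(LINT \<tau>|tmeas T. indicator {s<..<t} \<tau> * F (r n \<tau>)) = (\<Sum>w\<in>range (r n). (LINT \<tau>|tmeas T. indicator {s<..<t} \<tau> * indicator {w} (r n \<tau>)) * F w)" for n and F :: "field => real"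
 proof -
  have "(LINT \<tau>|tmeas T. indicator {s<..<t} \<tau> * F (r n \<tau>))
   = (LINT \<tau>|tmeas T. (\<Sum>w\<in>range (r n). (indicator {s<..<t} \<tau> * indicator {w} (r n \<tau>)) * F w))"
   by (subst simple_time_expand[OF r(1), of F]) (simp add: sum_distrib_left mult_ac)
  also have "\<dots> = (\<Sum>w\<in>range (r n). (LINT \<tau>|tmeas T. (indicator {s<..<t} \<tau> * indicator {w} (r n \<tau>)) * F w))"
   by (rule Bochner_Integration.integral_sum) (use iw in simp)
  finally show ?thesis by simp
 qed
 have A_sum: "A (%x. \<Sum>w\<in>W. k w *\<^sub>R w x) v = (\<Sum>w\<in>W. k w * A w v)" if "finite W" "W \<subseteq> X" for W and k :: "field => real"
  using that
 proof induction
  case empty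
  show ?case using A_scale[OF zero_mem v, of 0] by simp
 next
  case (insert w W)
  have eq: "(%x. \<Sum>w\<in>insert w W. k w *\<^sub>R w x) = (%x. k w *\<^sub>R w x + (\<Sum>w\<in>W. k w *\<^sub>R w x))"
   using insert.hyps by (intro ext) simp
  have m: "w \<in> X" "W \<subseteq> X" using insert.prems by auto
  show ?case unfolding eq A_add[OF scale_mem[OF m(1)] sum_mem(1)[OF insert.hyps(1) m(2)] v] A_scale[OF m(1) v]
   using insert by simp
 qed
 have AI: "A (I n) v = (LINT \<tau>|tmeas T. indicator {s<..<t} \<tau> * A (r n \<tau>) v)" for n
  unfolding form_I[where F="%w. A w v"] unfolding I_def by (rule A_sum[OF fin])
 have BI: "B (I n) g = (LINT \<tau>|tmeas T. indicator {s<..<t} \<tau> * B (r n \<tau>) g)" if "g \<in> X" for n g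
  unfolding form_I[where F="%w. B w g"] unfolding I_def by (rule sum_mem(2)[OF fin that])
 have near: "\<bar>LINT \<tau>|tmeas T. indicator {s<..<t} \<tau> * F (u' \<tau> - r n \<tau>)\<bar> <= K * e n"
  if F: "!!f. f \<in> X ==> \<bar>F f\<bar> <= K * N f" and m: "integrable (tmeas T) (%\<tau>. F (u' \<tau> - r n \<tau>))" for F K n
 proof -
  have "\<bar>LINT \<tau>|tmeas T. indicator {s<..<t} \<tau> * F (u' \<tau> - r n \<tau>)\<bar> <= (LINT \<tau>|tmeas T. \<bar>indicator {s<..<t} \<tau> * F (u' \<tau> - r n \<tau>)\<bar>)"
   by (rule integral_abs_bound)
  also have "\<dots> <= (LINT \<tau>|tmeas T. K * N (u' \<tau> - r n \<tau>))"
  proof (rule integral_mono_AE)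
   show "integrable (tmeas T) (%\<tau>. \<bar>indicator {s<..<t} \<tau> * F (u' \<tau> - r n \<tau>)\<bar>)"
    by (rule integrable_abs[OF ii[OF m]])
   show "integrable (tmeas T) (%\<tau>. K * N (u' \<tau> - r n \<tau>))" using L2_time_N_integrable[OF dL] by simp
   show "AE \<tau> in tmeas T. \<bar>indicator {s<..<t} \<tau> * F (u' \<tau> - r n \<tau>)\<bar> <= K * N (u' \<tau> - r n \<tau>)"
    using ae
   proof eventually_elim
    case (elim \<tau>)
    have "\<bar>F (u' \<tau> - r n \<tau>)\<bar> <= K * N (u' \<tau> - r n \<tau>)" by (intro F diff_mem elim rX)
    then show ?case by (auto simp: indicator_def)
   qed
  qed
  finally show ?thesis by (simp add: e_def)
 qed
 have N_d: "N ((u t - u s) - I n) <= e n" for n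
 proof -
  let ?d = "(u t - u s) - I n"
  have d: "?d \<in> X" by (rule diff_mem[OF dts IX])
  have iB: "integrable (tmeas T) (%\<tau>. B (u' \<tau>) ?d)" "integrable (tmeas T) (%\<tau>. B (r n \<tau>) ?d)"
   "integrable (tmeas T) (%\<tau>. B (u' \<tau> - r n \<tau>) ?d)"
   using self.L2_time_integrable[OF u' const_L2_time[OF d]] self.L2_time_integrable[OF rL const_L2_time[OF d]]
    self.L2_time_integrable[OF dL const_L2_time[OF d]] by auto
  have "B ?d ?d = B (u t - u s) ?d - B (I n) ?d" by (rule B_diff[OF dts IX d])
  also have "\<dots> = (LINT \<tau>|tmeas T. indicator {s<..<t} \<tau> * B (u' \<tau>) ?d) - (LINT \<tau>|tmeas T. indicator {s<..<t} \<tau> * B (r n \<tau>) ?d)"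
   using u st d BI[OF d] unfolding primitive_def by simp
  also have "\<dots> = (LINT \<tau>|tmeas T. indicator {s<..<t} \<tau> * B (u' \<tau>) ?d - indicator {s<..<t} \<tau> * B (r n \<tau>) ?d)"
   by (rule Bochner_Integration.integral_diff[symmetric]) (intro ii iB)+
  also have "\<dots> = (LINT \<tau>|tmeas T. indicator {s<..<t} \<tau> * B (u' \<tau> - r n \<tau>) ?d)"
  proof (rule integral_cong_AE)
   show "AE \<tau> in tmeas T. indicator {s<..<t} \<tau> * B (u' \<tau>) ?d - indicator {s<..<t} \<tau> * B (r n \<tau>) ?d = indicator {s<..<t} \<tau> * B (u' \<tau> - r n \<tau>) ?d"
    using ae by eventually_elim (simp add: B_diff[OF _ rX d] right_diff_distrib)
  qed (intro borel_measurable_diff borel_measurable_integrable ii iB)+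
  also have "\<dots> <= N ?d * e n"
   using near[of "%f. B f ?d" "N ?d" n] cauchy_schwarz[OF _ d] iB(3) by (force simp: mult.commute)
  finally have *: "N ?d * N ?d <= N ?d * e n" using N_square[OF d] by (simp add: power2_eq_square)
  show ?thesis
  proof (cases "N ?d = 0")
   case True
   have "AE \<tau> in tmeas T. 0 <= N (u' \<tau> - r n \<tau>)"
    using ae by eventually_elim (intro N_nonneg diff_mem rX)
   then have "0 <= e n" unfolding e_def by (rule integral_nonneg_AE)
   then show ?thesis using True by simp
  next
   case False
   then have "0 < N ?d" using N_nonneg[OF d] by simp
   then show ?thesis using * by simp
  qed
 qed
 have iA: "integrable (tmeas T) (%\<tau>. A (u' \<tau>) v)" "integrable (tmeas T) (%\<tau>. A (r n \<tau>) v)"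
   "integrable (tmeas T) (%\<tau>. A (u' \<tau> - r n \<tau>) v)" for n
  using L2_time_integrable[OF u' const_L2_time[OF v]] L2_time_integrable[OF rL const_L2_time[OF v]]
   L2_time_integrable[OF dL const_L2_time[OF v]] by auto
 have main: "\<bar>A (u t - u s) v - (LINT \<tau>|tmeas T. indicator {s<..<t} \<tau> * A (u' \<tau>) v)\<bar> <= 2 * (c * N v * e n)" for n
 proof -
  have 1: "\<bar>A ((u t - u s) - I n) v\<bar> <= c * N v * e n"
  proof -
   have "\<bar>A ((u t - u s) - I n) v\<bar> <= c * N v * N ((u t - u s) - I n)"
    using A_bound[OF diff_mem[OF dts IX] v] by (simp add: mult_ac)
   also have "\<dots> <= c * N v * e n" by (intro mult_left_mono N_d mult_nonneg_nonneg c_nonneg N_nonneg v)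
   finally show ?thesis .
  qed
  have 2: "\<bar>LINT \<tau>|tmeas T. indicator {s<..<t} \<tau> * A (u' \<tau> - r n \<tau>) v\<bar> <= c * N v * e n"
  proof (rule near[where F="%f. A f v", OF _ iA(3)])
   show "\<bar>A f v\<bar> <= c * N v * N f" if "f \<in> X" for f using A_bound[OF that v] by (simp add: mult_ac)
  qed
  have "(LINT \<tau>|tmeas T. indicator {s<..<t} \<tau> * A (u' \<tau> - r n \<tau>) v)
   = (LINT \<tau>|tmeas T. indicator {s<..<t} \<tau> * A (u' \<tau>) v - indicator {s<..<t} \<tau> * A (r n \<tau>) v)"
  proof (rule integral_cong_AE)
   show "AE \<tau> in tmeas T. indicator {s<..<t} \<tau> * A (u' \<tau> - r n \<tau>) v = indicator {s<..<t} \<tau> * A (u' \<tau>) v - indicator {s<..<t} \<tau> * A (r n \<tau>) v"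
    using ae by eventually_elim (simp add: A_diff[OF _ rX v] right_diff_distrib)
  qed (intro borel_measurable_diff borel_measurable_integrable ii iA)+
  also have "\<dots> = (LINT \<tau>|tmeas T. indicator {s<..<t} \<tau> * A (u' \<tau>) v) - A (I n) v"
   unfolding AI by (rule Bochner_Integration.integral_diff) (intro ii iA)+
  finally show ?thesis using 1 2 A_diff[OF dts IX v, of n] by linarith
 qed
 have "(%n. 2 * (c * N v * e n)) ----> 2 * (c * N v * 0)"
  unfolding e_def by (intro tendsto_intros r(2))
 then have "\<bar>A (u t - u s) v - (LINT \<tau>|tmeas T. indicator {s<..<t} \<tau> * A (u' \<tau>) v)\<bar> <= 2 * (c * N v * 0)"
  by (rule LIMSEQ_le_const) (use main in blast)
 then show ?thesis by simp
qed

text \<open>Fubini is applied to \<open>A (p t) (q s)\<close>, whose joint measurability follows from that of the approximating simple functions on the set where these converge.\<close>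

lemma product_form_measurable:
 assumes p: "p \<in> L2_time X N T" and q: "q \<in> L2_time X N T"
 obtains P Q where "P \<in> sets (tmeas T)" "Q \<in> sets (tmeas T)"
  "AE t in tmeas T. t \<in> P" "AE t in tmeas T. t \<in> Q"
  "!!t. t \<in> P ==> p t \<in> X" "!!t. t \<in> Q ==> q t \<in> X"
  "(%(t, s). indicator P t * indicator Q s * A (p t) (q s)) \<in> bmeas (tmeas T \<Otimes>\<^sub>M tmeas T)"
proof -
 let ?M = "tmeas T"
 have good: "\<exists>s P. (\<forall>n. simple_time X T (s n)) \<and> P \<in> sets ?M \<and> (AE t in ?M. t \<in> P) \<and>
   (\<forall>t\<in>P. u t \<in> X \<and> (%n. N (u t - s n t)) ----> 0)" if u: "u \<in> L2_time X N T" for u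
 proof -
  obtain s where s: "!!n. simple_time X T (s n)" "AE t in ?M. (%n. N (u t - s n t)) ----> 0"
   using u strongly_measurableE unfolding L2_time_def by blast
  have "AE t in ?M. u t \<in> X" using u by (simp add: L2_time_def)
  with s(2) have "AE t in ?M. u t \<in> X \<and> (%n. N (u t - s n t)) ----> 0" by eventually_elim simp
  then obtain Z where Z: "{t \<in> space ?M. \<not> (u t \<in> X \<and> (%n. N (u t - s n t)) ----> 0)} \<subseteq> Z" "Z \<in> null_sets ?M"
   unfolding eventually_ae_filter by blast
  have "AE t in ?M. t \<in> space ?M - Z" using AE_not_in[OF Z(2)] AE_space by eventually_elim simp
  moreover have "space ?M - Z \<in> sets ?M" using Z(2) by auto
  ultimately show ?thesis using s(1) Z(1) by (intro exI[of _ s] exI[of _ "space ?M - Z"]) blast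
 qed
 obtain s P where s: "!!n. simple_time X T (s n)" and P: "P \<in> sets ?M" "AE t in ?M. t \<in> P"
  "!!t. t \<in> P ==> p t \<in> X" "!!t. t \<in> P ==> (%n. N (p t - s n t)) ----> 0" using good[OF p] by blast
 obtain r Q where r: "!!n. simple_time X T (r n)" and Q: "Q \<in> sets ?M" "AE t in ?M. t \<in> Q"
  "!!t. t \<in> Q ==> q t \<in> X" "!!t. t \<in> Q ==> (%n. N (q t - r n t)) ----> 0" using good[OF q] by blast
 note [measurable] = P(1) Q(1)
 have "(%z. indicator P (fst z) * indicator Q (snd z) * A (p (fst z)) (q (snd z))) \<in> bmeas (?M \<Otimes>\<^sub>M ?M)"
 proof (rule borel_measurable_LIMSEQ_real)
  show "(%n. indicator P (fst z) * indicator Q (snd z) * A (s n (fst z)) (r n (snd z))) ----> indicator P (fst z) * indicator Q (snd z) * A (p (fst z)) (q (snd z))" for z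
  proof (cases "fst z \<in> P \<and> snd z \<in> Q")
   case True
   then show ?thesis
    by (intro tendsto_mult tendsto_const A_tendsto P Q simple_time_mem[OF s] simple_time_mem[OF r]) auto
  qed (auto simp: indicator_def)
  show "(%z. indicator P (fst z) * indicator Q (snd z) * A (s n (fst z)) (r n (snd z))) \<in> bmeas (?M \<Otimes>\<^sub>M ?M)" for n
  proof -
   note m1 = measurable_compose[OF measurable_fst simple_time_indicator_measurable[OF s, of _ n]]
   note m2 = measurable_compose[OF measurable_snd simple_time_indicator_measurable[OF r, of _ n]]
   show ?thesis unfolding simple_time_expand2[OF s r]
    by (intro borel_measurable_times borel_measurable_sum m1 m2) measurable
  qed
 qed
 then show ?thesis using that[OF P(1) Q(1) P(2) Q(2) P(3) Q(3)] by (simp add: case_prod_beta')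
qed

text \<open>The fundamental theorem turns one of the integrals into a double integral of \<open>A (p' t) (q' s)\<close> over a triangle, where the order of integration is exchanged.\<close>

lemma integration_by_parts:
 assumes p: "primitive T p p'" and q: "primitive T q q'" and T: "0 <= T"
 shows "(LINT t|tmeas T. A (p' t) (q t)) + (LINT t|tmeas T. A (p t) (q' t)) = A (p T) (q T) - A (p 0) (q 0)"
proof -
 let ?M = "tmeas T"
 have pL: "p \<in> L2_time X N T" "p' \<in> L2_time X N T" and qL: "q \<in> L2_time X N T" "q' \<in> L2_time X N T"
  using p q by (simp_all add: primitive_def)
 have X: "p T \<in> X" "p 0 \<in> X" "q T \<in> X" "q 0 \<in> X" using primitive_mem[OF p] primitive_mem[OF q] T by auto
 have pX: "p t \<in> X" and qX: "q t \<in> X" if "t \<in> space ?M" for t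
  using primitive_mem[OF p] primitive_mem[OF q] that by auto
 obtain P Q where P: "P \<in> sets ?M" "Q \<in> sets ?M" "AE t in ?M. t \<in> P" "AE t in ?M. t \<in> Q"
  "!!t. t \<in> P ==> p' t \<in> X" "!!t. t \<in> Q ==> q' t \<in> X"
  "(%(t, s). indicator P t * indicator Q s * A (p' t) (q' s)) \<in> bmeas (?M \<Otimes>\<^sub>M ?M)"
  by (rule product_form_measurable[OF pL(2) qL(2)]) (rule that)
 interpret sf: finite_measure ?M by (rule finite_time_measure)
 interpret pair: pair_sigma_finite ?M ?M ..
 define K where "K t s = indicator P t * indicator Q s * A (p' t) (q' s)" for t s
 define J where "J t s = (if 0 < s \<and> s < t then K t s else 0)" for t s
 have Km: "(%(t, s). K t s) \<in> bmeas (?M \<Otimes>\<^sub>M ?M)" using P(7) by (simp add: K_def)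
 have idm: "(%t. t) \<in> bmeas ?M" by (rule borel_time_measurable) simp
 have tri: "{z \<in> space (?M \<Otimes>\<^sub>M ?M). 0 < snd z \<and> snd z < fst z} \<in> sets (?M \<Otimes>\<^sub>M ?M)"
 proof -
  have [measurable]: "(%z. fst z) \<in> bmeas (?M \<Otimes>\<^sub>M ?M)" "(%z. snd z) \<in> bmeas (?M \<Otimes>\<^sub>M ?M)"
   using measurable_compose[OF measurable_fst idm] measurable_compose[OF measurable_snd idm] by auto
  show ?thesis by measurable
 qed
 have Jm: "(%(t, s). J t s) \<in> bmeas (?M \<Otimes>\<^sub>M ?M)"
 proof -
  have "(%z. if 0 < snd z \<and> snd z < fst z then (case z of (t, s) => K t s) else 0) \<in> bmeas (?M \<Otimes>\<^sub>M ?M)"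
   by (rule measurable_If[OF Km _ tri]) simp
  moreover have "(%z. if 0 < snd z \<and> snd z < fst z then (case z of (t, s) => K t s) else 0) = (%(t, s). J t s)"
   by (auto simp: J_def fun_eq_iff)
  ultimately show ?thesis by simp
 qed
 have Kb: "\<bar>K t s\<bar> <= (c * \<bar>N (p' t)\<bar>) * \<bar>N (q' s)\<bar>" for t s
 proof (cases "t \<in> P \<and> s \<in> Q")
  case True
  then have "\<bar>A (p' t) (q' s)\<bar> <= c * N (p' t) * N (q' s)" "0 <= N (p' t)" "0 <= N (q' s)"
   using P(5,6) by (auto intro: A_bound N_nonneg)
  then show ?thesis using True by (simp add: K_def)
 next
  case False
  then have "K t s = 0" by (auto simp: K_def)
  then show ?thesis by (simp add: c_nonneg)
 qed
 have Jb: "\<bar>J t s\<bar> <= (c * \<bar>N (p' t)\<bar>) * \<bar>N (q' s)\<bar>" for t s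
  using Kb[of t s] c_nonneg by (simp add: J_def)
 note iN = integrable_abs[OF L2_time_N_integrable[OF pL(2)]] integrable_abs[OF L2_time_N_integrable[OF qL(2)]]
 have Jt: "(%s. J t s) \<in> bmeas ?M" if "t \<in> space ?M" for t
  using measurable_Pair2[OF Jm that] by simp
 have Ji: "integrable ?M (%s. J t s)" if "t \<in> space ?M" for t
  by (rule integrable_dominated(1)[OF _ Jt[OF that] Jb]) (use iN(2) in simp)
 have Jint: "integrable (?M \<Otimes>\<^sub>M ?M) (%(t, s). J t s)"
 proof (rule pair.Fubini_integrable[OF Jm])
  show "AE t in ?M. integrable ?M (%s. case (t, s) of (t, s) => J t s)"
   using Ji by (auto intro!: AE_I2)
  have m: "(%t. LINT s|?M. norm (J t s)) \<in> bmeas ?M"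
   using Jm by (intro sf.borel_measurable_lebesgue_integral) (simp add: case_prod_beta' borel_measurable_norm)
  have "integrable ?M (%t. c * \<bar>N (p' t)\<bar> * (LINT s|?M. \<bar>N (q' s)\<bar>))" using iN(1) by simp
  then have "integrable ?M (%t. LINT s|?M. norm (J t s))"
  proof (rule Bochner_Integration.integrable_bound[OF _ m])
   show "AE t in ?M. norm (LINT s|?M. norm (J t s)) <= norm (c * \<bar>N (p' t)\<bar> * (LINT s|?M. \<bar>N (q' s)\<bar>))"
   proof (rule AE_I2)
    fix t assume t: "t \<in> space ?M"
    have "(LINT s|?M. \<bar>J t s\<bar>) <= (LINT s|?M. c * \<bar>N (p' t)\<bar> * \<bar>N (q' s)\<bar>)"
     by (rule integral_mono) (use Ji[OF t] iN(2) Jb in auto)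
    then show "norm (LINT s|?M. norm (J t s)) <= norm (c * \<bar>N (p' t)\<bar> * (LINT s|?M. \<bar>N (q' s)\<bar>))"
     by simp
   qed
  qed
  then show "integrable ?M (%t. LINT s|?M. norm (case (t, s) of (t, s) => J t s))" by simp
 qed
 have fub: "(LINT t|?M. LINT s|?M. J t s) = (LINT s|?M. LINT t|?M. J t s)"
  using pair.Fubini_integral[OF Jint] by simp
 have ind_eq: "(LINT s|?M. J t s) = A (q t - q 0) (p' t)" if t: "t \<in> P" "t \<in> space ?M" for t
 proof -
  have "A (q t - q 0) (p' t) = (LINT s|?M. indicator {0<..<t} s * A (q' s) (p' t))"
   by (rule primitive_form[OF q P(5)[OF t(1)]]) (use t in auto)
  also have "\<dots> = (LINT s|?M. J t s)"
  proof (rule integral_cong_AE)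
   show "AE s in ?M. indicator {0<..<t} s * A (q' s) (p' t) = J t s"
    using P(4) by eventually_elim (use t P(5,6) A_sym in \<open>auto simp: J_def K_def indicator_def\<close>)
   show "(%s. indicator {0<..<t} s * A (q' s) (p' t)) \<in> bmeas ?M"
    by (intro borel_measurable_times indicator_time_measurable L2_time_measurable qL const_L2_time P(5) t) simp
  qed (rule Jt[OF t(2)])
  finally show ?thesis by simp
 qed
 have ind_eq2: "(LINT t|?M. J t s) = A (p T - p s) (q' s)" if s: "s \<in> Q" "s \<in> space ?M" "s \<noteq> 0" for s
 proof -
  have "A (p T - p s) (q' s) = (LINT t|?M. indicator {s<..<T} t * A (p' t) (q' s))"
   by (rule primitive_form[OF p P(6)[OF s(1)]]) (use s in auto)
  also have "\<dots> = (LINT t|?M. J t s)"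
  proof (rule integral_cong_AE)
   have "AE t in ?M. t \<noteq> T" by (rule AE_time_neq)
   then show "AE t in ?M. indicator {s<..<T} t * A (p' t) (q' s) = J t s"
    using P(3) AE_space by eventually_elim (use s in \<open>auto simp: J_def K_def indicator_def\<close>)
   show "(%t. indicator {s<..<T} t * A (p' t) (q' s)) \<in> bmeas ?M"
    by (intro borel_measurable_times indicator_time_measurable L2_time_measurable pL const_L2_time P(6) s) simp
   show "(%t. J t s) \<in> bmeas ?M" using measurable_Pair1[OF Jm s(2)] by simp
  qed
  finally show ?thesis by simp
 qed
 have iA: "integrable ?M (%t. A (p' t) (q t))" "integrable ?M (%t. A (p' t) (q 0))" "integrable ?M (%t. A (p t) (q' t))"
  "integrable ?M (%t. A (p T) (q' t))"
  using L2_time_integrable pL qL const_L2_time X by auto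
 have full: "(LINT \<tau>|?M. indicator {0<..<T} \<tau> * h \<tau>) = (LINT \<tau>|?M. h \<tau>)" if "integrable ?M h" for h :: "real => real"
 proof (rule integral_cong_AE)
  have "AE t in ?M. t \<noteq> T" "AE t in ?M. t \<noteq> 0" by (rule AE_time_neq)+
  then show "AE \<tau> in ?M. indicator {0<..<T} \<tau> * h \<tau> = h \<tau>"
   using AE_space by eventually_elim (auto simp: indicator_def)
  show "(%\<tau>. indicator {0<..<T} \<tau> * h \<tau>) \<in> bmeas ?M"
   by (intro borel_measurable_times indicator_time_measurable borel_measurable_integrable that) simp
 qed (use that in auto)
 have "(LINT t|?M. A (p' t) (q t)) - (LINT t|?M. A (p' t) (q 0)) = (LINT t|?M. A (p' t) (q t) - A (p' t) (q 0))"
  using iA by simp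
 also have "\<dots> = (LINT t|?M. LINT s|?M. J t s)"
 proof (rule integral_cong_AE)
  show "AE t in ?M. A (p' t) (q t) - A (p' t) (q 0) = (LINT s|?M. J t s)"
   using P(3) AE_space
  proof eventually_elim
   case (elim t)
   have "A (q t - q 0) (p' t) = A (q t) (p' t) - A (q 0) (p' t)" by (intro A_diff qX elim X P(5))
   then show ?case using ind_eq[OF elim] A_sym[OF P(5)[OF elim(1)]] qX[OF elim(2)] X(4) by simp
  qed
  show "(%t. LINT s|?M. J t s) \<in> bmeas ?M"
   using Jm by (intro sf.borel_measurable_lebesgue_integral)
 qed (intro borel_measurable_diff borel_measurable_integrable iA)
 also have "\<dots> = (LINT s|?M. LINT t|?M. J t s)" by (rule fub)
 also have "\<dots> = (LINT s|?M. A (p T) (q' s) - A (p s) (q' s))"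
 proof (rule integral_cong_AE)
  have "AE t in ?M. t \<noteq> 0" by (rule AE_time_neq)
  then show "AE s in ?M. (LINT t|?M. J t s) = A (p T) (q' s) - A (p s) (q' s)"
   using P(4) AE_space
  proof eventually_elim
   case (elim s)
   then show ?case using ind_eq2 A_diff[OF X(1) pX P(6)] by simp
  qed
  show "(%s. LINT t|?M. J t s) \<in> bmeas ?M"
   using measurable_pair_swap[OF Jm] by (intro sf.borel_measurable_lebesgue_integral) (simp add: case_prod_beta')
 qed (intro borel_measurable_diff borel_measurable_integrable iA)
 also have "\<dots> = (LINT s|?M. A (p T) (q' s)) - (LINT s|?M. A (p s) (q' s))" using iA by simp
 finally have 1: "(LINT t|?M. A (p' t) (q t)) - (LINT t|?M. A (p' t) (q 0)) = (LINT s|?M. A (p T) (q' s)) - (LINT s|?M. A (p s) (q' s))" .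
 have 2: "(LINT t|?M. A (p' t) (q 0)) = A (p T) (q 0) - A (p 0) (q 0)"
  using primitive_form[OF p X(4), of 0 T] full[OF iA(2)] T A_diff[OF X(1,2,4)] by simp
 have "A (q T - q 0) (p T) = (LINT t|?M. A (q' t) (p T))"
  using primitive_form[OF q X(1), of 0 T] full[OF L2_time_integrable[OF qL(2) const_L2_time[OF X(1)]]] T by simp
 moreover have "(LINT t|?M. A (q' t) (p T)) = (LINT t|?M. A (p T) (q' t))"
 proof (rule integral_cong_AE)
  show "AE t in ?M. A (q' t) (p T) = A (p T) (q' t)" using P(4) by eventually_elim (intro A_sym P(6) X)
 qed (intro L2_time_measurable qL const_L2_time X)+
 ultimately have 3: "(LINT t|?M. A (p T) (q' t)) = A (p T) (q T) - A (p T) (q 0)"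
  using A_diff[OF X(3,4,1)] A_sym[OF X(3,1)] A_sym[OF X(4,1)] by simp
 show ?thesis using 1 2 3 by linarith
qed

end

section \<open>The cost functional at two controls\<close>

interpretation L2_field: pre_inner_field "Lp 2 Om :: field set" "L2_inner Om" for Om
 by unfold_locales

lemma L2_N_fun: "L2.N Om = Lp_norm 2 Om"
 by (rule ext) (rule L2_N)

lemma L2_time_mono:
 assumes U: "U \<in> L2_time X N T" and XY: "X \<subseteq> Y" shows "U \<in> L2_time Y N T"
proof -
 obtain s where s: "!!n. simple_time X T (s n)" "AE t in tmeas T. (%n. N (U t - s n t)) ----> 0"
  using U unfolding L2_time_def by (auto elim!: strongly_measurableE)
 have "simple_time Y T (s n)" for n using s(1)[of n] XY by (auto simp: simple_time_def)
 then have "strongly_measurable Y N T U"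
  unfolding strongly_measurable_def using s(2) by (intro exI[of _ s]) (simp add: simple_time_def)
 moreover have "AE t in tmeas T. U t \<in> X" using U by (simp add: L2_time_def)
 then have "AE t in tmeas T. U t \<in> Y" by eventually_elim (use XY in blast)
 ultimately show ?thesis using U by (simp add: L2_time_def)
qed

lemma L2_time_H_L2: "U \<in> L2_time (H_space Om) (H_norm Om) T ==> U \<in> L2_time (Lp 2 Om) (Lp_norm 2 Om) T"
 by (rule L2_time_mono) (auto simp: H_space_def)

text \<open>The form \<open>a_form\<close> below is the one under the time derivative in the state equation; it is equivalent to the inner product of the energy space.\<close>

locale kelvin_voigt = fluid_domain +
 fixes \<mu> :: real
 assumes mu_pos: "0 < \<mu>"
begin

sublocale V: pre_inner_field "V_space Om" "V_inner Om"
 by unfold_locales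

lemma V_N_fun: "V.N = V_norm Om"
 by (rule ext) (rule V_N)

definition a_form :: "field => field => real" where
 "a_form v w = L2_inner Om v w + \<mu> * V_inner Om v w"

lemma L2_le_V:
 assumes "v \<in> V_space Om" "w \<in> V_space Om"
 shows "\<bar>L2_inner Om v w\<bar> <= poincare\<^sup>2 * V_norm Om v * V_norm Om w"
proof -
 have "\<bar>L2_inner Om v w\<bar> <= Lp_norm 2 Om v * Lp_norm 2 Om w"
  using L2.cauchy_schwarz[OF V_L2[OF assms(1)] V_L2[OF assms(2)]] by (simp add: L2_N)
 also have "\<dots> <= (poincare * V_norm Om v) * (poincare * V_norm Om w)"
  by (intro mult_mono poincare assms mult_nonneg_nonneg poincare_nonneg V_norm_nonneg Lp_norm_nonneg)
 finally show ?thesis by (simp add: power2_eq_square mult_ac)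
qed

sublocale L2V: bounded_form_field "V_space Om" "V_inner Om" "L2_inner Om" "poincare\<^sup>2"
proof
 show "L2_inner Om (%x. f x + g x) h = L2_inner Om f h + L2_inner Om g h"
  if "f \<in> V_space Om" "g \<in> V_space Om" "h \<in> V_space Om" for f g h
  using L2.B_add[OF that[THEN V_L2]] .
 show "L2_inner Om (%x. k *\<^sub>R f x) h = k * L2_inner Om f h" if "f \<in> V_space Om" "h \<in> V_space Om" for f h k
  using L2.B_scale[OF that[THEN V_L2]] .
 show "L2_inner Om f g = L2_inner Om g f" for f g by (simp add: L2_inner_def inner_commute)
 show "\<bar>L2_inner Om f g\<bar> <= poincare\<^sup>2 * V.N f * V.N g" if "f \<in> V_space Om" "g \<in> V_space Om" for f g
  using L2_le_V[OF that] by (simp add: V_N_fun)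
qed simp

sublocale A: bounded_form_field "V_space Om" "V_inner Om" a_form "poincare\<^sup>2 + \<mu>"
proof
 show "a_form (%x. f x + g x) h = a_form f h + a_form g h"
  if "f \<in> V_space Om" "g \<in> V_space Om" "h \<in> V_space Om" for f g h
  using L2.B_add[OF that[THEN V_L2]] V.B_add[OF that] by (simp add: a_form_def algebra_simps)
 show "a_form (%x. k *\<^sub>R f x) h = k * a_form f h" if "f \<in> V_space Om" "h \<in> V_space Om" for f h k
  using L2.B_scale[OF that[THEN V_L2]] V.B_scale[OF that] by (simp add: a_form_def algebra_simps)
 show "a_form f g = a_form g f" for f g
  by (simp add: a_form_def V_inner_def L2_inner_def inner_commute)
 show "\<bar>a_form f g\<bar> <= (poincare\<^sup>2 + \<mu>) * V.N f * V.N g" if "f \<in> V_space Om" "g \<in> V_space Om" for f g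
 proof -
  have "\<bar>a_form f g\<bar> <= \<bar>L2_inner Om f g\<bar> + \<mu> * \<bar>V_inner Om f g\<bar>"
   using mu_pos abs_triangle_ineq[of "L2_inner Om f g" "\<mu> * V_inner Om f g"] by (simp add: a_form_def abs_mult)
  moreover have "\<mu> * \<bar>V_inner Om f g\<bar> <= \<mu> * (V.N f * V.N g)"
   using V.cauchy_schwarz[OF that] mu_pos by (intro mult_left_mono) auto
  ultimately show ?thesis using L2_le_V[OF that] by (simp add: V_N_fun algebra_simps)
 qed
 show "0 <= poincare\<^sup>2 + \<mu>" using mu_pos by simp
qed

lemma L2_time_V_L2:
 assumes p: "p \<in> L2_time (V_space Om) (V_norm Om) T" shows "p \<in> L2_time (Lp 2 Om) (Lp_norm 2 Om) T"
 unfolding L2_time_def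
proof (intro CollectI conjI)
 have ae: "AE t in tmeas T. p t \<in> V_space Om" using p by (simp add: L2_time_def)
 then show "AE t in tmeas T. p t \<in> Lp 2 Om" by eventually_elim (rule V_L2)
 obtain s where s: "!!n. simple_time (V_space Om) T (s n)" "AE t in tmeas T. (%n. V_norm Om (p t - s n t)) ----> 0"
  using p unfolding L2_time_def by (auto elim!: strongly_measurableE)
 have s': "simple_time (Lp 2 Om) T (s n)" for n
  using s(1)[of n] V_L2 unfolding simple_time_def by auto
 have "AE t in tmeas T. (%n. Lp_norm 2 Om (p t - s n t)) ----> 0"
  using s(2) ae
 proof eventually_elim
  case (elim t)
  show ?case
  proof (rule tendsto_sandwich[OF _ _ tendsto_const tendsto_mult_right_zero[OF elim(1)]])
   show "\<forall>\<^sub>F n in sequentially. Lp_norm 2 Om (p t - s n t) <= poincare * V_norm Om (p t - s n t)"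
    by (intro always_eventually[where F=sequentially] allI poincare V.diff_mem elim simple_time_mem[OF s(1)])
  qed (simp add: Lp_norm_nonneg)
 qed
 then show "strongly_measurable (Lp 2 Om) (Lp_norm 2 Om) T p"
  unfolding strongly_measurable_def using s' by (intro exI[of _ s]) (simp add: simple_time_def)
 have "(Lp_norm 2 Om (p t))\<^sup>2 = L2_inner Om (p t) (p t)" for t
  by (simp add: Lp2_norm L2_inner_def power2_norm_eq_inner)
 then show "integrable (tmeas T) (%t. (Lp_norm 2 Om (p t))\<^sup>2)"
  using L2V.L2_time_integrable[OF p[folded V_N_fun] p[folded V_N_fun]] by simp
qed

lemma time_deriv:
 assumes "u \<in> H1_time_V Om T"
 shows "time_deriv Om T u \<in> L2_time (V_space Om) (V_norm Om) T" "weak_time_deriv Om T u (time_deriv Om T u)"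
proof -
 have "\<exists>u'. u' \<in> L2_time (V_space Om) (V_norm Om) T \<and> weak_time_deriv Om T u u'"
  using assms unfolding H1_time_V_def by auto
 from someI_ex[OF this] show "time_deriv Om T u \<in> L2_time (V_space Om) (V_norm Om) T" "weak_time_deriv Om T u (time_deriv Om T u)"
  unfolding time_deriv_def by auto
qed

lemma primitive_time_deriv:
 assumes "u \<in> C_time (V_space Om) (V_norm Om) T" "u \<in> H1_time_V Om T"
 shows "V.primitive T u (time_deriv Om T u)"
proof (rule V.primitiveI)
 show "u \<in> C_time (V_space Om) V.N T" "u \<in> L2_time (V_space Om) V.N T" "time_deriv Om T u \<in> L2_time (V_space Om) V.N T"
  using assms time_deriv(1)[OF assms(2)] by (simp_all add: V_N_fun H1_time_V_def)
 show "(LINT t|tmeas T. V_inner Om (u t) g * deriv \<psi> t) = - (LINT t|tmeas T. V_inner Om (time_deriv Om T u t) g * \<psi> t)"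
  if "g \<in> V_space Om" "test_fun {0<..<T} \<psi>" for g \<psi>
  using time_deriv(2)[OF assms(2)] that by (simp add: weak_time_deriv_def)
qed

text \<open>An equation that holds for every test function for almost all times may be tested with a
 function of time, since the latter takes, up to approximation, countably many values.\<close>

lemma test_with_time_dependent:
 assumes p: "p \<in> L2_time (V_space Om) (V_norm Om) T"
  and F: "AE t in tmeas T. cfun (F t)"
  and eq: "!!v. v \<in> V_space Om ==> AE t in tmeas T. F t v = 0"
 shows "AE t in tmeas T. F t (p t) = 0"
proof -
 have ae: "AE t in tmeas T. p t \<in> V_space Om" using p by (simp add: L2_time_def)
 obtain s where s: "!!n. simple_time (V_space Om) T (s n)" "AE t in tmeas T. (%n. V_norm Om (p t - s n t)) ----> 0"
  using p unfolding L2_time_def by (auto elim!: strongly_measurableE)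
 define D where "D = (\<Union>n. range (s n))"
 have "countable D" unfolding D_def using s(1) by (intro countable_UN countableI_type) (auto simp: simple_time_def intro: countable_finite)
 moreover have "D \<subseteq> V_space Om" unfolding D_def using simple_time_mem[OF s(1)] by auto
 ultimately have "AE t in tmeas T. \<forall>v\<in>D. F t v = 0"
  using eq by (subst AE_ball_countable) auto
 with F s(2) ae show ?thesis
 proof eventually_elim
  case (elim t)
  then obtain K where lin: "!!v w. v \<in> V_space Om ==> w \<in> V_space Om ==> F t (v - w) = F t v - F t w"
   and K: "!!v. v \<in> V_space Om ==> \<bar>F t v\<bar> <= K * V_norm Om v" unfolding cfun_def by blast
  have "\<bar>F t (p t)\<bar> <= K * V_norm Om (p t - s n t)" for n
  proof -
   have m: "s n t \<in> V_space Om" by (rule simple_time_mem[OF s(1)])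
   have "F t (s n t) = 0" using elim(4) by (auto simp: D_def)
   then have "F t (p t) = F t (p t - s n t)" using lin[OF elim(3) m] by simp
   then show ?thesis using K[OF V.diff_mem[OF elim(3) m]] by simp
  qed
  moreover have "(%n. K * V_norm Om (p t - s n t)) ----> 0" by (rule tendsto_mult_right_zero[OF elim(2)])
  ultimately have "\<bar>F t (p t)\<bar> <= 0" by (intro LIMSEQ_le_const) auto
  then show ?case by simp
 qed
qed

lemma state_equation_tested:
 assumes s: "weak_solution Om T \<mu> \<nu> \<alpha> \<beta> r u0 U u" and U: "U \<in> L2_time (H_space Om) (H_norm Om) T"
  and r: "1 <= r" "r <= 5" and p: "p \<in> L2_time (V_space Om) (V_norm Om) T"
 shows "AE t in tmeas T. a_form (time_deriv Om T u t) (p t) + \<nu> * V_inner Om (u t) (p t) + b_form Om (u t) (u t) (p t)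
  + \<alpha> * L2_inner Om (u t) (p t) + \<beta> * L2_inner Om (%x. damping r (u t x)) (p t) = L2_inner Om (U t) (p t)"
proof -
 let ?u' = "time_deriv Om T u"
 have u: "u \<in> L2_time (V_space Om) (V_norm Om) T" "u \<in> H1_time_V Om T" using s by (auto simp: weak_solution_def H1_time_V_def)
 let ?F = "%t v. L2_inner Om (?u' t) v + \<mu> * V_inner Om (?u' t) v + \<nu> * V_inner Om (u t) v + b_form Om (u t) (u t) v
  + \<alpha> * L2_inner Om (u t) v + \<beta> * L2_inner Om (%x. damping r (u t x)) v - L2_inner Om (U t) v"
 have "AE t in tmeas T. ?F t (p t) = 0"
 proof (rule test_with_time_dependent[OF p, where F="?F"])
  have "AE t in tmeas T. u t \<in> V_space Om" "AE t in tmeas T. ?u' t \<in> V_space Om" "AE t in tmeas T. U t \<in> Lp 2 Om"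
   using u time_deriv(1)[OF u(2)] L2_time_H_L2[OF U] by (auto simp: L2_time_def)
  then show "AE t in tmeas T. cfun (?F t)"
  proof eventually_elim
   case (elim t)
   show ?case
    by (intro cfun_add cfun_diff cfun_scale cfun_L2[OF V_L2[OF elim(1)]] cfun_L2[OF V_L2[OF elim(2)]] cfun_L2[OF elim(3)]
      cfun_V cfun_b3 damping_pairing(2) elim r)
  qed
  show "AE t in tmeas T. ?F t v = 0" if "v \<in> V_space Om" for v
  proof -
   have "AE t in tmeas T. L2_inner Om (?u' t) v + \<mu> * V_inner Om (?u' t) v + \<nu> * V_inner Om (u t) v + b_form Om (u t) (u t) v
   + \<alpha> * L2_inner Om (u t) v + \<beta> * L2_inner Om (%x. damping r (u t x)) v = L2_inner Om (U t) v"
    using s that unfolding weak_solution_def by blast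
   then show ?thesis by eventually_elim simp
  qed
 qed
 then show ?thesis by eventually_elim (simp add: a_form_def)
qed

lemma adjoint_equation_tested:
 assumes ad: "adjoint_state Om T \<mu> \<nu> \<alpha> \<beta> r \<kappa> ud z \<phi>" and z: "z \<in> L2_time (V_space Om) (V_norm Om) T"
  and ud: "ud \<in> L2_time (V_space Om) (V_norm Om) T"
  and r: "1 <= r" "r <= 5" and p: "p \<in> L2_time (V_space Om) (V_norm Om) T"
 shows "AE t in tmeas T. - a_form (time_deriv Om T \<phi> t) (p t) + \<nu> * V_inner Om (\<phi> t) (p t) + b_form Om (p t) (z t) (\<phi> t)
  - b_form Om (z t) (\<phi> t) (p t) + \<alpha> * L2_inner Om (\<phi> t) (p t) + \<beta> * L2_inner Om (%x. damping_deriv r (z t x) (\<phi> t x)) (p t)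
  = \<kappa> * V_inner Om (z t - ud t) (p t)"
proof -
 let ?\<phi>' = "time_deriv Om T \<phi>"
 have f: "\<phi> \<in> L2_time (V_space Om) (V_norm Om) T" "\<phi> \<in> H1_time_V Om T" using ad by (auto simp: adjoint_state_def H1_time_V_def)
 let ?F = "%t v. (- 1) * L2_inner Om (?\<phi>' t) v - \<mu> * V_inner Om (?\<phi>' t) v + \<nu> * V_inner Om (\<phi> t) v + b_form Om v (z t) (\<phi> t)
  - b_form Om (z t) (\<phi> t) v + \<alpha> * L2_inner Om (\<phi> t) v + \<beta> * L2_inner Om (%x. damping_deriv r (z t x) (\<phi> t x)) v
  - \<kappa> * V_inner Om (z t - ud t) v"
 have "AE t in tmeas T. ?F t (p t) = 0"
 proof (rule test_with_time_dependent[OF p, where F="?F"])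
  have "AE t in tmeas T. z t \<in> V_space Om" "AE t in tmeas T. \<phi> t \<in> V_space Om" "AE t in tmeas T. ?\<phi>' t \<in> V_space Om"
   "AE t in tmeas T. ud t \<in> V_space Om"
   using f z ud time_deriv(1)[OF f(2)] by (auto simp: L2_time_def)
  then show "AE t in tmeas T. cfun (?F t)"
  proof eventually_elim
   case (elim t)
   show ?case
    by (intro cfun_add cfun_diff cfun_scale cfun_L2[OF V_L2[OF elim(2)]] cfun_L2[OF V_L2[OF elim(3)]]
      cfun_V cfun_b3 cfun_b1 damping_deriv_pairing(2) V.diff_mem elim r)
  qed
  show "AE t in tmeas T. ?F t v = 0" if "v \<in> V_space Om" for v
  proof -
   have "AE t in tmeas T.
    - L2_inner Om (?\<phi>' t) v - \<mu> * V_inner Om (?\<phi>' t) v + \<nu> * V_inner Om (\<phi> t) v + b_form Om v (z t) (\<phi> t) - b_form Om (z t) (\<phi> t) v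
    + \<alpha> * L2_inner Om (\<phi> t) v + \<beta> * L2_inner Om (%x. damping_deriv r (z t x) (\<phi> t x)) v = \<kappa> * V_inner Om (z t - ud t) v"
    using ad that unfolding adjoint_state_def by blast
   then show ?thesis by eventually_elim simp
  qed
 qed
 then show ?thesis by eventually_elim (simp add: a_form_def)
qed

text \<open>What the expansion of the nonlinear terms at \<open>z\<close> leaves over, tested with \<open>p\<close>; the convection term is quadratic, so its remainder is the form itself.\<close>

definition remainder :: "real => real => field => field => field => real" where
 "remainder \<beta> r u z p = b_form Om (u - z) (u - z) p + \<beta> * (L2_inner Om (%x. damping r (u x)) p - L2_inner Om (%x. damping r (z x)) p
  - L2_inner Om (%x. damping_deriv r (z x) ((u - z) x)) p)"

text \<open>Weak gradients do not depend on the representative, so states that agree almost everywhere have the same energy.\<close>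

lemma V_AE_zero:
 assumes v: "v \<in> V_space Om" and z: "AE x in leb Om. v x = 0"
 shows "V_norm Om v = 0"
proof -
 have "AE x in leb Om. wgrad Om (%y. v y $ i) x = 0" for i
 proof (rule wgrad_eq(2))
  show "(%y. v y $ i) \<in> Lp 2 Om" using V_L2[OF v] by (simp add: Lp2_vec_iff)
  show "(%x. 0) \<in> Lp 2 Om" by (rule L2.zero_mem)
  show "weak_gradient Om (%y. v y $ i) (%x. 0)"
   unfolding weak_gradient_def
  proof (intro allI impI)
   fix \<psi> :: "R3 => real" and j assume \<psi>: "test_fun Om \<psi>"
   have "(LINT x|leb Om. v x $ i * gradient \<psi> x $ j) = (LINT x|leb Om. 0)"
   proof (rule integral_cong_AE)
    show "(%x. v x $ i * gradient \<psi> x $ j) \<in> bmeas (leb Om)"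
     using V_measurable[OF v] Lp_measurable[OF test_fun_L2[OF test_fun_gradient[OF \<psi>, of j]]]
     by (intro borel_measurable_times) (simp_all add: borel_measurable_vec_iff)
    show "AE x in leb Om. v x $ i * gradient \<psi> x $ j = 0" using z by eventually_elim simp
   qed simp
   then show "(LINT x|leb Om. v x $ i * gradient \<psi> x $ j) = - (LINT x|leb Om. 0 $ j * \<psi> x)" by simp
  qed
 qed
 then have "AE x in leb Om. \<forall>i. wgrad Om (%y. v y $ i) x = 0" by (rule AE_all_finite)
 then have "AE x in leb Om. vgrad Om v x = 0" by eventually_elim (simp add: vec_eq_iff[of "vgrad Om v _"] vgrad_nth)
 then show ?thesis using Lp2_norm_zero_iff[OF V_vgrad_L2[OF v]] by (simp add: V_norm_def)
qed

text \<open>Testing the adjoint equation with the difference \<open>w\<close> of the states and the difference of the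
 state equations with the adjoint state, all linear terms cancel after integration by parts in
 time; what remains besides the control term is the second-order remainder.\<close>

lemma cost_difference:
 assumes u: "weak_solution Om T \<mu> \<nu> \<alpha> \<beta> r u0 U (S U)" and z: "weak_solution Om T \<mu> \<nu> \<alpha> \<beta> r u0 Ut (S Ut)"
  and ad: "adjoint_state Om T \<mu> \<nu> \<alpha> \<beta> r \<kappa> ud (S Ut) \<phi>"
  and U: "U \<in> L2_time (H_space Om) (H_norm Om) T" "Ut \<in> L2_time (H_space Om) (H_norm Om) T"
  and ud: "ud \<in> L2_time (V_space Om) (V_norm Om) T"
  and r: "1 <= r" "r <= 5" and T: "0 < T" and lam: "0 <= lam"
  and rem: "AE t in tmeas T. \<bar>remainder \<beta> r (S U t) (S Ut t) (\<phi> t)\<bar> <= K * (V_norm Om (S U t - S Ut t))\<^sup>2"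
  and var: "0 <= (LINT t|tmeas T. LINT x|leb Om. (\<phi> t x + lam *\<^sub>R Ut t x) \<bullet> (U t x - Ut t x))"
 shows "(\<kappa> / 2 - K) * (LINT t|tmeas T. (V_norm Om (S U t - S Ut t))\<^sup>2) <= cost Om T \<kappa> lam ud S U - cost Om T \<kappa> lam ud S Ut"
proof -
 let ?L = "L2_inner Om"
 let ?VS = "V_space Om"
 let ?N = "V_norm Om"
 let ?H = "H_norm Om"
 let ?I = "V_inner Om"
 let ?b = "b_form Om"
 let ?M = "tmeas T" and ?u = "S U" and ?z = "S Ut"
 let ?u' = "time_deriv Om T ?u" and ?z' = "time_deriv Om T ?z" and ?p' = "time_deriv Om T \<phi>"
 have uL: "?u \<in> L2_time (?VS) (?N) T" and zL: "?z \<in> L2_time (?VS) (?N) T" and pL: "\<phi> \<in> L2_time (?VS) (?N) T"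
  using u z ad by (auto simp: weak_solution_def adjoint_state_def H1_time_V_def)
 have up: "V.primitive T ?u ?u'" and zp: "V.primitive T ?z ?z'" and pp: "V.primitive T \<phi> ?p'"
  using u z ad by (auto simp: weak_solution_def adjoint_state_def intro!: primitive_time_deriv)
 have u'L: "?u' \<in> L2_time (?VS) (?N) T" and z'L: "?z' \<in> L2_time (?VS) (?N) T" and p'L: "?p' \<in> L2_time (?VS) (?N) T"
  using up zp pp by (simp_all add: V.primitive_def V_N_fun)
 note L' = uL[folded V_N_fun] zL[folded V_N_fun] pL[folded V_N_fun] u'L[folded V_N_fun] z'L[folded V_N_fun] p'L[folded V_N_fun] ud[folded V_N_fun]
 have mem: "AE t in ?M. ?u t \<in> ?VS \<and> ?z t \<in> ?VS \<and> \<phi> t \<in> ?VS \<and> ?u' t \<in> ?VS \<and> ?z' t \<in> ?VS \<and> ?p' t \<in> ?VS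
   \<and> ud t \<in> ?VS \<and> U t \<in> Lp 2 Om \<and> Ut t \<in> Lp 2 Om"
  using uL zL pL u'L z'L p'L ud L2_time_H_L2[OF U(1)] L2_time_H_L2[OF U(2)] by (simp add: L2_time_def)
 define w where "w t = ?u t - ?z t" for t
 define h where "h t = U t - Ut t" for t
 have wL: "w \<in> L2_time (?VS) V.N T" unfolding w_def[abs_def] by (rule V.L2_time_diff[OF L'(1,2)])
 have zuL: "(%t. ?z t - ud t) \<in> L2_time (?VS) V.N T" by (rule V.L2_time_diff[OF L'(2,7)])
 have uuL: "(%t. ?u t - ud t) \<in> L2_time (?VS) V.N T" by (rule V.L2_time_diff[OF L'(1,7)])
 note UL = L2_time_H_L2[OF U(1), folded L2_N_fun] L2_time_H_L2[OF U(2), folded L2_N_fun]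
 have hL: "h \<in> L2_time (Lp 2 Om) (L2.N Om) T" unfolding h_def[abs_def] by (rule L2_field.L2_time_diff[OF UL])
 note pL2 = L2_time_V_L2[OF pL, folded L2_N_fun]
 define X where "X t = \<kappa> * ?I (?z t - ud t) (w t)" for t
 have iX: "integrable ?M X" unfolding X_def using V.self.L2_time_integrable[OF zuL wL] by simp
 have iw: "integrable ?M (%t. (?N (w t))\<^sup>2)" using wL by (simp add: L2_time_def V_N_fun)
 have ih: "integrable ?M (%t. (?H (h t))\<^sup>2)" using hL by (simp add: L2_time_def L2_N_fun)
 have i1: "integrable ?M (%t. ?L (\<phi> t) (h t))" "integrable ?M (%t. ?L (Ut t) (h t))"
  using L2_field.self.L2_time_integrable[OF pL2 hL] L2_field.self.L2_time_integrable[OF UL(2) hL] by auto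
 have i2: "integrable ?M (%t. a_form (?u' t) (\<phi> t))" "integrable ?M (%t. a_form (?z' t) (\<phi> t))"
  "integrable ?M (%t. a_form (?u t) (?p' t))" "integrable ?M (%t. a_form (?z t) (?p' t))"
  by (intro A.L2_time_integrable L')+
 \<comment> \<open>Pointwise in time: the equations are tested, and all bilinear terms cancel except the remainder.\<close>
 have lower: "AE t in ?M. ?L (\<phi> t) (h t) - (a_form (?u' t) (\<phi> t) - a_form (?z' t) (\<phi> t))
   - (a_form (?u t) (?p' t) - a_form (?z t) (?p' t)) - K * (?N (w t))\<^sup>2 <= X t"
  using mem rem state_equation_tested[OF u U(1) r pL] state_equation_tested[OF z U(2) r pL]
   adjoint_equation_tested[OF ad zL ud r uL] adjoint_equation_tested[OF ad zL ud r zL]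
 proof eventually_elim
  case (elim t)
  then have m: "?u t \<in> ?VS" "?z t \<in> ?VS" "\<phi> t \<in> ?VS" "?u' t \<in> ?VS" "?z' t \<in> ?VS"
   "?p' t \<in> ?VS" "ud t \<in> ?VS" "U t \<in> Lp 2 Om" "Ut t \<in> Lp 2 Om" by auto
  have wm: "w t \<in> ?VS" and zu: "?z t - ud t \<in> ?VS" by (auto simp: w_def intro: V.diff_mem m)
  have X: "X t = \<kappa> * ?I (?z t - ud t) (?u t) - \<kappa> * ?I (?z t - ud t) (?z t)"
   unfolding X_def w_def V.B_diff_right[OF m(1,2) zu] by (simp add: right_diff_distrib)
  have sym: "?L f g = ?L g f" "?I f g = ?I g f" "a_form f g = a_form g f" for f g :: field
   by (simp_all add: a_form_def V_inner_def L2_inner_def inner_commute)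
  have hh: "?L (\<phi> t) (h t) = ?L (U t) (\<phi> t) - ?L (Ut t) (\<phi> t)"
  proof -
   have "?L (\<phi> t) (h t) = ?L (\<phi> t) (U t) - ?L (\<phi> t) (Ut t)"
    unfolding h_def by (rule L2.B_diff_right[OF m(8,9) V_L2[OF m(3)]])
   then show ?thesis unfolding sym(1)[of "\<phi> t"] .
  qed
  have b: "?b (?u t) (?u t) (\<phi> t) - ?b (?z t) (?z t) (\<phi> t)
    - (?b (?u t) (?z t) (\<phi> t) - ?b (?z t) (?z t) (\<phi> t)) + (?b (?z t) (\<phi> t) (?u t) - ?b (?z t) (\<phi> t) (?z t))
    = ?b (w t) (w t) (\<phi> t)"
  proof -
   have "?b (?u t - ?z t) (?z t) (\<phi> t) = ?b (?u t) (?z t) (\<phi> t) - ?b (?z t) (?z t) (\<phi> t)"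
    "?b (?z t) (\<phi> t) (?u t - ?z t) = ?b (?z t) (\<phi> t) (?u t) - ?b (?z t) (\<phi> t) (?z t)"
    using cfun_b1[OF m(2,3)] cfun_b3[OF m(2,3)] m(1,2) unfolding cfun_def by auto
   then show ?thesis using b_form_expand[OF m(1,2,3)] by (simp add: w_def)
  qed
  have d: "?L (%x. damping_deriv r (?z t x) (\<phi> t x)) (?u t) - ?L (%x. damping_deriv r (?z t x) (\<phi> t x)) (?z t)
   = ?L (%x. damping_deriv r (?z t x) (w t x)) (\<phi> t)"
  proof -
   have "?L (%x. damping_deriv r (?z t x) (\<phi> t x)) (w t) = ?L (%x. damping_deriv r (?z t x) (\<phi> t x)) (?u t) - ?L (%x. damping_deriv r (?z t x) (\<phi> t x)) (?z t)"
    using damping_deriv_pairing(2)[OF m(2,3) r] m(1,2) unfolding cfun_def w_def by auto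
   moreover have "?L (%x. damping_deriv r (?z t x) (\<phi> t x)) (w t) = ?L (%x. damping_deriv r (?z t x) (w t x)) (\<phi> t)"
    unfolding L2_inner_def by (subst damping_deriv_sym) simp
   ultimately show ?thesis by simp
  qed
  have rr: "remainder \<beta> r (?u t) (?z t) (\<phi> t) = ?b (w t) (w t) (\<phi> t) + \<beta> * ?L (%x. damping r (?u t x)) (\<phi> t)
   - \<beta> * ?L (%x. damping r (?z t x)) (\<phi> t)
   - (\<beta> * ?L (%x. damping_deriv r (?z t x) (\<phi> t x)) (?u t) - \<beta> * ?L (%x. damping_deriv r (?z t x) (\<phi> t x)) (?z t))"
   unfolding remainder_def w_def[symmetric] d[symmetric] by (simp add: algebra_simps)
  have "X t = ?L (\<phi> t) (h t) - (a_form (?u' t) (\<phi> t) - a_form (?z' t) (\<phi> t))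
   - (a_form (?u t) (?p' t) - a_form (?z t) (?p' t)) - remainder \<beta> r (?u t) (?z t) (\<phi> t)"
   using elim(3-6) hh unfolding X rr b[symmetric] sym(2)[of "\<phi> t"] sym(1)[of "\<phi> t"] sym(3)[of "?p' t"] by linarith
  moreover have "remainder \<beta> r (?u t) (?z t) (\<phi> t) <= K * (?N (w t))\<^sup>2" using elim(2) by (simp add: w_def)
  ultimately show ?case by linarith
 qed
 \<comment> \<open>The boundary terms vanish at the final time by the terminal condition and agree at the initial time.\<close>
 have ibp: "(LINT t|?M. a_form (?u' t) (\<phi> t)) + (LINT t|?M. a_form (?u t) (?p' t)) = (LINT t|?M. a_form (?z' t) (\<phi> t)) + (LINT t|?M. a_form (?z t) (?p' t))"
 proof -
  have X: "?u T \<in> ?VS" "?z T \<in> ?VS" "?u 0 \<in> ?VS" "?z 0 \<in> ?VS" "\<phi> T \<in> ?VS" "\<phi> 0 \<in> ?VS"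
   using A.primitive_mem[OF up] A.primitive_mem[OF zp] A.primitive_mem[OF pp] T by auto
  have pT: "a_form (\<phi> T) v = 0" if "v \<in> ?VS" for v using ad that by (simp add: adjoint_state_def a_form_def)
  have "a_form (?u T) (\<phi> T) = 0" "a_form (?z T) (\<phi> T) = 0"
   using pT[OF X(1)] pT[OF X(2)] A.A_sym[OF X(1,5)] A.A_sym[OF X(2,5)] by auto
  moreover have "a_form (?u 0 - ?z 0) (\<phi> 0) = 0"
  proof (rule A.A_zero_left)
   have "AE x in leb Om. ?u 0 x = u0 x" "AE x in leb Om. ?z 0 x = u0 x" using u z by (auto simp: weak_solution_def)
   then have "AE x in leb Om. (?u 0 - ?z 0) x = 0" by eventually_elim simp
   then show "V.N (?u 0 - ?z 0) = 0" using V_AE_zero[OF V.diff_mem[OF X(3,4)]] by (simp add: V_N_fun)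
  qed (intro V.diff_mem X)+
  then have "a_form (?u 0) (\<phi> 0) = a_form (?z 0) (\<phi> 0)" using A.A_diff[OF X(3,4,6)] by simp
  ultimately show ?thesis using A.integration_by_parts[OF up pp] A.integration_by_parts[OF zp pp] T by simp
 qed
 have "(LINT t|?M. ?L (\<phi> t) (h t) - (a_form (?u' t) (\<phi> t) - a_form (?z' t) (\<phi> t))
   - (a_form (?u t) (?p' t) - a_form (?z t) (?p' t)) - K * (?N (w t))\<^sup>2) <= (LINT t|?M. X t)"
  by (rule integral_mono_AE[OF _ iX lower]) (intro Bochner_Integration.integrable_diff i1 i2 integrable_mult_right iw)
 then have Xint: "(LINT t|?M. ?L (\<phi> t) (h t)) - K * (LINT t|?M. (?N (w t))\<^sup>2) <= (LINT t|?M. X t)"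
  using i1 i2 iw ibp by simp
 have var': "0 <= (LINT t|?M. ?L (\<phi> t) (h t)) + lam * (LINT t|?M. ?L (Ut t) (h t))"
 proof -
  have eq: "AE t in ?M. (LINT x|leb Om. (\<phi> t x + lam *\<^sub>R Ut t x) \<bullet> (U t x - Ut t x)) = ?L (\<phi> t) (h t) + lam * ?L (Ut t) (h t)"
   using mem
  proof eventually_elim
   case (elim t)
   then have m: "\<phi> t \<in> Lp 2 Om" "Ut t \<in> Lp 2 Om" "h t \<in> Lp 2 Om" using V_L2 L2.diff_mem by (auto simp: h_def)
   have "(LINT x|leb Om. (\<phi> t x + lam *\<^sub>R Ut t x) \<bullet> (U t x - Ut t x)) = ?L (%x. \<phi> t x + lam *\<^sub>R Ut t x) (h t)"
    by (simp add: L2_inner_def h_def)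
   then show ?case using L2.B_add[OF m(1) L2.scale_mem[OF m(2)] m(3)] L2.B_scale[OF m(2,3)] by simp
  qed
  have i: "integrable ?M (%t. ?L (\<phi> t) (h t) + lam * ?L (Ut t) (h t))" using i1 by simp
  have "(LINT t|?M. LINT x|leb Om. (\<phi> t x + lam *\<^sub>R Ut t x) \<bullet> (U t x - Ut t x)) = (LINT t|?M. ?L (\<phi> t) (h t) + lam * ?L (Ut t) (h t))"
  proof (rule integral_cong_AE[OF _ _ eq])
   show "(%t. LINT x|leb Om. (\<phi> t x + lam *\<^sub>R Ut t x) \<bullet> (U t x - Ut t x)) \<in> bmeas ?M"
    by (rule borel_measurable_AE_cong_lebesgue_on[OF _ borel_measurable_integrable[OF i]]) (use eq in \<open>auto elim: eventually_mono\<close>)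
  qed (use i in auto)
  then show ?thesis using var i1 by simp
 qed
 have state: "(LINT t|?M. (Lp_norm 2 Om (vgrad Om (?u t - ud t)))\<^sup>2) = (LINT t|?M. (Lp_norm 2 Om (vgrad Om (?z t - ud t)))\<^sup>2)
   + 2 * (LINT t|?M. ?I (?z t - ud t) (w t)) + (LINT t|?M. (?N (w t))\<^sup>2)"
 proof -
  have iz: "integrable ?M (%t. (?N (?z t - ud t))\<^sup>2)" "integrable ?M (%t. (?N (?u t - ud t))\<^sup>2)"
   using zuL uuL by (simp_all add: L2_time_def V_N_fun)
  have iv: "integrable ?M (%t. ?I (?z t - ud t) (w t))" by (rule V.self.L2_time_integrable[OF zuL wL])
  have "(LINT t|?M. (?N (?u t - ud t))\<^sup>2) = (LINT t|?M. (?N (?z t - ud t))\<^sup>2 + 2 * ?I (?z t - ud t) (w t) + (?N (w t))\<^sup>2)"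
  proof (rule integral_cong_AE)
   show "AE t in ?M. (?N (?u t - ud t))\<^sup>2 = (?N (?z t - ud t))\<^sup>2 + 2 * ?I (?z t - ud t) (w t) + (?N (w t))\<^sup>2"
    using mem
   proof eventually_elim
    case (elim t)
    have e: "?u t - ud t = (%x. (?z t - ud t) x + w t x)" by (rule ext) (simp add: w_def)
    have m: "?z t - ud t \<in> ?VS" "w t \<in> ?VS" using elim V.diff_mem by (auto simp: w_def)
    show ?case unfolding e using V.N_add_square[OF m] by (simp add: V_N_fun)
   qed
  qed (use iz iv iw in auto)
  then show ?thesis using iz iv iw by (simp add: V_norm_def)
 qed
 have control: "(LINT t|?M. (?H (U t))\<^sup>2) = (LINT t|?M. (?H (Ut t))\<^sup>2) + 2 * (LINT t|?M. ?L (Ut t) (h t)) + (LINT t|?M. (?H (h t))\<^sup>2)"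
 proof -
  have iz: "integrable ?M (%t. (?H (U t))\<^sup>2)" "integrable ?M (%t. (?H (Ut t))\<^sup>2)"
   using UL by (simp_all add: L2_time_def L2_N_fun)
  have "(LINT t|?M. (?H (U t))\<^sup>2) = (LINT t|?M. (?H (Ut t))\<^sup>2 + 2 * ?L (Ut t) (h t) + (?H (h t))\<^sup>2)"
  proof (rule integral_cong_AE)
   show "AE t in ?M. (?H (U t))\<^sup>2 = (?H (Ut t))\<^sup>2 + 2 * ?L (Ut t) (h t) + (?H (h t))\<^sup>2"
    using mem
   proof eventually_elim
    case (elim t)
    have e: "U t = (%x. Ut t x + h t x)" by (rule ext) (simp add: h_def)
    have m: "Ut t \<in> Lp 2 Om" "h t \<in> Lp 2 Om" using elim L2.diff_mem by (auto simp: h_def)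
    have "(?H (%x. Ut t x + h t x))\<^sup>2 = (?H (Ut t))\<^sup>2 + 2 * ?L (Ut t) (h t) + (?H (h t))\<^sup>2"
     using L2.N_add_square[OF m] by (simp add: L2_N)
    then show ?case unfolding e[symmetric] .
   qed
  qed (use iz i1 ih in auto)
  then show ?thesis using iz i1 ih by simp
 qed
 have Xi: "(LINT t|?M. X t) = \<kappa> * (LINT t|?M. ?I (?z t - ud t) (w t))" by (simp add: X_def)
 have h0: "0 <= lam / 2 * (LINT t|?M. (?H (h t))\<^sup>2)" using lam by simp
 have "cost Om T \<kappa> lam ud S U - cost Om T \<kappa> lam ud S Ut = \<kappa> / 2 * (LINT t|?M. (?N (w t))\<^sup>2) + (LINT t|?M. X t)
  + lam * (LINT t|?M. ?L (Ut t) (h t)) + lam / 2 * (LINT t|?M. (?H (h t))\<^sup>2)"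
  unfolding cost_def state control Xi by (simp add: algebra_simps)
 moreover have "(\<kappa> / 2 - K) * (LINT t|?M. (?N (w t))\<^sup>2) = \<kappa> / 2 * (LINT t|?M. (?N (w t))\<^sup>2) - K * (LINT t|?M. (?N (w t))\<^sup>2)"
  by (simp add: left_diff_distrib)
 ultimately show ?thesis using Xint var' h0 unfolding w_def by linarith
qed

end

section \<open>Bounds for the second-order remainder\<close>

context kelvin_voigt begin

lemma remainder_dominated:
 assumes u: "u \<in> V_space Om" and z: "z \<in> V_space Om" and p: "p \<in> V_space Om" and r: "1 <= r" "r <= 5" and \<beta>: "0 <= \<beta>"
  and G: "integrable (leb Om) G"
   "!!x. norm (damping r (u x) - damping r (z x) - damping_deriv r (z x) ((u - z) x)) * norm (p x) <= G x"
 shows "\<bar>remainder \<beta> r u z p\<bar> <= C * (V_norm Om (u - z))\<^sup>2 * V_norm Om p + \<beta> * (LINT x|leb Om. G x)"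
proof -
 have w: "u - z \<in> V_space Om" by (rule V.diff_mem[OF u z])
 let ?R = "%x. damping r (u x) - damping r (z x) - damping_deriv r (z x) ((u - z) x)"
 note i = damping_pairing(1)[OF u r p] damping_pairing(1)[OF z r p] damping_deriv_pairing(1)[OF z w r p]
 have "L2_inner Om (%x. damping r (u x)) p - L2_inner Om (%x. damping r (z x)) p - L2_inner Om (%x. damping_deriv r (z x) ((u - z) x)) p
  = (LINT x|leb Om. ?R x \<bullet> p x)"
  using i by (simp add: L2_inner_def inner_diff_left)
 moreover have "\<bar>LINT x|leb Om. ?R x \<bullet> p x\<bar> <= (LINT x|leb Om. G x)"
 proof (rule integrable_dominated(2)[OF G(1)])
  have "(%x. damping r (u x) \<bullet> p x - damping r (z x) \<bullet> p x - damping_deriv r (z x) ((u - z) x) \<bullet> p x) \<in> bmeas (leb Om)"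
   by (intro borel_measurable_diff borel_measurable_integrable i)
  then show "(%x. ?R x \<bullet> p x) \<in> bmeas (leb Om)" by (simp add: inner_diff_left)
  show "\<bar>?R x \<bullet> p x\<bar> <= G x" for x
   using Cauchy_Schwarz_ineq2[of "?R x" "p x"] G(2)[of x] by linarith
 qed
 moreover have "\<bar>b_form Om (u - z) (u - z) p\<bar> <= C * (V_norm Om (u - z))\<^sup>2 * V_norm Om p"
  using b_integrable(2)[OF w w p] by (simp add: power2_eq_square mult.assoc)
 moreover have "\<bar>b_form Om (u - z) (u - z) p + \<beta> * X\<bar> <= \<bar>b_form Om (u - z) (u - z) p\<bar> + \<beta> * \<bar>X\<bar>" for X
  using abs_triangle_ineq[of "b_form Om (u - z) (u - z) p" "\<beta> * X"] \<beta> by (simp add: abs_mult)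
 moreover have "\<beta> * \<bar>X\<bar> <= \<beta> * Y" if "\<bar>X\<bar> <= Y" for X Y using that \<beta> by (intro mult_left_mono) auto
 ultimately show ?thesis unfolding remainder_def by (smt (verit))
qed

lemma remainder_bound_1:
 assumes "u \<in> V_space Om" "z \<in> V_space Om" "p \<in> V_space Om" "0 <= \<beta>"
 shows "\<bar>remainder \<beta> 1 u z p\<bar> <= C * V_norm Om p * (V_norm Om (u - z))\<^sup>2"
proof -
 have d: "damping 1 v = v" for v by (simp add: damping_def)
 have "\<bar>remainder \<beta> 1 u z p\<bar> <= C * (V_norm Om (u - z))\<^sup>2 * V_norm Om p + \<beta> * (LINT x|leb Om. 0)"
  by (rule remainder_dominated) (use assms in \<open>auto simp: d damping_deriv_def\<close>)
 then show ?thesis by (simp add: mult_ac)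
qed

lemma remainder_bound_2:
 assumes u: "u \<in> V_space Om" and z: "z \<in> V_space Om" and p: "p \<in> V_space Om" and \<beta>: "0 <= \<beta>"
 shows "\<bar>remainder \<beta> 2 u z p\<bar> <= C * (V_norm Om p + 4 * \<beta> * Lp_norm 2 Om p) * (V_norm Om (u - z))\<^sup>2"
proof -
 have w: "u - z \<in> V_space Om" by (rule V.diff_mem[OF u z])
 let ?G = "%x. 4 * (norm ((u - z) x) * norm (p x) * norm ((u - z) x))"
 note H = Holder_4_2_4[OF V_L4(1)[OF w] V_L2[OF p] V_L4(1)[OF w]]
 have "\<bar>remainder \<beta> 2 u z p\<bar> <= C * (V_norm Om (u - z))\<^sup>2 * V_norm Om p + \<beta> * (LINT x|leb Om. ?G x)"
 proof (rule remainder_dominated[OF u z p _ _ \<beta>])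
  show "integrable (leb Om) ?G" using H(1) by simp
  show "norm (damping 2 (u x) - damping 2 (z x) - damping_deriv 2 (z x) ((u - z) x)) * norm (p x) <= ?G x" for x
  proof -
   have "norm (damping 2 (u x) - damping 2 (z x) - damping_deriv 2 (z x) ((u - z) x)) <= 4 * (norm ((u - z) x))\<^sup>2"
    using damping_remainder_bound_2[of "z x" "(u - z) x"] by simp
   from mult_right_mono[OF this norm_ge_zero[of "p x"]] show ?thesis by (simp add: power2_eq_square mult_ac)
  qed
 qed auto
 moreover have "(LINT x|leb Om. ?G x) <= 4 * (C * Lp_norm 2 Om p * (V_norm Om (u - z))\<^sup>2)"
 proof -
  have "Lp_norm 4 Om (u - z) * Lp_norm 2 Om p * Lp_norm 4 Om (u - z) <= (sqrt C * V_norm Om (u - z)) * Lp_norm 2 Om p * (sqrt C * V_norm Om (u - z))"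
   using C_pos by (intro mult_mono V_L4 w mult_nonneg_nonneg Lp_norm_nonneg V_norm_nonneg) auto
  also have "\<dots> = (sqrt C * sqrt C) * Lp_norm 2 Om p * (V_norm Om (u - z))\<^sup>2" by (simp only: power2_eq_square mult_ac)
  finally show ?thesis using H(2) C_pos by simp
 qed
 then have "\<beta> * (LINT x|leb Om. ?G x) <= \<beta> * (4 * (C * Lp_norm 2 Om p * (V_norm Om (u - z))\<^sup>2))"
  using \<beta> by (rule mult_left_mono)
 ultimately show ?thesis by (simp add: algebra_simps)
qed

text \<open>The factor \<open>norm u powr (r - 2)\<close> is taken in \<open>Lp (r + 1)\<close>, where the energy estimate bounds it by \<open>k\<close>, the two factors \<open>u - z\<close> in the space of exponent \<open>12 * (r + 1) / (17 - r)\<close> and \<open>p\<close> in \<open>Lp 6\<close>; the reciprocals, weighted with the powers, add up to one. The weight contains the powers of both \<open>u\<close> and \<open>z\<close>, whence the factor two.\<close>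

lemma remainder_bound_gt_2:
 assumes u: "u \<in> V_space Om" and z: "z \<in> V_space Om" and p: "p \<in> V_space Om" and \<beta>: "0 <= \<beta>" and r: "2 < r" "r <= 5"
  and C6: "0 < C6" "embedding_const Om (12 * (r + 1) / (17 - r)) (sqrt C6)"
  and k: "Lp_norm (r + 1) Om u <= k" "Lp_norm (r + 1) Om z <= k"
 shows "\<bar>remainder \<beta> r u z p\<bar> <= (C + 2 * \<beta> * (C6 * C7) * ((r - 1) * (r + 3)) * k powr (r - 2)) * V_norm Om p * (V_norm Om (u - z))\<^sup>2"
proof -
 have w: "u - z \<in> V_space Om" by (rule V.diff_mem[OF u z])
 let ?q = "12 * (r + 1) / (17 - r)" and ?c = "(r - 1) * (r + 3)"
 have wq: "u - z \<in> Lp ?q Om" "Lp_norm ?q Om (u - z) <= sqrt C6 * V_norm Om (u - z)"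
  using C6(2) w by (auto simp: embedding_const_def)
 have c: "0 <= ?c" using r by simp
 have e: "(r - 2) / (r + 1) + 2 / ?q + 1 / 6 = 1"
 proof -
  have "2 / ?q = (2 * (17 - r)) / (2 * (6 * (r + 1)))" by simp
  also have "\<dots> = (17 - r) / (6 * (r + 1))" by (rule mult_divide_mult_cancel_left) simp
  finally have "2 / ?q = (17 - r) / (6 * (r + 1))" .
  moreover have "(r - 2) / (r + 1) = 6 * (r - 2) / (6 * (r + 1))"
   by (rule mult_divide_mult_cancel_left[symmetric]) simp
  ultimately have "(r - 2) / (r + 1) + 2 / ?q = (6 * (r - 2) + (17 - r)) / (6 * (r + 1))"
   by (simp only: add_divide_distrib)
  also have "6 * (r - 2) + (17 - r) = 5 * (r + 1)" by simp
  also have "5 * (r + 1) / (6 * (r + 1)) = 5 / 6" by (rule mult_divide_mult_cancel_right) (use r in simp)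
  finally have e: "(r - 2) / (r + 1) + 2 / ?q = 5 / 6" .
  show ?thesis unfolding e by simp
 qed
 have q0: "0 < ?q" using r by simp
 have one: "integrable (leb Om) (%x. norm (v x) powr (r - 2) * norm ((u - z) x) powr 2 * norm (p x))"
  "(LINT x|leb Om. norm (v x) powr (r - 2) * norm ((u - z) x) powr 2 * norm (p x)) <= k powr (r - 2) * (C6 * C7) * V_norm Om p * (V_norm Om (u - z))\<^sup>2"
  if v: "v \<in> V_space Om" "Lp_norm (r + 1) Om v <= k" for v
 proof -
  have vL: "v \<in> Lp (r + 1) Om" using Lp_subset_L6[OF V_L6(1)[OF v(1)]] r by simp
  note H = Lp_Holder3[OF vL wq(1) V_L6(1)[OF p], of "r - 2" 2 1]
  show "integrable (leb Om) (%x. norm (v x) powr (r - 2) * norm ((u - z) x) powr 2 * norm (p x))"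
   using H(1) r q0 e by simp
  have "(LINT x|leb Om. norm (v x) powr (r - 2) * norm ((u - z) x) powr 2 * norm (p x))
   <= Lp_norm (r + 1) Om v powr (r - 2) * Lp_norm ?q Om (u - z) powr 2 * Lp_norm 6 Om p"
   using H(2) r q0 e by (simp add: Lp_norm_nonneg)
  also have "\<dots> <= k powr (r - 2) * (sqrt C6 * V_norm Om (u - z)) powr 2 * (C7 * V_norm Om p)"
   using r C6(1) by (intro mult_mono powr_mono2 v(2) wq(2) V_L6(2) p mult_nonneg_nonneg Lp_norm_nonneg V_norm_nonneg) auto
  also have "(sqrt C6 * V_norm Om (u - z)) powr 2 = C6 * (V_norm Om (u - z))\<^sup>2"
   using C6(1) by (simp add: powr_numeral V_norm_nonneg power_mult_distrib)
  finally show "(LINT x|leb Om. norm (v x) powr (r - 2) * norm ((u - z) x) powr 2 * norm (p x)) <= k powr (r - 2) * (C6 * C7) * V_norm Om p * (V_norm Om (u - z))\<^sup>2"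
   by (simp only: mult_ac)
 qed
 let ?g = "%v x. norm (v x) powr (r - 2) * norm ((u - z) x) powr 2 * norm (p x)"
 let ?G = "%x. ?c * (?g u x + ?g z x)"
 have "\<bar>remainder \<beta> r u z p\<bar> <= C * (V_norm Om (u - z))\<^sup>2 * V_norm Om p + \<beta> * (LINT x|leb Om. ?G x)"
 proof (rule remainder_dominated[OF u z p _ _ \<beta>])
  show "integrable (leb Om) ?G"
   by (intro integrable_mult_right Bochner_Integration.integrable_add one u z k)
  show "norm (damping r (u x) - damping r (z x) - damping_deriv r (z x) ((u - z) x)) * norm (p x) <= ?G x" for x
  proof -
   have "norm (damping r (u x) - damping r (z x) - damping_deriv r (z x) ((u - z) x)) <= ?c * (norm (u x) powr (r - 2) + norm (z x) powr (r - 2)) * (norm ((u - z) x))\<^sup>2"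
    using damping_remainder_bound[OF r(1), of "z x" "(u - z) x"] by simp
   from mult_right_mono[OF this norm_ge_zero[of "p x"]]
   show ?thesis unfolding norm_powr_2 by (simp add: algebra_simps)
  qed
 qed (use r in auto)
 moreover have "(LINT x|leb Om. ?G x) <= ?c * (2 * (k powr (r - 2) * (C6 * C7) * V_norm Om p * (V_norm Om (u - z))\<^sup>2))"
 proof -
  have "(LINT x|leb Om. ?G x) = ?c * ((LINT x|leb Om. ?g u x) + (LINT x|leb Om. ?g z x))"
   using one(1)[OF u k(1)] one(1)[OF z k(2)] by simp
  also have "\<dots> <= ?c * (2 * (k powr (r - 2) * (C6 * C7) * V_norm Om p * (V_norm Om (u - z))\<^sup>2))"
   using one(2)[OF u k(1)] one(2)[OF z k(2)] c by (intro mult_left_mono) auto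
  finally show ?thesis .
 qed
 then have "\<beta> * (LINT x|leb Om. ?G x) <= \<beta> * (?c * (2 * (k powr (r - 2) * (C6 * C7) * V_norm Om p * (V_norm Om (u - z))\<^sup>2)))"
  using \<beta> by (rule mult_left_mono)
 moreover have "C * (V_norm Om (u - z))\<^sup>2 * V_norm Om p + \<beta> * (?c * (2 * (k powr (r - 2) * (C6 * C7) * V_norm Om p * (V_norm Om (u - z))\<^sup>2)))
  = (C + 2 * \<beta> * (C6 * C7) * ?c * k powr (r - 2)) * V_norm Om p * (V_norm Om (u - z))\<^sup>2"
  unfolding distrib_right by (simp only: mult_ac)
 ultimately show ?thesis by linarith
qed

text \<open>The summands of the energy are nonnegative, so each of them is bounded by the constant alone. The supremum does not include the initial time, which is a null set in the applications.\<close>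

lemma energy_bound_Lp:
 assumes e: "energy_bound Om T \<mu> \<nu> \<alpha> \<beta> r u K" and pos: "0 <= \<nu>" "0 <= \<alpha>" "0 < \<beta>" "1 <= r" and t: "t \<in> {0<..T}"
 shows "Lp_norm (r + 1) Om (u t) <= (K * (r + 1) / (2 * \<beta>)) powr (1 / (r + 1))"
proof -
 let ?L = "Lp_norm (r + 1) Om (u t)"
 let ?E = "%t. \<alpha> * (H_norm Om (u t))\<^sup>2 + \<nu> * (V_norm Om (u t))\<^sup>2 + 2 * \<beta> / (r + 1) * Lp_norm (r + 1) Om (u t) powr (r + 1)"
 let ?D = "\<mu> * (LINT t|tmeas T. (V_norm Om (time_deriv Om T u t))\<^sup>2)"
 have D: "0 <= ?D" using mu_pos by simp
 have "ereal (?E t) <= (SUP t\<in>{0<..T}. ereal (?E t))" by (rule SUP_upper[OF t])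
 then have "ereal (?E t) + ereal ?D <= ereal K" using e unfolding energy_bound_def by (meson add_right_mono order_trans)
 then have "?E t <= K" using D by simp
 moreover have "0 <= \<alpha> * (H_norm Om (u t))\<^sup>2" "0 <= \<nu> * (V_norm Om (u t))\<^sup>2" using pos by auto
 ultimately have "2 * \<beta> / (r + 1) * ?L powr (r + 1) <= K" by linarith
 then have "?L powr (r + 1) <= K * (r + 1) / (2 * \<beta>)" using pos by (simp add: field_simps)
 then have "(?L powr (r + 1)) powr (1 / (r + 1)) <= (K * (r + 1) / (2 * \<beta>)) powr (1 / (r + 1))"
  using pos by (intro powr_mono2) auto
 then show ?thesis using pos by (simp add: powr_powr Lp_norm_nonneg)
qed

end

section \<open>Divergence-free fields along polygonal paths\<close>

text \<open>The box around an axis-parallel segment.\<close>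

definition thick :: "real => R3 => R3 => R3 set" where
 "thick ep a b = {y. \<forall>i. min (a $ i) (b $ i) - ep <= y $ i \<and> y $ i <= max (a $ i) (b $ i) + ep}"

abbreviation cube :: "R3 => real => R3 set" where "cube x ep \<equiv> thick ep x x"

definition seg_ok :: "R3 set => real => R3 => R3 => bool" where
 "seg_ok Om ep a b \<longleftrightarrow> (\<exists>j. \<forall>i. i \<noteq> j --> a $ i = b $ i) \<and> thick ep a b \<subseteq> Om"

fun path_ok :: "R3 set => real => R3 list => bool" where
 "path_ok Om ep (a # b # xs) \<longleftrightarrow> seg_ok Om ep a b \<and> path_ok Om ep (b # xs)"
| "path_ok Om ep [a] \<longleftrightarrow> seg_ok Om ep a a"
| "path_ok Om ep [] \<longleftrightarrow> False"

definition moll :: "real => R3 => real" where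
 "moll ep y = (\<Prod>i\<in>UNIV. bump (y $ i / ep) / ep)"

text \<open>The mollification with \<open>moll ep\<close> of the current of integration along the segment from \<open>a\<close> to \<open>b\<close>.
 For an axis-parallel segment at most one component is different from zero.\<close>

definition seg_field :: "real => R3 => R3 => field" where
 "seg_field ep a b y = (\<chi> j. (step ((y $ j - a $ j) / ep) - step ((y $ j - b $ j) / ep)) * (\<Prod>i\<in>UNIV - {j}. bump ((y $ i - a $ i) / ep) / ep))"

fun path_field :: "real => R3 list => field" where
 "path_field ep (a # b # xs) = (%y. seg_field ep a b y + path_field ep (b # xs) y)"
| "path_field ep xs = (%y. 0)"

lemma seg_field_nth: "seg_field ep a b y $ j = (step ((y $ j - a $ j) / ep) - step ((y $ j - b $ j) / ep)) * (\<Prod>i\<in>UNIV - {j}. bump ((y $ i - a $ i) / ep) / ep)"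
 by (simp add: seg_field_def)

lemma seg_field_component_zero: "a $ j = b $ j ==> seg_field ep a b y $ j = 0"
 by (simp add: seg_field_nth)

lemma seg_field_same: "seg_field ep a a = (%y. 0)"
 by (rule ext) (simp add: vec_eq_iff seg_field_nth)

lemma compact_thick: "compact (thick ep a b)"
proof -
 have "thick ep a b = cbox (\<chi> i. min (a $ i) (b $ i) - ep) (\<chi> i. max (a $ i) (b $ i) + ep)"
  by (auto simp: thick_def mem_box_cart)
 then show ?thesis by simp
qed

lemma thick_mono: "ep <= ep' ==> thick ep a b \<subseteq> thick ep' a b"
 unfolding thick_def by (auto; smt (verit))

lemma cube_iff: "y \<in> cube x ep \<longleftrightarrow> (\<forall>i. \<bar>y $ i - x $ i\<bar> <= ep)"
 unfolding thick_def by (auto simp: abs_le_iff algebra_simps)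

lemma thick_commute: "thick ep a b = thick ep b a"
 by (simp add: thick_def min.commute max.commute)

lemma seg_ok_mono: "seg_ok Om ep' a b ==> ep <= ep' ==> seg_ok Om ep a b"
 unfolding seg_ok_def using thick_mono by blast

lemma seg_ok_sym: "seg_ok Om ep a b ==> seg_ok Om ep b a"
 unfolding seg_ok_def using thick_commute by metis

lemma seg_ok_same: "seg_ok Om ep a a \<longleftrightarrow> cube a ep \<subseteq> Om"
 by (simp add: seg_ok_def)

lemma seg_ok_end: assumes "seg_ok Om ep a b" shows "seg_ok Om ep a a" "seg_ok Om ep b b"
proof -
 have "cube a ep \<subseteq> thick ep a b" "cube b ep \<subseteq> thick ep a b" unfolding thick_def by (auto; smt (verit))+
 then show "seg_ok Om ep a a" "seg_ok Om ep b b" using assms by (auto simp: seg_ok_def)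
qed

lemma path_ok_mono: "path_ok Om ep' xs ==> ep <= ep' ==> path_ok Om ep xs"
 by (induction Om ep xs rule: path_ok.induct) (auto intro: seg_ok_mono)

lemma path_ok_nonempty: "path_ok Om ep xs ==> xs \<noteq> []"
 by auto

lemma path_ok_append:
 "path_ok Om ep xs ==> path_ok Om ep ys ==> seg_ok Om ep (last xs) (hd ys) ==> path_ok Om ep (xs @ ys)"
proof (induction Om ep xs rule: path_ok.induct)
 case (2 Om ep a)
 then show ?case by (cases ys) auto
qed auto

lemma path_field_append:
 "xs \<noteq> [] ==> ys \<noteq> [] ==> path_field ep (xs @ ys) y = path_field ep xs y + seg_field ep (last xs) (hd ys) y + path_field ep ys y"
proof (induction ep xs rule: path_field.induct)
 case ("2_2" ep a)
 then show ?case by (cases ys) auto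
qed (auto simp: add.assoc)

lemma path_ok_rev: "path_ok Om ep xs ==> path_ok Om ep (rev xs)"
proof (induction Om ep xs rule: path_ok.induct)
 case (1 Om ep a b xs)
 then have "path_ok Om ep (rev (b # xs) @ [a])"
  by (intro path_ok_append) (auto intro: seg_ok_sym dest: seg_ok_end)
 then show ?case by simp
qed auto

lemma seg_field_swap: assumes "seg_ok Om ep a b" shows "seg_field ep b a y = - seg_field ep a b y"
proof -
 obtain j where j: "!!i. i \<noteq> j ==> a $ i = b $ i" using assms by (auto simp: seg_ok_def)
 have "seg_field ep b a y $ i = - seg_field ep a b y $ i" for i
 proof (cases "i = j")
  case True
  have "(\<Prod>i\<in>UNIV - {j}. bump ((y $ i - a $ i) / ep) / ep) = (\<Prod>i\<in>UNIV - {j}. bump ((y $ i - b $ i) / ep) / ep)"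
   by (rule prod.cong) (use j in auto)
  then show ?thesis using True by (simp add: seg_field_nth left_diff_distrib)
 next
  case False
  then show ?thesis using j by (simp add: seg_field_component_zero)
 qed
 then show ?thesis by (simp add: vec_eq_iff)
qed

lemma path_field_rev: "path_ok Om ep xs ==> path_field ep (rev xs) y = - path_field ep xs y"
proof (induction Om ep xs rule: path_ok.induct)
 case (1 Om ep a b xs)
 have "path_field ep (rev (a # b # xs)) y = path_field ep (rev (b # xs)) y + seg_field ep b a y"
  using path_field_append[of "rev (b # xs)" "[a]" ep y] by (simp add: last_rev)
 also have "\<dots> = - path_field ep (b # xs) y - seg_field ep a b y" using 1 seg_field_swap[of Om ep a b y] by simp
 finally show ?case by simp
qed auto

subsection \<open>The fields are divergence-free test fields\<close>

lemma smooth_nth: "smooth h ==> smooth (%y::R3. h ((y $ i - a) / ep))"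
 using smooth_coordinate[of h "- a / ep" "1 / ep" "axis i 1 :: R3"]
 by (simp add: inner_axis diff_divide_distrib add.commute)

lemma smooth_seg_field: "smooth (%y. seg_field ep a b y $ j)"
proof -
 have "smooth (%y::R3. (step ((y $ j - a $ j) / ep) - step ((y $ j - b $ j) / ep)) * (\<Prod>i\<in>UNIV - {j}. bump ((y $ i - a $ i) / ep) * (1 / ep)))"
  by (intro smooth_mult smooth_diff smooth_prod smooth_nth smooth_step smooth_bump smooth_const)
 then show ?thesis by (simp add: seg_field_nth)
qed

lemma seg_field_support:
 assumes ep: "0 < ep" and ok: "seg_ok Om ep a b" and y: "y \<notin> thick ep a b"
 shows "seg_field ep a b y = 0"
proof -
 obtain j where j: "!!i. i \<noteq> j ==> a $ i = b $ i" using ok by (auto simp: seg_ok_def)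
 obtain i where i: "\<not> (min (a $ i) (b $ i) - ep <= y $ i \<and> y $ i <= max (a $ i) (b $ i) + ep)" using y by (auto simp: thick_def)
 have "seg_field ep a b y $ k = 0" for k
 proof (cases "k = j")
  case False
  then show ?thesis using j by (simp add: seg_field_component_zero)
 next
  case k: True
  show ?thesis
  proof (cases "i = j")
   case True
   consider "y $ j < min (a $ j) (b $ j) - ep" | "max (a $ j) (b $ j) + ep < y $ j" using i True by fastforce
   then have "step ((y $ j - a $ j) / ep) = step ((y $ j - b $ j) / ep)"
   proof cases
    case 1
    then have "(y $ j - a $ j) / ep <= -1" "(y $ j - b $ j) / ep <= -1" using ep by (auto simp: field_simps)
    then show ?thesis by (simp add: step_left)
   next
    case 2
    then have "1 <= (y $ j - a $ j) / ep" "1 <= (y $ j - b $ j) / ep" using ep by (auto simp: field_simps)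
    then show ?thesis by (simp add: step_right)
   qed
   then show ?thesis using k by (simp add: seg_field_nth)
  next
   case False
   have "1 <= \<bar>(y $ i - a $ i) / ep\<bar>" using i j[OF False] ep by (auto simp: abs_if field_simps)
   then have "bump ((y $ i - a $ i) / ep) / ep = 0" by (simp add: bump_zero)
   then have "(\<Prod>i\<in>UNIV - {j}. bump ((y $ i - a $ i) / ep) / ep) = 0"
    using False by (intro prod_zero) auto
   then show ?thesis using k by (simp add: seg_field_nth)
  qed
 qed
 then show ?thesis by (simp add: vec_eq_iff)
qed

lemma seg_field_test_fun:
 assumes "0 < ep" "seg_ok Om ep a b" shows "test_fun Om (%y. seg_field ep a b y $ j)"
 by (rule test_funI[OF smooth_seg_field _ compact_thick[of ep a b]])
  (use seg_field_support[OF assms] assms(2) in \<open>auto simp: seg_ok_def\<close>)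

lemma path_field_test_fun:
 "0 < ep ==> path_ok Om ep xs ==> test_fun Om (%y. path_field ep xs y $ j)"
proof (induction Om ep xs rule: path_ok.induct)
 case (1 Om ep a b xs)
 then show ?case using test_fun_add[OF seg_field_test_fun[of ep Om a b j] "1.IH"] by simp
qed (auto simp: test_fun_zero)

lemma smooth_moll: "smooth (%y. moll ep (y - a))"
proof -
 have "smooth (%y::R3. \<Prod>i\<in>UNIV. bump ((y $ i - a $ i) / ep) * (1 / ep))"
  by (intro smooth_prod smooth_mult smooth_nth smooth_bump smooth_const)
 then show ?thesis by (simp add: moll_def)
qed

lemma gradient_seg_field:
 assumes ep: "0 < ep" and j: "!!i. i \<noteq> j ==> a $ i = b $ i"
 shows "gradient (%y. seg_field ep a b y $ j) y $ j = moll ep (y - a) - moll ep (y - b)"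
proof -
 let ?P = "\<Prod>i\<in>UNIV - {j}. bump ((y $ i - a $ i) / ep) / ep"
 have ax: "(y + t *\<^sub>R axis j 1) $ i = y $ i + (if i = j then t else 0)" for t i by (simp add: axis_def)
 have eq: "seg_field ep a b (y + t *\<^sub>R axis j 1) $ j = (step ((y $ j + t - a $ j) / ep) - step ((y $ j + t - b $ j) / ep)) * ?P" for t
 proof -
  have "(\<Prod>i\<in>UNIV - {j}. bump (((y + t *\<^sub>R axis j 1) $ i - a $ i) / ep) / ep) = ?P"
   by (rule prod.cong) (auto simp: axis_def)
  then show ?thesis unfolding seg_field_nth by (simp add: axis_def)
 qed
 have "((%t. (step ((y $ j + t - a $ j) / ep) - step ((y $ j + t - b $ j) / ep)) * ?P) has_real_derivative
   (bump ((y $ j + 0 - a $ j) / ep) * (1 / ep) - bump ((y $ j + 0 - b $ j) / ep) * (1 / ep)) * ?P) (at 0)"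
  by (intro DERIV_cmult_right DERIV_diff DERIV_chain2[OF step_deriv]) (use ep in \<open>auto intro!: derivative_eq_intros\<close>)
 then have "gradient (%y. seg_field ep a b y $ j) y $ j = (bump ((y $ j - a $ j) / ep) / ep - bump ((y $ j - b $ j) / ep) / ep) * ?P"
  using DERIV_unique[OF smooth_directional[OF smooth_seg_field[of ep a b j], of y j]] by (simp add: eq)
 moreover have "moll ep (y - c) = bump ((y $ j - c $ j) / ep) / ep * ?P" if "c = a \<or> c = b" for c
 proof -
  have "moll ep (y - c) = bump ((y $ j - c $ j) / ep) / ep * (\<Prod>i\<in>UNIV - {j}. bump ((y $ i - c $ i) / ep) / ep)"
   unfolding moll_def by (subst prod.remove[of _ j]) auto
  moreover have "(\<Prod>i\<in>UNIV - {j}. bump ((y $ i - c $ i) / ep) / ep) = ?P"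
   by (rule prod.cong) (use that j in auto)
  ultimately show ?thesis by simp
 qed
 ultimately show ?thesis by (simp add: left_diff_distrib)
qed

lemma test_fun_integrable_mult:
 fixes \<psi> f :: "'a::euclidean_space => real"
 shows "test_fun S \<psi> ==> smooth f ==> integrable lborel (%y. \<psi> y * f y)"
 by (rule test_fun_integrable_lborel[OF test_fun_mult])

text \<open>The divergence of the mollified segment is the difference of the mollified point masses at its ends.\<close>

lemma seg_field_divergence:
 assumes ep: "0 < ep" and ok: "seg_ok Om ep a b" and \<phi>: "test_fun S \<phi>"
 shows "(LINT y|lborel. seg_field ep a b y \<bullet> gradient \<phi> y) = (LINT y|lborel. \<phi> y * moll ep (y - b)) - (LINT y|lborel. \<phi> y * moll ep (y - a))"
  and "integrable lborel (%y. seg_field ep a b y \<bullet> gradient \<phi> y)"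
proof -
 obtain j where j: "!!i. i \<noteq> j ==> a $ i = b $ i" using ok by (auto simp: seg_ok_def)
 have inner: "seg_field ep a b y \<bullet> gradient \<phi> y = gradient \<phi> y $ j * seg_field ep a b y $ j" for y
 proof -
  have "seg_field ep a b y \<bullet> gradient \<phi> y = (\<Sum>i\<in>UNIV. seg_field ep a b y $ i * gradient \<phi> y $ i)" by (simp add: inner_vec_def)
  also have "\<dots> = (\<Sum>i\<in>{j}. seg_field ep a b y $ i * gradient \<phi> y $ i)"
   by (rule sum.mono_neutral_right) (auto simp: seg_field_component_zero j)
  finally show ?thesis by simp
 qed
 show "integrable lborel (%y. seg_field ep a b y \<bullet> gradient \<phi> y)"
  unfolding inner by (rule test_fun_integrable_mult[OF test_fun_gradient[OF \<phi>] smooth_seg_field])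
 have "(LINT y|lborel. seg_field ep a b y \<bullet> gradient \<phi> y) = - (LINT y|lborel. \<phi> y * gradient (%y. seg_field ep a b y $ j) y $ j)"
  using integration_by_parts_test_fun[OF test_fun_smooth[OF \<phi>] seg_field_test_fun[OF ep ok, of j], of j] by (simp add: inner)
 also have "\<dots> = - (LINT y|lborel. \<phi> y * moll ep (y - a) - \<phi> y * moll ep (y - b))"
  by (simp add: gradient_seg_field[OF ep j] right_diff_distrib)
 also have "\<dots> = (LINT y|lborel. \<phi> y * moll ep (y - b)) - (LINT y|lborel. \<phi> y * moll ep (y - a))"
  using test_fun_integrable_mult[OF \<phi> smooth_moll[of ep a]] test_fun_integrable_mult[OF \<phi> smooth_moll[of ep b]] by simp
 finally show "(LINT y|lborel. seg_field ep a b y \<bullet> gradient \<phi> y) = (LINT y|lborel. \<phi> y * moll ep (y - b)) - (LINT y|lborel. \<phi> y * moll ep (y - a))" .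
qed

lemma path_field_divergence:
 assumes ep: "0 < ep" and \<phi>: "test_fun S \<phi>"
 shows "path_ok Om ep xs ==> (LINT y|lborel. path_field ep xs y \<bullet> gradient \<phi> y) = (LINT y|lborel. \<phi> y * moll ep (y - last xs)) - (LINT y|lborel. \<phi> y * moll ep (y - hd xs))
  \<and> integrable lborel (%y. path_field ep xs y \<bullet> gradient \<phi> y)"
 using ep
proof (induction Om ep xs rule: path_ok.induct)
 case (1 Om ep a b xs)
 then have ok: "seg_ok Om ep a b" and IH: "(LINT y|lborel. path_field ep (b # xs) y \<bullet> gradient \<phi> y) = (LINT y|lborel. \<phi> y * moll ep (y - last (b # xs))) - (LINT y|lborel. \<phi> y * moll ep (y - b))"
  "integrable lborel (%y. path_field ep (b # xs) y \<bullet> gradient \<phi> y)" by auto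
 then show ?case using seg_field_divergence[OF \<open>0 < ep\<close> ok \<phi>] by (simp add: inner_add_left)
qed auto

text \<open>The point masses at the ends cancel for a closed path.\<close>

lemma (in bounded_open) loop_field_V:
 assumes ep: "0 < ep" and ok: "path_ok Om ep xs" and loop: "hd xs = last xs"
 shows "path_field ep xs \<in> V_space Om"
proof (rule test_field_V[OF path_field_test_fun[OF ep ok]])
 show "div_free Om (path_field ep xs)"
  unfolding div_free_def
 proof (intro allI impI)
  fix \<phi> :: "R3 => real" assume \<phi>: "test_fun Om \<phi>"
  have z: "path_field ep xs x \<bullet> gradient \<phi> x = 0" if "x \<notin> Om" for x
  proof -
   have "path_field ep xs x $ j = 0" for j
    using that test_fun_supportE[OF path_field_test_fun[OF ep ok, of j]] by (metis subsetD)
   then have "path_field ep xs x = 0" by (simp add: vec_eq_iff)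
   then show ?thesis by simp
  qed
  note D = path_field_divergence[OF ep \<phi> ok]
  have "(LINT x|leb Om. path_field ep xs x \<bullet> gradient \<phi> x) = (LINT x|lborel. path_field ep xs x \<bullet> gradient \<phi> x)"
   by (rule LINT_lebesgue_on_support(1)[OF dom_sets]) (use D z in auto)
  then show "(LINT x|leb Om. path_field ep xs x \<bullet> gradient \<phi> x) = 0" using D loop by simp
 qed
qed

subsection \<open>Countably many loops suffice\<close>

text \<open>Rounding coordinates separately keeps axis-parallel segments axis-parallel.\<close>

definition round_pt :: "nat => R3 => R3" where
 "round_pt k x = (\<chi> i. of_int \<lfloor>real (Suc k) * x $ i\<rfloor> / real (Suc k))"

definition rat_pts :: "R3 set" where "rat_pts = {x. \<forall>i. x $ i \<in> \<rat>}"

lemma countable_rat_pts: "countable rat_pts"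
proof -
 have inj: "inj_on (%x::R3. \<lambda>i\<in>UNIV. x $ i) rat_pts" by (auto simp: inj_on_def vec_eq_iff restrict_def fun_eq_iff)
 have "(%x::R3. \<lambda>i\<in>UNIV. x $ i) ` rat_pts \<subseteq> PiE UNIV (%i. \<rat>)" by (auto simp: rat_pts_def)
 moreover have "countable (PiE (UNIV :: 3 set) (%i. \<rat> :: real set))" by (intro countable_PiE) (auto simp: countable_rat)
 ultimately have "countable ((%x::R3. \<lambda>i\<in>UNIV. x $ i) ` rat_pts)" by (rule countable_subset)
 then show ?thesis using countable_image_inj_on inj by blast
qed

lemma round_pt_rat: "round_pt k x \<in> rat_pts"
 by (simp add: round_pt_def rat_pts_def)

lemma round_pt_near: "\<bar>round_pt k x $ i - x $ i\<bar> <= 1 / real (Suc k)"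
proof -
 let ?k = "real (Suc k)"
 have "?k * x $ i - 1 <= of_int \<lfloor>?k * x $ i\<rfloor>" "of_int \<lfloor>?k * x $ i\<rfloor> <= ?k * x $ i" by linarith+
 then have "(?k * x $ i - 1) / ?k <= of_int \<lfloor>?k * x $ i\<rfloor> / ?k" "of_int \<lfloor>?k * x $ i\<rfloor> / ?k <= (?k * x $ i) / ?k"
  by (intro divide_right_mono; simp)+
 then show ?thesis by (simp add: round_pt_def diff_divide_distrib abs_le_iff)
qed

lemma round_pt_tendsto: "(%k. round_pt k x $ i) ----> x $ i"
proof (rule LIM_zero_cancel, rule Lim_null_comparison)
 show "\<forall>\<^sub>F k in sequentially. norm (round_pt k x $ i - x $ i) <= 1 / real (Suc k)" using round_pt_near by simp
 show "(%k. 1 / real (Suc k)) ----> 0" using LIMSEQ_inverse_real_of_nat by (simp add: inverse_eq_divide)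
qed

lemma seg_ok_round:
 assumes ok: "seg_ok Om (2 * ep) a b" and k: "1 / real (Suc k) <= ep"
 shows "seg_ok Om ep (round_pt k a) (round_pt k b)"
proof -
 have "thick ep (round_pt k a) (round_pt k b) \<subseteq> thick (2 * ep) a b"
 proof
  fix y assume y: "y \<in> thick ep (round_pt k a) (round_pt k b)"
  have "min (a $ i) (b $ i) - 2 * ep <= y $ i \<and> y $ i <= max (a $ i) (b $ i) + 2 * ep" for i
  proof -
   have "min (round_pt k a $ i) (round_pt k b $ i) - ep <= y $ i" "y $ i <= max (round_pt k a $ i) (round_pt k b $ i) + ep"
    using y by (auto simp: thick_def)
   then show ?thesis using round_pt_near[of k a i] round_pt_near[of k b i] k by (simp add: min_def max_def abs_le_iff split: if_splits)
  qed
  then show "y \<in> thick (2 * ep) a b" by (simp add: thick_def)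
 qed
 moreover have "\<exists>j. \<forall>i. i \<noteq> j --> round_pt k a $ i = round_pt k b $ i"
 proof -
  obtain j where "\<forall>i. i \<noteq> j --> a $ i = b $ i" using ok by (auto simp: seg_ok_def)
  then have "\<forall>i. i \<noteq> j --> round_pt k a $ i = round_pt k b $ i" by (simp add: round_pt_def)
  then show ?thesis by blast
 qed
 ultimately show ?thesis using ok by (auto simp: seg_ok_def)
qed

text \<open>The room of width \<open>2 * ep\<close> around the path is halved to absorb the rounding error.\<close>

lemma path_ok_round:
 "path_ok Om (2 * ep) xs ==> 1 / real (Suc k) <= ep ==> path_ok Om ep (map (round_pt k) xs)"
proof (induction xs)
 case (Cons a xs)
 then show ?case by (cases xs) (auto intro: seg_ok_round)
qed simp

lemma step_bump_tendsto:
 "(f \<longlongrightarrow> l) F ==> ((%x. step (f x)) \<longlongrightarrow> step l) F" "(f \<longlongrightarrow> l) F ==> ((%x. bump (f x)) \<longlongrightarrow> bump l) F"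
 by (rule continuous_on_tendsto_compose[of UNIV], rule smooth_continuous, simp_all add: smooth_step smooth_bump)+

lemma seg_field_round_tendsto:
 "(%k. seg_field ep (round_pt k a) (round_pt k b) y) ----> seg_field ep a b y"
proof (rule vec_tendstoI)
 fix j
 show "(%k. seg_field ep (round_pt k a) (round_pt k b) y $ j) ----> seg_field ep a b y $ j"
  unfolding seg_field_nth divide_inverse[of _ ep]
  by (intro tendsto_intros step_bump_tendsto round_pt_tendsto)
qed

lemma path_field_round_tendsto:
 "(%k. path_field ep (map (round_pt k) xs) y) ----> path_field ep xs y"
proof (induction ep xs rule: path_field.induct)
 case (1 ep a b xs)
 then show ?case using tendsto_add[OF seg_field_round_tendsto[of ep a b y]] by simp
qed auto

lemma seg_field_bounded:
 assumes "0 < ep"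
 obtains G where "0 <= G" "!!a b y. norm (seg_field ep a b y) <= G"
proof -
 obtain B where B: "0 < B" "!!t. bump t <= B" by (rule bump_bounded) (rule that)
 have "\<bar>seg_field ep a b y $ j\<bar> <= 1 * (\<Prod>i\<in>UNIV - {j}. B / ep)" for a b y j
  unfolding seg_field_nth abs_mult
 proof (rule mult_mono)
  show "\<bar>step ((y $ j - a $ j) / ep) - step ((y $ j - b $ j) / ep)\<bar> <= 1"
   using step_bounds[of "(y $ j - a $ j) / ep"] step_bounds[of "(y $ j - b $ j) / ep"] by (simp add: abs_le_iff)
  show "\<bar>\<Prod>i\<in>UNIV - {j}. bump ((y $ i - a $ i) / ep) / ep\<bar> <= (\<Prod>i\<in>UNIV - {j}. B / ep)"
   unfolding abs_prod by (rule prod_mono) (use assms B bump_nonneg in \<open>auto simp: abs_of_nonneg intro!: divide_right_mono\<close>)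
 qed auto
 then have "norm (seg_field ep a b y) <= (\<Sum>j\<in>(UNIV :: 3 set). (\<Prod>i\<in>UNIV - {j}. B / ep))" for a b y
  by (intro order_trans[OF norm_le_l1_cart] sum_mono) simp
 moreover have "0 <= (\<Sum>j\<in>(UNIV :: 3 set). (\<Prod>i\<in>UNIV - {j}. B / ep))" using assms B by (intro sum_nonneg prod_nonneg) auto
 ultimately show ?thesis using that by blast
qed

lemma path_field_bounded:
 assumes "0 < ep"
 obtains G where "0 <= G" "!!xs y. length xs <= n ==> norm (path_field ep xs y) <= G"
proof -
 obtain G where G: "0 <= G" "!!a b y. norm (seg_field ep a b y) <= G" by (rule seg_field_bounded[OF assms]) (rule that)
 have "norm (path_field ep xs y) <= real (length xs) * G" for xs y
 proof (induction xs rule: induct_list012)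
  case (3 c d xs)
  have "norm (path_field ep (c # d # xs) y) <= G + norm (path_field ep (d # xs) y)"
   using norm_triangle_ineq[of "seg_field ep c d y" "path_field ep (d # xs) y"] G(2)[of c d y] by simp
  also have "\<dots> <= G + real (length (d # xs)) * G" using 3 by simp
  finally show ?case by (simp add: algebra_simps)
 qed (use G in auto)
 moreover have "real (length xs) * G <= real n * G" if "length xs <= n" for xs :: "R3 list"
  using that G by (intro mult_right_mono) auto
 ultimately show ?thesis using that[of "real n * G"] G(1) order_trans by (metis mult_nonneg_nonneg of_nat_0_le_iff)
qed

section \<open>The approximate potentials\<close>

lemma integral_scaled_bump:
 assumes "0 < ep"
 shows "integrable lborel (%x. bump (x / ep) / ep)" "(LINT x|lborel. bump (x / ep) / ep) = 1"
proof -
 show "integrable lborel (%x. bump (x / ep) / ep)"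
  using lborel_integrable_real_affine[OF integrable_lborel_bump, of "1 / ep" 0] assms by simp
 show "(LINT x|lborel. bump (x / ep) / ep) = 1"
  using lborel_integral_real_affine[of "1 / ep" bump 0] assms integral_lborel_bump by simp
qed

lemma moll_nonneg: "0 < ep ==> 0 <= moll ep y"
 unfolding moll_def by (intro prod_nonneg ballI divide_nonneg_nonneg bump_nonneg) simp

lemma moll_measurable: "moll ep \<in> bmeas borel"
 using smooth_borel[OF smooth_moll[of ep 0]] by simp

lemma moll_integral:
 assumes ep: "0 < ep" shows "integrable lborel (moll ep)" "(LINT y|lborel. moll ep y) = 1"
proof -
 let ?f = "%x. bump (x / ep) / ep"
 have B: "(Basis :: R3 set) = range (%i. axis i 1)" by (auto simp: Basis_vec_def)
 have inj: "inj (%i::3. axis i (1::real))" by (auto simp: inj_def axis_eq_axis)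
 have m: "moll ep y = (\<Prod>b\<in>Basis. ?f (y \<bullet> b))" for y
  unfolding moll_def B by (subst prod.reindex[OF inj]) (simp add: inner_axis)
 have nn: "0 <= ?f x" for x using ep bump_nonneg by simp
 have "(\<integral>\<^sup>+y. ennreal (moll ep y) \<partial>lborel) = (\<integral>\<^sup>+y. (\<Prod>b\<in>Basis. ennreal (?f (y \<bullet> b))) \<partial>(lborel :: R3 measure))"
  unfolding m using nn by (subst prod_ennreal) auto
 also have "\<dots> = (\<Prod>b\<in>(Basis :: R3 set). \<integral>\<^sup>+x. ennreal (?f x) \<partial>lborel)"
 proof (rule nn_integral_lborel_prod)
  show "(%x. ennreal (?f x)) \<in> bmeas borel"
   using borel_measurable_integrable[OF integral_scaled_bump(1)[OF ep]] by simp
 qed simp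
 also have "(\<integral>\<^sup>+x. ennreal (?f x) \<partial>lborel) = 1"
  using nn_integral_eq_integral[OF integral_scaled_bump(1)[OF ep]] nn integral_scaled_bump(2)[OF ep] by simp
 finally have *: "(\<integral>\<^sup>+y. ennreal (moll ep y) \<partial>lborel) = 1" by simp
 show i: "integrable lborel (moll ep)"
  by (rule integrableI_nonneg) (use moll_measurable moll_nonneg[OF ep] * in auto)
 have "ennreal (LINT y|lborel. moll ep y) = 1"
  using nn_integral_eq_integral[OF i] moll_nonneg[OF ep] * by simp
 then show "(LINT y|lborel. moll ep y) = 1" by (metis ennreal_eq_1)
qed

lemma moll_integral_translate:
 assumes "0 < ep" shows "integrable lborel (%y. moll ep (y - x))" "(LINT y|lborel. moll ep (y - x)) = 1"
 using lborel_translate[OF moll_integral(1)[OF assms], of "- x"] moll_integral(2)[OF assms] by simp_all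

lemma moll_bounded: assumes "0 < ep" obtains G where "0 <= G" "!!y. moll ep y <= G"
proof -
 obtain B where B: "0 < B" "!!t. bump t <= B" by (rule bump_bounded) (rule that)
 have "moll ep y <= (\<Prod>i\<in>(UNIV :: 3 set). B / ep)" for y
  unfolding moll_def by (rule prod_mono) (use assms B bump_nonneg in \<open>auto intro!: divide_right_mono\<close>)
 then show ?thesis using that[of "\<Prod>i\<in>(UNIV :: 3 set). B / ep"] assms B by (simp add: prod_nonneg)
qed

lemma moll_support: assumes "0 < ep" "moll ep y \<noteq> 0" shows "\<bar>y $ i\<bar> < ep"
proof (rule ccontr)
 assume "\<not> \<bar>y $ i\<bar> < ep"
 then have "1 <= \<bar>y $ i / ep\<bar>" using assms(1) by (simp add: field_simps)
 then have "bump (y $ i / ep) / ep = 0" by (simp add: bump_zero)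
 then have "moll ep y = 0" unfolding moll_def by (intro prod_zero) auto
 then show False using assms(2) by simp
qed

lemma step_lipschitz: obtains G where "0 < G" "!!a b. \<bar>step a - step b\<bar> <= G * \<bar>a - b\<bar>"
proof -
 obtain G where G: "0 < G" "!!t. bump t <= G" by (rule bump_bounded) (rule that)
 have "norm (step a - step b) <= G * norm (a - b)" for a b
  by (rule field_differentiable_bound[of UNIV step bump])
   (use G step_deriv bump_nonneg in \<open>auto intro: has_field_derivative_at_within\<close>)
 then show ?thesis using that G(1) by simp
qed

lemma DERIV_line_shift:
 fixes F :: "'a::real_vector => real"
 assumes "((%t. F ((x + s *\<^sub>R e) + t *\<^sub>R e)) has_real_derivative D) (at 0)"
 shows "((%t. F (x + t *\<^sub>R e)) has_real_derivative D) (at s)"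
proof -
 have "((%t. F ((x + s *\<^sub>R e) + t *\<^sub>R e)) has_real_derivative D) (at (s - s))" using assms by simp
 then have "((%t. F ((x + s *\<^sub>R e) + (t - s) *\<^sub>R e)) has_real_derivative D) (at s)"
  using DERIV_shift[of "%t. F ((x + s *\<^sub>R e) + t *\<^sub>R e)" D s "- s"] by simp
 then show ?thesis by (simp add: algebra_simps)
qed

definition eps :: "nat => real" where "eps n = 1 / real (Suc n)"

lemma eps_pos: "0 < eps n" by (simp add: eps_def)

lemma eps_tendsto: "eps ----> 0"
 using LIMSEQ_inverse_real_of_nat unfolding eps_def by (simp add: inverse_eq_divide)

lemma eps_eventually: assumes "0 < \<rho>" obtains N where "!!n. N <= n ==> eps n <= \<rho>"
proof -
 have "\<forall>\<^sub>F n in sequentially. eps n < \<rho>" by (rule order_tendstoD(2)[OF eps_tendsto assms])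
 then show ?thesis using that unfolding eventually_sequentially by (meson less_imp_le)
qed

lemma cube_subset: assumes "open S" "x \<in> S" obtains \<rho> where "0 < \<rho>" "cube x (2 * \<rho>) \<subseteq> S"
proof -
 obtain e where e: "0 < e" "ball x e \<subseteq> S" using assms open_contains_ball by blast
 have "cube x (2 * (e / 8)) \<subseteq> ball x e"
 proof
  fix y assume y: "y \<in> cube x (2 * (e / 8))"
  have "norm (y - x) <= (\<Sum>i\<in>UNIV. \<bar>(y - x) $ i\<bar>)" by (rule norm_le_l1_cart)
  also have "\<dots> <= (\<Sum>i\<in>(UNIV :: 3 set). e / 4)" using y by (intro sum_mono) (simp add: cube_iff)
  finally have "norm (y - x) < e" using e(1) by simp
  then show "y \<in> ball x e" by (simp add: dist_norm norm_minus_commute)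
 qed
 then show ?thesis using that[of "e / 8"] e by auto
qed

locale bounded_field = bounded_open +
 fixes h :: field and M :: real
 assumes h_borel: "h \<in> bmeas borel" and h_bound: "!!y. norm (h y) <= M" and h_zero: "!!y. y \<notin> Om ==> h y = 0"
begin

lemma M_nonneg: "0 <= M" using h_bound[of 0] norm_ge_zero order_trans by blast

lemma dom_integrable: "integrable lborel (indicator Om :: R3 => real)"
 using emeasure_bounded_finite[OF bounded_dom] open_dom by (intro integrable_real_indicator) auto

lemma h_nth_bound: "\<bar>h y $ j\<bar> <= M * indicator Om y"
 using component_le_norm_cart[of "h y" j] h_bound[of y] h_zero[of y] by (cases "y \<in> Om") auto

lemma h_nth_borel: "(%y. h y $ j) \<in> bmeas borel"
 using h_borel by (simp add: borel_measurable_vec_iff)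

lemma h_mult_integrable:
 fixes v :: "R3 => real"
 assumes "v \<in> bmeas borel" "!!y. \<bar>v y\<bar> <= B"
 shows "integrable lborel (%y. h y $ j * v y)"
proof (rule integrable_dominated(1))
 show "integrable lborel (%y. M * B * indicator Om y)" using dom_integrable by simp
 show "(%y. h y $ j * v y) \<in> bmeas lborel" using h_nth_borel assms(1) by simp
 show "\<bar>h y $ j * v y\<bar> <= M * B * indicator Om y" for y
 proof -
  have "\<bar>h y $ j\<bar> * \<bar>v y\<bar> <= (M * indicator Om y) * B"
   by (intro mult_mono h_nth_bound assms(2)) (use M_nonneg in auto)
  then show ?thesis by (simp add: abs_mult mult_ac)
 qed
qed

lemma h_inner_integrable:
 fixes v :: field
 assumes "!!j. (%y. v y $ j) \<in> bmeas borel" "!!y. norm (v y) <= B"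
 shows "integrable lborel (%y. h y \<bullet> v y)"
 unfolding inner_vec_def
proof (rule Bochner_Integration.integrable_sum)
 fix j
 have "\<bar>v y $ j\<bar> <= B" for y using component_le_norm_cart[of "v y" j] assms(2)[of y] by linarith
 from h_mult_integrable[OF assms(1)[of j] this, of j] show "integrable lborel (%y. h y $ j \<bullet> v y $ j)" by simp
qed

lemma seg_integrable: assumes "0 < ep" shows "integrable lborel (%y. h y \<bullet> seg_field ep a b y)"
proof -
 obtain G where G: "!!a b y. norm (seg_field ep a b y) <= G" by (rule seg_field_bounded[OF assms]) (rule that)
 show ?thesis by (rule h_inner_integrable[OF smooth_borel[OF smooth_seg_field] G])
qed

lemma path_field_borel: "(%y. path_field ep xs y $ j) \<in> bmeas borel"
proof (induction ep xs rule: path_field.induct)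
 case (1 ep a b xs)
 then show ?case using smooth_borel[OF smooth_seg_field[of ep a b j]] by simp
qed auto

lemma path_integrable: assumes "0 < ep" shows "integrable lborel (%y. h y \<bullet> path_field ep xs y)"
proof -
 obtain G where "!!ys y. length ys <= length xs ==> norm (path_field ep ys y) <= G"
  by (rule path_field_bounded[OF assms, of "length xs"]) (rule that)
 then show ?thesis by (intro h_inner_integrable path_field_borel) auto
qed

definition mh :: "nat => 3 => R3 => real" where
 "mh n j x = (LINT y|lborel. h y $ j * moll (eps n) (y - x))"

lemma mh_bound: "\<bar>mh n j x\<bar> <= M"
proof -
 note T = moll_integral_translate[OF eps_pos, of n x]
 obtain G where G: "!!y. moll (eps n) y <= G" by (rule moll_bounded[OF eps_pos]) (rule that)
 have "\<bar>mh n j x\<bar> <= (LINT y|lborel. M * moll (eps n) (y - x))"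
  unfolding mh_def
 proof (rule integrable_dominated(2))
  show "integrable lborel (%y. M * moll (eps n) (y - x))" using T by simp
  show "(%y. h y $ j * moll (eps n) (y - x)) \<in> bmeas lborel"
   using h_nth_borel smooth_borel[OF smooth_moll] by simp
  show "\<bar>h y $ j * moll (eps n) (y - x)\<bar> <= M * moll (eps n) (y - x)" for y
   using component_le_norm_cart[of "h y" j] h_bound[of y] moll_nonneg[OF eps_pos, of n "y - x"]
   by (simp add: abs_mult mult_right_mono)
 qed
 then show ?thesis using T by simp
qed

end

text \<open>The assumption on loops is the absence of circulation at scale \<open>eps n\<close>, inside the part of the domain that has room \<open>2 * eps n\<close>.\<close>

locale potential = bounded_field +
 fixes x0 :: R3
 assumes conn: "connected Om" and x0: "x0 \<in> Om"
  and loops: "!!n xs. path_ok Om (2 * eps n) xs ==> hd xs = last xs ==> (LINT y|lborel. h y \<bullet> path_field (eps n) xs y) = 0"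
begin

definition path_to :: "nat => R3 => R3 list => bool" where
 "path_to n x xs \<longleftrightarrow> path_ok Om (2 * eps n) xs \<and> hd xs = x0 \<and> last xs = x"

text \<open>For a fixed scale the boundary layer and thin parts of the domain cannot be reached from \<open>x0\<close>; every point is reached once the scale is small.\<close>

definition reach :: "nat => R3 => bool" where "reach n x \<longleftrightarrow> (\<exists>xs. path_to n x xs)"

text \<open>The choice of the path is immaterial by \<open>pot_eq\<close>: two paths with the same end form a loop.\<close>

definition pot :: "nat => R3 => real" where
 "pot n x = (LINT y|lborel. h y \<bullet> path_field (eps n) (SOME xs. path_to n x xs) y)"

lemma pot_eq: assumes "path_to n x xs" shows "pot n x = (LINT y|lborel. h y \<bullet> path_field (eps n) xs y)"
proof -
 define ys where "ys = (SOME xs. path_to n x xs)"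
 have ys: "path_to n x ys" unfolding ys_def by (rule someI[of "path_to n x", OF assms])
 have ne: "xs \<noteq> []" "ys \<noteq> []" using assms ys path_ok_nonempty by (auto simp: path_to_def)
 have hl: "hd (rev ys) = x" "last (rev ys) = x0" using ys ne by (auto simp: path_to_def hd_rev last_rev)
 have okr: "path_ok Om (2 * eps n) (rev ys)" using ys by (auto simp: path_to_def intro: path_ok_rev)
 have end_ok: "path_ok Om ep zs ==> seg_ok Om ep (last zs) (last zs)" for ep zs
  by (induction Om ep zs rule: path_ok.induct) auto
 have "path_ok Om (2 * eps n) (xs @ rev ys)"
  using assms okr end_ok[of "2 * eps n" xs] hl by (intro path_ok_append) (auto simp: path_to_def)
 then have "0 = (LINT y|lborel. h y \<bullet> path_field (eps n) (xs @ rev ys) y)"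
  using loops[of n "xs @ rev ys"] assms ne hl by (simp add: path_to_def)
 also have "\<dots> = (LINT y|lborel. h y \<bullet> path_field (eps n) xs y - h y \<bullet> path_field (eps n) ys y)"
 proof (rule Bochner_Integration.integral_cong[OF refl])
  fix y
  have "path_field (eps n) (xs @ rev ys) y = path_field (eps n) xs y - path_field (eps n) ys y"
   using path_field_append[of xs "rev ys" "eps n" y] ne hl assms path_field_rev[of Om "2 * eps n" ys]
    path_field_rev[OF path_ok_mono[of Om "2 * eps n" ys "eps n"], of y] ys eps_pos[of n]
   by (simp add: path_to_def seg_field_same)
  then show "h y \<bullet> path_field (eps n) (xs @ rev ys) y = h y \<bullet> path_field (eps n) xs y - h y \<bullet> path_field (eps n) ys y"
   by (simp add: inner_diff_right)
 qed
 also have "\<dots> = (LINT y|lborel. h y \<bullet> path_field (eps n) xs y) - pot n x"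
  unfolding pot_def ys_def[symmetric] by (intro Bochner_Integration.integral_diff path_integrable eps_pos)
 finally show ?thesis by simp
qed

lemma reach_seg:
 assumes r: "reach n x" and ok: "seg_ok Om (2 * eps n) x y"
 shows "reach n y" "pot n y = pot n x + (LINT z|lborel. h z \<bullet> seg_field (eps n) x y z)"
proof -
 obtain xs where xs: "path_to n x xs" using r by (auto simp: reach_def)
 have ne: "xs \<noteq> []" using xs path_ok_nonempty by (auto simp: path_to_def)
 have xsy: "path_to n y (xs @ [y])"
  using xs ok ne seg_ok_end(2)[OF ok] unfolding path_to_def by (auto intro!: path_ok_append)
 then show "reach n y" by (auto simp: reach_def)
 have "pot n y = (LINT z|lborel. h z \<bullet> path_field (eps n) (xs @ [y]) z)" by (rule pot_eq[OF xsy])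
 also have "\<dots> = (LINT z|lborel. h z \<bullet> path_field (eps n) xs z + h z \<bullet> seg_field (eps n) x y z)"
  using path_field_append[OF ne, of "[y]"] xs by (simp add: path_to_def inner_add_right)
 also have "\<dots> = pot n x + (LINT z|lborel. h z \<bullet> seg_field (eps n) x y z)"
  unfolding pot_eq[OF xs] by (intro Bochner_Integration.integral_add path_integrable seg_integrable eps_pos)
 finally show "pot n y = pot n x + (LINT z|lborel. h z \<bullet> seg_field (eps n) x y z)" .
qed

lemma axis_seg_ok:
 assumes "cube x (3 * eps n) \<subseteq> Om" "\<bar>t\<bar> <= eps n"
 shows "seg_ok Om (2 * eps n) x (x + t *\<^sub>R axis j 1)"
proof -
 have "thick (2 * eps n) x (x + t *\<^sub>R axis j 1) \<subseteq> cube x (3 * eps n)"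
 proof
  fix y assume y: "y \<in> thick (2 * eps n) x (x + t *\<^sub>R axis j 1)"
  have "\<bar>y $ i - x $ i\<bar> <= 3 * eps n" for i
  proof -
   have "min (x $ i) (x $ i + (if i = j then t else 0)) - 2 * eps n <= y $ i" "y $ i <= max (x $ i) (x $ i + (if i = j then t else 0)) + 2 * eps n"
    using y by (auto simp: thick_def axis_def dest: spec[of _ i] split: if_splits)
   then show ?thesis using assms(2) eps_pos[of n] by (auto simp: min_def max_def abs_le_iff split: if_splits)
  qed
  then show "y \<in> cube x (3 * eps n)" by (simp add: cube_iff)
 qed
 moreover have "\<exists>k. \<forall>i. i \<noteq> k --> x $ i = (x + t *\<^sub>R axis j 1) $ i" by (intro exI[of _ j]) (simp add: axis_def)
 ultimately show ?thesis using assms(1) by (auto simp: seg_ok_def)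
qed

text \<open>A short axis-parallel segment changes the potential by the mollified field integrated over it, whose difference quotients converge under the integral.\<close>

lemma pot_derivative:
 assumes r: "reach n x" and c: "cube x (3 * eps n) \<subseteq> Om"
 shows "((%t. pot n (x + t *\<^sub>R axis j 1)) has_real_derivative mh n j x) (at 0)"
 unfolding DERIV_def tendsto_at_iff_sequentially comp_def
proof (intro allI impI)
 fix X :: "nat => real" assume X0: "\<forall>i. X i \<in> UNIV - {0}" and X: "X ----> 0"
 let ?e = "eps n"
 obtain G where G: "0 < G" "!!a b. \<bar>step a - step b\<bar> <= G * \<bar>a - b\<bar>" by (rule step_lipschitz) (rule that)
 obtain B where B: "0 < B" "!!t. bump t <= B" by (rule bump_bounded) (rule that)
 let ?P = "%y. \<Prod>i\<in>UNIV - {j}. bump ((y $ i - x $ i) / ?e) / ?e"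
 define q where "q k y = (step ((y $ j - x $ j) / ?e) - step ((y $ j - x $ j - X k) / ?e)) / X k" for k and y :: R3
 have Pn: "0 <= ?P y" "?P y <= (B / ?e) ^ 2" for y
 proof -
  show "0 <= ?P y" by (intro prod_nonneg) (use bump_nonneg eps_pos[of n] in auto)
  have "?P y <= (\<Prod>i\<in>UNIV - {j}. B / ?e)"
   by (rule prod_mono) (use B bump_nonneg eps_pos[of n] in \<open>auto intro!: divide_right_mono\<close>)
  then show "?P y <= (B / ?e) ^ 2" by simp
 qed
 have Pm: "?P \<in> bmeas borel"
 proof -
  have "smooth (%y::R3. \<Prod>i\<in>UNIV - {j}. bump ((y $ i - x $ i) / ?e) * (1 / ?e))"
   by (intro smooth_prod smooth_mult smooth_nth smooth_bump smooth_const)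
  from smooth_borel[OF this] show ?thesis by simp
 qed
 have qm: "q k \<in> bmeas borel" for k
 proof -
  have "smooth (%y::R3. (step ((y $ j - x $ j) / ?e) - step ((y $ j - (x $ j + X k)) / ?e)) * (1 / X k))"
   by (intro smooth_mult smooth_diff smooth_nth smooth_step smooth_const)
  from smooth_borel[OF this] show ?thesis unfolding q_def by (simp add: diff_diff_eq)
 qed
 have qb: "\<bar>q k y\<bar> <= G / ?e" for k y
 proof -
  have Xk: "X k \<noteq> 0" using X0 by auto
  have "\<bar>step ((y $ j - x $ j) / ?e) - step ((y $ j - x $ j - X k) / ?e)\<bar> <= G * \<bar>(y $ j - x $ j) / ?e - (y $ j - x $ j - X k) / ?e\<bar>"
   by (rule G(2))
  also have "(y $ j - x $ j) / ?e - (y $ j - x $ j - X k) / ?e = X k / ?e" by (simp add: diff_divide_distrib)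
  finally show ?thesis using Xk eps_pos[of n] by (simp add: q_def abs_divide divide_le_eq)
 qed
 have "(%k. LINT y|lborel. h y $ j * (q k y * ?P y)) ----> (LINT y|lborel. h y $ j * (bump ((y $ j - x $ j) / ?e) / ?e * ?P y))"
 proof (rule integral_dominated_convergence[where w="%y. M * (G / ?e * (B / ?e)^2) * indicator Om y"])
  have bm: "(%y::R3. bump ((y $ j - x $ j) / ?e) / ?e) \<in> bmeas borel"
   using smooth_borel[OF smooth_nth[OF smooth_bump]] by simp
  have "(%y. h y $ j * (bump ((y $ j - x $ j) / ?e) / ?e * ?P y)) \<in> bmeas borel"
   by (intro borel_measurable_times h_nth_borel bm Pm)
  then show "(%y. h y $ j * (bump ((y $ j - x $ j) / ?e) / ?e * ?P y)) \<in> bmeas lborel" by simp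
  have "(%y. h y $ j * (q k y * ?P y)) \<in> bmeas borel" for k
   by (intro borel_measurable_times h_nth_borel qm Pm)
  then show "(%y. h y $ j * (q k y * ?P y)) \<in> bmeas lborel" for k by simp
  show "integrable lborel (%y. M * (G / ?e * (B / ?e)^2) * indicator Om y)" using dom_integrable by simp
  show "AE y in lborel. norm (h y $ j * (q k y * ?P y)) <= M * (G / ?e * (B / ?e)^2) * indicator Om y" for k
  proof (intro always_eventually allI)
   fix y
   have qP: "\<bar>q k y\<bar> * \<bar>?P y\<bar> <= G / ?e * (B / ?e)^2"
    using Pn[of y] by (intro mult_mono qb) (use G eps_pos[of n] in auto)
   have "\<bar>h y $ j\<bar> * (\<bar>q k y\<bar> * \<bar>?P y\<bar>) <= (M * indicator Om y) * (G / ?e * (B / ?e)^2)"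
    by (rule mult_mono[OF h_nth_bound qP]) (use M_nonneg in auto)
   then show "norm (h y $ j * (q k y * ?P y)) <= M * (G / ?e * (B / ?e)^2) * indicator Om y"
    unfolding real_norm_def abs_mult by (simp only: mult_ac)
  qed
  show "AE y in lborel. (%k. h y $ j * (q k y * ?P y)) ----> h y $ j * (bump ((y $ j - x $ j) / ?e) / ?e * ?P y)"
  proof (intro always_eventually allI tendsto_mult tendsto_const)
   fix y :: R3
   let ?c = "y $ j - x $ j"
   have "((%s. - step ((?c - s) / ?e)) has_real_derivative - (bump ((?c - 0) / ?e) * (- 1 / ?e))) (at 0)"
    by (intro DERIV_minus DERIV_chain2[OF step_deriv]) (use eps_pos[of n] in \<open>auto intro!: derivative_eq_intros\<close>)
   then have "((%s. (step (?c / ?e) - step ((?c - s) / ?e)) / s) \<longlongrightarrow> bump (?c / ?e) / ?e) (at 0)"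
    by (simp add: DERIV_def)
   then have "((%s. (step (?c / ?e) - step ((?c - s) / ?e)) / s) \<circ> X) ----> bump (?c / ?e) / ?e"
    using X X0 unfolding tendsto_at_iff_sequentially by blast
   then show "(%k. q k y) ----> bump (?c / ?e) / ?e" by (simp add: q_def comp_def)
  qed
 qed
 moreover have "(LINT y|lborel. h y $ j * (bump ((y $ j - x $ j) / ?e) / ?e * ?P y)) = mh n j x"
  unfolding mh_def moll_def by (subst prod.remove[of UNIV j]) auto
 moreover have "\<forall>\<^sub>F k in sequentially. (LINT y|lborel. h y $ j * (q k y * ?P y)) = (pot n (x + (0 + X k) *\<^sub>R axis j 1) - pot n (x + 0 *\<^sub>R axis j 1)) / X k"
 proof -
  have "\<forall>\<^sub>F k in sequentially. \<bar>X k\<bar> < ?e" using order_tendstoD(2)[OF tendsto_rabs_zero[OF X] eps_pos] .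
  then show ?thesis
  proof eventually_elim
   case (elim k)
   let ?b = "x + X k *\<^sub>R axis j 1"
   have "pot n ?b - pot n x = (LINT z|lborel. h z \<bullet> seg_field ?e x ?b z)"
    using reach_seg(2)[OF r axis_seg_ok[OF c, of "X k" j]] elim by simp
   also have "\<dots> = (LINT z|lborel. X k * (h z $ j * (q k z * ?P z)))"
   proof (rule Bochner_Integration.integral_cong[OF refl])
    fix z
    have "h z \<bullet> seg_field ?e x ?b z = (\<Sum>i\<in>UNIV. h z $ i * seg_field ?e x ?b z $ i)" by (simp add: inner_vec_def)
    also have "\<dots> = (\<Sum>i\<in>{j}. h z $ i * seg_field ?e x ?b z $ i)"
     by (rule sum.mono_neutral_right) (auto simp: seg_field_component_zero axis_def)
    also have "\<dots> = h z $ j * ((step ((z $ j - x $ j) / ?e) - step ((z $ j - x $ j - X k) / ?e)) * ?P z)"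
     by (simp add: seg_field_nth axis_def diff_diff_eq)
    finally show "h z \<bullet> seg_field ?e x ?b z = X k * (h z $ j * (q k z * ?P z))"
     using X0 by (simp add: q_def)
   qed
   finally have "pot n ?b - pot n x = X k * (LINT y|lborel. h y $ j * (q k y * ?P y))" by simp
   then show ?case using X0 by (simp add: field_simps)
  qed
 qed
 ultimately show "(%k. (pot n (x + (0 + X k) *\<^sub>R axis j 1) - pot n (x + 0 *\<^sub>R axis j 1)) / X k) ----> mh n j x"
  using Lim_transform_eventually by fastforce
qed

lemma cube_in_cube: "y \<in> cube x \<rho> ==> \<delta> <= \<rho> ==> cube y \<delta> \<subseteq> cube x (2 * \<rho>)"
 unfolding subset_iff cube_iff
proof (intro allI impI)
 fix t i assume "\<forall>i. \<bar>y $ i - x $ i\<bar> <= \<rho>" "\<delta> <= \<rho>" "\<forall>i. \<bar>t $ i - y $ i\<bar> <= \<delta>"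
 then have "\<bar>y $ i - x $ i\<bar> <= \<rho>" "\<bar>t $ i - y $ i\<bar> <= \<rho>" by (auto intro: order_trans)
 then show "\<bar>t $ i - x $ i\<bar> <= 2 * \<rho>" by linarith
qed

lemma pot_local_axis:
 assumes c: "cube x (2 * \<rho>) \<subseteq> Om" and n: "3 * eps n <= \<rho>" and y: "y \<in> cube x \<rho>" and z: "z \<in> cube x \<rho>"
  and r: "reach n y" and yz: "!!i. i \<noteq> j ==> z $ i = y $ i"
 shows "reach n z \<and> \<bar>pot n z - pot n y\<bar> <= M * \<bar>z $ j - y $ j\<bar>"
proof -
 have reach': "reach n v" if v: "v \<in> cube x \<rho>" "!!i. i \<noteq> j ==> v $ i = y $ i" for v
 proof (rule reach_seg(1)[OF r])
  have "thick (2 * eps n) y v \<subseteq> cube x (2 * \<rho>)"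
  proof
   fix u assume u: "u \<in> thick (2 * eps n) y v"
   have "\<bar>u $ i - x $ i\<bar> <= 2 * \<rho>" for i
   proof -
    have "min (y $ i) (v $ i) - 2 * eps n <= u $ i" "u $ i <= max (y $ i) (v $ i) + 2 * eps n" using u by (auto simp: thick_def)
    moreover have "\<bar>y $ i - x $ i\<bar> <= \<rho>" "\<bar>v $ i - x $ i\<bar> <= \<rho>" using y v(1) by (auto simp: cube_iff)
    ultimately show ?thesis using n eps_pos[of n] by (simp add: min_def max_def abs_le_iff split: if_splits)
   qed
   then show "u \<in> cube x (2 * \<rho>)" by (simp add: cube_iff)
  qed
  then show "seg_ok Om (2 * eps n) y v" using c v(2) unfolding seg_ok_def by (metis subset_trans)
 qed
 define t where "t = z $ j - y $ j"
 have zy: "z = y + t *\<^sub>R axis j 1" using yz by (auto simp: vec_eq_iff t_def axis_def)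
 have pt: "y + \<tau> *\<^sub>R axis j 1 \<in> cube x \<rho>" if "\<tau> \<in> closed_segment 0 t" for \<tau>
 proof -
  have "min 0 t <= \<tau>" "\<tau> <= max 0 t" using that by (auto simp: closed_segment_eq_real_ivl split: if_splits)
  then have "\<bar>y $ j + \<tau> - x $ j\<bar> <= \<rho>"
  proof -
   have "\<bar>y $ j - x $ j\<bar> <= \<rho>" "\<bar>z $ j - x $ j\<bar> <= \<rho>" using y z by (auto simp: cube_iff)
   with \<open>min 0 t <= \<tau>\<close> \<open>\<tau> <= max 0 t\<close> show ?thesis by (simp add: t_def min_def max_def abs_le_iff split: if_splits)
  qed
  then show ?thesis using y unfolding cube_iff by (auto simp: axis_def)
 qed
 have "norm (pot n (y + t *\<^sub>R axis j 1) - pot n (y + 0 *\<^sub>R axis j 1)) <= M * norm (t - 0)"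
 proof (rule field_differentiable_bound[of "closed_segment 0 t" "%\<tau>. pot n (y + \<tau> *\<^sub>R axis j 1)" "%\<tau>. mh n j (y + \<tau> *\<^sub>R axis j 1)"])
  fix \<tau> assume \<tau>: "\<tau> \<in> closed_segment 0 t"
  have 1: "reach n (y + \<tau> *\<^sub>R axis j 1)" by (rule reach'[OF pt[OF \<tau>]]) (simp add: axis_def)
  have 2: "cube (y + \<tau> *\<^sub>R axis j 1) (3 * eps n) \<subseteq> Om" using cube_in_cube[OF pt[OF \<tau>] n] c by blast
  have "((%\<tau>. pot n (y + \<tau> *\<^sub>R axis j 1)) has_real_derivative mh n j (y + \<tau> *\<^sub>R axis j 1)) (at \<tau>)"
   by (rule DERIV_line_shift[where F="pot n", OF pot_derivative[OF 1 2, of j]])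
  then show "((%\<tau>. pot n (y + \<tau> *\<^sub>R axis j 1)) has_field_derivative mh n j (y + \<tau> *\<^sub>R axis j 1)) (at \<tau> within closed_segment 0 t)"
   by (rule has_field_derivative_at_within)
  show "norm (mh n j (y + \<tau> *\<^sub>R axis j 1)) <= M" using mh_bound by simp
 qed auto
 then show ?thesis using reach'[OF z yz] unfolding zy[symmetric] by (simp add: t_def)
qed

text \<open>Two points of a cube are joined inside it by three axis-parallel segments.\<close>

lemma pot_local:
 assumes c: "cube x (2 * \<rho>) \<subseteq> Om" and n: "3 * eps n <= \<rho>" and y: "y \<in> cube x \<rho>" and z: "z \<in> cube x \<rho>" and r: "reach n y"
 shows "reach n z" "\<bar>pot n z - pot n y\<bar> <= M * (\<Sum>i\<in>UNIV. \<bar>z $ i - y $ i\<bar>)"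
proof -
 define a where "a = (\<chi> i. if i = (1::3) then z $ i else y $ i)"
 define b where "b = (\<chi> i. if i = (3::3) then y $ i else z $ i)"
 have ab: "a \<in> cube x \<rho>" "b \<in> cube x \<rho>" using y z by (auto simp: cube_iff a_def b_def)
 have 1: "reach n a \<and> \<bar>pot n a - pot n y\<bar> <= M * \<bar>a $ 1 - y $ 1\<bar>"
  by (rule pot_local_axis[OF c n y ab(1) r]) (simp add: a_def)
 have 2: "reach n b \<and> \<bar>pot n b - pot n a\<bar> <= M * \<bar>b $ 2 - a $ 2\<bar>"
 proof (rule pot_local_axis[OF c n ab(1,2) conjunct1[OF 1]])
  fix i :: 3 assume "i \<noteq> 2"
  then have "i = 1 \<or> i = 3" using exhaust_3[of i] by auto
  then show "b $ i = a $ i" by (auto simp: a_def b_def)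
 qed
 have 3: "reach n z \<and> \<bar>pot n z - pot n b\<bar> <= M * \<bar>z $ 3 - b $ 3\<bar>"
  by (rule pot_local_axis[OF c n ab(2) z conjunct1[OF 2]]) (simp add: b_def)
 show "reach n z" using 3 by simp
 have "\<bar>pot n z - pot n y\<bar> <= M * \<bar>z $ 1 - y $ 1\<bar> + M * \<bar>z $ 2 - y $ 2\<bar> + M * \<bar>z $ 3 - y $ 3\<bar>"
 proof -
  have e: "a $ 1 = z $ 1" "b $ 2 = z $ 2" "a $ 2 = y $ 2" "b $ 3 = y $ 3" by (simp_all add: a_def b_def)
  show ?thesis using conjunct2[OF 1] conjunct2[OF 2] conjunct2[OF 3] unfolding e by linarith
 qed
 then show "\<bar>pot n z - pot n y\<bar> <= M * (\<Sum>i\<in>UNIV. \<bar>z $ i - y $ i\<bar>)" by (simp add: sum_3 distrib_left)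
qed

lemma ball_subset_cube: "ball x \<rho> \<subseteq> cube x \<rho>"
proof
 fix y assume "y \<in> ball x \<rho>"
 then have "norm (y - x) <= \<rho>" by (simp add: dist_norm norm_minus_commute)
 then show "y \<in> cube x \<rho>" unfolding cube_iff using component_le_norm_cart[of "y - x"] by (metis order_trans vector_minus_component)
qed

text \<open>By connectedness every point is eventually reached, with bounded potentials.\<close>

lemma eventually_reach:
 assumes "x \<in> Om" shows "\<exists>N K. \<forall>n\<ge>N. reach n x \<and> \<bar>pot n x\<bar> <= K"
proof (rule connected_induction_simple[where P="%x. \<exists>N K. \<forall>n\<ge>N. reach n x \<and> \<bar>pot n x\<bar> <= K", OF conn x0 assms])
 show "\<exists>N K. \<forall>n\<ge>N. reach n x0 \<and> \<bar>pot n x0\<bar> <= K"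
 proof -
  obtain \<rho> where \<rho>: "0 < \<rho>" "cube x0 (2 * \<rho>) \<subseteq> Om" by (rule cube_subset[OF open_dom x0]) (rule that)
  obtain N where N: "!!n. N <= n ==> eps n <= \<rho>" by (rule eps_eventually[OF \<rho>(1)]) (rule that)
  have "path_to n x0 [x0]" if "N <= n" for n
   using \<rho>(2) thick_mono[of "2 * eps n" "2 * \<rho>" x0 x0] N[OF that] by (auto simp: path_to_def seg_ok_same)
  then have "reach n x0 \<and> \<bar>pot n x0\<bar> <= 0" if "N <= n" for n
   using that pot_eq[of n x0 "[x0]"] by (auto simp: reach_def)
  then show ?thesis by blast
 qed
 fix a assume a: "a \<in> Om"
 obtain \<rho> where \<rho>: "0 < \<rho>" "cube a (2 * \<rho>) \<subseteq> Om" by (rule cube_subset[OF open_dom a]) (rule that)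
 obtain N where N: "!!n. N <= n ==> eps n <= \<rho> / 3" by (rule eps_eventually[of "\<rho> / 3"]) (use \<rho> in \<open>auto intro: that\<close>)
 show "\<exists>T. openin (top_of_set Om) T \<and> a \<in> T \<and> (\<forall>x\<in>T. \<forall>y\<in>T. (\<exists>N K. \<forall>n\<ge>N. reach n x \<and> \<bar>pot n x\<bar> <= K) --> (\<exists>N K. \<forall>n\<ge>N. reach n y \<and> \<bar>pot n y\<bar> <= K))"
 proof (intro exI[of _ "Om \<inter> ball a \<rho>"] conjI ballI impI)
  show "openin (top_of_set Om) (Om \<inter> ball a \<rho>)" by (intro openin_open_Int) simp
  show "a \<in> Om \<inter> ball a \<rho>" using a \<rho> by simp
  fix x y assume x: "x \<in> Om \<inter> ball a \<rho>" and y: "y \<in> Om \<inter> ball a \<rho>" and "\<exists>N K. \<forall>n\<ge>N. reach n x \<and> \<bar>pot n x\<bar> <= K"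
  then obtain N' K where K: "!!n. N' <= n ==> reach n x \<and> \<bar>pot n x\<bar> <= K" by blast
  have xy: "x \<in> cube a \<rho>" "y \<in> cube a \<rho>" using x y ball_subset_cube by blast+
  have "reach n y \<and> \<bar>pot n y\<bar> <= K + M * (\<Sum>i\<in>UNIV. \<bar>y $ i - x $ i\<bar>)" if "max N N' <= n" for n
  proof -
   have e: "3 * eps n <= \<rho>" using N[of n] that by simp
   have r: "reach n x" "\<bar>pot n x\<bar> <= K" using K[of n] that by auto
   show ?thesis using pot_local[OF \<rho>(2) e xy r(1)] r(2) by linarith
  qed
  then show "\<exists>N K. \<forall>n\<ge>N. reach n y \<and> \<bar>pot n y\<bar> <= K" by blast
 qed
qed

end

section \<open>A solenoidal field without circulation vanishes\<close>

lemma moll_even: "moll ep (- y) = moll ep y"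
 by (simp add: moll_def bump_def bump0_def mult.commute)

lemma moll_tendsto:
 fixes q :: "R3 => real"
 assumes q: "continuous_on UNIV q" and qB: "!!x. \<bar>q x\<bar> <= B"
 shows "(%n. LINT x|lborel. moll (eps n) (y - x) * q x) ----> q y"
proof (rule LIMSEQ_I)
 fix r :: real assume r: "0 < r"
 have "isCont q y" using q by (simp add: continuous_on_eq_continuous_at)
 then obtain d where d: "0 < d" "!!x. dist x y < d ==> dist (q x) (q y) < r / 2"
  using r unfolding continuous_at_eps_delta by (metis half_gt_zero)
 obtain N where N: "!!n. N <= n ==> eps n <= d / 4" by (rule eps_eventually[of "d / 4"]) (use d in \<open>auto intro: that\<close>)
 have "norm ((LINT x|lborel. moll (eps n) (y - x) * q x) - q y) < r" if n: "N <= n" for n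
 proof -
  have sw: "moll (eps n) (y - x) = moll (eps n) (x - y)" for x using moll_even[of "eps n" "x - y"] by simp
  note T = moll_integral_translate[OF eps_pos, of n y]
  have m: "(%x. moll (eps n) (x - y)) \<in> bmeas borel" by (rule smooth_borel[OF smooth_moll])
  have qm: "q \<in> bmeas borel" by (rule borel_measurable_continuous_onI[OF q])
  have nn: "0 <= moll (eps n) z" for z by (rule moll_nonneg[OF eps_pos])
  have i: "integrable lborel (%x. moll (eps n) (x - y) * q x)"
  proof (rule integrable_dominated(1))
   show "integrable lborel (%x. moll (eps n) (x - y) * B)" using T by simp
   show "(%x. moll (eps n) (x - y) * q x) \<in> bmeas lborel" using m qm by simp
   show "\<bar>moll (eps n) (x - y) * q x\<bar> <= moll (eps n) (x - y) * B" for x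
    using nn qB by (simp add: abs_mult mult_left_mono)
  qed
  have "(LINT x|lborel. moll (eps n) (y - x) * q x) - q y = (LINT x|lborel. moll (eps n) (x - y) * q x) - (LINT x|lborel. moll (eps n) (x - y) * q y)"
   using T by (simp add: sw)
  also have "\<dots> = (LINT x|lborel. moll (eps n) (x - y) * q x - moll (eps n) (x - y) * q y)"
   using T i by simp
  finally have e: "(LINT x|lborel. moll (eps n) (y - x) * q x) - q y = (LINT x|lborel. moll (eps n) (x - y) * q x - moll (eps n) (x - y) * q y)" .
  have "\<bar>LINT x|lborel. moll (eps n) (x - y) * q x - moll (eps n) (x - y) * q y\<bar> <= (LINT x|lborel. moll (eps n) (x - y) * (r / 2))"
  proof (rule integrable_dominated(2))
   show "integrable lborel (%x. moll (eps n) (x - y) * (r / 2))" using T by simp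
   show "(%x. moll (eps n) (x - y) * q x - moll (eps n) (x - y) * q y) \<in> bmeas lborel" using m qm by simp
   show "\<bar>moll (eps n) (x - y) * q x - moll (eps n) (x - y) * q y\<bar> <= moll (eps n) (x - y) * (r / 2)" for x
   proof (cases "moll (eps n) (x - y) = 0")
    case False
    have "norm (x - y) <= (\<Sum>i\<in>UNIV. \<bar>(x - y) $ i\<bar>)" by (rule norm_le_l1_cart)
    also have "\<dots> <= (\<Sum>i\<in>(UNIV :: 3 set). d / 4)"
     by (intro sum_mono) (use moll_support[OF eps_pos False] N[OF n] in \<open>meson less_imp_le order_trans\<close>)
    finally have "dist x y < d" using d(1) by (simp add: dist_norm)
    from d(2)[OF this] have "\<bar>q x - q y\<bar> <= r / 2" by (simp add: dist_real_def)
    then have "moll (eps n) (x - y) * \<bar>q x - q y\<bar> <= moll (eps n) (x - y) * (r / 2)" by (rule mult_left_mono[OF _ nn])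
    then show ?thesis using nn[of "x - y"] by (simp add: right_diff_distrib[symmetric] abs_mult)
   qed simp
  qed
  also have "\<dots> = r / 2" using T by simp
  finally show ?thesis unfolding e using r by simp
 qed
 then show "\<exists>no. \<forall>n\<ge>no. norm ((LINT x|lborel. moll (eps n) (y - x) * q x) - q y) < r" by blast
qed

context potential begin

lemma pot_near:
 assumes x: "x \<in> Om" and "0 < r"
 obtains \<delta> N where "0 < \<delta>" "ball x \<delta> \<subseteq> Om" "!!n y. N <= n ==> y \<in> ball x \<delta> ==> \<bar>pot n y - pot n x\<bar> <= r"
proof -
 obtain \<rho> where \<rho>: "0 < \<rho>" "cube x (2 * \<rho>) \<subseteq> Om" by (rule cube_subset[OF open_dom x]) (rule that)
 obtain N1 where N1: "!!n. N1 <= n ==> eps n <= \<rho> / 3" by (rule eps_eventually[of "\<rho> / 3"]) (use \<rho> in \<open>auto intro: that\<close>)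
 obtain N2 K where N2: "!!n. N2 <= n ==> reach n x \<and> \<bar>pot n x\<bar> <= K" using eventually_reach[OF x] by blast
 define \<delta> where "\<delta> = min \<rho> (r / (M + 1) / 3)"
 have M: "0 <= M" by (rule M_nonneg)
 have \<delta>: "0 < \<delta>" "\<delta> <= \<rho>" "M * (3 * \<delta>) <= r"
 proof -
  show "0 < \<delta>" "\<delta> <= \<rho>" using \<rho> assms(2) M by (auto simp: \<delta>_def)
  have "M * (3 * \<delta>) <= (M + 1) * (3 * (r / (M + 1) / 3))"
   using M \<open>0 < \<delta>\<close> by (intro mult_mono) (auto simp: \<delta>_def)
  also have "\<dots> = r"
  proof -
   have "c * (3 * (r / c / 3)) = r" if "c \<noteq> 0" for c :: real using that by simp
   from this[of "M + 1"] show ?thesis using M by linarith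
  qed
  finally show "M * (3 * \<delta>) <= r" .
 qed
 have sub: "ball x \<delta> \<subseteq> cube x \<rho>" using subset_ball[OF \<delta>(2)] ball_subset_cube by blast
 have xc: "x \<in> cube x \<rho>" using \<rho> by (simp add: cube_iff)
 show ?thesis
 proof (rule that[OF \<delta>(1), of "max N1 N2"])
  have "cube x \<rho> \<subseteq> cube x (2 * \<rho>)" using \<rho>(1) cube_in_cube[OF xc order_refl] by simp
  then show "ball x \<delta> \<subseteq> Om" using sub \<rho>(2) by blast
  fix n y assume n: "max N1 N2 <= n" and y: "y \<in> ball x \<delta>"
  have e: "3 * eps n <= \<rho>" using N1[of n] n by simp
  have "\<bar>pot n y - pot n x\<bar> <= M * (\<Sum>i\<in>UNIV. \<bar>y $ i - x $ i\<bar>)"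
   by (rule pot_local(2)[OF \<rho>(2) e xc]) (use y sub N2[of n] n in auto)
  also have "\<dots> <= M * (\<Sum>i\<in>(UNIV :: 3 set). \<delta>)"
  proof (intro mult_left_mono sum_mono M)
   fix i
   have "\<bar>(y - x) $ i\<bar> <= norm (y - x)" by (rule component_le_norm_cart)
   then show "\<bar>y $ i - x $ i\<bar> <= \<delta>" using y by (simp add: dist_norm norm_minus_commute)
  qed
  also have "\<dots> <= r" using \<delta>(3) by simp
  finally show "\<bar>pot n y - pot n x\<bar> <= r" .
 qed
qed

text \<open>The potentials are bounded at each point, though not uniformly in the point; after rescaling at each point a diagonal sequence converges on a countable dense set, and local equicontinuity extends the convergence to the whole domain.\<close>

lemma pot_subsequence:
 obtains k P where "strict_mono (k :: nat => nat)" "!!x. x \<in> Om ==> (%n. pot (k n) x) ----> P x"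
proof -
 define N K where "N x = (SOME N. \<exists>K. \<forall>n\<ge>N. reach n x \<and> \<bar>pot n x\<bar> <= K)"
  and "K x = (SOME K. \<forall>n\<ge>N x. reach n x \<and> \<bar>pot n x\<bar> <= K)" for x
 have NK: "\<bar>pot n x\<bar> <= K x" if "x \<in> Om" "N x <= n" for n x
 proof -
  have "\<exists>K. \<forall>n\<ge>N x. reach n x \<and> \<bar>pot n x\<bar> <= K" unfolding N_def by (rule someI_ex[OF eventually_reach[OF that(1)]])
  from someI_ex[OF this] show ?thesis using that(2) unfolding K_def[symmetric] by blast
 qed
 define f where "f n x = (if n < N x then 0 else pot n x / (1 + \<bar>K x\<bar>))" for n x
 obtain D :: "R3 set" where D: "countable D" "!!X. open X ==> X \<noteq> {} ==> \<exists>d\<in>D. d \<in> X" using countable_dense_setE by blast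
 have fb: "norm (f n x) <= 1" if "x \<in> D \<inter> Om" for n x
 proof -
  have "\<bar>pot n x\<bar> <= 1 + \<bar>K x\<bar>" if "\<not> n < N x"
   using NK[of x n] that \<open>x \<in> D \<inter> Om\<close> by simp
  then show ?thesis by (simp add: f_def)
 qed
 obtain k where k: "strict_mono (k :: nat => nat)" "!!x. x \<in> D \<inter> Om ==> \<exists>l. (%n. f (k n) x) ----> l"
  by (rule function_convergent_subsequence[where S="D \<inter> Om" and f=f and M=1]) (use D fb in \<open>auto intro: that\<close>)
 have kn: "n <= k n" for n by (rule seq_suble[OF k(1)])
 have cD: "Cauchy (%n. pot (k n) x)" if x: "x \<in> D \<inter> Om" for x
 proof -
  obtain l where "(%n. f (k n) x) ----> l" using k(2)[OF x] by blast
  then have "(%n. f (k n) x * (1 + \<bar>K x\<bar>)) ----> l * (1 + \<bar>K x\<bar>)" by (intro tendsto_intros)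
  moreover have "\<forall>\<^sub>F n in sequentially. f (k n) x * (1 + \<bar>K x\<bar>) = pot (k n) x"
   using eventually_ge_at_top[of "N x"]
  proof eventually_elim
   case (elim n)
   then show ?case using kn[of n] by (simp add: f_def add_nonneg_eq_0_iff)
  qed
  ultimately have "(%n. pot (k n) x) ----> l * (1 + \<bar>K x\<bar>)" by (rule Lim_transform_eventually)
  then show ?thesis by (rule LIMSEQ_imp_Cauchy)
 qed
 have "Cauchy (%n. pot (k n) x)" if x: "x \<in> Om" for x
 proof (rule metric_CauchyI)
  fix e :: real assume e: "0 < e"
  obtain \<delta> N where \<delta>: "0 < \<delta>" "ball x \<delta> \<subseteq> Om" "!!n y. N <= n ==> y \<in> ball x \<delta> ==> \<bar>pot n y - pot n x\<bar> <= e / 4"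
   by (rule pot_near[OF x, of "e / 4"]) (use e in \<open>auto intro: that\<close>)
  obtain d where d: "d \<in> D" "d \<in> ball x \<delta>" using D(2)[of "ball x \<delta>"] \<delta>(1) by auto
  then have "Cauchy (%n. pot (k n) d)" using cD \<delta>(2) by blast
  from metric_CauchyD[OF this, of "e / 4"] obtain N' where
   N': "!!m n. N' <= m ==> N' <= n ==> dist (pot (k m) d) (pot (k n) d) < e / 4" using e by auto
  have "dist (pot (k m) x) (pot (k n) x) < e" if "max N N' <= m" "max N N' <= n" for m n
  proof -
   have "\<bar>pot (k m) d - pot (k m) x\<bar> <= e / 4" "\<bar>pot (k n) d - pot (k n) x\<bar> <= e / 4"
    using \<delta>(3)[OF _ d(2)] that kn[of m] kn[of n] by auto
   moreover have "\<bar>pot (k m) d - pot (k n) d\<bar> < e / 4" using N'[of m n] that by (simp add: dist_real_def)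
   ultimately show ?thesis unfolding dist_real_def using e by linarith
  qed
  then show "\<exists>M. \<forall>m\<ge>M. \<forall>n\<ge>M. dist (pot (k m) x) (pot (k n) x) < e" by blast
 qed
 then have "\<exists>l. (%n. pot (k n) x) ----> l" if "x \<in> Om" for x using that Cauchy_convergent convergentD by blast
 note ex = this
 show ?thesis
 proof (rule that[OF k(1)])
  fix x assume "x \<in> Om"
  from someI_ex[OF ex[OF this]] show "(%n. pot (k n) x) ----> (SOME l. (%n. pot (k n) x) ----> l)" .
 qed
qed

lemma pot_limit_continuous:
 assumes k: "strict_mono (k :: nat => nat)" and P: "!!x. x \<in> Om ==> (%n. pot (k n) x) ----> P x"
 shows "continuous_on Om P"
proof (rule continuous_at_imp_continuous_on, rule ballI)
 fix x assume x: "x \<in> Om"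
 show "isCont P x"
  unfolding continuous_at_eps_delta
 proof (intro allI impI)
  fix e :: real assume e: "0 < e"
  obtain \<delta> N where \<delta>: "0 < \<delta>" "ball x \<delta> \<subseteq> Om" "!!n y. N <= n ==> y \<in> ball x \<delta> ==> \<bar>pot n y - pot n x\<bar> <= e / 2"
   by (rule pot_near[OF x, of "e / 2"]) (use e in \<open>auto intro: that\<close>)
  have "dist (P y) (P x) < e" if y: "dist y x < \<delta>" for y
  proof -
   have yb: "y \<in> ball x \<delta>" using y by (simp add: dist_commute)
   have "(%n. \<bar>pot (k n) y - pot (k n) x\<bar>) ----> \<bar>P y - P x\<bar>"
    using yb \<delta>(2) x by (intro tendsto_intros P) auto
   moreover have "\<exists>N. \<forall>n\<ge>N. \<bar>pot (k n) y - pot (k n) x\<bar> <= e / 2"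
    using \<delta>(3)[OF _ yb] seq_suble[OF k] by (meson order_trans)
   ultimately have "\<bar>P y - P x\<bar> <= e / 2" by (rule LIMSEQ_le_const2)
   then show ?thesis using e by (simp add: dist_real_def)
  qed
  then show "\<exists>d>0. \<forall>x'. dist x' x < d --> dist (P x') (P x) < e" using \<delta>(1) by blast
 qed
qed

text \<open>Test functions have compact support, on a neighbourhood of which one scale suffices for all points.\<close>

lemma pot_near_compact:
 assumes "compact K" "K \<subseteq> Om"
 obtains U N where "open U" "K \<subseteq> U" "U \<subseteq> Om" "!!n. N <= n ==> continuous_on U (pot n)"
  "!!n x. N <= n ==> x \<in> U ==> reach n x \<and> cube x (3 * eps n) \<subseteq> Om"
proof -
 let ?good = "%\<rho> N x. 0 < \<rho> \<and> ball x \<rho> \<subseteq> Om \<and> (\<forall>n\<ge>N. continuous_on (ball x \<rho>) (pot n) \<and> (\<forall>y\<in>ball x \<rho>. reach n y \<and> cube y (3 * eps n) \<subseteq> Om))"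
 have "\<exists>\<rho> N. ?good \<rho> N x" if x: "x \<in> K" for x
 proof -
  have xOm: "x \<in> Om" using x assms by auto
  obtain \<rho> where \<rho>: "0 < \<rho>" "cube x (2 * \<rho>) \<subseteq> Om" by (rule cube_subset[OF open_dom xOm]) (rule that)
  obtain N1 where N1: "!!n. N1 <= n ==> eps n <= \<rho> / 3" by (rule eps_eventually[of "\<rho> / 3"]) (use \<rho> in \<open>auto intro: that\<close>)
  obtain N2 K where N2: "!!n. N2 <= n ==> reach n x \<and> \<bar>pot n x\<bar> <= K" using eventually_reach[OF xOm] by blast
  have sub: "ball x \<rho> \<subseteq> cube x \<rho>" by (rule ball_subset_cube)
  have xc: "x \<in> cube x \<rho>" using \<rho> by (simp add: cube_iff)
  have "cube x \<rho> \<subseteq> cube x (2 * \<rho>)" using \<rho>(1) cube_in_cube[OF xc order_refl] by simp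
  then have "ball x \<rho> \<subseteq> Om" using sub \<rho>(2) by blast
  moreover have "continuous_on (ball x \<rho>) (pot n) \<and> (\<forall>y\<in>ball x \<rho>. reach n y \<and> cube y (3 * eps n) \<subseteq> Om)" if n: "max N1 N2 <= n" for n
  proof -
   have e: "3 * eps n <= \<rho>" using N1[of n] n by simp
   have r: "reach n y" if "y \<in> ball x \<rho>" for y
    by (rule pot_local(1)[OF \<rho>(2) e xc]) (use that sub N2[of n] n in auto)
   have "cube y (3 * eps n) \<subseteq> Om" if "y \<in> ball x \<rho>" for y
   proof -
    have "y \<in> cube x \<rho>" using sub that by blast
    from cube_in_cube[OF this e] show ?thesis using \<rho>(2) by blast
   qed
   moreover have "continuous_on (ball x \<rho>) (pot n)"
    unfolding continuous_on_def
   proof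
    fix y assume y: "y \<in> ball x \<rho>"
    have "((%z. pot n z - pot n y) \<longlongrightarrow> 0) (at y within ball x \<rho>)"
    proof (rule Lim_null_comparison)
     show "\<forall>\<^sub>F z in at y within ball x \<rho>. norm (pot n z - pot n y) <= M * (\<Sum>i\<in>UNIV. \<bar>z $ i - y $ i\<bar>)"
      unfolding eventually_at_filter
     proof (intro always_eventually allI impI)
      fix z assume "z \<in> ball x \<rho>"
      then show "norm (pot n z - pot n y) <= M * (\<Sum>i\<in>UNIV. \<bar>z $ i - y $ i\<bar>)"
       using pot_local(2)[OF \<rho>(2) e subsetD[OF sub y] _ r[OF y], of z] subsetD[OF sub, of z] by simp
     qed
     have "((%z. M * (\<Sum>i\<in>UNIV. \<bar>z $ i - y $ i\<bar>)) \<longlongrightarrow> M * (\<Sum>i\<in>UNIV. \<bar>y $ i - y $ i\<bar>)) (at y within ball x \<rho>)"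
      by (intro tendsto_intros)
     then show "((%z. M * (\<Sum>i\<in>UNIV. \<bar>z $ i - y $ i\<bar>)) \<longlongrightarrow> 0) (at y within ball x \<rho>)" by simp
    qed
    then show "(pot n \<longlongrightarrow> pot n y) (at y within ball x \<rho>)" by (simp add: LIM_zero_iff)
   qed
   ultimately show ?thesis using r by blast
  qed
  ultimately have "?good \<rho> (max N1 N2) x" using \<rho>(1) by blast
  then show ?thesis by blast
 qed
 then obtain \<rho> N where g: "!!x. x \<in> K ==> ?good (\<rho> x) (N x) x" by metis
 obtain F where F: "F \<subseteq> K" "finite F" "K \<subseteq> (\<Union>x\<in>F. ball x (\<rho> x))"
 proof (rule compactE_image[OF assms(1), of K "%x. ball x (\<rho> x)"])
  show "K \<subseteq> (\<Union>x\<in>K. ball x (\<rho> x))" using g by force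
 qed (auto intro: that)
 let ?U = "\<Union>x\<in>F. ball x (\<rho> x)"
 have N: "N x <= n" if "x \<in> F" "Max (insert 0 (N ` F)) <= n" for x n
  using that F(2) by (meson Max.coboundedI finite_imageI finite_insert imageI insertI2 order_trans)
 show ?thesis
 proof (rule that[of ?U "Max (insert 0 (N ` F))"])
  show "open ?U" by auto
  show "K \<subseteq> ?U" by (rule F(3))
  show "?U \<subseteq> Om" using g F(1) by blast
  show "continuous_on ?U (pot n)" if "Max (insert 0 (N ` F)) <= n" for n
  proof (rule continuous_on_open_UN)
   fix x assume x: "x \<in> F"
   show "continuous_on (ball x (\<rho> x)) (pot n)" using g[of x] N[OF x that] x F(1) by blast
  qed simp
  show "reach n x \<and> cube x (3 * eps n) \<subseteq> Om" if n: "Max (insert 0 (N ` F)) <= n" and x: "x \<in> ?U" for n x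
  proof -
   obtain z where z: "z \<in> F" "x \<in> ball z (\<rho> z)" using x by blast
   then show ?thesis using g[of z] N[OF z(1) n] F(1) by blast
  qed
 qed
qed

end

lemma continuous_on_comp_mult_support:
 fixes p :: "'a::t2_space => real" and \<xi> g :: "_ => real"
 assumes "open U" "compact K" "K \<subseteq> U" "continuous_on U p" and \<xi>: "continuous_on UNIV \<xi>" "!!x. x \<notin> K ==> \<xi> x = 0"
  and g: "continuous_on UNIV g"
 shows "continuous_on UNIV (%x. g (p x) * \<xi> x)"
proof -
 have "continuous_on U (%x. g (p x) * \<xi> x)"
  by (intro continuous_on_mult continuous_on_compose2[OF g assms(4)] continuous_on_subset[OF \<xi>(1)]) auto
 moreover have "continuous_on (- K) (%x. g (p x) * \<xi> x) \<longleftrightarrow> continuous_on (- K) (%x. 0 :: real)"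
  by (intro continuous_on_cong refl) (use \<xi>(2) in auto)
 then have "continuous_on (- K) (%x. g (p x) * \<xi> x)" by simp
 ultimately have "continuous_on (U \<union> - K) (%x. g (p x) * \<xi> x)"
  using assms(1) compact_imp_closed[OF assms(2)] by (intro continuous_on_open_Un) auto
 moreover have "U \<union> - K = UNIV" using assms(3) by auto
 ultimately show ?thesis by simp
qed

lemma inverse_1_add_square_le: "0 <= inverse (1 + (a::real)\<^sup>2)" "inverse (1 + (a::real)\<^sup>2) <= 1"
proof -
 have "1 <= 1 + a\<^sup>2" by simp
 then show "inverse (1 + a\<^sup>2) <= 1" by (rule inverse_le_1_iff[THEN iffD2, OF disjI2])
 show "0 <= inverse (1 + a\<^sup>2)" by simp
qed

lemma continuous_inverse_1_add_square: "continuous_on UNIV (%a::real. inverse (1 + a\<^sup>2))"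
 by (intro continuous_intros ballI) (metis add_nonneg_eq_0_iff zero_le_one zero_le_power2 one_neq_zero)

context bounded_field begin

lemma mh_borel: "mh n j \<in> bmeas borel"
proof -
 note [measurable] = h_nth_borel[of j] moll_measurable[of "eps n"]
 have "(%(x, y). h y $ j * moll (eps n) (y - x)) \<in> bmeas (borel \<Otimes>\<^sub>M lborel)" by measurable
 then show ?thesis unfolding mh_def by (rule lborel.borel_measurable_lebesgue_integral)
qed

text \<open>Mollification is symmetric, so it can be moved to the test function.\<close>

lemma mh_transfer:
 assumes q: "continuous_on UNIV q" "compact K" "!!x. x \<notin> K ==> q x = 0" "!!x. \<bar>q x\<bar> <= Q"
 shows "(LINT x|lborel. mh n j x * q x) = (LINT y|lborel. h y $ j * (LINT x|lborel. moll (eps n) (y - x) * q x))"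
proof -
 define f where "f y x = h y $ j * (moll (eps n) (y - x) * q x)" for x y
 obtain G where G: "0 <= G" "!!y. moll (eps n) y <= G" by (rule moll_bounded[OF eps_pos]) (rule that)
 have qm: "q \<in> bmeas borel" by (rule borel_measurable_continuous_onI[OF q(1)])
 note [measurable] = h_nth_borel[of j] moll_measurable[of "eps n"] qm
 have fm: "case_prod f \<in> bmeas (lborel \<Otimes>\<^sub>M lborel)" unfolding f_def by measurable
 have "integrable (lborel \<Otimes>\<^sub>M lborel) (case_prod f)"
  unfolding lborel_prod
 proof (rule integrable_dominated(1))
  have "emeasure lborel (Om \<times> K) < \<infinity>"
   by (rule emeasure_bounded_finite) (intro bounded_Times bounded_dom compact_imp_bounded q(2))
  moreover have "Om \<times> K \<in> sets lborel"
   using borel_Times[of Om K] open_dom compact_imp_closed[OF q(2)] by simp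
  ultimately show "integrable lborel (%z. M * (G * Q) * indicator (Om \<times> K) z)" by (simp add: integrable_real_indicator)
  show "case_prod f \<in> bmeas lborel" using fm by (simp only: lborel_prod)
  show "\<bar>case_prod f z\<bar> <= M * (G * Q) * indicator (Om \<times> K) z" for z
  proof (cases "z \<in> Om \<times> K")
   case True
   obtain y x where z: "z = (y, x)" by (cases z)
   have "\<bar>h y $ j\<bar> <= M" using h_nth_bound[of y j] True by (simp add: z)
   then have "\<bar>h y $ j\<bar> * (\<bar>moll (eps n) (y - x)\<bar> * \<bar>q x\<bar>) <= M * (G * Q)"
    using moll_nonneg[OF eps_pos, of n "y - x"] G M_nonneg q(4)[of x] by (intro mult_mono) auto
   then show ?thesis using True by (simp add: z f_def abs_mult)
  next
   case False
   obtain y x where z: "z = (y, x)" by (cases z)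
   have "h y = 0 \<or> q x = 0" using False h_zero q(3) by (auto simp: z)
   then show ?thesis using False by (auto simp: z f_def)
  qed
 qed
 then have "(LINT x|lborel. LINT y|lborel. f y x) = (LINT y|lborel. LINT x|lborel. f y x)"
  by (rule lborel_pair.Fubini_integral)
 moreover have "(LINT y|lborel. f y x) = mh n j x * q x" for x
  unfolding mh_def f_def by (simp add: mult.assoc[symmetric])
 ultimately show ?thesis unfolding f_def by simp
qed

lemma mh_weak_limit:
 assumes q: "continuous_on UNIV q" "compact K" "!!x. x \<notin> K ==> q x = 0" "!!x. \<bar>q x\<bar> <= Q"
 shows "(%n. LINT x|lborel. mh n j x * q x) ----> (LINT y|lborel. h y $ j * q y)"
proof -
 have "(%n. LINT y|lborel. h y $ j * (LINT x|lborel. moll (eps n) (y - x) * q x)) ----> (LINT y|lborel. h y $ j * q y)"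
proof (rule integral_dominated_convergence[where w="%y. M * Q * indicator Om y"])
 have qm: "q \<in> bmeas borel" by (rule borel_measurable_continuous_onI[OF q(1)])
 note [measurable] = h_nth_borel[of j] moll_measurable qm
 show "(%y. h y $ j * q y) \<in> bmeas lborel" by measurable
 show "(%y. h y $ j * (LINT x|lborel. moll (eps n) (y - x) * q x)) \<in> bmeas lborel" for n
 proof -
  have "(%(y, x). moll (eps n) (y - x) * q x) \<in> bmeas (borel \<Otimes>\<^sub>M lborel)" by measurable
  then have "(%y. LINT x|lborel. moll (eps n) (y - x) * q x) \<in> bmeas borel"
   by (rule lborel.borel_measurable_lebesgue_integral)
  then show ?thesis using h_nth_borel by simp
 qed
 show "integrable lborel (%y. M * Q * indicator Om y)" using dom_integrable by simp
 show "AE y in lborel. (%n. h y $ j * (LINT x|lborel. moll (eps n) (y - x) * q x)) ----> h y $ j * q y"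
  by (intro always_eventually allI tendsto_mult tendsto_const moll_tendsto[OF q(1,4)])
 show "AE y in lborel. norm (h y $ j * (LINT x|lborel. moll (eps n) (y - x) * q x)) <= M * Q * indicator Om y" for n
 proof (intro always_eventually allI)
  fix y
  have sw: "moll (eps n) (y - x) = moll (eps n) (x - y)" for x using moll_even[of "eps n" "x - y"] by simp
  note T = moll_integral_translate[OF eps_pos, of n y]
  have "\<bar>LINT x|lborel. moll (eps n) (y - x) * q x\<bar> <= (LINT x|lborel. moll (eps n) (x - y) * Q)"
   unfolding sw
  proof (rule integrable_dominated(2))
   show "integrable lborel (%x. moll (eps n) (x - y) * Q)" using T by simp
   show "(%x. moll (eps n) (x - y) * q x) \<in> bmeas lborel" by measurable
   show "\<bar>moll (eps n) (x - y) * q x\<bar> <= moll (eps n) (x - y) * Q" for x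
    using moll_nonneg[OF eps_pos, of n "x - y"] q(4)[of x] by (simp add: abs_mult mult_left_mono)
  qed
  also have "\<dots> = Q" using T by simp
  finally have "\<bar>h y $ j\<bar> * \<bar>LINT x|lborel. moll (eps n) (y - x) * q x\<bar> <= (M * indicator Om y) * Q"
   by (intro mult_mono h_nth_bound) (use M_nonneg in auto)
  then show "norm (h y $ j * (LINT x|lborel. moll (eps n) (y - x) * q x)) <= M * Q * indicator Om y"
   by (simp add: abs_mult mult_ac)
 qed
qed
 then show ?thesis by (simp add: mh_transfer[OF q])
qed

end

context potential begin

text \<open>The potential may be unbounded near the boundary; composing it with \<open>arctan\<close> before taking limits yields a function in \<open>H1\<close>. The product with the test function has a directional derivative at every point, so its integral vanishes by translation invariance.\<close>

lemma arctan_pot_identity: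
 assumes \<psi>: "test_fun Om \<psi>"
 obtains N where "!!n. N <= n ==> (LINT x|lborel. mh n j x * (inverse (1 + (pot n x)\<^sup>2) * \<psi> x)) = - (LINT x|lborel. arctan (pot n x) * gradient \<psi> x $ j)"
  and "!!n. N <= n ==> (%x. inverse (1 + (pot n x)\<^sup>2) * \<psi> x) \<in> bmeas borel"
  and "!!n. N <= n ==> (%x. arctan (pot n x) * gradient \<psi> x $ j) \<in> bmeas borel"
proof -
 let ?\<psi>' = "%x. gradient \<psi> x $ j"
 have \<psi>': "test_fun Om ?\<psi>'" by (rule test_fun_gradient[OF \<psi>])
 obtain K1 where K1: "compact K1" "K1 \<subseteq> Om" "!!x. x \<notin> K1 ==> \<psi> x = 0" by (rule test_fun_supportE[OF \<psi>]) (rule that)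
 obtain K2 where K2: "compact K2" "K2 \<subseteq> Om" "!!x. x \<notin> K2 ==> ?\<psi>' x = 0" by (rule test_fun_supportE[OF \<psi>']) (rule that)
 define K where "K = K1 \<union> K2"
 have K: "compact K" "K \<subseteq> Om" "!!x. x \<notin> K ==> \<psi> x = 0" "!!x. x \<notin> K ==> ?\<psi>' x = 0"
  using K1 K2 by (auto simp: K_def)
 obtain U N where U: "open U" "K \<subseteq> U" "U \<subseteq> Om" "!!n. N <= n ==> continuous_on U (pot n)"
  "!!n x. N <= n ==> x \<in> U ==> reach n x \<and> cube x (3 * eps n) \<subseteq> Om"
  by (rule pot_near_compact[OF K(1,2)]) (rule that)
 obtain B where B: "!!x. \<bar>\<psi> x\<bar> <= B" "0 <= B" by (rule test_fun_bounded[OF \<psi>]) (rule that)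
 obtain B' where B': "!!x. \<bar>?\<psi>' x\<bar> <= B'" "0 <= B'" by (rule test_fun_bounded[OF \<psi>']) (rule that)
 have c: "continuous_on UNIV (%x. g (pot n x) * \<psi> x)" "continuous_on UNIV (%x. g (pot n x) * ?\<psi>' x)"
  if "N <= n" "continuous_on UNIV g" for n g
  using continuous_on_comp_mult_support[OF U(1) K(1) U(2) U(4)[OF that(1)] smooth_continuous[OF test_fun_smooth[OF \<psi>]] K(3) that(2)]
   continuous_on_comp_mult_support[OF U(1) K(1) U(2) U(4)[OF that(1)] smooth_continuous[OF test_fun_smooth[OF \<psi>']] K(4) that(2)] by auto
 have ca: "continuous_on UNIV (arctan :: real => real)" by (intro continuous_intros)
 note m = borel_measurable_continuous_onI[OF c(1)[OF _ continuous_inverse_1_add_square]] borel_measurable_continuous_onI[OF c(2)[OF _ ca]]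
  borel_measurable_continuous_onI[OF c(1)[OF _ ca]]
 have ab: "\<bar>arctan a\<bar> <= 2" for a using arctan_bounded[of a] pi_less_4 by (auto simp: abs_le_iff)
 show ?thesis
 proof (rule that[of N])
  fix n assume n: "N <= n"
  let ?q = "%x. inverse (1 + (pot n x)\<^sup>2) * \<psi> x"
  let ?r = "%x. arctan (pot n x) * ?\<psi>' x"
  show qm: "?q \<in> bmeas borel" and rm: "?r \<in> bmeas borel" using m n by auto
  obtain R where R: "!!x. x \<in> K ==> norm x <= R" using compact_imp_bounded[OF K(1)] unfolding bounded_iff by blast
  have qb: "\<bar>?q x\<bar> <= \<bar>\<psi> x\<bar>" for x
   unfolding abs_mult using inverse_1_add_square_le[of "pot n x"] by (intro mult_left_le_one_le) auto
  have "(LINT x|lborel. mh n j x * ?q x + ?r x) = 0"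
  proof (rule integral_directional_derivative_zero[where e="axis j 1" and R=R and B="M * B + 2 * B'"])
   fix x
   show "((%t. arctan (pot n (x + t *\<^sub>R axis j 1)) * \<psi> (x + t *\<^sub>R axis j 1)) has_real_derivative mh n j x * ?q x + ?r x) (at 0)"
   proof (cases "x \<in> K")
    case True
    have r: "reach n x" "cube x (3 * eps n) \<subseteq> Om" using U(5)[OF n] True U(2) by blast+
    have "((%t. arctan (pot n (x + t *\<^sub>R axis j 1))) has_real_derivative inverse (1 + (pot n x)\<^sup>2) * mh n j x) (at 0)"
     using DERIV_chain2[OF DERIV_arctan pot_derivative[OF r, of j]] by simp
    from DERIV_mult[OF this smooth_directional[OF test_fun_smooth[OF \<psi>], of x j]]
    show ?thesis by (simp add: mult_ac add.commute)
   next
    case False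
    have "open {t. x + t *\<^sub>R axis j 1 \<in> - K}"
     using compact_imp_closed[OF K(1)] by (intro open_vimage[of "- K" "%t. x + t *\<^sub>R axis j 1", unfolded vimage_def] continuous_intros) auto
    from has_field_derivative_transform_within_open[OF DERIV_const[of "0::real" "at 0"] this, of "%t. arctan (pot n (x + t *\<^sub>R axis j 1)) * \<psi> (x + t *\<^sub>R axis j 1)"]
    have "((%t. arctan (pot n (x + t *\<^sub>R axis j 1)) * \<psi> (x + t *\<^sub>R axis j 1)) has_real_derivative 0) (at 0)"
     using False K(3) by simp
    then show ?thesis using K(3,4)[OF False] by simp
   qed
  next
   show "integrable lborel (%x. arctan (pot n x) * \<psi> x)"
   proof (rule integrable_dominated(1))
    show "integrable lborel (%x. 2 * \<bar>\<psi> x\<bar>)" using test_fun_integrable_lborel[OF \<psi>] by simp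
    show "(%x. arctan (pot n x) * \<psi> x) \<in> bmeas lborel" using m(3)[OF n] by simp
    show "\<bar>arctan (pot n x) * \<psi> x\<bar> <= 2 * \<bar>\<psi> x\<bar>" for x unfolding abs_mult by (intro mult_right_mono ab) simp
   qed
   show "(%x. mh n j x * ?q x + ?r x) \<in> bmeas borel" by (intro borel_measurable_add borel_measurable_times mh_borel qm rm)
   show "\<bar>mh n j x * ?q x + ?r x\<bar> <= M * B + 2 * B'" for x
   proof -
    have "\<bar>mh n j x\<bar> * \<bar>?q x\<bar> <= M * B" by (intro mult_mono mh_bound order_trans[OF qb B(1)]) (use M_nonneg in auto)
    moreover have "\<bar>arctan (pot n x)\<bar> * \<bar>?\<psi>' x\<bar> <= 2 * B'" by (intro mult_mono ab B'(1)) auto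
    ultimately show ?thesis using abs_triangle_ineq[of "mh n j x * ?q x" "?r x"] unfolding abs_mult by linarith
   qed
   show "arctan (pot n x) * \<psi> x = 0" if "R < norm x" for x
   proof -
    have "x \<notin> K" using R[of x] that by auto
    then show ?thesis using K(3) by simp
   qed
  qed
  moreover have "(LINT x|lborel. mh n j x * ?q x + ?r x) = (LINT x|lborel. mh n j x * ?q x) + (LINT x|lborel. ?r x)"
  proof (rule Bochner_Integration.integral_add)
   show "integrable lborel (%x. mh n j x * ?q x)"
   proof (rule integrable_dominated(1))
    show "integrable lborel (%x. M * \<bar>\<psi> x\<bar>)" using test_fun_integrable_lborel[OF \<psi>] by simp
    show "(%x. mh n j x * ?q x) \<in> bmeas lborel" using borel_measurable_times[OF mh_borel qm] by simp
    show "\<bar>mh n j x * ?q x\<bar> <= M * \<bar>\<psi> x\<bar>" for x unfolding abs_mult[of "mh n j x"] by (intro mult_mono mh_bound qb) (use M_nonneg in auto)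
   qed
   show "integrable lborel ?r"
   proof (rule integrable_dominated(1))
    show "integrable lborel (%x. 2 * \<bar>?\<psi>' x\<bar>)" using test_fun_integrable_lborel[OF \<psi>'] by simp
    show "?r \<in> bmeas lborel" using rm by simp
    show "\<bar>?r x\<bar> <= 2 * \<bar>?\<psi>' x\<bar>" for x unfolding abs_mult by (intro mult_right_mono ab) simp
   qed
  qed
  ultimately show "(LINT x|lborel. mh n j x * ?q x) = - (LINT x|lborel. ?r x)" by simp
 qed
qed

text \<open>The mollified fields converge only weakly, so their coefficient is first replaced by its pointwise limit, at the cost of an error that tends to zero in mean since the fields are uniformly bounded.\<close>

lemma arctan_limit_identity:
 assumes k: "strict_mono (k :: nat => nat)" and P: "!!x. x \<in> Om ==> (%n. pot (k n) x) ----> P x"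
  and \<psi>: "test_fun Om \<psi>"
 shows "(LINT x|leb Om. arctan (P x) * gradient \<psi> x $ j) = - (LINT x|leb Om. (inverse (1 + (P x)\<^sup>2) *\<^sub>R h x) $ j * \<psi> x)"
proof -
 let ?\<psi>' = "%x. gradient \<psi> x $ j"
 let ?q = "%n x. inverse (1 + (pot n x)\<^sup>2) * \<psi> x"
 let ?r = "%n x. arctan (pot n x) * ?\<psi>' x"
 let ?qlim = "%x. inverse (1 + (P x)\<^sup>2) * \<psi> x"
 let ?rlim = "%x. arctan (P x) * ?\<psi>' x"
 have \<psi>': "test_fun Om ?\<psi>'" by (rule test_fun_gradient[OF \<psi>])
 obtain K1 where K1: "compact K1" "K1 \<subseteq> Om" "!!x. x \<notin> K1 ==> \<psi> x = 0" by (rule test_fun_supportE[OF \<psi>]) (rule that)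
 obtain K2 where K2: "compact K2" "K2 \<subseteq> Om" "!!x. x \<notin> K2 ==> ?\<psi>' x = 0" by (rule test_fun_supportE[OF \<psi>']) (rule that)
 obtain B where B: "!!x. \<bar>\<psi> x\<bar> <= B" "0 <= B" by (rule test_fun_bounded[OF \<psi>]) (rule that)
 obtain N where N: "!!n. N <= n ==> (LINT x|lborel. mh n j x * ?q n x) = - (LINT x|lborel. ?r n x)"
   "!!n. N <= n ==> ?q n \<in> bmeas borel" "!!n. N <= n ==> ?r n \<in> bmeas borel"
  by (rule arctan_pot_identity[OF \<psi>, of j]) (rule that)
 define k' where "k' n = k (n + N)" for n
 have k': "strict_mono k'" using k by (auto simp: k'_def strict_mono_def)
 have k'N: "N <= k' n" for n using seq_suble[OF k, of "n + N"] by (simp add: k'_def)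
 have P': "(%n. pot (k' n) x) ----> P x" if "x \<in> Om" for x
  unfolding k'_def using LIMSEQ_ignore_initial_segment[OF P[OF that], of N] .
 have Pc: "continuous_on Om P" by (rule pot_limit_continuous[OF k P])
 have ca: "continuous_on UNIV (arctan :: real => real)" by (intro continuous_intros)
 have q0c: "continuous_on UNIV ?qlim"
  by (rule continuous_on_comp_mult_support[OF open_dom K1(1,2) Pc smooth_continuous[OF test_fun_smooth[OF \<psi>]] K1(3) continuous_inverse_1_add_square])
 have r0c: "continuous_on UNIV ?rlim"
  by (rule continuous_on_comp_mult_support[OF open_dom K2(1,2) Pc smooth_continuous[OF test_fun_smooth[OF \<psi>']] K2(3) ca])
 have q0m: "?qlim \<in> bmeas borel" and r0m: "?rlim \<in> bmeas borel"
  using q0c r0c by (auto intro: borel_measurable_continuous_onI)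
 have ab: "\<bar>arctan a\<bar> <= 2" for a using arctan_bounded[of a] pi_less_4 by (auto simp: abs_le_iff)
 have qb: "\<bar>inverse (1 + a\<^sup>2) * \<psi> x\<bar> <= \<bar>\<psi> x\<bar>" for a x
  unfolding abs_mult using inverse_1_add_square_le[of a] by (intro mult_left_le_one_le) auto
 have q_lim: "(%n. ?q (k' n) x) ----> ?qlim x" for x
 proof (cases "x \<in> Om")
  case True
  have "1 + (P x)\<^sup>2 \<noteq> 0" by (simp add: add_nonneg_eq_0_iff)
  then show ?thesis by (intro tendsto_intros P'[OF True])
 next
  case False
  then have "\<psi> x = 0" using K1 by blast
  then show ?thesis by simp
 qed
 have r_lim: "(%n. ?r (k' n) x) ----> ?rlim x" for x
 proof (cases "x \<in> Om")
  case True
  then show ?thesis by (intro tendsto_intros P'[OF True])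
 next
  case False
  then have "?\<psi>' x = 0" using K2 by blast
  then show ?thesis by simp
 qed
 have I: "integrable lborel (%x. mh n j x * q x)" if "q \<in> bmeas borel" "!!x. \<bar>q x\<bar> <= \<bar>\<psi> x\<bar>" for n q
 proof (rule integrable_dominated(1))
  show "integrable lborel (%x. M * \<bar>\<psi> x\<bar>)" using test_fun_integrable_lborel[OF \<psi>] by simp
  show "(%x. mh n j x * q x) \<in> bmeas lborel" using borel_measurable_times[OF mh_borel that(1)] by simp
  show "\<bar>mh n j x * q x\<bar> <= M * \<bar>\<psi> x\<bar>" for x unfolding abs_mult[of "mh n j x"] by (intro mult_mono mh_bound that(2)) (use M_nonneg in auto)
 qed
 have "(%n. LINT x|lborel. mh (k' n) j x * (?q (k' n) x - ?qlim x)) ----> (LINT x|(lborel :: R3 measure). 0)"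
 proof (rule integral_dominated_convergence[where w="%x. M * (2 * \<bar>\<psi> x\<bar>)"])
  show "(%x. mh (k' n) j x * (?q (k' n) x - ?qlim x)) \<in> bmeas lborel" for n
   using borel_measurable_times[OF mh_borel borel_measurable_diff[OF N(2)[OF k'N] q0m]] by simp
  show "integrable lborel (%x. M * (2 * \<bar>\<psi> x\<bar>))" using test_fun_integrable_lborel[OF \<psi>] by simp
  have b: "\<bar>mh (k' n) j x * (?q (k' n) x - ?qlim x)\<bar> <= M * \<bar>?q (k' n) x - ?qlim x\<bar>" for n x
   unfolding abs_mult[of "mh (k' n) j x"] by (intro mult_right_mono mh_bound) simp
  show "AE x in lborel. (%n. mh (k' n) j x * (?q (k' n) x - ?qlim x)) ----> 0"
  proof (intro always_eventually allI)
   fix x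
   have "(%n. M * \<bar>?q (k' n) x - ?qlim x\<bar>) ----> M * \<bar>?qlim x - ?qlim x\<bar>" by (intro tendsto_intros q_lim)
   then have z: "(%n. M * \<bar>?q (k' n) x - ?qlim x\<bar>) ----> 0" by simp
   show "(%n. mh (k' n) j x * (?q (k' n) x - ?qlim x)) ----> 0"
    by (rule Lim_null_comparison[OF _ z]) (intro always_eventually allI, use b in simp)
  qed
  show "AE x in lborel. norm (mh (k' n) j x * (?q (k' n) x - ?qlim x)) <= M * (2 * \<bar>\<psi> x\<bar>)" for n
  proof (intro always_eventually allI)
   fix x
   have "\<bar>?q (k' n) x - ?qlim x\<bar> <= 2 * \<bar>\<psi> x\<bar>" using qb[of "pot (k' n) x" x] qb[of "P x" x] by linarith
   then have "M * \<bar>?q (k' n) x - ?qlim x\<bar> <= M * (2 * \<bar>\<psi> x\<bar>)" using M_nonneg by (rule mult_left_mono)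
   then show "norm (mh (k' n) j x * (?q (k' n) x - ?qlim x)) <= M * (2 * \<bar>\<psi> x\<bar>)" using b[of n x] by simp
  qed
 qed simp
 moreover have "(%n. LINT x|lborel. mh (k' n) j x * ?qlim x) ----> (LINT y|lborel. h y $ j * ?qlim y)"
 proof (rule LIMSEQ_subseq_LIMSEQ[OF mh_weak_limit k', unfolded comp_def])
  show "continuous_on UNIV ?qlim" "compact K1" by (rule q0c, rule K1(1))
  show "?qlim x = 0" if "x \<notin> K1" for x using K1(3)[OF that] by simp
  show "\<bar>?qlim x\<bar> <= B" for x by (rule order_trans[OF qb B(1)])
 qed
 ultimately have "(%n. (LINT x|lborel. mh (k' n) j x * (?q (k' n) x - ?qlim x)) + (LINT x|lborel. mh (k' n) j x * ?qlim x)) ----> (LINT x|(lborel :: R3 measure). 0) + (LINT y|lborel. h y $ j * ?qlim y)"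
  by (rule tendsto_add)
 moreover have "(LINT x|lborel. mh (k' n) j x * (?q (k' n) x - ?qlim x)) + (LINT x|lborel. mh (k' n) j x * ?qlim x) = - (LINT x|lborel. ?r (k' n) x)" for n
  unfolding N(1)[OF k'N, symmetric] right_diff_distrib
  using I[OF N(2)[OF k'N[of n]] qb, of "k' n"] I[OF q0m qb, of "k' n"] by simp
 ultimately have L: "(%n. - (LINT x|lborel. ?r (k' n) x)) ----> (LINT y|lborel. h y $ j * ?qlim y)" by simp
 have "(%n. LINT x|lborel. ?r (k' n) x) ----> (LINT x|lborel. ?rlim x)"
 proof (rule integral_dominated_convergence[where w="%x. 2 * \<bar>?\<psi>' x\<bar>"])
  show "?rlim \<in> bmeas lborel" using r0m by simp
  show "?r (k' n) \<in> bmeas lborel" for n using N(3)[OF k'N] by simp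
  show "integrable lborel (%x. 2 * \<bar>?\<psi>' x\<bar>)" using test_fun_integrable_lborel[OF \<psi>'] by simp
  show "AE x in lborel. (%n. ?r (k' n) x) ----> ?rlim x" by (intro always_eventually allI r_lim)
  show "AE x in lborel. norm (?r (k' n) x) <= 2 * \<bar>?\<psi>' x\<bar>" for n
   unfolding real_norm_def abs_mult by (intro always_eventually allI mult_right_mono ab) simp
 qed
 from LIMSEQ_unique[OF tendsto_minus[OF this] L]
 have *: "(LINT x|lborel. ?rlim x) = - (LINT y|lborel. h y $ j * ?qlim y)" by simp
 have "(LINT x|leb Om. ?rlim x) = (LINT x|lborel. ?rlim x)"
  by (rule LINT_lebesgue_on_support(1)[OF dom_sets r0m]) (use K2 in auto)
 moreover have "(LINT x|leb Om. h x $ j * ?qlim x) = (LINT x|lborel. h x $ j * ?qlim x)"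
  by (rule LINT_lebesgue_on_support(1)[OF dom_sets borel_measurable_times[OF h_nth_borel q0m]]) (use h_zero in auto)
 ultimately show ?thesis using * by (simp add: mult_ac)
qed

text \<open>The gradient of \<open>arctan P\<close> is a positive multiple of \<open>h\<close>, and \<open>h\<close> is orthogonal to it.\<close>

lemma solenoidal_zero:
 assumes "normal_trace_zero Om h"
 shows "AE x in leb Om. h x = 0"
proof -
 obtain k P where k: "strict_mono (k :: nat => nat)" and P: "!!x. x \<in> Om ==> (%n. pot (k n) x) ----> P x"
  by (rule pot_subsequence) (rule that)
 let ?g = "%x. inverse (1 + (P x)\<^sup>2)"
 have Pc: "continuous_on Om P" by (rule pot_limit_continuous[OF k P])
 have ac: "continuous_on Om (%x. arctan (P x))" by (intro continuous_intros Pc)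
 have gc: "continuous_on Om ?g" by (rule continuous_on_compose2[OF continuous_inverse_1_add_square Pc]) simp
 have hm: "h \<in> bmeas (leb Om)" by (rule borel_imp_lebesgue_on[OF h_borel])
 have gm: "?g \<in> bmeas (leb Om)" by (rule continuous_imp_measurable_on_sets_lebesgue[OF gc dom_sets])
 have f2: "(%x. arctan (P x)) \<in> Lp 2 Om"
 proof (rule bounded_L2_test[OF open_dom bounded_dom continuous_imp_measurable_on_sets_lebesgue[OF ac dom_sets]])
  show "norm (arctan (P x)) <= 2" for x using arctan_bounded[of "P x"] pi_less_4 by (auto simp: abs_le_iff)
 qed
 have gle: "norm (?g x *\<^sub>R h x) <= M" for x
 proof -
  have "\<bar>?g x\<bar> * norm (h x) <= 1 * M"
   by (intro mult_mono h_bound) (use inverse_1_add_square_le[of "P x"] in auto)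
  then show ?thesis by simp
 qed
 have g2: "(%x. ?g x *\<^sub>R h x) \<in> Lp 2 Om"
  by (rule bounded_L2_test[OF open_dom bounded_dom borel_measurable_scaleR[OF gm hm] gle])
 have h2: "h \<in> Lp 2 Om" by (rule bounded_L2_test[OF open_dom bounded_dom hm h_bound])
 have wg: "weak_gradient Om (%x. arctan (P x)) (%x. ?g x *\<^sub>R h x)"
  unfolding weak_gradient_def using arctan_limit_identity[OF k P] by blast
 note W = wgrad_eq[OF f2 g2 wg]
 have "0 = L2_inner Om h (wgrad Om (%x. arctan (P x)))" using assms W(1) by (simp add: normal_trace_zero_def)
 also have "\<dots> = L2_inner Om h (%x. ?g x *\<^sub>R h x)"
  by (rule L2_inner_cong[OF _ W(2) h2 _ h2 g2]) (use wgrad(1)[OF W(1)] in auto)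
 finally have "(LINT x|leb Om. h x \<bullet> (?g x *\<^sub>R h x)) = 0" by (simp add: L2_inner_def)
 moreover have "integrable (leb Om) (%x. h x \<bullet> (?g x *\<^sub>R h x))" by (rule L2_integrable_inner[OF h2 g2])
 moreover have nn: "0 <= h x \<bullet> (?g x *\<^sub>R h x)" for x using inverse_1_add_square_le[of "P x"] by simp
 ultimately have "AE x in leb Om. h x \<bullet> (?g x *\<^sub>R h x) = 0"
  using integral_nonneg_eq_0_iff_AE[of "leb Om" "%x. h x \<bullet> (?g x *\<^sub>R h x)"] by auto
 then show ?thesis
 proof eventually_elim
  case (elim x)
  have "1 + (P x)\<^sup>2 \<noteq> 0" by (simp add: add_nonneg_eq_0_iff)
  then show ?case using elim by simp
 qed
qed

end

lemma (in bounded_open) L2_bounded_borel_representative: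
 fixes h :: field
 assumes h: "h \<in> bmeas (leb Om)" and b: "AE x in leb Om. norm (h x) <= M"
 obtains g where "g \<in> bmeas borel" "!!x. norm (g x) <= \<bar>M\<bar>" "!!x. x \<notin> Om ==> g x = 0" "AE x in leb Om. g x = h x"
proof -
 have "\<exists>g. g \<in> bmeas borel \<and> (AE x in lebesgue. indicator Om x * h x $ j = g x)" for j
 proof -
  have "(%x. h x $ j) \<in> bmeas (leb Om)" using h unfolding borel_measurable_vec_iff by blast
  then have "(%x. indicator Om x *\<^sub>R (h x $ j)) \<in> bmeas lebesgue"
   by (rule borel_measurable_restrict_space_iff[THEN iffD1, rotated]) (use dom_sets in simp)
  then have "(%x. indicator Om x * h x $ j) \<in> bmeas lebesgue" by simp
  from lebesgue_borel_representative[OF this] show ?thesis by blast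
 qed
 then have "\<forall>j. \<exists>g. g \<in> bmeas borel \<and> (AE x in lebesgue. indicator Om x * h x $ j = g x)" by blast
 from choice[OF this] obtain g where "\<forall>j. g j \<in> bmeas borel \<and> (AE x in lebesgue. indicator Om x * h x $ j = g j x)" ..
 then have g: "!!j. g j \<in> bmeas borel" "!!j. AE x in lebesgue. indicator Om x * h x $ j = g j x" by blast+
 define g1 where "g1 x = (\<chi> j. g j x)" for x
 define g2 where "g2 x = (if x \<in> Om \<and> norm (g1 x) <= M then g1 x else 0)" for x
 have g1m [measurable]: "g1 \<in> bmeas borel" unfolding borel_measurable_vec_iff g1_def using g(1) by simp
 have [measurable]: "Om \<in> sets borel" using open_dom by simp
 show ?thesis
 proof (rule that[of g2])
  show "g2 \<in> bmeas borel" unfolding g2_def by measurable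
  show "norm (g2 x) <= \<bar>M\<bar>" for x by (auto simp: g2_def)
  show "g2 x = 0" if "x \<notin> Om" for x using that by (simp add: g2_def)
  have "AE x in lebesgue. \<forall>j. indicator Om x * h x $ j = g j x" by (rule AE_all_finite[OF g(2)])
  then have "AE x in lebesgue. x \<in> Om --> g1 x = h x"
  proof eventually_elim
   case (elim x)
   then show ?case by (auto simp: g1_def vec_eq_iff)
  qed
  then have "AE x in leb Om. g1 x = h x" unfolding AE_lebesgue_on[OF dom_sets] .
  moreover have "AE x in leb Om. x \<in> Om" unfolding AE_lebesgue_on[OF dom_sets] by simp
  ultimately show "AE x in leb Om. g2 x = h x" using b
  proof eventually_elim
   case (elim x)
   then show ?case by (simp add: g2_def)
  qed
 qed
qed

text \<open>The countable family suffices since a loop is approximated by its rounded versions, for which dominated convergence applies to the bounded field \<open>h\<close>.\<close>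

lemma (in bounded_open) orthogonal_to_loops_zero:
 assumes conn: "connected Om" and x0: "x0 \<in> Om" and h: "h \<in> H_space Om" and b: "AE x in leb Om. norm (h x) <= M"
  and orth: "!!n xs. xs \<in> lists rat_pts ==> path_ok Om (eps n) xs ==> hd xs = last xs ==> L2_inner Om h (path_field (eps n) xs) = 0"
 shows "AE x in leb Om. h x = 0"
proof -
 have h2: "h \<in> Lp 2 Om" using h by (simp add: H_space_def)
 obtain g where g: "g \<in> bmeas borel" "!!x. norm (g x) <= \<bar>M\<bar>" "!!x. x \<notin> Om ==> g x = 0" "AE x in leb Om. g x = h x"
  by (rule L2_bounded_borel_representative[OF Lp_measurable[OF h2] b]) (rule that)
 interpret g: bounded_field Om g "\<bar>M\<bar>" by unfold_locales (use g in auto)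
 have g2: "g \<in> Lp 2 Om" by (rule bounded_L2_test[OF open_dom bounded_dom borel_imp_lebesgue_on[OF g(1)] g(2)])
 have inner: "(LINT y|lborel. g y \<bullet> path_field (eps n) xs y) = L2_inner Om h (path_field (eps n) xs)"
  if "path_ok Om (eps n) xs" "hd xs = last xs" for n xs
 proof -
  have p: "path_field (eps n) xs \<in> Lp 2 Om" by (rule V_L2[OF loop_field_V[OF eps_pos that]])
  have m: "(%y. g y \<bullet> path_field (eps n) xs y) \<in> bmeas borel"
   using borel_measurable_integrable[OF g.path_integrable[OF eps_pos]] by simp
  have "(LINT y|lborel. g y \<bullet> path_field (eps n) xs y) = L2_inner Om g (path_field (eps n) xs)"
   unfolding L2_inner_def by (rule LINT_lebesgue_on_support(1)[OF dom_sets m, symmetric]) (simp add: g(3))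
  also have "\<dots> = L2_inner Om h (path_field (eps n) xs)"
   by (rule L2_inner_cong[OF g(4) _ g2 p h2 p]) simp
  finally show ?thesis .
 qed
 interpret g: potential Om g "\<bar>M\<bar>" x0
 proof
  show "connected Om" "x0 \<in> Om" by (rule conn, rule x0)
  fix n xs assume ok: "path_ok Om (2 * eps n) xs" and loop: "hd xs = last xs"
  have ne: "xs \<noteq> []" using path_ok_nonempty[OF ok] .
  obtain G where G: "0 <= G" "!!ys y. length ys <= length xs ==> norm (path_field (eps n) ys y) <= G"
   by (rule path_field_bounded[OF eps_pos, of "length xs"]) (rule that)
  have "(%k. LINT y|lborel. g y \<bullet> path_field (eps n) (map (round_pt k) xs) y) ----> (LINT y|lborel. g y \<bullet> path_field (eps n) xs y)"
  proof (rule integral_dominated_convergence[where w="%y. \<bar>M\<bar> * G * indicator Om y"])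
   show "(%y. g y \<bullet> path_field (eps n) xs y) \<in> bmeas lborel"
    by (rule borel_measurable_integrable[OF g.path_integrable[OF eps_pos]])
   show "(%y. g y \<bullet> path_field (eps n) (map (round_pt k) xs) y) \<in> bmeas lborel" for k
    by (rule borel_measurable_integrable[OF g.path_integrable[OF eps_pos]])
   show "integrable lborel (%y. \<bar>M\<bar> * G * indicator Om y)" using g.dom_integrable by simp
   show "AE y in lborel. (%k. g y \<bullet> path_field (eps n) (map (round_pt k) xs) y) ----> g y \<bullet> path_field (eps n) xs y"
    by (intro always_eventually allI tendsto_inner tendsto_const path_field_round_tendsto)
   show "AE y in lborel. norm (g y \<bullet> path_field (eps n) (map (round_pt k) xs) y) <= \<bar>M\<bar> * G * indicator Om y" for k
   proof (intro always_eventually allI)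
    fix y
    have "norm (g y \<bullet> path_field (eps n) (map (round_pt k) xs) y) <= norm (g y) * norm (path_field (eps n) (map (round_pt k) xs) y)"
     by (simp add: Cauchy_Schwarz_ineq2)
    also have "\<dots> <= \<bar>M\<bar> * G * indicator Om y"
    proof (cases "y \<in> Om")
     case True
     then show ?thesis using mult_mono[OF g(2)[of y] G(2)[of "map (round_pt k) xs" y]] by simp
    qed (simp add: g(3))
    finally show "norm (g y \<bullet> path_field (eps n) (map (round_pt k) xs) y) <= \<bar>M\<bar> * G * indicator Om y" .
   qed
  qed
  moreover have "\<forall>\<^sub>F k in sequentially. (LINT y|lborel. g y \<bullet> path_field (eps n) (map (round_pt k) xs) y) = 0"
   using eventually_ge_at_top[of n]
  proof eventually_elim
   case (elim k)
   have "1 / real (Suc k) <= eps n" unfolding eps_def using elim by (simp add: divide_simps)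
   then have ok': "path_ok Om (eps n) (map (round_pt k) xs)" by (rule path_ok_round[OF ok])
   have loop': "hd (map (round_pt k) xs) = last (map (round_pt k) xs)" using ne loop by (simp add: hd_map last_map)
   have "map (round_pt k) xs \<in> lists rat_pts" using round_pt_rat by (auto simp: in_lists_conv_set)
   then show ?case unfolding inner[OF ok' loop'] using ok' loop' by (rule orth)
  qed
  then have "(%k. LINT y|lborel. g y \<bullet> path_field (eps n) (map (round_pt k) xs) y) ----> 0" by (rule tendsto_eventually)
  ultimately show "(LINT y|lborel. g y \<bullet> path_field (eps n) xs y) = 0" by (rule LIMSEQ_unique)
 qed
 have "normal_trace_zero Om g"
  unfolding normal_trace_zero_def
 proof
  fix \<phi> assume \<phi>: "\<phi> \<in> H1 Om"
  have "L2_inner Om g (wgrad Om \<phi>) = L2_inner Om h (wgrad Om \<phi>)"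
   by (rule L2_inner_cong[OF g(4) _ g2 wgrad(1)[OF \<phi>] h2 wgrad(1)[OF \<phi>]]) simp
  then show "L2_inner Om g (wgrad Om \<phi>) = 0" using h \<phi> by (simp add: H_space_def normal_trace_zero_def)
 qed
 from g.solenoidal_zero[OF this] g(4) show ?thesis
 proof eventually_elim
  case (elim x)
  then show ?case by simp
 qed
qed

section \<open>Equal states force equal controls\<close>

lemma ereal_le_esssup_AE: "AE t in tmeas T. ereal (N (\<phi> t)) <= Linf_time_norm N T \<phi>"
 unfolding Linf_time_norm_def by (rule esssup_AE)

lemma AE_time_mem: "AE t in tmeas T. t \<in> {0<..T}"
proof -
 have "AE t in tmeas T. t \<in> {0..T}" using AE_lebesgue_on[of "{0..T}" "%t. t \<in> {0..T}"] by simp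
 then show ?thesis using AE_time_neq[where a=0]
 proof eventually_elim
  case (elim t)
  then show ?case by auto
 qed
qed

lemma continuous_AE_zero:
 fixes k :: "real => real"
 assumes c: "continuous_on {0..T} k" and ae: "AE t in tmeas T. k t = 0" and t: "t \<in> {0<..<T}"
 shows "k t = 0"
proof -
 have "AE t in lebesgue. t \<in> {0..T} --> k t = 0" using ae by (simp add: AE_lebesgue_on)
 then obtain N where N: "negligible N" "{t. \<not> (t \<in> {0..T} --> k t = 0)} \<subseteq> N" unfolding eventually_ae_filter_negligible by blast
 let ?S = "{0<..<T} \<inter> k -` (- {0})"
 have "open ?S" by (rule continuous_open_preimage[OF continuous_on_subset[OF c]]) auto
 moreover have "negligible ?S" by (rule negligible_subset[OF N(1) subset_trans[OF _ N(2)]]) auto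
 ultimately have "?S = {}" using open_not_negligible[of ?S] by blast
 then show ?thesis using t by auto
qed

context kelvin_voigt begin

lemma a_form_continuous:
 assumes u: "u \<in> C_time (V_space Om) (V_norm Om) T" and v: "v \<in> V_space Om"
 shows "continuous_on {0..T} (%t. a_form (u t) v)"
 unfolding continuous_on_def
proof
 fix t assume t: "t \<in> {0..T}"
 have lim: "((%s. V_norm Om (u s - u t)) \<longlongrightarrow> 0) (at t within {0..T})" using u t by (simp add: C_time_def)
 show "((%s. a_form (u s) v) \<longlongrightarrow> a_form (u t) v) (at t within {0..T})"
 proof (rule LIM_zero_cancel, rule Lim_null_comparison)
  show "((%s. (poincare\<^sup>2 + \<mu>) * V_norm Om (u s - u t) * V_norm Om v) \<longlongrightarrow> 0) (at t within {0..T})"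
   using tendsto_mult_left_zero[OF tendsto_mult_right_zero[OF lim]] .
  show "\<forall>\<^sub>F s in at t within {0..T}. norm (a_form (u s) v - a_form (u t) v) <= (poincare\<^sup>2 + \<mu>) * V_norm Om (u s - u t) * V_norm Om v"
   unfolding eventually_at_filter
  proof (intro always_eventually allI impI)
   fix s assume "s \<noteq> t" "s \<in> {0..T}"
   then have m: "u s \<in> V_space Om" "u t \<in> V_space Om" using u t by (auto simp: C_time_def)
   show "norm (a_form (u s) v - a_form (u t) v) <= (poincare\<^sup>2 + \<mu>) * V_norm Om (u s - u t) * V_norm Om v"
    using A.A_bound[OF V.diff_mem[OF m] v] by (simp add: A.A_diff[OF m v] V_N_fun)
  qed
 qed
qed

text \<open>The difference of the two functions is a continuous function of time that vanishes almost everywhere, hence everywhere inside the interval; so its increments, which are the integrals of the difference of the derivatives, vanish as well.\<close>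

lemma time_deriv_form_eq:
 assumes u: "u \<in> C_time (V_space Om) (V_norm Om) T" "u \<in> H1_time_V Om T"
  and z: "z \<in> C_time (V_space Om) (V_norm Om) T" "z \<in> H1_time_V Om T"
  and w: "AE t in tmeas T. V_norm Om (u t - z t) = 0" and v: "v \<in> V_space Om"
 shows "AE t in tmeas T. a_form (time_deriv Om T u t) v = a_form (time_deriv Om T z t) v"
proof -
 let ?u' = "time_deriv Om T u" and ?z' = "time_deriv Om T z"
 let ?f = "%t. a_form (?u' t) v - a_form (?z' t) v"
 let ?k = "%t. a_form (u t) v - a_form (z t) v"
 have mem: "u t \<in> V_space Om" "z t \<in> V_space Om" if "t \<in> {0..T}" for t using u z that by (auto simp: C_time_def)
 have vT: "(%t. v) \<in> L2_time (V_space Om) V.N T" by (rule V.const_L2_time[OF v])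
 have iu: "integrable (tmeas T) (%t. a_form (?u' t) v)"
  by (rule A.L2_time_integrable[OF _ vT]) (use time_deriv(1)[OF u(2)] in \<open>simp add: V_N_fun\<close>)
 have iz: "integrable (tmeas T) (%t. a_form (?z' t) v)"
  by (rule A.L2_time_integrable[OF _ vT]) (use time_deriv(1)[OF z(2)] in \<open>simp add: V_N_fun\<close>)
 have "AE t in tmeas T. t \<in> {0<..T}" by (rule AE_time_mem)
 with w have kae: "AE t in tmeas T. ?k t = 0"
 proof eventually_elim
  case (elim t)
  then have m: "u t \<in> V_space Om" "z t \<in> V_space Om" using mem[of t] by auto
  have "a_form (u t - z t) v = 0" by (rule A.A_zero_left[OF V.diff_mem[OF m] v]) (use elim in \<open>simp add: V_N_fun\<close>)
  then show ?case by (simp add: A.A_diff[OF m v])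
 qed
 have kc: "continuous_on {0..T} ?k" by (intro continuous_on_diff a_form_continuous u z v)
 have k0: "?k t = 0" if "t \<in> {0<..<T}" for t by (rule continuous_AE_zero[OF kc kae that])
 have oT: "{0<..<T} \<in> sets lebesgue" "{0..T} \<in> sets lebesgue" by auto
 have "AE t in leb {0<..<T}. ?f t = 0"
 proof (rule AE_zero_if_zero_on_inner_boxes)
  show "open {0<..<T}" by simp
  have "integrable lebesgue (%x. indicator {0..T} x *\<^sub>R ?f x)"
   by (rule LINT_lebesgue_on(2)[OF oT(2), THEN iffD1, OF Bochner_Integration.integrable_diff[OF iu iz]])
  from integrable_mult_indicator[OF oT(1) this]
  have "integrable lebesgue (%x. indicator {0<..<T} x *\<^sub>R (indicator {0..T} x *\<^sub>R ?f x))" .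
  also have "(%x. indicator {0<..<T} x *\<^sub>R (indicator {0..T} x *\<^sub>R ?f x)) = (%x. indicator {0<..<T} x *\<^sub>R ?f x)"
   by (auto simp: indicator_def fun_eq_iff)
  finally show "integrable (leb {0<..<T}) ?f" unfolding LINT_lebesgue_on(2)[OF oT(1)] .
  fix a b :: real assume ab: "cbox a b \<subseteq> {0<..<T}"
  show "(LINT x|leb {0<..<T}. indicator (box a b) x * ?f x) = 0"
  proof (cases "a <= b")
   case True
   have a: "a \<in> {0<..<T}" "b \<in> {0<..<T}" using ab True by auto
   have st: "0 <= a" "a <= b" "b <= T" using a True by auto
   have "(LINT x|leb {0<..<T}. indicator (box a b) x * ?f x) = (LINT x|lebesgue. indicator {0<..<T} x *\<^sub>R (indicator (box a b) x * ?f x))"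
    by (rule LINT_lebesgue_on(1)[OF oT(1)])
   also have "\<dots> = (LINT x|lebesgue. indicator {0..T} x *\<^sub>R (indicator (box a b) x * ?f x))"
    using a by (intro Bochner_Integration.integral_cong) (auto simp: indicator_def)
   also have "\<dots> = (LINT x|tmeas T. indicator (box a b) x * ?f x)" by (rule LINT_lebesgue_on(1)[OF oT(2), symmetric])
   also have "\<dots> = (LINT x|tmeas T. indicator {a<..<b} x * a_form (?u' x) v - indicator {a<..<b} x * a_form (?z' x) v)"
    by (simp add: right_diff_distrib)
   also have "\<dots> = (LINT x|tmeas T. indicator {a<..<b} x * a_form (?u' x) v) - (LINT x|tmeas T. indicator {a<..<b} x * a_form (?z' x) v)"
   proof (rule Bochner_Integration.integral_diff)
    have "{a<..<b} \<in> sets (tmeas T)" using a by (auto simp: sets_restrict_space_iff)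
    from integrable_mult_indicator[OF this iu] integrable_mult_indicator[OF this iz]
    show "integrable (tmeas T) (%x. indicator {a<..<b} x * a_form (?u' x) v)"
     "integrable (tmeas T) (%x. indicator {a<..<b} x * a_form (?z' x) v)" by simp_all
   qed
   also have "\<dots> = a_form (u b - u a) v - a_form (z b - z a) v"
    using A.primitive_form[OF primitive_time_deriv[OF u] v st] A.primitive_form[OF primitive_time_deriv[OF z] v st] by simp
   also have "\<dots> = ?k b - ?k a"
    using mem[of a] mem[of b] a by (simp add: A.A_diff v)
   also have "\<dots> = 0" using k0 a by simp
   finally show ?thesis .
  qed simp
 qed
 then have "AE t in lebesgue. t \<in> {0<..<T} --> ?f t = 0" by (simp add: AE_lebesgue_on[OF oT(1)])
 then have "AE t in lebesgue. t \<in> {0..T} --> (t \<in> {0<..<T} --> ?f t = 0)" by eventually_elim simp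
 then have "AE t in tmeas T. t \<in> {0<..<T} --> ?f t = 0" unfolding AE_lebesgue_on[OF oT(2)] .
 then show ?thesis using AE_time_mem[of T] AE_time_neq[of T T]
 proof eventually_elim
  case (elim t)
  then show ?case by auto
 qed
qed

lemma same_state_orthogonal:
 assumes u: "weak_solution Om T \<mu> \<nu> \<alpha> \<beta> r u0 U u" and z: "weak_solution Om T \<mu> \<nu> \<alpha> \<beta> r u0 W z"
  and U: "U \<in> L2_time (H_space Om) (H_norm Om) T" "W \<in> L2_time (H_space Om) (H_norm Om) T"
  and r: "1 <= r" "r <= 5" and w: "AE t in tmeas T. V_norm Om (u t - z t) = 0" and v: "v \<in> V_space Om"
 shows "AE t in tmeas T. L2_inner Om (U t - W t) v = 0"
proof -
 have uz: "u \<in> C_time (V_space Om) (V_norm Om) T" "u \<in> H1_time_V Om T" "z \<in> C_time (V_space Om) (V_norm Om) T" "z \<in> H1_time_V Om T"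
  using u z by (auto simp: weak_solution_def)
 have vT: "(%t. v) \<in> L2_time (V_space Om) (V_norm Om) T" using V.const_L2_time[OF v] by (simp add: V_N_fun)
 have "AE t in tmeas T. U t \<in> Lp 2 Om" "AE t in tmeas T. W t \<in> Lp 2 Om"
  using L2_time_H_L2[OF U(1)] L2_time_H_L2[OF U(2)] by (auto simp: L2_time_def)
 then show ?thesis using w state_equation_tested[OF u U(1) r vT] state_equation_tested[OF z U(2) r vT]
  time_deriv_form_eq[OF uz w v] AE_time_mem[of T]
 proof eventually_elim
  case (elim t)
  have m: "u t \<in> V_space Om" "z t \<in> V_space Om" using uz elim(7) by (auto simp: C_time_def)
  have d: "u t - z t \<in> V_space Om" by (rule V.diff_mem[OF m])
  have n0: "V.N (u t - z t) = 0" using elim(3) by (simp add: V_N_fun)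
  have 1: "V_inner Om (u t) v = V_inner Om (z t) v"
   using V.self.A_zero_left[OF d v n0] by (simp add: V.B_diff[OF m v])
  have 2: "L2_inner Om (u t) v = L2_inner Om (z t) v"
   using L2V.A_zero_left[OF d v n0] by (simp add: L2V.A_diff[OF m v])
  have 3: "b_form Om (u t) (u t) v = b_form Om (z t) (z t) v"
   using b_form_expand[OF m v] b_integrable(2)[OF d m(2) v] b_integrable(2)[OF m(2) v d] b_integrable(2)[OF d d v] elim(3) by simp
  have "Lp_norm 2 Om (u t - z t) <= 0" using poincare[OF d] elim(3) by simp
  then have "Lp_norm 2 Om (u t - z t) = 0" using Lp_norm_nonneg[of 2 Om "u t - z t"] by linarith
  then have ae: "AE x in leb Om. (u t - z t) x = 0" using Lp2_norm_zero_iff[OF V_L2[OF d]] by simp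
  have 4: "L2_inner Om (%x. damping r (u t x)) v = L2_inner Om (%x. damping r (z t x)) v"
   unfolding L2_inner_def
  proof (rule integral_cong_AE)
   show "(%x. damping r (u t x) \<bullet> v x) \<in> bmeas (leb Om)" "(%x. damping r (z t x) \<bullet> v x) \<in> bmeas (leb Om)"
    by (rule borel_measurable_integrable[OF damping_pairing(1)[OF m(1) r v]], rule borel_measurable_integrable[OF damping_pairing(1)[OF m(2) r v]])
   show "AE x in leb Om. damping r (u t x) \<bullet> v x = damping r (z t x) \<bullet> v x" using ae by eventually_elim simp
  qed
  have "L2_inner Om (U t) v = L2_inner Om (W t) v" using elim(4,5,6) 1 2 3 4 by simp
  then show ?case using L2.B_diff[OF elim(1,2) V_L2[OF v]] by simp
 qed
qed

end

lemma Linf_cylinder_bound: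
 assumes w: "w \<in> Linf_cylinder Om T" and Om: "open Om"
 obtains B where "AE t in tmeas T. AE x in leb Om. norm (w t x) <= B"
proof -
 obtain B where B: "AE (t, x) in leb ({0<..T} \<times> Om). norm (w t x) <= B"
  using w by (auto simp: Linf_cylinder_def)
 have "{0<..T} \<times> Om \<in> sets borel" using borel_Times[of "{0<..T}" Om] Om by simp
 then have m: "{0<..T} \<times> Om \<in> sets lebesgue" by simp
 have Omm: "Om \<in> sets lebesgue" using Om by auto
 have "AE z in lebesgue. z \<in> {0<..T} \<times> Om --> norm (w (fst z) (snd z)) <= B"
  using B unfolding AE_lebesgue_on[OF m] by (simp add: case_prod_unfold)
 then have "AE z in lborel. z \<in> {0<..T} \<times> Om --> norm (w (fst z) (snd z)) <= B" by (simp only: AE_completion_iff)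
 then have *: "AE z in lborel \<Otimes>\<^sub>M lborel. z \<in> {0<..T} \<times> Om --> norm (w (fst z) (snd z)) <= B" by (simp only: lborel_prod)
 have "AE t in lebesgue. AE x in lborel. (t, x) \<in> {0<..T} \<times> Om --> norm (w (fst (t, x)) (snd (t, x))) <= B"
  by (rule AE_completion[OF lborel_pair.AE_pair[OF *]])
 then have "AE t in lebesgue. t \<in> {0..T} --> (AE x in lborel. (t, x) \<in> {0<..T} \<times> Om --> norm (w (fst (t, x)) (snd (t, x))) <= B)"
  by eventually_elim (rule impI)
 then have "AE t in tmeas T. AE x in lborel. (t, x) \<in> {0<..T} \<times> Om --> norm (w (fst (t, x)) (snd (t, x))) <= B"
  by (rule AE_lebesgue_on[of "{0..T}", THEN iffD2, rotated]) simp
 then have "AE t in tmeas T. AE x in leb Om. norm (w t x) <= B"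
  using AE_time_mem[of T]
 proof eventually_elim
  case (elim t)
  from elim(1) have "AE x in lborel. x \<in> Om --> norm (w t x) <= B" by eventually_elim (use elim(2) in simp)
  then show ?case unfolding AE_lebesgue_on[OF Omm] by (simp only: AE_completion_iff)
 qed
 then show ?thesis by (rule that)
qed

lemma norm_le_box_bounds:
 fixes v a b :: R3
 assumes "!!i. a $ i <= v $ i" "!!i. v $ i <= b $ i" "norm a <= A" "norm b <= B"
 shows "norm v <= 3 * (A + B)"
proof -
 have "norm v <= (\<Sum>i\<in>UNIV. \<bar>v $ i\<bar>)" by (rule norm_le_l1_cart)
 also have "\<dots> <= (\<Sum>i\<in>(UNIV :: 3 set). A + B)"
 proof (rule sum_mono)
  fix i
  show "\<bar>v $ i\<bar> <= A + B"
   using assms(1)[of i] assms(2)[of i] component_le_norm_cart[of a i] component_le_norm_cart[of b i] assms(3,4) by linarith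
 qed
 finally show ?thesis by simp
qed

lemma U_ad_bounded:
 assumes "Umin \<in> Linf_cylinder Om T" "Umax \<in> Linf_cylinder Om T" "open Om"
 obtains B where "!!U. U \<in> U_ad Om T Umin Umax ==> AE t in tmeas T. AE x in leb Om. norm (U t x) <= B"
proof -
 obtain A where A: "AE t in tmeas T. AE x in leb Om. norm (Umin t x) <= A"
  by (rule Linf_cylinder_bound[OF assms(1,3)]) (rule that)
 obtain B where B: "AE t in tmeas T. AE x in leb Om. norm (Umax t x) <= B"
  by (rule Linf_cylinder_bound[OF assms(2,3)]) (rule that)
 have "AE t in tmeas T. AE x in leb Om. norm (U t x) <= 3 * (A + B)" if U: "U \<in> U_ad Om T Umin Umax" for U
 proof -
  have "AE t in tmeas T. AE x in leb Om. \<forall>i. Umin t x $ i <= U t x $ i \<and> U t x $ i <= Umax t x $ i"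
   using U by (simp add: U_ad_def)
  with A B show ?thesis
  proof eventually_elim
   case (elim t)
   then show ?case
   proof eventually_elim
    case (elim x)
    show ?case by (rule norm_le_box_bounds[of "Umin t x" _ "Umax t x"]) (use elim in auto)
   qed
  qed
 qed
 then show ?thesis by (rule that)
qed

lemma (in bounded_open) H_space_diff:
 assumes "v \<in> H_space Om" "w \<in> H_space Om" shows "v - w \<in> H_space Om"
proof -
 have L: "v \<in> Lp 2 Om" "w \<in> Lp 2 Om" using assms by (auto simp: H_space_def)
 have "div_free Om (v - w)"
  unfolding div_free_def
 proof (intro allI impI)
  fix \<phi> :: "R3 => real" assume \<phi>: "test_fun Om \<phi>"
  have "L2_inner Om (v - w) (gradient \<phi>) = L2_inner Om v (gradient \<phi>) - L2_inner Om w (gradient \<phi>)"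
   by (rule L2.B_diff[OF L test_fun_gradient_L2[OF \<phi>]])
  then show "(LINT x|leb Om. (v - w) x \<bullet> gradient \<phi> x) = 0"
   using assms \<phi> by (simp add: H_space_def div_free_def L2_inner_def)
 qed
 moreover have "normal_trace_zero Om (v - w)"
  unfolding normal_trace_zero_def
 proof
  fix \<phi> assume \<phi>: "\<phi> \<in> H1 Om"
  show "L2_inner Om (v - w) (wgrad Om \<phi>) = 0"
   using assms \<phi> by (simp add: L2.B_diff[OF L wgrad(1)[OF \<phi>]] H_space_def normal_trace_zero_def)
 qed
 ultimately show ?thesis using L2.diff_mem[OF L] by (simp add: H_space_def)
qed

text \<open>The loop fields are countably many, so that almost every time is admissible for all of them simultaneously.\<close>

lemma (in kelvin_voigt) same_state_same_control:
 assumes conn: "connected Om" and x0: "x0 \<in> Om"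
  and u: "weak_solution Om T \<mu> \<nu> \<alpha> \<beta> r u0 U u" and z: "weak_solution Om T \<mu> \<nu> \<alpha> \<beta> r u0 W z"
  and U: "U \<in> L2_time (H_space Om) (H_norm Om) T" "W \<in> L2_time (H_space Om) (H_norm Om) T"
  and B: "AE t in tmeas T. AE x in leb Om. norm (U t x) <= B" "AE t in tmeas T. AE x in leb Om. norm (W t x) <= B"
  and r: "1 <= r" "r <= 5" and w: "AE t in tmeas T. V_norm Om (u t - z t) = 0"
 shows "AE t in tmeas T. AE x in leb Om. U t x = W t x"
proof -
 define loops where "loops = {p. \<exists>n xs. p = path_field (eps n) xs \<and> xs \<in> lists rat_pts \<and> path_ok Om (eps n) xs \<and> hd xs = last xs}"
 have "loops \<subseteq> (%(n, xs). path_field (eps n) xs) ` (UNIV \<times> lists rat_pts)" by (auto simp: loops_def)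
 moreover have "countable ((%(n, xs). path_field (eps n) xs) ` (UNIV \<times> lists rat_pts))"
  by (intro countable_image countable_SIGMA countable_lists countable_rat_pts) auto
 ultimately have c: "countable loops" by (rule countable_subset)
 have "AE t in tmeas T. L2_inner Om (U t - W t) p = 0" if pl: "p \<in> loops" for p
 proof -
  obtain n xs where "p = path_field (eps n) xs" "path_ok Om (eps n) xs" "hd xs = last xs" using pl unfolding loops_def by blast
  then have "p \<in> V_space Om" using loop_field_V[OF eps_pos] by simp
  then show ?thesis by (rule same_state_orthogonal[OF u z U r w])
 qed
 then have "AE t in tmeas T. \<forall>p\<in>loops. L2_inner Om (U t - W t) p = 0" by (subst AE_ball_countable[OF c]) blast
 moreover have "AE t in tmeas T. U t \<in> H_space Om" "AE t in tmeas T. W t \<in> H_space Om"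
  using U by (auto simp: L2_time_def)
 ultimately show ?thesis using B
 proof eventually_elim
  case (elim t)
  have b: "AE x in leb Om. norm ((U t - W t) x) <= B + B"
   using elim(4,5)
  proof eventually_elim
   case (elim x)
   then show ?case using norm_triangle_ineq4[of "U t x" "W t x"] by simp
  qed
  have "AE x in leb Om. (U t - W t) x = 0"
  proof (rule orthogonal_to_loops_zero[OF conn x0 H_space_diff[OF elim(2,3)] b])
   fix n xs assume "xs \<in> lists rat_pts" "path_ok Om (eps n) xs" "hd xs = last xs"
   then have "path_field (eps n) xs \<in> loops" by (auto simp: loops_def)
   then show "L2_inner Om (U t - W t) (path_field (eps n) xs) = 0" using elim(1) by blast
  qed
  then show ?case by eventually_elim simp
 qed
qed

text \<open>The essential suprema in the threshold bound the norms of the adjoint state at almost every time.\<close>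

lemma (in kelvin_voigt) remainder_le_threshold:
 assumes th: "kappa_threshold Om T \<beta> r C (C6 * C7) ((r - 1) * (r + 3)) k \<phi> <= ereal K"
  and k: "k = (C1 * (r + 1) / (2 * \<beta>)) powr (1 / (r + 1))"
  and r: "r = 1 \<or> 2 <= r \<and> r <= 5" and pos: "0 < \<beta>" "0 <= \<nu>" "0 <= \<alpha>"
  and C6: "0 < C6" "embedding_const Om (12 * (r + 1) / (17 - r)) (sqrt C6)"
  and u: "u \<in> C_time (V_space Om) (V_norm Om) T" "energy_bound Om T \<mu> \<nu> \<alpha> \<beta> r u C1"
  and z: "z \<in> C_time (V_space Om) (V_norm Om) T" "energy_bound Om T \<mu> \<nu> \<alpha> \<beta> r z C1"
  and p: "\<phi> \<in> C_time (V_space Om) (V_norm Om) T"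
 shows "AE t in tmeas T. \<bar>remainder \<beta> r (u t) (z t) (\<phi> t)\<bar> <= K * (V_norm Om (u t - z t))\<^sup>2"
 using ereal_le_esssup_AE[where T=T and N="V_norm Om" and \<phi>=\<phi>] ereal_le_esssup_AE[where T=T and N="H_norm Om" and \<phi>=\<phi>] AE_time_mem[of T]
proof eventually_elim
 case (elim t)
 have m: "u t \<in> V_space Om" "z t \<in> V_space Om" "\<phi> t \<in> V_space Om" using u z p elim(3) by (auto simp: C_time_def)
 have C: "0 <= C" using C_pos by simp
 have \<beta>: "0 <= \<beta>" using pos by simp
 obtain c where c: "\<bar>remainder \<beta> r (u t) (z t) (\<phi> t)\<bar> <= c * (V_norm Om (u t - z t))\<^sup>2" "ereal c <= ereal K"
 proof -
  consider "r = 1" | "r = 2" | "2 < r" "r <= 5" using r by fastforce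
  then show ?thesis
  proof cases
   case 1
   have "ereal C * ereal (V_norm Om (\<phi> t)) <= ereal C * Linf_time_norm (V_norm Om) T \<phi>"
    by (rule ereal_mult_left_mono[OF elim(1)]) (use C in simp)
   also have "\<dots> <= ereal K" using th 1 by (simp add: kappa_threshold_def)
   finally have "ereal (C * V_norm Om (\<phi> t)) <= ereal K" by simp
   then show ?thesis by (rule that[rotated]) (use remainder_bound_1[OF m \<beta>] 1 in simp)
  next
   case 2
   have "ereal C * (ereal (V_norm Om (\<phi> t)) + ereal (4 * \<beta>) * ereal (H_norm Om (\<phi> t)))
    <= ereal C * (Linf_time_norm (V_norm Om) T \<phi> + ereal (4 * \<beta>) * Linf_time_norm (H_norm Om) T \<phi>)"
    by (intro ereal_mult_left_mono add_mono elim) (use C \<beta> in auto)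
   also have "\<dots> <= ereal K" using th 2 by (simp add: kappa_threshold_def)
   finally have "ereal (C * (V_norm Om (\<phi> t) + 4 * \<beta> * H_norm Om (\<phi> t))) <= ereal K" by simp
   then show ?thesis by (rule that[rotated]) (use remainder_bound_2[OF m \<beta>] 2 in simp)
  next
   case 3
   let ?c = "C + 2 * \<beta> * (C6 * C7) * ((r - 1) * (r + 3)) * k powr (r - 2)"
   have "0 <= ?c" using C \<beta> C6(1) C7_pos 3 by (intro add_nonneg_nonneg mult_nonneg_nonneg) auto
   then have "ereal ?c * ereal (V_norm Om (\<phi> t)) <= ereal ?c * Linf_time_norm (V_norm Om) T \<phi>"
    by (intro ereal_mult_left_mono[OF elim(1)]) simp
   also have "\<dots> <= ereal K" using th 3 unfolding kappa_threshold_def by simp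
   finally have K: "ereal (?c * V_norm Om (\<phi> t)) <= ereal K" by simp
   have e: "Lp_norm (r + 1) Om (u t) <= k" "Lp_norm (r + 1) Om (z t) <= k"
    unfolding k by (rule energy_bound_Lp[OF u(2) pos(2,3,1) _ elim(3)] energy_bound_Lp[OF z(2) pos(2,3,1) _ elim(3)], use 3 in linarith)+
   show ?thesis by (rule that[OF remainder_bound_gt_2[OF m \<beta> 3 C6 e] K])
  qed
 qed
 have "c * (V_norm Om (u t - z t))\<^sup>2 <= K * (V_norm Om (u t - z t))\<^sup>2"
  by (rule mult_right_mono) (use c(2) in auto)
 then show ?case using c(1) by linarith
qed

lemma (in kelvin_voigt) cost_gap:
 assumes r: "r = 1 \<or> 2 <= r \<and> r <= 5" and pos: "0 < T" "0 < \<nu>" "0 < \<alpha>" "0 < \<beta>" "0 <= lam"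
  and ud: "ud \<in> L2_time (V_space Om) (V_norm Om) T"
  and UU: "U_ad Om T Umin Umax \<subseteq> \<U>" and S: "\<forall>U\<in>\<U>. weak_solution Om T \<mu> \<nu> \<alpha> \<beta> r u0 U (S U)"
  and C6: "0 < C6" "embedding_const Om (12 * (r + 1) / (17 - r)) (sqrt C6)"
  and en: "\<forall>U\<in>\<U>. energy_bound Om T \<mu> \<nu> \<alpha> \<beta> r (S U) C1"
  and k: "k = (C1 * (r + 1) / (2 * \<beta>)) powr (1 / (r + 1))"
  and Ut: "Ut \<in> U_ad Om T Umin Umax" and ad: "adjoint_state Om T \<mu> \<nu> \<alpha> \<beta> r \<kappa> ud (S Ut) \<phi>"
  and var: "\<forall>U\<in>U_ad Om T Umin Umax. 0 <= (LINT t|tmeas T. LINT x|leb Om. (\<phi> t x + lam *\<^sub>R Ut t x) \<bullet> (U t x - Ut t x))"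
  and th: "kappa_threshold Om T \<beta> r C (C6 * C7) ((r - 1) * (r + 3)) k \<phi> <= ereal K"
  and U: "U \<in> U_ad Om T Umin Umax"
 shows "(\<kappa> / 2 - K) * (LINT t|tmeas T. (V_norm Om (S U t - S Ut t))\<^sup>2) <= cost Om T \<kappa> lam ud S U - cost Om T \<kappa> lam ud S Ut"
proof -
 have m: "U \<in> \<U>" "Ut \<in> \<U>" using U Ut UU by auto
 have L: "U \<in> L2_time (H_space Om) (H_norm Om) T" "Ut \<in> L2_time (H_space Om) (H_norm Om) T" using U Ut by (auto simp: U_ad_def)
 have r15: "1 <= r" "r <= 5" using r by auto
 have c: "S U \<in> C_time (V_space Om) (V_norm Om) T" "S Ut \<in> C_time (V_space Om) (V_norm Om) T" "\<phi> \<in> C_time (V_space Om) (V_norm Om) T"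
  using bspec[OF S m(1)] bspec[OF S m(2)] ad by (auto simp: weak_solution_def adjoint_state_def)
 show ?thesis
  by (rule cost_difference[OF bspec[OF S m(1)] bspec[OF S m(2)] ad L ud r15 pos(1,5) _ bspec[OF var U]])
   (rule remainder_le_threshold[OF th k r pos(4) less_imp_le[OF pos(2)] less_imp_le[OF pos(3)] C6 c(1) bspec[OF en m(1)] c(2) bspec[OF en m(2)] c(3)])
qed

lemma (in kelvin_voigt) zero_state_gap:
 assumes u: "u \<in> L2_time (V_space Om) (V_norm Om) T" and z: "z \<in> L2_time (V_space Om) (V_norm Om) T"
  and le: "(LINT t|tmeas T. (V_norm Om (u t - z t))\<^sup>2) <= 0"
 shows "AE t in tmeas T. V_norm Om (u t - z t) = 0"
proof -
 have "(%t. u t - z t) \<in> L2_time (V_space Om) (V_norm Om) T"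
  using V.L2_time_diff[of u T z] u z by (simp add: V_N_fun)
 then have i: "integrable (tmeas T) (%t. (V_norm Om (u t - z t))\<^sup>2)" by (simp add: L2_time_def)
 have "0 <= (LINT t|tmeas T. (V_norm Om (u t - z t))\<^sup>2)" by (rule Bochner_Integration.integral_nonneg) simp
 with le have "(LINT t|tmeas T. (V_norm Om (u t - z t))\<^sup>2) = 0" by linarith
 then have "AE t in tmeas T. (V_norm Om (u t - z t))\<^sup>2 = 0"
  using integral_nonneg_eq_0_iff_AE[OF i] by simp
 then show ?thesis by eventually_elim simp
qed

lemma global_optimality:
 assumes r: "r = 1 \<or> 2 <= r \<and> r <= 5" and S: "\<forall>U\<in>\<U>. weak_solution Om T \<mu> \<nu> \<alpha> \<beta> r u0 U (S U)"
  and UU: "U_ad Om T Umin Umax \<subseteq> \<U>"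
  and C4: "embedding_const Om 4 (sqrt C)" and C6: "embedding_const Om (12 * (r + 1) / (17 - r)) (sqrt C6)"
  and C7: "embedding_const Om 6 C7" and C5: "C5 = C6 * C7"
  and en: "\<forall>U\<in>\<U>. energy_bound Om T \<mu> \<nu> \<alpha> \<beta> r (S U) C1tilde"
  and C1: "C1hat = (C1tilde * (r + 1) / (2 * \<beta>)) powr (1 / (r + 1))"
  and ad: "adjoint_state Om T \<mu> \<nu> \<alpha> \<beta> r \<kappa> ud (S Ut) \<phi>"
  and Ut: "Ut \<in> U_ad Om T Umin Umax"
  and var: "\<forall>U\<in>U_ad Om T Umin Umax. 0 <= (LINT t|leb {0..T}. LINT x|leb Om. (\<phi> t x + lam *\<^sub>R Ut t x) \<bullet> (U t x - Ut t x))"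
  and dom: "smooth_bounded_domain Om" and ud: "ud \<in> L2_time (V_space Om) (V_norm Om) T"
  and pos: "0 < T" "0 < \<mu>" "0 < \<nu>" "0 < \<alpha>" "0 < \<beta>" "0 <= lam" "0 < C" "0 < C6" "0 < C7"
  and th: "kappa_threshold Om T \<beta> r C C5 ((r - 1) * (r + 3)) C1hat \<phi> <= ereal (\<kappa> / 2)"
 shows "\<forall>U\<in>U_ad Om T Umin Umax. cost Om T \<kappa> lam ud S Ut <= cost Om T \<kappa> lam ud S U"
proof -
 have o: "open Om" "bounded Om" "connected Om" "Om \<noteq> {}" using dom by (auto simp: smooth_bounded_domain_def)
 interpret kelvin_voigt Om C C7 \<mu> by unfold_locales (use o C4 C7 pos in auto)
 note gap = cost_gap[OF r pos(1,3,4,5,6) ud UU S pos(8) C6 en C1 Ut ad var]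
 show ?thesis
 proof
  fix U assume U: "U \<in> U_ad Om T Umin Umax"
  show "cost Om T \<kappa> lam ud S Ut <= cost Om T \<kappa> lam ud S U"
   using gap[OF th[unfolded C5] U] by simp
 qed
qed

lemma global_uniqueness:
 assumes r: "r = 1 \<or> 2 <= r \<and> r <= 5" and S: "\<forall>U\<in>\<U>. weak_solution Om T \<mu> \<nu> \<alpha> \<beta> r u0 U (S U)"
  and UU: "U_ad Om T Umin Umax \<subseteq> \<U>"
  and C4: "embedding_const Om 4 (sqrt C)" and C6: "embedding_const Om (12 * (r + 1) / (17 - r)) (sqrt C6)"
  and C7: "embedding_const Om 6 C7" and C5: "C5 = C6 * C7"
  and en: "\<forall>U\<in>\<U>. energy_bound Om T \<mu> \<nu> \<alpha> \<beta> r (S U) C1tilde"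
  and C1: "C1hat = (C1tilde * (r + 1) / (2 * \<beta>)) powr (1 / (r + 1))"
  and ad: "adjoint_state Om T \<mu> \<nu> \<alpha> \<beta> r \<kappa> ud (S Ut) \<phi>"
  and Ut: "Ut \<in> U_ad Om T Umin Umax"
  and var: "\<forall>U\<in>U_ad Om T Umin Umax. 0 <= (LINT t|leb {0..T}. LINT x|leb Om. (\<phi> t x + lam *\<^sub>R Ut t x) \<bullet> (U t x - Ut t x))"
  and dom: "smooth_bounded_domain Om" and ud: "ud \<in> L2_time (V_space Om) (V_norm Om) T"
  and pos: "0 < T" "0 < \<mu>" "0 < \<nu>" "0 < \<alpha>" "0 < \<beta>" "0 <= lam" "0 < C" "0 < C6" "0 < C7"
  and Umin: "Umin \<in> Linf_cylinder Om T" and Umax: "Umax \<in> Linf_cylinder Om T"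
  and th: "kappa_threshold Om T \<beta> r C C5 ((r - 1) * (r + 3)) C1hat \<phi> < ereal (\<kappa> / 2)"
 shows "\<forall>W\<in>U_ad Om T Umin Umax. (\<forall>U\<in>U_ad Om T Umin Umax. cost Om T \<kappa> lam ud S W <= cost Om T \<kappa> lam ud S U) -->
  (AE t in leb {0..T}. AE x in leb Om. W t x = Ut t x)"
proof -
 have o: "open Om" "bounded Om" "connected Om" "Om \<noteq> {}" using dom by (auto simp: smooth_bounded_domain_def)
 interpret kelvin_voigt Om C C7 \<mu> by unfold_locales (use o C4 C7 pos in auto)
 note gap = cost_gap[OF r pos(1,3,4,5,6) ud UU S pos(8) C6 en C1 Ut ad var]
 \<comment> \<open>A real number strictly between the threshold and \<open>\<kappa> / 2\<close> leaves a positive coefficient in the lower bound.\<close>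
 obtain K where K: "kappa_threshold Om T \<beta> r C C5 ((r - 1) * (r + 3)) C1hat \<phi> <= ereal K" "K < \<kappa> / 2"
  using ereal_dense2[OF th] by (auto intro: less_imp_le)
 obtain x0 where x0: "x0 \<in> Om" using o by blast
 obtain B where B: "!!U. U \<in> U_ad Om T Umin Umax ==> AE t in tmeas T. AE x in leb Om. norm (U t x) <= B"
  by (rule U_ad_bounded[OF Umin Umax o(1)]) (rule that)
 have r15: "1 <= r" "r <= 5" using r by auto
 show ?thesis
 proof (intro ballI impI)
  fix W assume W: "W \<in> U_ad Om T Umin Umax" and opt: "\<forall>U\<in>U_ad Om T Umin Umax. cost Om T \<kappa> lam ud S W <= cost Om T \<kappa> lam ud S U"
  have sol: "weak_solution Om T \<mu> \<nu> \<alpha> \<beta> r u0 W (S W)" "weak_solution Om T \<mu> \<nu> \<alpha> \<beta> r u0 Ut (S Ut)"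
   using W Ut UU S by auto
  have L: "W \<in> L2_time (H_space Om) (H_norm Om) T" "Ut \<in> L2_time (H_space Om) (H_norm Om) T" using W Ut by (auto simp: U_ad_def)
  let ?I = "LINT t|tmeas T. (V_norm Om (S W t - S Ut t))\<^sup>2"
  have "(\<kappa> / 2 - K) * ?I <= cost Om T \<kappa> lam ud S W - cost Om T \<kappa> lam ud S Ut"
   by (rule gap[OF K(1)[unfolded C5] W])
  also have "\<dots> <= 0" using opt Ut by simp
  finally have "?I <= 0" using K(2) by (simp add: mult_le_0_iff)
  then have w: "AE t in tmeas T. V_norm Om (S W t - S Ut t) = 0"
   using sol by (intro zero_state_gap) (auto simp: weak_solution_def H1_time_V_def)
  show "AE t in leb {0..T}. AE x in leb Om. W t x = Ut t x"
   by (rule same_state_same_control[OF o(3) x0 sol L B[OF W] B[OF Ut] r15 w])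
 qed
qed

theorem mainTheorem8:
  shows "\<exists>Cr :: real \<Rightarrow> real. (\<forall>r. 2 < r \<and> r \<le> 5 \<longrightarrow> 0 < Cr r) \<and>
    (\<forall>(r::real) (\<Omega>::R3 set) (T::real) (\<mu>::real) (\<nu>::real) (\<alpha>::real) (\<beta>::real) (\<kappa>::real) (lam::real)
      (u0::field) (ud::real \<Rightarrow> field) (Umin::real \<Rightarrow> field) (Umax::real \<Rightarrow> field)
      (\<U>::(real \<Rightarrow> field) set) (S::(real \<Rightarrow> field) \<Rightarrow> real \<Rightarrow> field)
      (C::real) (C5::real) (C6::real) (C7::real) (C1tilde::real) (C1hat::real)
      (Ut::real \<Rightarrow> field) (\<phi>::real \<Rightarrow> field).
      (r = 1 \<or> 2 \<le> r \<and> r \<le> 5) \<longrightarrow>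
      smooth_bounded_domain \<Omega> \<longrightarrow>
      0 < T \<longrightarrow> 0 < \<mu> \<longrightarrow> 0 < \<nu> \<longrightarrow> 0 < \<alpha> \<longrightarrow> 0 < \<beta> \<longrightarrow> 0 < \<kappa> \<longrightarrow> 0 \<le> lam \<longrightarrow>
      u0 \<in> V_space \<Omega> \<longrightarrow>
      ud \<in> L2_time (V_space \<Omega>) (V_norm \<Omega>) T \<longrightarrow>
      Umin \<in> Linf_cylinder \<Omega> T \<longrightarrow> Umax \<in> Linf_cylinder \<Omega> T \<longrightarrow>
      (AE (t, x) in lebesgue_on ({0<..T} \<times> \<Omega>). \<forall>i. Umin t x $ i \<le> Umax t x $ i) \<longrightarrow>
      bounded_open_control_set \<Omega> T \<U> \<longrightarrow>
      U_ad \<Omega> T Umin Umax \<subseteq> \<U> \<longrightarrow>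
      (\<forall>U\<in>\<U>. weak_solution \<Omega> T \<mu> \<nu> \<alpha> \<beta> r u0 U (S U)) \<longrightarrow>
      0 < C \<longrightarrow> embedding_const \<Omega> 4 (sqrt C) \<longrightarrow>
      0 < C6 \<longrightarrow> embedding_const \<Omega> (12 * (r + 1) / (17 - r)) (sqrt C6) \<longrightarrow>
      0 < C7 \<longrightarrow> embedding_const \<Omega> 6 C7 \<longrightarrow>
      C5 = C6 * C7 \<longrightarrow>
      0 < C1tilde \<longrightarrow> (\<forall>U\<in>\<U>. energy_bound \<Omega> T \<mu> \<nu> \<alpha> \<beta> r (S U) C1tilde) \<longrightarrow>
      C1hat = (C1tilde * (r + 1) / (2 * \<beta>)) powr (1 / (r + 1)) \<longrightarrow>
      Ut \<in> U_ad \<Omega> T Umin Umax \<longrightarrow>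
      adjoint_state \<Omega> T \<mu> \<nu> \<alpha> \<beta> r \<kappa> ud (S Ut) \<phi> \<longrightarrow>
      (\<forall>U\<in>U_ad \<Omega> T Umin Umax.
         0 \<le> (LINT t|lebesgue_on {0..T}. LINT x|lebesgue_on \<Omega>.
                (\<phi> t x + lam *\<^sub>R Ut t x) \<bullet> (U t x - Ut t x))) \<longrightarrow>
      (kappa_threshold \<Omega> T \<beta> r C C5 (Cr r) C1hat \<phi> \<le> ereal (\<kappa> / 2) \<longrightarrow>
        (\<forall>U\<in>U_ad \<Omega> T Umin Umax. cost \<Omega> T \<kappa> lam ud S Ut \<le> cost \<Omega> T \<kappa> lam ud S U)) \<and>
      (kappa_threshold \<Omega> T \<beta> r C C5 (Cr r) C1hat \<phi> < ereal (\<kappa> / 2) \<longrightarrow>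
        (\<forall>W\<in>U_ad \<Omega> T Umin Umax.
           (\<forall>U\<in>U_ad \<Omega> T Umin Umax. cost \<Omega> T \<kappa> lam ud S W \<le> cost \<Omega> T \<kappa> lam ud S U) \<longrightarrow>
           (AE t in lebesgue_on {0..T}. AE x in lebesgue_on \<Omega>. W t x = Ut t x))))"
 \<comment> \<open>The constant of the pointwise Taylor estimate of the damping term.\<close>
 apply (rule exI[of _ "\<lambda>r. (r - 1) * (r + 3)"])
 apply (rule conjI)
 apply simp
 apply (intro allI impI)
 subgoal premises p for r \<Omega> T \<mu> \<nu> \<alpha> \<beta> \<kappa> lam u0 ud Umin Umax \<U> S C C5 C6 C7 C1tilde C1hat Ut \<phi>
 proof (rule conjI; rule impI)
  show "\<forall>U\<in>U_ad \<Omega> T Umin Umax. cost \<Omega> T \<kappa> lam ud S Ut \<le> cost \<Omega> T \<kappa> lam ud S U"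
   if th: "kappa_threshold \<Omega> T \<beta> r C C5 ((r - 1) * (r + 3)) C1hat \<phi> \<le> ereal (\<kappa> / 2)"
   by (rule global_optimality[OF p(1,17,16,19,21,23,24,26,27,29,28,30,2,11,3-7,9,18,20,22) th])
  show "\<forall>W\<in>U_ad \<Omega> T Umin Umax. (\<forall>U\<in>U_ad \<Omega> T Umin Umax. cost \<Omega> T \<kappa> lam ud S W \<le> cost \<Omega> T \<kappa> lam ud S U) \<longrightarrow>
    (AE t in lebesgue_on {0..T}. AE x in lebesgue_on \<Omega>. W t x = Ut t x)"
   if th: "kappa_threshold \<Omega> T \<beta> r C C5 ((r - 1) * (r + 3)) C1hat \<phi> < ereal (\<kappa> / 2)"
   by (rule global_uniqueness[OF p(1,17,16,19,21,23,24,26,27,29,28,30,2,11,3-7,9,18,20,22,12,13) th])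
 qed
 done

end
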